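(* Let $A$ be a finite-dimensional algebra, let $e$ be an idempotent of $A$, and let $\tilde{\mathcal{C}}\subseteq \mathrm{mod}(A)$ be a $2$-precluster-tilting subcategory. Let $\mathcal{C}:=\tilde{\mathcal{C}}\cap \mathrm{mod}(A/\langle e\rangle)$. Suppose that (i) $\mathrm{Hom}_A(A/\langle e\rangle,X)\in\tilde{\mathcal{C}}$ for every $X\in\tilde{\mathcal{C}}$; and (ii) $A/\langle e\rangle\otimes_A X\in\tilde{\mathcal{C}}$ for every $X\in\tilde{\mathcal{C}}$. Then $\mathcal{C}\subseteq \mathrm{mod}(A/\langle e\rangle)$ is a $2$-precluster-tilting subcategory.
   Context: Conventions: $K$ is a field, and finite-dimensional algebras are finite-dimensional $K$-algebras of the form $KQ/I$, with $KQ$ the path algebra of a quiver $Q$ and $I$ an admissible ideal. Modules are finitely generated left modules, and $\mathrm{mod}(A)$ is the category of $A$-modules. For an idempotent $e\in A$, $\langle e\rangle=AeA$ is the two-sided ideal generated by $e$. The category $\mathrm{mod}(A/\langle e\rangle)$ is regarded as the full subcategory of $\mathrm{mod}(A)$ of modules annihilated by $\langle e\rangle$, and $\mathrm{Hom}_A(A/\langle e\rangle,X)$ and $A/\langle e\rangle\otimes_A X$ are $A/\langle e\rangle$-modules, hence also $A$-modules. $\mathrm{add}(M)$ is the full subcategory of modules isomorphic to direct summands of finite direct sums of copies of $M$. Let $\tau$, $\tau^-$ be the Auslander--Reiten translation and its inverse, and $\Omega$, $\Omega^{-}$ the syzygy and cosyzygy (all computed over the algebra $B$ under consideration). For a positive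 integer $d$ put $\tau_d:=\tau\Omega^{d-1}$ and $\tau_d^-:=\tau^-\Omega^{-(d-1)}$. For a finite-dimensional algebra $B$, a module $M\in\mathrm{mod}(B)$ is $d$-precluster tilting if: (P1) $M$ is a generator-cogenerator for $\mathrm{mod}(B)$ (i.e. $\mathrm{add}(M)$ contains all projective and all injective $B$-modules); (P2) $\tau_dM\in\mathrm{add}(M)$ and $\tau_d^-M\in\mathrm{add}(M)$; (P3) $\mathrm{Ext}^i_B(M,M)=0$ for all $0<i<d$. A $d$-precluster-tilting subcategory of $\mathrm{mod}(B)$ is a subcategory of the form $\mathrm{add}(M)$ with $M$ a $d$-precluster-tilting module. *)

theory Defs
  imports
    "HOL-Algebra.QuotRing"
    "HOL-Algebra.Module"
    "HOL-Algebra.Free_Abelian_Groups"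
    "HOL-Algebra.Elementary_Groups"
    "Graph_Theory.Arc_Walk"
begin

section \<open>Finite-dimensional algebras\<close>

text \<open>An algebra over \<open>K\<close> is a record of type \<^typ>\<open>('k, 'a) module\<close>: the ring fields give the ring
  and \<^const>\<open>smult\<close> gives the scalar multiplication. (The library locale \<open>algebra\<close> is restricted to
  commutative algebras.)\<close>

definition k_algebra :: "('k, 'x) ring_scheme \<Rightarrow> ('k, 'a, 'y) module_scheme \<Rightarrow> bool" where
  "k_algebra K A \<longleftrightarrow> field K \<and> ring A \<and> Module.module K A \<and>
     (\<forall>k \<in> carrier K. \<forall>a \<in> carrier A. \<forall>b \<in> carrier A.
        (k \<odot>\<^bsub>A\<^esub> a) \<otimes>\<^bsub>A\<^esub> b = k \<odot>\<^bsub>A\<^esub> (a \<otimes>\<^bsub>A\<^esub> b) \<and> a \<otimes>\<^bsub>A\<^esub> (k \<odot>\<^bsub>A\<^esub> b) = k \<odot>\<^bsub>A\<^esub> (a \<otimes>\<^bsub>A\<^esub> b))"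

definition k_algebra_iso ::
    "('k, 'x) ring_scheme \<Rightarrow> ('k, 'a, 'y) module_scheme \<Rightarrow> ('k, 'b, 'z) module_scheme \<Rightarrow> bool" where
  "k_algebra_iso K A B \<longleftrightarrow>
     (\<exists>h \<in> ring_iso A B. \<forall>k \<in> carrier K. \<forall>a \<in> carrier A. h (k \<odot>\<^bsub>A\<^esub> a) = k \<odot>\<^bsub>B\<^esub> h a)"

text \<open>The ring fields are those of the library's \<^term>\<open>A Quot I\<close>.\<close>

definition quot_algebra :: "('k, 'a, 'y) module_scheme \<Rightarrow> 'a set \<Rightarrow> ('k, 'a set) module" where
  "quot_algebra A I =
     \<lparr> carrier = carrier (A Quot I), monoid.mult = monoid.mult (A Quot I),
       monoid.one = monoid.one (A Quot I), ring.zero = ring.zero (A Quot I),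
       ring.add = ring.add (A Quot I),
       smult = (\<lambda>k X. \<Union>x\<in>X. I +>\<^bsub>A\<^esub> (k \<odot>\<^bsub>A\<^esub> x)) \<rparr>"

definition opp_algebra :: "('k, 'a) module \<Rightarrow> ('k, 'a) module" where
  "opp_algebra A = A\<lparr>monoid.mult := (\<lambda>x y. y \<otimes>\<^bsub>A\<^esub> x)\<rparr>"

text \<open>A quiver is a directed multigraph. A path is encoded as a pair of its starting vertex and its
  list of arrows, so \<open>(u, [])\<close> is the trivial path at \<open>u\<close>.\<close>

definition quiver_path :: "('v, 'e) pre_digraph \<Rightarrow> 'v \<times> 'e list \<Rightarrow> bool" where
  "quiver_path Q = (\<lambda>(u, p). \<exists>v. pre_digraph.awalk Q u p v)"

text \<open>Elements of the path algebra are the finitely supported functions from paths to \<open>K\<close>. Paths are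
  multiplied by traversing the left factor first; the opposite convention gives the path
  algebra of the opposite quiver.\<close>

definition path_algebra ::
    "('k, 'x) ring_scheme \<Rightarrow> ('v, 'e) pre_digraph \<Rightarrow> ('k, 'v \<times> 'e list \<Rightarrow> 'k) module" where
  "path_algebra K Q =
     \<lparr> carrier = {f. (\<forall>p. f p \<in> carrier K) \<and> (\<forall>p. \<not> quiver_path Q p \<longrightarrow> f p = \<zero>\<^bsub>K\<^esub>) \<and>
                     finite {p. f p \<noteq> \<zero>\<^bsub>K\<^esub>}},
       monoid.mult = (\<lambda>f g (u, p). \<Oplus>\<^bsub>K\<^esub>i \<in> {..length p}.
                 f (u, take i p) \<otimes>\<^bsub>K\<^esub> g (pre_digraph.awlast Q u (take i p), drop i p)),
       monoid.one = (\<lambda>(u, p). if u \<in> verts Q \<and> p = [] then \<one>\<^bsub>K\<^esub> else \<zero>\<^bsub>K\<^esub>),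
       ring.zero = (\<lambda>_. \<zero>\<^bsub>K\<^esub>),
       ring.add = (\<lambda>f g p. f p \<oplus>\<^bsub>K\<^esub> g p),
       smult = (\<lambda>k f p. k \<otimes>\<^bsub>K\<^esub> f p) \<rparr>"

text \<open>The \<open>l\<close>-th power of the arrow ideal is spanned by the paths of length at least \<open>l\<close>.\<close>

definition arrow_ideal_power ::
    "('k, 'x) ring_scheme \<Rightarrow> ('v, 'e) pre_digraph \<Rightarrow> nat \<Rightarrow> ('v \<times> 'e list \<Rightarrow> 'k) set" where
  "arrow_ideal_power K Q l =
     {f \<in> carrier (path_algebra K Q). \<forall>u p. length p < l \<longrightarrow> f (u, p) = \<zero>\<^bsub>K\<^esub>}"

definition admissible_ideal ::
    "('k, 'x) ring_scheme \<Rightarrow> ('v, 'e) pre_digraph \<Rightarrow> ('v \<times> 'e list \<Rightarrow> 'k) set \<Rightarrow> bool" where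
  "admissible_ideal K Q I \<longleftrightarrow> ideal I (path_algebra K Q) \<and>
     (\<exists>m \<ge> 2. arrow_ideal_power K Q m \<subseteq> I) \<and> I \<subseteq> arrow_ideal_power K Q 2"

text \<open>Quivers are finite, so vertices and arrows may be taken to be natural numbers.\<close>

definition fd_algebra :: "('k, 'x) ring_scheme \<Rightarrow> ('k, 'a) module \<Rightarrow> bool" where
  "fd_algebra K A \<longleftrightarrow> k_algebra K A \<and>
     (\<exists>(Q :: (nat, nat) pre_digraph) I. fin_digraph Q \<and> admissible_ideal K Q I \<and>
        k_algebra_iso K A (quot_algebra (path_algebra K Q) I))"


section \<open>Modules\<close>

text \<open>Left modules are records of the library type \<^typ>\<open>('a, 'm) module\<close>, whose fields
  \<^const>\<open>monoid.mult\<close> and \<^const>\<open>monoid.one\<close> play no role; the locale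
  \<open>module\<close> is only for commutative rings. Right \<open>A\<close>-modules are left modules over \<^term>\<open>opp_algebra A\<close>.\<close>

locale left_module = R?: ring R + M?: abelian_group M for R (structure) and M (structure) +
  assumes smult_closed [simp, intro]:
      "\<lbrakk>a \<in> carrier R; x \<in> carrier M\<rbrakk> \<Longrightarrow> a \<odot>\<^bsub>M\<^esub> x \<in> carrier M"
    and smult_l_distr:
      "\<lbrakk>a \<in> carrier R; b \<in> carrier R; x \<in> carrier M\<rbrakk> \<Longrightarrow>
        (a \<oplus> b) \<odot>\<^bsub>M\<^esub> x = a \<odot>\<^bsub>M\<^esub> x \<oplus>\<^bsub>M\<^esub> b \<odot>\<^bsub>M\<^esub> x"
    and smult_r_distr:
      "\<lbrakk>a \<in> carrier R; x \<in> carrier M; y \<in> carrier M\<rbrakk> \<Longrightarrow>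
        a \<odot>\<^bsub>M\<^esub> (x \<oplus>\<^bsub>M\<^esub> y) = a \<odot>\<^bsub>M\<^esub> x \<oplus>\<^bsub>M\<^esub> a \<odot>\<^bsub>M\<^esub> y"
    and smult_assoc1:
      "\<lbrakk>a \<in> carrier R; b \<in> carrier R; x \<in> carrier M\<rbrakk> \<Longrightarrow>
        (a \<otimes> b) \<odot>\<^bsub>M\<^esub> x = a \<odot>\<^bsub>M\<^esub> (b \<odot>\<^bsub>M\<^esub> x)"
    and smult_one [simp]:
      "x \<in> carrier M \<Longrightarrow> \<one> \<odot>\<^bsub>M\<^esub> x = x"

definition fin_generated :: "('a, 'x) ring_scheme \<Rightarrow> ('a, 'm, 'y) module_scheme \<Rightarrow> bool" where
  "fin_generated A X \<longleftrightarrow>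
     (\<exists>S. finite S \<and> S \<subseteq> carrier X \<and> (\<forall>N. submodule N A X \<and> S \<subseteq> N \<longrightarrow> N = carrier X))"

text \<open>The objects of \<open>mod(A)\<close>. A finitely generated module over a finite-dimensional algebra is
  finite-dimensional over \<open>K\<close>, hence isomorphic to one whose carrier is a set of functions
  \<^typ>\<open>nat \<Rightarrow> 'k\<close>; so this type of elements represents every isomorphism class. The module
  operations on the carrier are arbitrary.\<close>

definition fg_mod :: "('k, 'a) module \<Rightarrow> ('a, nat \<Rightarrow> 'k) module set" where
  "fg_mod A = {X. left_module A X \<and> fin_generated A X}"

definition mod_hom ::
    "('a, 'x) ring_scheme \<Rightarrow> ('a, 'm, 'y) module_scheme \<Rightarrow> ('a, 'n, 'z) module_scheme \<Rightarrow> ('m \<Rightarrow> 'n) set"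
  where
  "mod_hom A X Y = {f \<in> extensional (carrier X). f \<in> hom (add_monoid X) (add_monoid Y) \<and>
     (\<forall>a \<in> carrier A. \<forall>x \<in> carrier X. f (a \<odot>\<^bsub>X\<^esub> x) = a \<odot>\<^bsub>Y\<^esub> f x)}"

definition mod_iso ::
    "('a, 'x) ring_scheme \<Rightarrow> ('a, 'm, 'y) module_scheme \<Rightarrow> ('a, 'n, 'z) module_scheme \<Rightarrow> bool" where
  "mod_iso A X Y \<longleftrightarrow> (\<exists>f \<in> mod_hom A X Y. bij_betw f (carrier X) (carrier Y))"

definition mod_ker ::
    "('a, 'm, 'y) module_scheme \<Rightarrow> ('b, 'n, 'z) module_scheme \<Rightarrow> ('m \<Rightarrow> 'n) \<Rightarrow> 'm set" where
  "mod_ker X Y f = {x \<in> carrier X. f x = \<zero>\<^bsub>Y\<^esub>}"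

definition quot_module :: "('a, 'm) module \<Rightarrow> 'm set \<Rightarrow> ('a, 'm set) module" where
  "quot_module X N =
     \<lparr> carrier = a_rcosets\<^bsub>X\<^esub> N, monoid.mult = undefined, monoid.one = undefined, ring.zero = N,
       ring.add = set_add X, smult = (\<lambda>a C. \<Union>x\<in>C. N +>\<^bsub>X\<^esub> (a \<odot>\<^bsub>X\<^esub> x)) \<rparr>"

definition regular_module :: "('a, 'x) ring_scheme \<Rightarrow> ('a, 'a) module" where
  "regular_module A =
     \<lparr> carrier = carrier A, monoid.mult = monoid.mult A, monoid.one = monoid.one A,
       ring.zero = ring.zero A, ring.add = ring.add A,
       smult = monoid.mult A \<rparr>"

definition restrict_scalars :: "('a \<Rightarrow> 'b) \<Rightarrow> ('b, 'm) module \<Rightarrow> ('a, 'm) module" where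
  "restrict_scalars h X =
     \<lparr> carrier = carrier X, monoid.mult = monoid.mult X, monoid.one = monoid.one X,
       ring.zero = ring.zero X, ring.add = ring.add X,
       smult = (\<lambda>a. module.smult X (h a)) \<rparr>"

definition hom_group ::
    "('a, 'x) ring_scheme \<Rightarrow> ('a, 'm) module \<Rightarrow> ('a, 'n) module \<Rightarrow> ('m \<Rightarrow> 'n) monoid" where
  "hom_group A X Y =
     \<lparr> carrier = mod_hom A X Y,
       monoid.mult = (\<lambda>f g. \<lambda>x\<in>carrier X. f x \<oplus>\<^bsub>Y\<^esub> g x),
       monoid.one = (\<lambda>x\<in>carrier X. \<zero>\<^bsub>Y\<^esub>) \<rparr>"

text \<open>\<open>Hom\<^sub>A(X, Y)\<close> as a module, with the scalar multiplication \<open>act\<close> coming from a further action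
  on \<open>X\<close> or on \<open>Y\<close>.\<close>

definition hom_module ::
    "('a, 'x) ring_scheme \<Rightarrow> ('a, 'm) module \<Rightarrow> ('a, 'n) module \<Rightarrow>
     ('b \<Rightarrow> ('m \<Rightarrow> 'n) \<Rightarrow> 'm \<Rightarrow> 'n) \<Rightarrow> ('b, 'm \<Rightarrow> 'n) module" where
  "hom_module A X Y act =
     \<lparr> carrier = mod_hom A X Y, monoid.mult = undefined, monoid.one = undefined,
       ring.zero = monoid.one (hom_group A X Y), ring.add = monoid.mult (hom_group A X Y),
       smult = (\<lambda>b f. restrict (act b f) (carrier X)) \<rparr>"

text \<open>\<open>D = Hom\<^sub>K(-, K)\<close>, from left \<open>A\<close>-modules to right \<open>A\<close>-modules.\<close>

definition dual_module ::
    "('k, 'x) ring_scheme \<Rightarrow> ('k, 'a) module \<Rightarrow> ('a, 'm) module \<Rightarrow> ('a, 'm \<Rightarrow> 'k) module" where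
  "dual_module K A X =
     hom_module K (restrict_scalars (\<lambda>k. k \<odot>\<^bsub>A\<^esub> \<one>\<^bsub>A\<^esub>) X) (regular_module K)
       (\<lambda>a f x. f (a \<odot>\<^bsub>X\<^esub> x))"

text \<open>\<open>Hom\<^sub>A(-, A)\<close>, from left \<open>A\<close>-modules to right \<open>A\<close>-modules.\<close>

definition star_module :: "('k, 'a) module \<Rightarrow> ('a, 'm) module \<Rightarrow> ('a, 'm \<Rightarrow> 'a) module" where
  "star_module A X = hom_module A X (regular_module A) (\<lambda>a f x. f x \<otimes>\<^bsub>A\<^esub> a)"

text \<open>The tensor product of a right \<open>A\<close>-module (the abelian group \<open>N\<close> with right action \<open>r\<close>) and a left
  \<open>A\<close>-module \<open>X\<close>: the free abelian group on pairs modulo the usual relations. The left action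
  \<open>l\<close> on \<open>N\<close> makes the result a module.\<close>

definition tensor_relations ::
    "('a, 'x) ring_scheme \<Rightarrow> ('n, 'y) ring_scheme \<Rightarrow> ('n \<Rightarrow> 'a \<Rightarrow> 'n) \<Rightarrow> ('a, 'm) module \<Rightarrow>
     ('n \<times> 'm \<Rightarrow>\<^sub>0 int) set" where
  "tensor_relations A N r X =
     {frag_of (n \<oplus>\<^bsub>N\<^esub> n', x) - frag_of (n, x) - frag_of (n', x) | n n' x.
        n \<in> carrier N \<and> n' \<in> carrier N \<and> x \<in> carrier X} \<union>
     {frag_of (n, x \<oplus>\<^bsub>X\<^esub> x') - frag_of (n, x) - frag_of (n, x') | n x x'.
        n \<in> carrier N \<and> x \<in> carrier X \<and> x' \<in> carrier X} \<union>
     {frag_of (r n a, x) - frag_of (n, a \<odot>\<^bsub>X\<^esub> x) | n a x.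
        n \<in> carrier N \<and> a \<in> carrier A \<and> x \<in> carrier X}"

definition tensor_module ::
    "('a, 'x) ring_scheme \<Rightarrow> ('n, 'y) ring_scheme \<Rightarrow> ('n \<Rightarrow> 'a \<Rightarrow> 'n) \<Rightarrow> ('b \<Rightarrow> 'n \<Rightarrow> 'n) \<Rightarrow>
     ('a, 'm) module \<Rightarrow> ('b, ('n \<times> 'm \<Rightarrow>\<^sub>0 int) set) module" where
  "tensor_module A N r l X =
     (let F = free_Abelian_group (carrier N \<times> carrier X);
          H = generate F (tensor_relations A N r X)
      in \<lparr> carrier = carrier (F Mod H), monoid.mult = undefined, monoid.one = undefined,
           ring.zero = monoid.one (F Mod H), ring.add = monoid.mult (F Mod H),
           smult = (\<lambda>b C. \<Union>c\<in>C. H #>\<^bsub>F\<^esub> frag_extend (\<lambda>(n, x). frag_of (l b n, x)) c) \<rparr>)"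

definition mod_power :: "('a, 'm) module \<Rightarrow> nat \<Rightarrow> ('a, nat \<Rightarrow> 'm) module" where
  "mod_power X n =
     \<lparr> carrier = {..<n} \<rightarrow>\<^sub>E carrier X, monoid.mult = undefined, monoid.one = undefined,
       ring.zero = (\<lambda>i\<in>{..<n}. \<zero>\<^bsub>X\<^esub>),
       ring.add = (\<lambda>f g. \<lambda>i\<in>{..<n}. f i \<oplus>\<^bsub>X\<^esub> g i),
       smult = (\<lambda>a f. \<lambda>i\<in>{..<n}. a \<odot>\<^bsub>X\<^esub> f i) \<rparr>"

text \<open>\<^term>\<open>in_add A M X\<close>: \<open>X\<close> is isomorphic to a direct summand of some \<open>M\<^sup>n\<close>.\<close>

definition in_add :: "('a, 'x) ring_scheme \<Rightarrow> ('a, 'm) module \<Rightarrow> ('a, 'n) module \<Rightarrow> bool" where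
  "in_add A M X \<longleftrightarrow> (\<exists>n S T. submodule S A (mod_power M n) \<and> submodule T A (mod_power M n) \<and>
     S \<inter> T = {\<zero>\<^bsub>mod_power M n\<^esub>} \<and> S <+>\<^bsub>mod_power M n\<^esub> T = carrier (mod_power M n) \<and>
     mod_iso A X (mod_power M n\<lparr>carrier := S\<rparr>))"

definition add_subcat :: "('k, 'a) module \<Rightarrow> ('a, nat \<Rightarrow> 'k) module \<Rightarrow> ('a, nat \<Rightarrow> 'k) module set" where
  "add_subcat A M = {X \<in> fg_mod A. in_add A M X}"

text \<open>Membership in an isomorphism-closed subcategory of a module whose elements may have another
  type.\<close>

definition in_subcat :: "('a, 'x) ring_scheme \<Rightarrow> ('a, 'm) module set \<Rightarrow> ('a, 'n) module \<Rightarrow> bool" where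
  "in_subcat A C X \<longleftrightarrow> (\<exists>Y \<in> C. mod_iso A X Y)"


section \<open>Homological notions\<close>

definition projective :: "('k, 'a) module \<Rightarrow> ('a, nat \<Rightarrow> 'k) module \<Rightarrow> bool" where
  "projective A P \<longleftrightarrow> P \<in> fg_mod A \<and>
     (\<forall>X \<in> fg_mod A. \<forall>Y \<in> fg_mod A. \<forall>g \<in> mod_hom A X Y. \<forall>f \<in> mod_hom A P Y.
        g ` carrier X = carrier Y \<longrightarrow> (\<exists>h \<in> mod_hom A P X. \<forall>p \<in> carrier P. g (h p) = f p))"

definition injective :: "('k, 'a) module \<Rightarrow> ('a, nat \<Rightarrow> 'k) module \<Rightarrow> bool" where
  "injective A J \<longleftrightarrow> J \<in> fg_mod A \<and>
     (\<forall>X \<in> fg_mod A. \<forall>Y \<in> fg_mod A. \<forall>g \<in> mod_hom A X Y. \<forall>f \<in> mod_hom A X J.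
        inj_on g (carrier X) \<longrightarrow> (\<exists>h \<in> mod_hom A Y J. \<forall>x \<in> carrier X. h (g x) = f x))"

definition projective_cover ::
    "('k, 'a) module \<Rightarrow> ('a, nat \<Rightarrow> 'k) module \<Rightarrow> ((nat \<Rightarrow> 'k) \<Rightarrow> 'm) \<Rightarrow> ('a, 'm) module \<Rightarrow> bool" where
  "projective_cover A P g X \<longleftrightarrow> projective A P \<and> g \<in> mod_hom A P X \<and> g ` carrier P = carrier X \<and>
     (\<forall>N. submodule N A P \<and> N <+>\<^bsub>P\<^esub> mod_ker P X g = carrier P \<longrightarrow> N = carrier P)"

definition injective_envelope ::
    "('k, 'a) module \<Rightarrow> ('a, 'm) module \<Rightarrow> ('m \<Rightarrow> nat \<Rightarrow> 'k) \<Rightarrow> ('a, nat \<Rightarrow> 'k) module \<Rightarrow> bool" where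
  "injective_envelope A X g J \<longleftrightarrow> injective A J \<and> g \<in> mod_hom A X J \<and> inj_on g (carrier X) \<and>
     (\<forall>N. submodule N A J \<and> N \<inter> g ` carrier X = {\<zero>\<^bsub>J\<^esub>} \<longrightarrow> N = {\<zero>\<^bsub>J\<^esub>})"

text \<open>\<open>P\<^sub>1 \<rightarrow> P\<^sub>0 \<rightarrow> X \<rightarrow> 0\<close> with maps \<open>f\<close> and \<open>g\<close>.\<close>

definition minimal_presentation ::
    "('k, 'a) module \<Rightarrow> ('a, nat \<Rightarrow> 'k) module \<Rightarrow> ((nat \<Rightarrow> 'k) \<Rightarrow> (nat \<Rightarrow> 'k)) \<Rightarrow>
     ('a, nat \<Rightarrow> 'k) module \<Rightarrow> ((nat \<Rightarrow> 'k) \<Rightarrow> 'm) \<Rightarrow> ('a, 'm) module \<Rightarrow> bool" where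
  "minimal_presentation A P1 f P0 g X \<longleftrightarrow>
     projective_cover A P0 g X \<and> projective_cover A P1 f (P0\<lparr>carrier := mod_ker P0 X g\<rparr>)"

text \<open>The following constructions are determined up to isomorphism only; \<^const>\<open>Eps\<close> chooses a
  representative.\<close>

definition syzygy :: "('k, 'a) module \<Rightarrow> ('a, nat \<Rightarrow> 'k) module \<Rightarrow> ('a, nat \<Rightarrow> 'k) module" where
  "syzygy A X = (SOME Y. Y \<in> fg_mod A \<and>
     (\<exists>P g. projective_cover A P g X \<and> mod_iso A Y (P\<lparr>carrier := mod_ker P X g\<rparr>)))"

definition cosyzygy :: "('k, 'a) module \<Rightarrow> ('a, nat \<Rightarrow> 'k) module \<Rightarrow> ('a, nat \<Rightarrow> 'k) module" where
  "cosyzygy A X = (SOME Y. Y \<in> fg_mod A \<and>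
     (\<exists>J g. injective_envelope A X g J \<and> mod_iso A Y (quot_module J (g ` carrier X))))"

text \<open>The transpose of a left \<open>A\<close>-module is a right \<open>A\<close>-module: the cokernel of
  \<open>Hom\<^sub>A(P\<^sub>0, A) \<rightarrow> Hom\<^sub>A(P\<^sub>1, A)\<close>.\<close>

definition module_transpose :: "('k, 'a) module \<Rightarrow> ('a, 'm) module \<Rightarrow> ('a, nat \<Rightarrow> 'k) module" where
  "module_transpose A X = (SOME Y. Y \<in> fg_mod (opp_algebra A) \<and>
     (\<exists>P1 f P0 g. minimal_presentation A P1 f P0 g X \<and>
        mod_iso (opp_algebra A) Y
          (quot_module (star_module A P1)
             ((\<lambda>h. compose (carrier P1) h f) ` carrier (star_module A P0)))))"

text \<open>\<open>\<tau> = D Tr\<close> and \<open>\<tau>\<^sup>- = Tr D\<close>.\<close>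

definition ar_translate ::
    "('k, 'x) ring_scheme \<Rightarrow> ('k, 'a) module \<Rightarrow> ('a, nat \<Rightarrow> 'k) module \<Rightarrow> ('a, (nat \<Rightarrow> 'k) \<Rightarrow> 'k) module"
  where
  "ar_translate K A X = dual_module K (opp_algebra A) (module_transpose A X)"

definition ar_translate_inv ::
    "('k, 'x) ring_scheme \<Rightarrow> ('k, 'a) module \<Rightarrow> ('a, nat \<Rightarrow> 'k) module \<Rightarrow> ('a, nat \<Rightarrow> 'k) module" where
  "ar_translate_inv K A X = module_transpose (opp_algebra A) (dual_module K A X)"

definition tau_d ::
    "('k, 'x) ring_scheme \<Rightarrow> ('k, 'a) module \<Rightarrow> nat \<Rightarrow> ('a, nat \<Rightarrow> 'k) module \<Rightarrow>
     ('a, (nat \<Rightarrow> 'k) \<Rightarrow> 'k) module" where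
  "tau_d K A d X = ar_translate K A ((syzygy A ^^ (d - 1)) X)"

definition tau_d_inv ::
    "('k, 'x) ring_scheme \<Rightarrow> ('k, 'a) module \<Rightarrow> nat \<Rightarrow> ('a, nat \<Rightarrow> 'k) module \<Rightarrow>
     ('a, nat \<Rightarrow> 'k) module" where
  "tau_d_inv K A d X = ar_translate_inv K A ((cosyzygy A ^^ (d - 1)) X)"

text \<open>The complex \<open>\<dots> \<rightarrow> P\<^sub>1 \<rightarrow> P\<^sub>0 \<rightarrow> M \<rightarrow> 0\<close> is exact, where \<open>\<delta> 0\<close> is the augmentation and
  \<open>\<delta> (Suc n)\<close> maps \<open>P (Suc n)\<close> to \<open>P n\<close>.\<close>

definition projective_resolution ::
    "('k, 'a) module \<Rightarrow> ('a, nat \<Rightarrow> 'k) module \<Rightarrow> (nat \<Rightarrow> ('a, nat \<Rightarrow> 'k) module) \<Rightarrow>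
     (nat \<Rightarrow> (nat \<Rightarrow> 'k) \<Rightarrow> nat \<Rightarrow> 'k) \<Rightarrow> bool" where
  "projective_resolution A M P \<delta> \<longleftrightarrow> (\<forall>n. projective A (P n)) \<and>
     \<delta> 0 \<in> mod_hom A (P 0) M \<and> \<delta> 0 ` carrier (P 0) = carrier M \<and>
     (\<forall>n. \<delta> (Suc n) \<in> mod_hom A (P (Suc n)) (P n)) \<and>
     \<delta> 1 ` carrier (P 1) = mod_ker (P 0) M (\<delta> 0) \<and>
     (\<forall>n. \<delta> (Suc (Suc n)) ` carrier (P (Suc (Suc n))) = mod_ker (P (Suc n)) (P n) (\<delta> (Suc n)))"

definition ext_cocycles ::
    "('a, 'x) ring_scheme \<Rightarrow> (nat \<Rightarrow> ('a, 'm) module) \<Rightarrow> (nat \<Rightarrow> 'm \<Rightarrow> 'm) \<Rightarrow> nat \<Rightarrow> ('a, 'n) module \<Rightarrow>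
     ('m \<Rightarrow> 'n) set" where
  "ext_cocycles A P \<delta> n N =
     {f \<in> mod_hom A (P n) N. \<forall>x \<in> carrier (P (Suc n)). f (\<delta> (Suc n) x) = \<zero>\<^bsub>N\<^esub>}"

definition ext_coboundaries ::
    "('a, 'x) ring_scheme \<Rightarrow> (nat \<Rightarrow> ('a, 'm) module) \<Rightarrow> (nat \<Rightarrow> 'm \<Rightarrow> 'm) \<Rightarrow> nat \<Rightarrow> ('a, 'n) module \<Rightarrow>
     ('m \<Rightarrow> 'n) set" where
  "ext_coboundaries A P \<delta> n N =
     (case n of 0 \<Rightarrow> {monoid.one (hom_group A (P 0) N)}
      | Suc m \<Rightarrow> (\<lambda>f. compose (carrier (P (Suc m))) f (\<delta> (Suc m))) ` mod_hom A (P m) N)"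

text \<open>\<open>Ext\<^sup>n\<^sub>A(M, N)\<close> as the \<open>n\<close>-th cohomology of \<open>Hom\<^sub>A(P, N)\<close> for a chosen projective resolution
  \<open>P\<close> of \<open>M\<close>.\<close>

definition Ext ::
    "('k, 'a) module \<Rightarrow> nat \<Rightarrow> ('a, nat \<Rightarrow> 'k) module \<Rightarrow> ('a, nat \<Rightarrow> 'k) module \<Rightarrow>
     ((nat \<Rightarrow> 'k) \<Rightarrow> nat \<Rightarrow> 'k) set monoid" where
  "Ext A n M N =
     (let (P, \<delta>) = (SOME (P, \<delta>). projective_resolution A M P \<delta>)
      in (hom_group A (P n) N)\<lparr>carrier := ext_cocycles A P \<delta> n N\<rparr> Mod ext_coboundaries A P \<delta> n N)"


section \<open>Precluster tilting\<close>

definition precluster_tilting_module ::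
    "('k, 'x) ring_scheme \<Rightarrow> ('k, 'a) module \<Rightarrow> nat \<Rightarrow> ('a, nat \<Rightarrow> 'k) module \<Rightarrow> bool" where
  "precluster_tilting_module K A d M \<longleftrightarrow> M \<in> fg_mod A \<and>
     (\<forall>X. projective A X \<or> injective A X \<longrightarrow> X \<in> add_subcat A M) \<and>
     in_add A M (tau_d K A d M) \<and> in_add A M (tau_d_inv K A d M) \<and>
     (\<forall>i. 0 < i \<and> i < d \<longrightarrow> trivial_group (Ext A i M M))"

definition precluster_tilting_subcat ::
    "('k, 'x) ring_scheme \<Rightarrow> ('k, 'a) module \<Rightarrow> nat \<Rightarrow> ('a, nat \<Rightarrow> 'k) module set \<Rightarrow> bool" where
  "precluster_tilting_subcat K A d C \<longleftrightarrow>
     (\<exists>M. precluster_tilting_module K A d M \<and> C = add_subcat A M)"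


section \<open>Modules over the quotient by an ideal\<close>

definition inflate :: "('k, 'a) module \<Rightarrow> 'a set \<Rightarrow> ('a set, 'm) module \<Rightarrow> ('a, 'm) module" where
  "inflate A I X = restrict_scalars (\<lambda>a. I +>\<^bsub>A\<^esub> a) X"

text \<open>\<open>Hom\<^sub>A(A/I, X)\<close> as an \<open>A/I\<close>-module, via the right multiplication of \<open>A/I\<close> on itself.\<close>

definition hom_from_quot ::
    "('k, 'a) module \<Rightarrow> 'a set \<Rightarrow> ('a, 'm) module \<Rightarrow> ('a set, 'a set \<Rightarrow> 'm) module" where
  "hom_from_quot A I X =
     hom_module A (inflate A I (regular_module (quot_algebra A I))) X
       (\<lambda>b f y. f (y \<otimes>\<^bsub>quot_algebra A I\<^esub> b))"

text \<open>\<open>A/I \<otimes>\<^sub>A X\<close> as an \<open>A/I\<close>-module.\<close>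

definition quot_tensor ::
    "('k, 'a) module \<Rightarrow> 'a set \<Rightarrow> ('a, 'm) module \<Rightarrow> ('a set, ('a set \<times> 'm \<Rightarrow>\<^sub>0 int) set) module" where
  "quot_tensor A I X =
     tensor_module A (quot_algebra A I)
       (\<lambda>y a. y \<otimes>\<^bsub>quot_algebra A I\<^esub> (I +>\<^bsub>A\<^esub> a)) (\<lambda>b y. b \<otimes>\<^bsub>quot_algebra A I\<^esub> y) X"

text \<open>The intersection of \<open>C\<close> with \<open>mod(A/I)\<close>, as a subcategory of \<open>mod(A/I)\<close>.\<close>

definition subcat_inter_quot ::
    "('k, 'a) module \<Rightarrow> 'a set \<Rightarrow> ('a, nat \<Rightarrow> 'k) module set \<Rightarrow> ('a set, nat \<Rightarrow> 'k) module set" where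
  "subcat_inter_quot A I C = {X \<in> fg_mod (quot_algebra A I). inflate A I X \<in> C}"

end

theory Submission
  imports Defs
begin

text \<open>Let \<open>I\<close> be the ideal generated by the idempotent, \<open>B = A/I\<close>, and \<open>M\<close> a precluster tilting module with \<open>add(M)\<close> the given subcategory. The module
  \<open>Hom(A/I, X)\<close> is the socle \<open>{x. I x = 0}\<close> of \<open>X\<close> and \<open>A/I \<otimes> X\<close> is the top \<open>X/IX\<close>, the largest
  submodule and the largest factor module of \<open>X\<close> on which \<open>B\<close> acts. The two hypotheses say that
  \<open>add(M)\<close> is closed under socles and tops. Let \<open>N = M/IM\<close>. A \<open>B\<close>-module lies in \<open>add(N)\<close> iff it lies
  in \<open>add(M)\<close> (\<open>inN_iff\<close>), so the subcategory over \<open>B\<close> is \<open>add(N)\<close>, and \<open>N\<close> has to be precluster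
  tilting.

  Membership in \<open>add(M)\<close> is handled through maps: \<open>thru R M X Y h\<close> says that \<open>h\<close> is a finite sum of
  composites \<open>X \<rightarrow> M \<rightarrow> Y\<close>, and \<open>X\<close> is in \<open>add(M)\<close> iff the identity of \<open>X\<close> is of this form (\<open>in_add_iff\<close>).
  Additive functors preserve such sums. Lifting them to projective presentations shows that the syzygy
  and the transpose computed from minimal data are summands of powers of those computed from any
  projective presentation (\<open>syzygy_minimal\<close>, \<open>tr_minimal\<close>).

  Generator-cogenerator: the top of \<open>A\<close> is \<open>B\<close>. Duality exchanges socles and tops, so if \<open>V\<close> is the top of
  a right module \<open>U\<close> with \<open>D U\<close> in \<open>add(M)\<close>, then \<open>D V\<close>, being the socle of \<open>D U\<close>, is in \<open>add(N)\<close>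
  (\<open>dual_top_inN\<close>); for \<open>U = A\<close> this gives the injective modules.

  Extensions: the vanishing of \<open>Ext\<^sup>1(M, M)\<close> means that a homomorphism into an object of \<open>add(M)\<close> extends
  from the kernel of a surjection \<open>E \<rightarrow> X\<close> to \<open>E\<close> if \<open>X\<close> is in \<open>add(M)\<close>. Here \<open>E\<close> may be any module
  (\<open>ext_vanish\<close>), so the condition is inherited by \<open>B\<close>.

  Translations: let \<open>Y\<close> be the kernel of a projective cover \<open>G \<rightarrow> M\<close> and \<open>P\<^sub>1 \<rightarrow> P\<^sub>0 \<rightarrow> Y \<rightarrow> 0\<close> its minimal
  presentation, so that \<open>\<tau>\<^sub>2 M\<close> is the dual of \<open>Tr Y\<close>. Extending homomorphisms \<open>Y \<rightarrow> D B\<close> to \<open>G\<close> shows that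
  \<open>Y \<inter> IG = IY\<close>. Hence \<open>Y/IY\<close> is the kernel of \<open>G/IG \<rightarrow> N\<close>, and the reduced presentation is a projective
  presentation of it. Reduction modulo \<open>I\<close> commutes with \<open>Hom(P, A)\<close> for projective \<open>P\<close>, so its transpose
  is the top of \<open>Tr Y\<close> (\<open>tr_quotient\<close>). By minimality the dual of this top has \<open>\<tau>\<^sub>2 N\<close> as a summand of a
  power, and it is in \<open>add(N)\<close> by \<open>dual_top_inN\<close>. For the inverse translation the same reduction is applied
  over the opposite algebra to \<open>D J \<rightarrow> D M\<close> with \<open>J\<close> the injective envelope of \<open>M\<close>. There
  \<open>Y \<inter> IG = IY\<close> says that socle elements of \<open>J/M\<close> lift to socle elements of \<open>J\<close>, which follows by extending
  a homomorphism \<open>I \<rightarrow> M\<close> to \<open>A\<close> (\<open>soc_lift\<close>), and the result is a summand of a power of the top of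
  \<open>\<tau>\<^sub>2\<^sup>- M\<close>, which is in \<open>add(N)\<close> by hypothesis.\<close>

section \<open>Modules and linear maps\<close>

text \<open>Most statements involve several modules at once, so that every operation has to name its structure; it is written as a plain subscript.\<close>

abbreviation (input) add_in (\<open>(_ \<oplus>\<^sub>_/ _)\<close> [65, 1000, 66] 65) where "x \<oplus>\<^sub>X y \<equiv> x \<oplus>\<^bsub>X\<^esub> y"
abbreviation (input) mult_in (\<open>(_ \<otimes>\<^sub>_/ _)\<close> [70, 1000, 71] 70) where "x \<otimes>\<^sub>X y \<equiv> x \<otimes>\<^bsub>X\<^esub> y"
abbreviation (input) smult_in (\<open>(_ \<odot>\<^sub>_/ _)\<close> [70, 1000, 71] 70) where "a \<odot>\<^sub>X x \<equiv> a \<odot>\<^bsub>X\<^esub> x"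
abbreviation (input) diff_in (\<open>(_ \<ominus>\<^sub>_/ _)\<close> [65, 1000, 66] 65) where "x \<ominus>\<^sub>X y \<equiv> x \<ominus>\<^bsub>X\<^esub> y"
abbreviation (input) neg_in (\<open>(\<ominus>\<^sub>_/ _)\<close> [1000, 81] 80) where "\<ominus>\<^sub>X x \<equiv> \<ominus>\<^bsub>X\<^esub> x"
abbreviation (input) zero_in (\<open>\<zero>\<^sub>_\<close> [1000] 1000) where "\<zero>\<^sub>X \<equiv> \<zero>\<^bsub>X\<^esub>"
abbreviation (input) one_in (\<open>\<one>\<^sub>_\<close> [1000] 1000) where "\<one>\<^sub>X \<equiv> \<one>\<^bsub>X\<^esub>"
abbreviation (input) coset_in (\<open>(_ +>\<^sub>_/ _)\<close> [60, 1000, 61] 60) where "N +>\<^sub>X x \<equiv> N +>\<^bsub>X\<^esub> x"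
abbreviation (input) coset_add_in (\<open>(_ <+>\<^sub>_/ _)\<close> [60, 1000, 61] 60) where "N <+>\<^sub>X C \<equiv> N <+>\<^bsub>X\<^esub> C"
abbreviation (input) sub_module (infixl \<open>\<restriction>\<close> 900) where "X\<restriction>N \<equiv> X\<lparr>carrier := N\<rparr>"
abbreviation (input) reg where "reg \<equiv> regular_module"
abbreviation (input) star where "star \<equiv> star_module"
notation opp_algebra (\<open>_\<^sup>o\<close> [1000] 1000)

text \<open>Homomorphisms without the extensionality of \<^const>\<open>mod_hom\<close>, so that composites and pointwise
  sums of them are again homomorphisms.\<close>

definition lin ::
    "('a, 'x) ring_scheme \<Rightarrow> ('a, 'm, 'y) module_scheme \<Rightarrow> ('a, 'n, 'z) module_scheme \<Rightarrow> ('m \<Rightarrow> 'n) \<Rightarrow> bool" where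
  "lin R X Y f \<longleftrightarrow> (\<forall>x\<in>carrier X. f x \<in> carrier Y) \<and>
     (\<forall>x\<in>carrier X. \<forall>y\<in>carrier X. f (x \<oplus>\<^sub>X y) = f x \<oplus>\<^sub>Y f y) \<and>
     (\<forall>a\<in>carrier R. \<forall>x\<in>carrier X. f (a \<odot>\<^sub>X x) = a \<odot>\<^sub>Y f x)"

lemma surjE: "f ` C = D ==> y \<in> D ==> \<exists>x\<in>C. y = f x"
  by blast

lemma linI:
  assumes "\<And>x. x \<in> carrier X ==> f x \<in> carrier Y"
    and "\<And>x y. x \<in> carrier X ==> y \<in> carrier X ==> f (x \<oplus>\<^sub>X y) = f x \<oplus>\<^sub>Y f y"
    and "\<And>a x. a \<in> carrier R ==> x \<in> carrier X ==> f (a \<odot>\<^sub>X x) = a \<odot>\<^sub>Y f x"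
  shows "lin R X Y f"
  using assms by (auto simp: lin_def)

lemma lin_closed: "lin R X Y f ==> x \<in> carrier X ==> f x \<in> carrier Y"
  by (auto simp: lin_def)

lemma lin_add: "lin R X Y f ==> x \<in> carrier X ==> y \<in> carrier X ==> f (x \<oplus>\<^sub>X y) = f x \<oplus>\<^sub>Y f y"
  by (auto simp: lin_def)

lemma lin_smult: "lin R X Y f ==> a \<in> carrier R ==> x \<in> carrier X ==> f (a \<odot>\<^sub>X x) = a \<odot>\<^sub>Y f x"
  by (auto simp: lin_def)

lemma mod_hom_iff: "f \<in> mod_hom R X Y \<longleftrightarrow> f \<in> extensional (carrier X) \<and> lin R X Y f"
  by (auto simp: mod_hom_def lin_def hom_def)

lemma lm_ring: "left_module R X ==> ring R"
  by (simp add: left_module_def)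

lemma lm_ag: "left_module R X ==> abelian_group X"
  by (simp add: left_module_def)

lemma ag_closed: "abelian_group X ==> x \<in> carrier X ==> y \<in> carrier X ==> x \<oplus>\<^sub>X y \<in> carrier X"
  by (simp add: abelian_group.axioms(1) abelian_monoid.a_closed)

lemma ag_zero: "abelian_group X ==> \<zero>\<^sub>X \<in> carrier X"
  by (simp add: abelian_group.axioms(1) abelian_monoid.zero_closed)

lemma ag_neg: "abelian_group X ==> x \<in> carrier X ==> \<ominus>\<^sub>X x \<in> carrier X"
  by (simp add: abelian_group.a_inv_closed)

lemma ag_diff: "abelian_group X ==> x \<in> carrier X ==> y \<in> carrier X ==> x \<ominus>\<^sub>X y \<in> carrier X"
  by (simp add: abelian_group.minus_closed)

lemma ag_assoc: "abelian_group X ==> x \<in> carrier X ==> y \<in> carrier X ==> z \<in> carrier X ==>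
   (x \<oplus>\<^sub>X y) \<oplus>\<^sub>X z = x \<oplus>\<^sub>X (y \<oplus>\<^sub>X z)"
  by (simp add: abelian_group.axioms(1) abelian_monoid.a_assoc)

lemma ag_comm: "abelian_group X ==> x \<in> carrier X ==> y \<in> carrier X ==> x \<oplus>\<^sub>X y = y \<oplus>\<^sub>X x"
  by (simp add: abelian_group.axioms(1) abelian_monoid.a_comm)

lemma ag_lcomm: "abelian_group X ==> x \<in> carrier X ==> y \<in> carrier X ==> z \<in> carrier X ==>
   x \<oplus>\<^sub>X (y \<oplus>\<^sub>X z) = y \<oplus>\<^sub>X (x \<oplus>\<^sub>X z)"
  by (simp add: abelian_group.axioms(1) abelian_monoid.a_lcomm)

lemma ag_lzero: "abelian_group X ==> x \<in> carrier X ==> \<zero>\<^sub>X \<oplus>\<^sub>X x = x"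
  by (simp add: abelian_group.axioms(1) abelian_monoid.l_zero)

lemma ag_rzero: "abelian_group X ==> x \<in> carrier X ==> x \<oplus>\<^sub>X \<zero>\<^sub>X = x"
  by (simp add: abelian_group.axioms(1) abelian_monoid.r_zero)

lemma ag_lneg: "abelian_group X ==> x \<in> carrier X ==> \<ominus>\<^sub>X x \<oplus>\<^sub>X x = \<zero>\<^sub>X"
  by (simp add: abelian_group.l_neg)

lemma ag_rneg: "abelian_group X ==> x \<in> carrier X ==> x \<oplus>\<^sub>X \<ominus>\<^sub>X x = \<zero>\<^sub>X"
  by (simp add: abelian_group.r_neg)

lemma ag_neg_add: "abelian_group X ==> x \<in> carrier X ==> y \<in> carrier X ==>
    \<ominus>\<^sub>X (x \<oplus>\<^sub>X y) = \<ominus>\<^sub>X x \<oplus>\<^sub>X \<ominus>\<^sub>X y"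
  by (simp add: abelian_group.minus_add)

lemma ag_neg_neg: "abelian_group X ==> x \<in> carrier X ==> \<ominus>\<^sub>X (\<ominus>\<^sub>X x) = x"
  by (simp add: abelian_group.minus_minus)

lemma ag_cancel: "abelian_group X ==> x \<in> carrier X ==> y \<in> carrier X ==> \<ominus>\<^sub>X x \<oplus>\<^sub>X (x \<oplus>\<^sub>X y) = y"
  by (simp add: abelian_group.r_neg1)

lemma ag_cancel': "abelian_group X ==> x \<in> carrier X ==> y \<in> carrier X ==> x \<oplus>\<^sub>X (\<ominus>\<^sub>X x \<oplus>\<^sub>X y) = y"
  by (simp add: abelian_group.r_neg2)

lemma ag_diff_zero: "abelian_group X ==> x \<in> carrier X ==> y \<in> carrier X ==> x \<ominus>\<^sub>X y = \<zero>\<^sub>X \<longleftrightarrow> x = y"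
  by (metis a_minus_def ag_cancel ag_neg ag_neg_neg ag_rneg ag_rzero ag_comm)

lemma ag_diff_add: "abelian_group X ==> x \<in> carrier X ==> y \<in> carrier X ==> (x \<ominus>\<^sub>X y) \<oplus>\<^sub>X y = x"
  by (simp add: a_minus_def ag_assoc ag_neg ag_lneg ag_rzero)

lemmas ag_simps = ag_closed ag_zero ag_neg ag_diff ag_lzero ag_rzero ag_lneg ag_rneg
  ag_cancel ag_cancel' ag_neg_neg

lemmas ag_ac = ag_assoc ag_comm ag_lcomm

lemma lm_smult: "left_module R X ==> a \<in> carrier R ==> x \<in> carrier X ==> a \<odot>\<^sub>X x \<in> carrier X"
  by (simp add: left_module.smult_closed)

lemma lm_l_distr: "left_module R X ==> a \<in> carrier R ==> b \<in> carrier R ==> x \<in> carrier X ==>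
    (a \<oplus>\<^sub>R b) \<odot>\<^sub>X x = a \<odot>\<^sub>X x \<oplus>\<^sub>X b \<odot>\<^sub>X x"
  by (simp add: left_module.smult_l_distr)

lemma lm_r_distr: "left_module R X ==> a \<in> carrier R ==> x \<in> carrier X ==> y \<in> carrier X ==>
    a \<odot>\<^sub>X (x \<oplus>\<^sub>X y) = a \<odot>\<^sub>X x \<oplus>\<^sub>X a \<odot>\<^sub>X y"
  by (simp add: left_module.smult_r_distr)

lemma lm_assoc: "left_module R X ==> a \<in> carrier R ==> b \<in> carrier R ==> x \<in> carrier X ==>
    (a \<otimes>\<^sub>R b) \<odot>\<^sub>X x = a \<odot>\<^sub>X (b \<odot>\<^sub>X x)"
  by (simp add: left_module.smult_assoc1)

lemma lm_one: "left_module R X ==> x \<in> carrier X ==> \<one>\<^sub>R \<odot>\<^sub>X x = x"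
  by (simp add: left_module.smult_one)

lemma ag_eq_zeroI: "abelian_group X ==> x \<in> carrier X ==> x \<oplus>\<^sub>X x = x ==> x = \<zero>\<^sub>X"
  by (metis ag_cancel ag_lneg)

lemma lm_zero_smult: "left_module R X ==> x \<in> carrier X ==> \<zero>\<^sub>R \<odot>\<^sub>X x = \<zero>\<^sub>X"
  by (metis ag_eq_zeroI ag_lzero ag_zero lm_ag lm_l_distr lm_ring lm_smult ring.is_abelian_group)

lemma lm_smult_zero: "left_module R X ==> a \<in> carrier R ==> a \<odot>\<^sub>X \<zero>\<^sub>X = \<zero>\<^sub>X"
  by (metis ag_eq_zeroI ag_lzero ag_zero lm_ag lm_r_distr lm_smult)

lemma ag_neg_unique: "abelian_group X ==> x \<in> carrier X ==> y \<in> carrier X ==> x \<oplus>\<^sub>X y = \<zero>\<^sub>X ==> y = \<ominus>\<^sub>X x"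
  by (metis ag_cancel ag_rzero ag_neg)

lemma lm_neg_smult: "left_module R X ==> a \<in> carrier R ==> x \<in> carrier X ==> (\<ominus>\<^sub>R a) \<odot>\<^sub>X x = \<ominus>\<^sub>X (a \<odot>\<^sub>X x)"
  by (rule ag_neg_unique[OF lm_ag])
     (simp_all only: lm_smult ag_neg[OF ring.is_abelian_group[OF lm_ring]] lm_l_distr[symmetric]
        ag_rneg[OF ring.is_abelian_group[OF lm_ring]] lm_zero_smult)

lemma lm_smult_neg: "left_module R X ==> a \<in> carrier R ==> x \<in> carrier X ==> a \<odot>\<^sub>X (\<ominus>\<^sub>X x) = \<ominus>\<^sub>X (a \<odot>\<^sub>X x)"
  by (rule ag_neg_unique[OF lm_ag])
     (simp_all only: lm_smult ag_neg[OF lm_ag] lm_r_distr[symmetric] ag_rneg[OF lm_ag] lm_smult_zero)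

lemma lin_zero:
  assumes f: "lin R X Y f" and X: "abelian_group X" and Y: "abelian_group Y"
  shows "f \<zero>\<^sub>X = \<zero>\<^sub>Y"
proof (rule ag_eq_zeroI[OF Y lin_closed[OF f ag_zero[OF X]]])
  show "f \<zero>\<^sub>X \<oplus>\<^sub>Y f \<zero>\<^sub>X = f \<zero>\<^sub>X"
    by (simp only: lin_add[OF f ag_zero[OF X] ag_zero[OF X], symmetric] ag_lzero[OF X ag_zero[OF X]])
qed

lemma lin_neg:
  assumes "lin R X Y f" "abelian_group X" "abelian_group Y" "x \<in> carrier X"
  shows "f (\<ominus>\<^sub>X x) = \<ominus>\<^sub>Y (f x)"
  by (rule ag_neg_unique[OF assms(3)])
     (simp_all add: assms ag_neg lin_closed[OF assms(1)] lin_add[OF assms(1), symmetric] ag_rneg lin_zero[OF assms(1-3)])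

lemma lin_diff: "lin R X Y f ==> abelian_group X ==> abelian_group Y ==> x \<in> carrier X ==> y \<in> carrier X ==>
    f (x \<ominus>\<^sub>X y) = f x \<ominus>\<^sub>Y f y"
  by (simp add: a_minus_def lin_add lin_neg ag_neg)

lemmas lm_zero = ag_zero[OF lm_ag]
lemmas lm_closed = ag_closed[OF lm_ag]
lemmas lm_lin_zero = lin_zero[OF _ lm_ag lm_ag]
lemmas lm_simps = lm_smult lm_zero_smult lm_smult_zero lm_one lm_neg_smult lm_smult_neg
lemmas lin_simps = lin_closed lin_add lin_smult

lemma lin_cong: "(\<And>x. x \<in> carrier X ==> f x = g x) ==> left_module R X ==> lin R X Y f \<longleftrightarrow> lin R X Y g"
  by (auto simp: lin_def lm_smult lm_ag ag_closed)

lemma lin_comp: "lin R X Y f ==> lin R Y Z g ==> lin R X Z (\<lambda>x. g (f x))"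
  by (auto simp: lin_def)

lemma lin_id: "lin R X X (\<lambda>x. x)"
  by (auto simp: lin_def)

lemma lin_const_zero: "left_module R Y ==> lin R X Y (\<lambda>x. \<zero>\<^sub>Y)"
  by (auto simp: lin_def lm_smult_zero lm_ag ag_simps)

lemma lin_plus: "left_module R Y ==> lin R X Y f ==> lin R X Y g ==> lin R X Y (\<lambda>x. f x \<oplus>\<^sub>Y g x)"
  by (frule lm_ag) (auto simp: lin_def lm_r_distr ag_simps ag_ac)

lemma lin_uminus: "left_module R Y ==> lin R X Y f ==> lin R X Y (\<lambda>x. \<ominus>\<^sub>Y (f x))"
  by (frule lm_ag) (auto simp: lin_def lm_smult_neg ag_simps ag_neg_add)

lemma lin_minus: "left_module R Y ==> lin R X Y f ==> lin R X Y g ==> lin R X Y (\<lambda>x. f x \<ominus>\<^sub>Y g x)"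
  unfolding a_minus_def by (intro lin_plus lin_uminus)

lemma lin_restrict: "left_module R X ==> lin R X Y (restrict f (carrier X)) \<longleftrightarrow> lin R X Y f"
  by (rule lin_cong) auto

lemma lin_sub: "lin R X Y f ==> N \<subseteq> carrier X ==> lin R (X\<restriction>N) Y f"
  by (auto simp: lin_def subset_iff)

lemma lin_into_sub: "lin R X (Y\<restriction>N) f \<longleftrightarrow> lin R X Y f \<and> (\<forall>x\<in>carrier X. f x \<in> N)" if "N \<subseteq> carrier Y"
  using that by (auto simp: lin_def)

lemma lm_intro:
  assumes "ring R" "abelian_group M"
    "\<And>a x. a \<in> carrier R ==> x \<in> carrier M ==> a \<odot>\<^sub>M x \<in> carrier M"
    "\<And>a b x. a \<in> carrier R ==> b \<in> carrier R ==> x \<in> carrier M ==> (a \<oplus>\<^sub>R b) \<odot>\<^sub>M x = a \<odot>\<^sub>M x \<oplus>\<^sub>M b \<odot>\<^sub>M x"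
    "\<And>a x y. a \<in> carrier R ==> x \<in> carrier M ==> y \<in> carrier M ==> a \<odot>\<^sub>M (x \<oplus>\<^sub>M y) = a \<odot>\<^sub>M x \<oplus>\<^sub>M a \<odot>\<^sub>M y"
    "\<And>a b x. a \<in> carrier R ==> b \<in> carrier R ==> x \<in> carrier M ==> (a \<otimes>\<^sub>R b) \<odot>\<^sub>M x = a \<odot>\<^sub>M (b \<odot>\<^sub>M x)"
    "\<And>x. x \<in> carrier M ==> \<one>\<^sub>R \<odot>\<^sub>M x = x"
  shows "left_module R M"
  using assms by (simp add: left_module_def left_module_axioms_def)

lemma ag_intro:
  assumes "\<And>x y. x \<in> carrier X ==> y \<in> carrier X ==> x \<oplus>\<^sub>X y \<in> carrier X"
    "\<zero>\<^sub>X \<in> carrier X"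
    "\<And>x y z. x \<in> carrier X ==> y \<in> carrier X ==> z \<in> carrier X ==> (x \<oplus>\<^sub>X y) \<oplus>\<^sub>X z = x \<oplus>\<^sub>X (y \<oplus>\<^sub>X z)"
    "\<And>x y. x \<in> carrier X ==> y \<in> carrier X ==> x \<oplus>\<^sub>X y = y \<oplus>\<^sub>X x"
    "\<And>x. x \<in> carrier X ==> \<zero>\<^sub>X \<oplus>\<^sub>X x = x"
    "\<And>x. x \<in> carrier X ==> \<exists>y\<in>carrier X. y \<oplus>\<^sub>X x = \<zero>\<^sub>X"
  shows "abelian_group X"
  by (rule abelian_groupI) (use assms in auto)

lemma submodI:
  assumes "left_module R X" "N \<subseteq> carrier X" "\<zero>\<^sub>X \<in> N"
    "\<And>x y. x \<in> N ==> y \<in> N ==> x \<oplus>\<^sub>X y \<in> N"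
    "\<And>a x. a \<in> carrier R ==> x \<in> N ==> a \<odot>\<^sub>X x \<in> N"
  shows "submodule N R X"
proof -
  have R: "ring R" and G: "abelian_group X" using assms(1) by (auto simp: lm_ring lm_ag)
  have neg: "\<ominus>\<^sub>X x \<in> N" if "x \<in> N" for x
  proof -
    have one: "\<one>\<^sub>R \<in> carrier R" and x: "x \<in> carrier X"
      using R that assms(2) by (auto simp: ring.ring_simprules(6))
    have "\<ominus>\<^sub>X x = (\<ominus>\<^sub>R \<one>\<^sub>R) \<odot>\<^sub>X x"
      by (simp only: lm_neg_smult[OF assms(1) one x] lm_one[OF assms(1) x])
    thus ?thesis using that assms(5) ag_neg[OF ring.is_abelian_group[OF R] one] by simp
  qed
  have "subgroup N (add_monoid X)"
    by (rule subgroup.intro) (simp_all add: assms(2-4) neg[unfolded a_inv_def])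
  thus ?thesis
    using assms(5) by (intro submodule.intro submodule_axioms.intro) auto
qed

lemma submodD:
  assumes "left_module R X" "submodule N R X"
  shows "N \<subseteq> carrier X" "\<zero>\<^sub>X \<in> N"
    "\<And>x y. x \<in> N ==> y \<in> N ==> x \<oplus>\<^sub>X y \<in> N"
    "\<And>a x. a \<in> carrier R ==> x \<in> N ==> a \<odot>\<^sub>X x \<in> N"
    "\<And>x. x \<in> N ==> \<ominus>\<^sub>X x \<in> N"
    "\<And>x y. x \<in> N ==> y \<in> N ==> x \<ominus>\<^sub>X y \<in> N"
proof -
  interpret N: subgroup N "add_monoid X" using assms(2) by (rule submodule.axioms(1))
  show 1: "N \<subseteq> carrier X" using N.subset by simp
  show "\<zero>\<^sub>X \<in> N" using N.one_closed by simp
  show add: "\<And>x y. x \<in> N ==> y \<in> N ==> x \<oplus>\<^sub>X y \<in> N" using N.m_closed by simp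
  show "\<And>a x. a \<in> carrier R ==> x \<in> N ==> a \<odot>\<^sub>X x \<in> N" using assms(2) by (rule submodule.smult_closed)
  show neg: "\<And>x. x \<in> N ==> \<ominus>\<^sub>X x \<in> N" using N.m_inv_closed by (simp add: a_inv_def)
  show "\<And>x y. x \<in> N ==> y \<in> N ==> x \<ominus>\<^sub>X y \<in> N" using add neg by (simp add: a_minus_def)
qed

lemma sub_lm:
  assumes X: "left_module R X" and N: "submodule N R X"
  shows "left_module R (X\<restriction>N)"
proof -
  note D = submodD[OF X N] and G = lm_ag[OF X]
  have sub: "\<And>x. x \<in> N ==> x \<in> carrier X" using D(1) by auto
  have "abelian_group (X\<restriction>N)"
    by (rule ag_intro) (auto simp: D(2,3) sub G ag_simps ag_ac intro!: bexI[where x = "\<ominus>\<^sub>X _"] D(5))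
  thus ?thesis
    by (intro lm_intro)
       (auto simp: lm_ring[OF X] D(4) sub lm_l_distr[OF X] lm_r_distr[OF X] lm_assoc[OF X] lm_one[OF X])
qed

lemma ker_submod:
  assumes X: "left_module R X" and Y: "left_module R Y" and f: "lin R X Y f"
  shows "submodule (mod_ker X Y f) R X"
  by (rule submodI[OF X])
     (auto simp: mod_ker_def lm_ag[OF X] lm_ag[OF Y] ag_simps lin_zero[OF f] lin_simps[OF f] lm_simps[OF X] lm_simps[OF Y])

lemma image_submod:
  assumes X: "left_module R X" and Y: "left_module R Y" and f: "lin R X Y f" and N: "submodule N R X"
  shows "submodule (f ` N) R Y"
proof (rule submodI[OF Y])
  note D = submodD[OF X N]
  have sub: "\<And>x. x \<in> N ==> x \<in> carrier X" using D(1) by auto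
  show "f ` N \<subseteq> carrier Y" using sub lin_closed[OF f] by auto
  show "\<zero>\<^sub>Y \<in> f ` N" using D(2) lm_lin_zero[OF f X Y] by (metis image_eqI)
  show "x \<oplus>\<^sub>Y y \<in> f ` N" if "x \<in> f ` N" "y \<in> f ` N" for x y
    using that sub D(3) by (auto simp: lin_add[OF f, symmetric])
  show "a \<odot>\<^sub>Y x \<in> f ` N" if "a \<in> carrier R" "x \<in> f ` N" for a x
    using that sub D(4) by (auto simp: lin_smult[OF f, symmetric])
qed

lemma carrier_submod: "left_module R X ==> submodule (carrier X) R X"
  by (rule submodI) (auto simp: lm_smult lm_ag ag_simps)

lemma zero_submod: "left_module R X ==> submodule {\<zero>\<^sub>X} R X"
  by (rule submodI) (auto simp: lm_smult_zero lm_ag ag_simps)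

lemma preimage_submod:
  assumes X: "left_module R X" and Y: "left_module R Y" and f: "lin R X Y f" and N: "submodule N R Y"
  shows "submodule {x \<in> carrier X. f x \<in> N} R X"
  by (rule submodI[OF X])
     (auto simp: lm_ag[OF X] lm_ag[OF Y] ag_simps lin_zero[OF f] lin_simps[OF f] lm_simps[OF X] submodD[OF Y N])

text \<open>A quotient module is given throughout by a surjection and its kernel; then a map out of it is one
  that vanishes on the kernel.\<close>

lemma lin_factor:
  assumes X: "left_module R X" and Y: "left_module R Y" and Q: "left_module R Q"
    and p: "lin R X Q p" "p ` carrier X = carrier Q" and f: "lin R X Y f"
    and ker: "\<And>x. x \<in> carrier X ==> p x = \<zero>\<^sub>Q ==> f x = \<zero>\<^sub>Y"
  obtains f' where "lin R Q Y f'" "\<And>x. x \<in> carrier X ==> f' (p x) = f x"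
proof -
  define s where "s q = (SOME x. x \<in> carrier X \<and> p x = q)" for q
  have s: "s q \<in> carrier X \<and> p (s q) = q" if "q \<in> carrier Q" for q
  proof -
    have "\<exists>x. x \<in> carrier X \<and> p x = q" using that p(2)[symmetric] by auto
    thus ?thesis unfolding s_def by (rule someI_ex)
  qed
  have wd: "f x = f y" if "x \<in> carrier X" "y \<in> carrier X" "p x = p y" for x y
  proof -
    have "p (x \<ominus>\<^sub>X y) = \<zero>\<^sub>Q"
      using that p(1) X Q by (simp add: lin_diff lm_ag ag_diff_zero lin_closed)
    hence "f (x \<ominus>\<^sub>X y) = \<zero>\<^sub>Y" using that X by (intro ker) (auto simp: lm_ag ag_simps)
    thus ?thesis using that f X Y by (simp add: lin_diff lm_ag ag_diff_zero lin_closed)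
  qed
  have eq: "f (s (p x)) = f x" if "x \<in> carrier X" for x
    using that s[of "p x"] lin_closed[OF p(1)] by (auto intro: wd)
  have "lin R Q Y (\<lambda>q. f (s q))"
  proof (rule linI)
    fix a b assume "a \<in> carrier Q" "b \<in> carrier Q"
    then obtain x y where "x \<in> carrier X" "y \<in> carrier X" "a = p x" "b = p y" using p(2) by blast
    then show "f (s (a \<oplus>\<^sub>Q b)) = f (s a) \<oplus>\<^sub>Y f (s b)"
      by (simp add: lin_add[OF p(1), symmetric] eq lm_ag[OF X] ag_closed lin_add[OF f])
  next
    fix r a assume "a \<in> carrier Q" "r \<in> carrier R"
    then obtain x where "x \<in> carrier X" "a = p x" using p(2) by blast
    then show "f (s (r \<odot>\<^sub>Q a)) = r \<odot>\<^sub>Y f (s a)"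
      using \<open>r \<in> carrier R\<close>
      by (simp add: lin_smult[OF p(1), symmetric] eq lm_smult[OF X] lin_smult[OF f])
  qed (use s lin_closed[OF f] in auto)
  with that eq show thesis by blast
qed

lemma lin_surj_sum:
  assumes X: "left_module R X" and Y: "left_module R Y" and f: "lin R X Y f"
    and x: "x \<in> carrier X" "y \<in> carrier X" "f x = f y"
  shows "x \<ominus>\<^sub>X y \<in> mod_ker X Y f"
  using assms by (simp add: mod_ker_def lin_diff lm_ag ag_diff_zero lin_closed ag_simps)

lemma lin_inverse:
  assumes X: "left_module R X" and Y: "left_module R Y" and f: "lin R X Y f"
    and b: "bij_betw f (carrier X) (carrier Y)"
  obtains g where "lin R Y X g" "\<And>x. x \<in> carrier X ==> g (f x) = x" "\<And>y. y \<in> carrier Y ==> f (g y) = y"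
proof -
  have "f ` carrier X = carrier Y" and inj: "inj_on f (carrier X)" using b by (auto simp: bij_betw_def)
  moreover have "x = \<zero>\<^sub>X" if "x \<in> carrier X" "f x = \<zero>\<^sub>Y" for x
    using that inj_onD[OF inj, of x "\<zero>\<^sub>X"] lm_lin_zero[OF f X Y] lm_zero[OF X]
    by simp
  ultimately obtain g where g: "lin R Y X g" "\<And>x. x \<in> carrier X ==> g (f x) = x"
    using lin_factor[OF X X Y f _ lin_id] by blast
  moreover have "f (g y) = y" if "y \<in> carrier Y" for y
    using that g(2) \<open>f ` carrier X = carrier Y\<close> by (metis image_iff)
  ultimately show thesis using that by blast
qed

lemma inj_if_ker:
  assumes X: "left_module R X" and Y: "left_module R Y" and f: "lin R X Y f"
    and ker: "\<And>x. x \<in> carrier X ==> f x = \<zero>\<^sub>Y ==> x = \<zero>\<^sub>X"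
  shows "inj_on f (carrier X)"
proof (rule inj_onI)
  fix x y assume "x \<in> carrier X" "y \<in> carrier X" "f x = f y"
  then have "x \<ominus>\<^sub>X y = \<zero>\<^sub>X"
    using ker[of "x \<ominus>\<^sub>X y"] lin_surj_sum[OF X Y f] by (auto simp: mod_ker_def)
  thus "x = y" using \<open>x \<in> carrier X\<close> \<open>y \<in> carrier X\<close> X by (simp add: ag_diff_zero lm_ag)
qed

lemma mod_isoI:
  assumes "left_module R X" "lin R X Y f" "bij_betw f (carrier X) (carrier Y)"
  shows "mod_iso R X Y"
  unfolding mod_iso_def
  by (rule bexI[of _ "restrict f (carrier X)"])
     (use assms in \<open>auto simp: mod_hom_iff lin_restrict bij_betw_def inj_on_def\<close>)

lemma bij_if_inverse:
  assumes "lin R X Y f" "lin R Y X g" "\<And>x. x \<in> carrier X ==> g (f x) = x" "\<And>y. y \<in> carrier Y ==> f (g y) = y"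
  shows "bij_betw f (carrier X) (carrier Y)"
  by (rule bij_betw_byWitness[of _ g]) (auto simp: assms lin_closed[OF assms(1)] lin_closed[OF assms(2)])

lemma mod_isoE:
  assumes "mod_iso R X Y" "left_module R X" "left_module R Y"
  obtains f g where "lin R X Y f" "lin R Y X g" "\<And>x. x \<in> carrier X ==> g (f x) = x" "\<And>y. y \<in> carrier Y ==> f (g y) = y"
proof -
  from assms(1) obtain f where "lin R X Y f" "bij_betw f (carrier X) (carrier Y)"
    by (auto simp: mod_iso_def mod_hom_iff)
  from lin_inverse[OF assms(2,3) this] that[OF this(1)] show thesis by blast
qed

section \<open>Maps that factor through powers of a module\<close>

text \<open>The maps that factor through a finite power of \<open>M\<close>. As sums of composites they are amenable to
  rule induction, and no direct sums have to be formed.\<close>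

inductive thru for R M X Y where
  thru_zero: "(\<And>x. x \<in> carrier X ==> h x = \<zero>\<^sub>Y) ==> thru R M X Y h"
| thru_add: "thru R M X Y g ==> lin R X M u ==> lin R M Y v ==>
    (\<And>x. x \<in> carrier X ==> h x = g x \<oplus>\<^sub>Y v (u x)) ==> thru R M X Y h"

abbreviation summand where "summand R M X \<equiv> thru R M X X (\<lambda>x. x)"

lemma thru_cong: "thru R M X Y g ==> (\<And>x. x \<in> carrier X ==> h x = g x) ==> thru R M X Y h"
  by (induction arbitrary: h rule: thru.induct) (auto intro: thru.intros)

lemma thru_lin:
  assumes "thru R M X Y h" "left_module R X" "left_module R Y"
  shows "lin R X Y h"
  using assms
proof (induction rule: thru.induct)
  case (thru_zero h)
  then show ?case using lin_cong[of X h "\<lambda>_. \<zero>\<^sub>Y"] lin_const_zero by blast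
next
  case (thru_add g u v h)
  then have "lin R X Y (\<lambda>x. g x \<oplus>\<^sub>Y v (u x))" by (intro lin_plus lin_comp[of R X M u Y v]) auto
  then show ?case using thru_add lin_cong[of X h "\<lambda>x. g x \<oplus>\<^sub>Y v (u x)"] by blast
qed

lemma thru_single:
  assumes "lin R X M u" "lin R M Y v" "left_module R X" "left_module R Y"
  shows "thru R M X Y (\<lambda>x. v (u x))"
  by (rule thru_add[OF thru_zero, of X "\<lambda>_. \<zero>\<^sub>Y" Y R M u v])
     (use assms in \<open>auto simp: lm_ag ag_lzero lin_closed\<close>)

lemma thru_plus:
  assumes "thru R M X Y h" "thru R M X Y g" "left_module R X" "left_module R Y"
  shows "thru R M X Y (\<lambda>x. g x \<oplus>\<^sub>Y h x)"
  using assms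
proof (induction rule: thru.induct)
  case (thru_zero h)
  then show ?case using thru_lin[of R M X Y g]
    by (auto intro!: thru_cong[of R M X Y g "\<lambda>x. g x \<oplus>\<^sub>Y h x"] simp: lm_ag ag_rzero lin_closed)
next
  case (thru_add g' u v h)
  note L = thru_lin[OF thru_add.prems(1-3)] thru_lin[OF thru_add.hyps(1) thru_add.prems(2,3)]
  show ?case
    by (rule thru.thru_add[OF thru_add.IH[OF thru_add.prems] thru_add.hyps(2,3)])
       (use thru_add L in \<open>auto simp: lm_ag ag_assoc lin_closed\<close>)
qed

lemma thru_pre:
  assumes "thru R M X Y h" "lin R X' X f"
  shows "thru R M X' Y (\<lambda>x. h (f x))"
  using assms
proof (induction rule: thru.induct)
  case (thru_add g u v h)
  show ?case
    by (rule thru.thru_add[OF thru_add.IH lin_comp[OF thru_add.prems thru_add.hyps(2)] thru_add.hyps(3)])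
       (use thru_add lin_closed in \<open>fastforce+\<close>)
qed (auto intro: thru.thru_zero simp: lin_closed)

lemma thru_post:
  assumes "thru R M X Y h" "lin R Y Y' f" "left_module R X" "left_module R Y" "left_module R Y'"
  shows "thru R M X Y' (\<lambda>x. f (h x))"
  using assms
proof (induction rule: thru.induct)
  case (thru_zero h)
  then show ?case by (auto intro!: thru.thru_zero simp: lin_zero lm_ag)
next
  case (thru_add g u v h)
  show ?case
    by (rule thru.thru_add[OF thru_add.IH[OF thru_add.prems] thru_add.hyps(2) lin_comp[OF thru_add.hyps(3) thru_add.prems(1)]])
       (use thru_add thru_lin[OF thru_add.hyps(1) thru_add.prems(2,3)] in \<open>auto simp: lin_add lin_closed\<close>)
qed

lemma thru_trans:
  assumes "thru R M X Y h" and M: "summand R M' M" "left_module R X" "left_module R Y" "left_module R M"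
  shows "thru R M' X Y h"
  using assms(1)
proof (induction rule: thru.induct)
  case (thru_add g u v h)
  have "thru R M' X Y (\<lambda>x. v (u x))"
    using thru_post[OF thru_pre[OF M(1) thru_add.hyps(2)] thru_add.hyps(3)] M by simp
  from thru_cong[OF thru_plus[OF this thru_add.IH]] show ?case using thru_add M by simp
qed (rule thru.thru_zero)

lemma thru_retract:
  assumes "lin R X M u" "lin R M X v" "\<And>x. x \<in> carrier X ==> v (u x) = x" "left_module R X"
  shows "summand R M X"
  using thru_cong[OF thru_single[OF assms(1,2,4,4)]] assms(3) by simp

lemma thru_transfer:
  assumes "summand R M X" "lin R Y X u" "lin R X Y v" "\<And>x. x \<in> carrier Y ==> v (u x) = x"
    "left_module R X" "left_module R Y"
  shows "summand R M Y"
  using thru_cong[OF thru_post[OF thru_pre[OF assms(1,2)] assms(3)]] assms(4-) by simp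

lemma thru_iso:
  assumes "summand R M X" "mod_iso R X Y \<or> mod_iso R Y X" "left_module R X" "left_module R Y"
  shows "summand R M Y"
proof -
  obtain f g where "lin R Y X f" "lin R X Y g" "\<And>x. x \<in> carrier Y ==> g (f x) = x"
    using assms(2)
  proof
    assume "mod_iso R X Y"
    from mod_isoE[OF this assms(3,4)] that show thesis by metis
  next
    assume "mod_iso R Y X"
    from mod_isoE[OF this assms(4,3)] that show thesis by metis
  qed
  from thru_transfer[OF assms(1) this assms(3,4)] show ?thesis .
qed

lemma thru_iso_base:
  assumes "summand R M X" "mod_iso R M M' \<or> mod_iso R M' M" "left_module R X" "left_module R M" "left_module R M'"
  shows "summand R M' X"
proof (rule thru_trans[OF assms(1) _ assms(3,3,4)])
  have "summand R M' M'"
    by (rule thru_retract[OF lin_id lin_id refl assms(5)])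
  thus "summand R M' M" using assms(2) by (intro thru_iso[OF _ _ assms(5,4)]) auto
qed


lemma regular_simps [simp]:
  "carrier (reg R) = carrier R" "\<zero>\<^bsub>reg R\<^esub> = \<zero>\<^sub>R"
  "x \<oplus>\<^bsub>reg R\<^esub> y = x \<oplus>\<^sub>R y" "a \<odot>\<^bsub>reg R\<^esub> x = a \<otimes>\<^sub>R x"
  by (simp_all add: regular_module_def)

lemma regular_ag: "ring R ==> abelian_group (reg R)"
proof (rule ag_intro)
  assume "ring R"
  hence G: "abelian_group R" by (rule ring.is_abelian_group)
  fix x assume "x \<in> carrier (reg R)"
  thus "\<exists>y\<in>carrier (reg R). y \<oplus>\<^bsub>reg R\<^esub> x = \<zero>\<^bsub>reg R\<^esub>"
    using ag_lneg[OF G, of x] ag_neg[OF G, of x] by auto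
qed (auto simp: ag_simps ag_ac ring.is_abelian_group)

lemma ag_neg_zero: "abelian_group X ==> \<ominus>\<^sub>X \<zero>\<^sub>X = \<zero>\<^sub>X"
  using ag_neg_unique[of X "\<zero>\<^sub>X" "\<zero>\<^sub>X"] by (simp add: ag_simps)

lemma ag_add_left_zero:
  assumes "abelian_group X" "x \<in> carrier X" "y \<in> carrier X" "x \<oplus>\<^sub>X y = y"
  shows "x = \<zero>\<^sub>X"
proof -
  have "x = \<ominus>\<^sub>X y \<oplus>\<^sub>X (y \<oplus>\<^sub>X x)" using assms(1-3) by (simp add: ag_cancel)
  also have "y \<oplus>\<^sub>X x = y" using assms ag_comm by metis
  finally show ?thesis using assms(1-3) by (simp add: ag_lneg)
qed

lemma regular_lm: "ring R ==> left_module R (reg R)"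
  by (rule lm_intro) (auto simp: regular_ag ring.ring_simprules(5,11,12,13,23))

lemma cyclic_lin:
  assumes X: "left_module R X" and x: "x \<in> carrier X"
  shows "lin R (reg R) X (\<lambda>a. a \<odot>\<^sub>X x)"
  by (rule linI) (auto simp: lm_smult[OF X _ x] lm_l_distr[OF X _ _ x] lm_assoc[OF X _ _ x])

lemma fgI:
  assumes "finite S" "S \<subseteq> carrier X" "\<And>N. submodule N R X ==> S \<subseteq> N ==> carrier X \<subseteq> N" "left_module R X"
  shows "fin_generated R X"
  unfolding fin_generated_def using assms submodD(1)[OF assms(4)] by (intro exI[of _ S]) blast

text \<open>If the identity is \<open>x \<mapsto> \<Sum> v\<^sub>i (u\<^sub>i x)\<close>, then the elements \<open>v\<^sub>i 1\<close> generate.\<close>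

lemma thru_regular_fg:
  assumes th: "summand R (reg R) X" and X: "left_module R X"
  shows "fin_generated R X"
proof -
  have "\<exists>S. finite S \<and> S \<subseteq> carrier X \<and> (\<forall>N. submodule N R X \<longrightarrow> S \<subseteq> N \<longrightarrow> h ` carrier X \<subseteq> N)"
    if "thru R (reg R) X X h" for h
    using that
  proof (induction rule: thru.induct)
    case (thru_zero h)
    then show ?case using submodD(2)[OF X] by (intro exI[of _ "{}"]) auto
  next
    case (thru_add g u v h)
    then obtain S where S: "finite S" "S \<subseteq> carrier X" "\<And>N. submodule N R X ==> S \<subseteq> N ==> g ` carrier X \<subseteq> N"
      by blast
    have one: "\<one>\<^sub>R \<in> carrier R" using lm_ring[OF X] by (simp add: ring.ring_simprules(6))
    have v: "v r = r \<odot>\<^sub>X v \<one>\<^sub>R" if "r \<in> carrier R" for r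
      using lin_smult[OF thru_add.hyps(3) that, of "\<one>\<^sub>R"] one that lm_ring[OF X]
      by (simp add: monoid.r_one ring.is_monoid)
    have "h ` carrier X \<subseteq> N" if "submodule N R X" "insert (v \<one>\<^sub>R) S \<subseteq> N" for N
    proof
      fix y assume "y \<in> h ` carrier X"
      then obtain x where x: "x \<in> carrier X" "y = h x" by auto
      have "u x \<in> carrier R" using lin_closed[OF thru_add.hyps(2) x(1)] by simp
      from v[OF this] this have "v (u x) \<in> N" using submodD(4)[OF X that(1)] that(2) by auto
      moreover have "g x \<in> N" using S(3)[OF that(1)] that(2) x by auto
      ultimately show "y \<in> N" using x thru_add.hyps(4) submodD(3)[OF X that(1)] by simp
    qed
    moreover have "v \<one>\<^sub>R \<in> carrier X" using lin_closed[OF thru_add.hyps(3)] one by simp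
    ultimately show ?case using S(1,2) by (intro exI[of _ "insert (v \<one>\<^sub>R) S"]) auto
  qed
  from this[OF th] obtain S where "finite S" "S \<subseteq> carrier X" "\<forall>N. submodule N R X \<longrightarrow> S \<subseteq> N \<longrightarrow> carrier X \<subseteq> N"
    by auto
  thus ?thesis by (intro fgI[of S X R, OF _ _ _ X]) auto
qed

section \<open>Finite-dimensional vector spaces\<close>

definition adj where "adj K V U v = {u \<oplus>\<^sub>V k \<odot>\<^sub>V v | u k. u \<in> U \<and> k \<in> carrier K}"

locale fspace = fixes K :: "'k ring" and V :: "('k, 'v) module"
  assumes fld: "field K" and V: "left_module K V"
begin

lemma K: "ring K" using V by (rule lm_ring)
lemma VG: "abelian_group V" using V by (rule lm_ag)
lemma KG: "abelian_group K" using K by (rule ring.is_abelian_group)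

lemma adj_submod:
  assumes U: "submodule U K V" and v: "v \<in> carrier V"
  shows "submodule (adj K V U v) K V" "U \<subseteq> adj K V U v" "v \<in> adj K V U v"
proof -
  note D = submodD[OF V U]
  have c: "u \<in> carrier V" if "u \<in> U" for u using that D(1) by auto
  have s: "k \<odot>\<^sub>V v \<in> carrier V" if "k \<in> carrier K" for k using lm_smult[OF V that v] .
  show "U \<subseteq> adj K V U v"
  proof
    fix u assume u: "u \<in> U"
    have "u = u \<oplus>\<^sub>V \<zero>\<^sub>K \<odot>\<^sub>V v" using c[OF u] VG by (simp add: lm_zero_smult[OF V v] ag_rzero)
    thus "u \<in> adj K V U v" unfolding adj_def using u ag_zero[OF KG] by auto
  qed
  show "v \<in> adj K V U v"
  proof -
    have "v = \<zero>\<^sub>V \<oplus>\<^sub>V \<one>\<^sub>K \<odot>\<^sub>V v" using v VG by (simp add: lm_one[OF V] ag_lzero)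
    moreover have "\<one>\<^sub>K \<in> carrier K" using K by (simp add: ring.ring_simprules(6))
    ultimately show ?thesis unfolding adj_def using D(2) by blast
  qed
  show "submodule (adj K V U v) K V"
  proof (rule submodI[OF V])
    show "adj K V U v \<subseteq> carrier V" by (auto simp: adj_def c s ag_closed[OF VG])
    show "\<zero>\<^sub>V \<in> adj K V U v" using \<open>U \<subseteq> adj K V U v\<close> D(2) by auto
  next
    fix x y assume "x \<in> adj K V U v" "y \<in> adj K V U v"
    then obtain u k u' k' where xy: "u \<in> U" "u' \<in> U" "k \<in> carrier K" "k' \<in> carrier K"
      "x = u \<oplus>\<^sub>V k \<odot>\<^sub>V v" "y = u' \<oplus>\<^sub>V k' \<odot>\<^sub>V v" by (auto simp: adj_def)
    have "x \<oplus>\<^sub>V y = (u \<oplus>\<^sub>V u') \<oplus>\<^sub>V (k \<oplus>\<^sub>K k') \<odot>\<^sub>V v"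
      using xy c s by (simp add: lm_l_distr[OF V _ _ v] ag_ac[OF VG] ag_closed[OF VG])
    moreover have "k \<oplus>\<^sub>K k' \<in> carrier K" using xy ag_closed[OF KG] by simp
    ultimately show "x \<oplus>\<^sub>V y \<in> adj K V U v" unfolding adj_def using D(3)[OF xy(1,2)] by blast
  next
    fix a x assume a: "a \<in> carrier K" and "x \<in> adj K V U v"
    then obtain u k where xy: "u \<in> U" "k \<in> carrier K" "x = u \<oplus>\<^sub>V k \<odot>\<^sub>V v" by (auto simp: adj_def)
    have "a \<odot>\<^sub>V x = a \<odot>\<^sub>V u \<oplus>\<^sub>V (a \<otimes>\<^sub>K k) \<odot>\<^sub>V v"
      using xy a c s by (simp add: lm_r_distr[OF V] lm_assoc[OF V _ _ v])
    moreover have "a \<otimes>\<^sub>K k \<in> carrier K" using xy a K by (simp add: ring.ring_simprules(5))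
    ultimately show "a \<odot>\<^sub>V x \<in> adj K V U v" unfolding adj_def using D(4)[OF a xy(1)] by blast
  qed
qed

lemma field_cancel:
  assumes U: "submodule U K V" and v: "v \<in> carrier V" "v \<notin> U" and k: "k \<in> carrier K" "k \<odot>\<^sub>V v \<in> U"
  shows "k = \<zero>\<^sub>K"
proof (rule ccontr)
  assume "k \<noteq> \<zero>\<^sub>K"
  then have unit: "k \<in> Units K" using k(1) field.field_Units[OF fld] by auto
  have i: "inv\<^bsub>K\<^esub> k \<in> carrier K" using unit K by (simp add: monoid.Units_inv_closed ring.is_monoid)
  have "(inv\<^bsub>K\<^esub> k) \<odot>\<^sub>V (k \<odot>\<^sub>V v) = v"
    using lm_assoc[OF V i k(1) v(1)] unit K v(1) by (simp add: monoid.Units_l_inv ring.is_monoid lm_one[OF V])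
  with submodD(4)[OF V U i k(2)] v(2) show False by simp
qed

text \<open>The coefficient of \<open>v\<close> is well defined: a nonzero multiple of \<open>v\<close> in \<open>U\<close> would put \<open>v\<close> into \<open>U\<close>.\<close>

lemma coord:
  assumes U: "submodule U K V" and v: "v \<in> carrier V" "v \<notin> U"
  obtains c where "lin K (V\<restriction>(adj K V U v)) (reg K) c" "\<And>u. u \<in> U ==> c u = \<zero>\<^sub>K"
    "c v = \<one>\<^sub>K" "\<And>x. x \<in> adj K V U v ==> x \<ominus>\<^sub>V c x \<odot>\<^sub>V v \<in> U"
proof -
  note D = submodD[OF V U] note A = adj_submod[OF U v(1)]
  have cU: "u \<in> carrier V" if "u \<in> U" for u using that D(1) by auto
  have s: "k \<odot>\<^sub>V v \<in> carrier V" if "k \<in> carrier K" for k using lm_smult[OF V that v(1)] .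
  have uniq: "k = k'" if "u \<in> U" "u' \<in> U" "k \<in> carrier K" "k' \<in> carrier K"
      "u \<oplus>\<^sub>V k \<odot>\<^sub>V v = u' \<oplus>\<^sub>V k' \<odot>\<^sub>V v" for u u' k k'
  proof -
    have "(k \<ominus>\<^sub>K k') \<odot>\<^sub>V v = k \<odot>\<^sub>V v \<oplus>\<^sub>V \<ominus>\<^sub>V (k' \<odot>\<^sub>V v)"
      using that v by (simp add: a_minus_def lm_l_distr[OF V] lm_neg_smult[OF V] ag_neg[OF KG])
    also have "\<dots> = \<ominus>\<^sub>V u \<oplus>\<^sub>V (u \<oplus>\<^sub>V k \<odot>\<^sub>V v) \<oplus>\<^sub>V \<ominus>\<^sub>V (k' \<odot>\<^sub>V v)"
      using that(1-4) cU s by (simp add: ag_simps[OF VG])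
    also have "\<dots> = \<ominus>\<^sub>V u \<oplus>\<^sub>V (u' \<oplus>\<^sub>V k' \<odot>\<^sub>V v) \<oplus>\<^sub>V \<ominus>\<^sub>V (k' \<odot>\<^sub>V v)" by (simp only: that(5))
    also have "\<dots> = \<ominus>\<^sub>V u \<oplus>\<^sub>V u'"
      using that(1-4) cU s by (simp add: ag_simps[OF VG] ag_assoc[OF VG])
    also have "\<dots> \<in> U" using that D(3,5) by simp
    finally have "k \<ominus>\<^sub>K k' = \<zero>\<^sub>K" using that(1-4) ag_diff[OF KG] by (intro field_cancel[OF U v]) auto
    thus ?thesis using that(1-4) by (simp add: ag_diff_zero[OF KG])
  qed
  define c where "c x = (THE k. k \<in> carrier K \<and> (\<exists>u\<in>U. x = u \<oplus>\<^sub>V k \<odot>\<^sub>V v))" for x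
  have c: "c (u \<oplus>\<^sub>V k \<odot>\<^sub>V v) = k" if "u \<in> U" "k \<in> carrier K" for u k
    unfolding c_def
  proof (rule the_equality)
    show "k \<in> carrier K \<and> (\<exists>u'\<in>U. u \<oplus>\<^sub>V k \<odot>\<^sub>V v = u' \<oplus>\<^sub>V k \<odot>\<^sub>V v)" using that by blast
    fix k' assume "k' \<in> carrier K \<and> (\<exists>u'\<in>U. u \<oplus>\<^sub>V k \<odot>\<^sub>V v = u' \<oplus>\<^sub>V k' \<odot>\<^sub>V v)"
    then obtain u' where "k' \<in> carrier K" "u' \<in> U" "u \<oplus>\<^sub>V k \<odot>\<^sub>V v = u' \<oplus>\<^sub>V k' \<odot>\<^sub>V v" by blast
    from uniq[OF that(1) this(2) that(2) this(1) this(3)] show "k' = k" by simp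
  qed
  have cc: "c (u \<oplus>\<^sub>V k \<odot>\<^sub>V v) = k \<and> u \<oplus>\<^sub>V k \<odot>\<^sub>V v \<ominus>\<^sub>V k \<odot>\<^sub>V v = u" if "u \<in> U" "k \<in> carrier K" for u k
    using that c by (simp add: a_minus_def ag_assoc[OF VG] ag_simps[OF VG] cU s)
  have L: "lin K (V\<restriction>(adj K V U v)) (reg K) c"
  proof (rule linI)
    fix x assume "x \<in> carrier (V\<restriction>(adj K V U v))"
    then show "c x \<in> carrier (reg K)" by (auto simp: adj_def c)
  next
    fix x y assume "x \<in> carrier (V\<restriction>(adj K V U v))" "y \<in> carrier (V\<restriction>(adj K V U v))"
    then obtain u k u' k' where xy: "u \<in> U" "u' \<in> U" "k \<in> carrier K" "k' \<in> carrier K"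
      "x = u \<oplus>\<^sub>V k \<odot>\<^sub>V v" "y = u' \<oplus>\<^sub>V k' \<odot>\<^sub>V v" by (auto simp: adj_def)
    have "x \<oplus>\<^sub>V y = (u \<oplus>\<^sub>V u') \<oplus>\<^sub>V (k \<oplus>\<^sub>K k') \<odot>\<^sub>V v"
      using xy cU s v by (simp add: lm_l_distr[OF V] ag_ac[OF VG] ag_closed[OF VG])
    then show "c (x \<oplus>\<^bsub>V\<restriction>(adj K V U v)\<^esub> y) = c x \<oplus>\<^bsub>reg K\<^esub> c y"
      using xy D(3) by (simp add: c ag_closed[OF KG])
  next
    fix a x assume a: "a \<in> carrier K" and "x \<in> carrier (V\<restriction>(adj K V U v))"
    then obtain u k where xy: "u \<in> U" "k \<in> carrier K" "x = u \<oplus>\<^sub>V k \<odot>\<^sub>V v" by (auto simp: adj_def)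
    have "a \<odot>\<^sub>V x = a \<odot>\<^sub>V u \<oplus>\<^sub>V (a \<otimes>\<^sub>K k) \<odot>\<^sub>V v"
      using xy a cU s v by (simp add: lm_r_distr[OF V] lm_assoc[OF V])
    then show "c (a \<odot>\<^bsub>V\<restriction>(adj K V U v)\<^esub> x) = a \<odot>\<^bsub>reg K\<^esub> c x"
      using xy a D(4) K by (simp add: c ring.ring_simprules(5))
  qed
  have one: "\<one>\<^sub>K \<in> carrier K" and zero: "\<zero>\<^sub>K \<in> carrier K" using K by (auto simp: ring.ring_simprules)
  have "c u = \<zero>\<^sub>K" if "u \<in> U" for u
    using c[OF that zero] cU[OF that] v by (simp add: lm_zero_smult[OF V] ag_rzero[OF VG])
  moreover have "c v = \<one>\<^sub>K"
    using c[OF D(2) one] v by (simp add: lm_one[OF V] ag_lzero[OF VG])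
  moreover have "x \<ominus>\<^sub>V c x \<odot>\<^sub>V v \<in> U" if "x \<in> adj K V U v" for x
    using that cc by (auto simp: adj_def)
  ultimately show thesis using that L by blast
qed

lemma coord_pr:
  assumes U: "submodule U K V" and v: "v \<in> carrier V"
    and c: "lin K (V\<restriction>(adj K V U v)) (reg K) c"
      "\<And>x. x \<in> adj K V U v ==> x \<ominus>\<^sub>V c x \<odot>\<^sub>V v \<in> U"
  shows "lin K (V\<restriction>(adj K V U v)) (V\<restriction>U) (\<lambda>x. x \<ominus>\<^sub>V c x \<odot>\<^sub>V v)"
proof (rule linI)
        have AV: "adj K V U v \<subseteq> carrier V" using submodD(1)[OF V] adj_submod[OF U v] by auto
        have cc: "c x \<odot>\<^sub>V v \<in> carrier V" "c x \<in> carrier K" if "x \<in> adj K V U v" for x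
          using lin_closed[OF c(1)] that lm_smult[OF V _ v(1)] by auto
        fix x y assume "x \<in> carrier (V\<restriction>(adj K V U v))" "y \<in> carrier (V\<restriction>(adj K V U v))"
        hence x: "x \<in> adj K V U v" "y \<in> adj K V U v" "x \<in> carrier V" "y \<in> carrier V" using AV by auto
        show "x \<oplus>\<^bsub>V\<restriction>(adj K V U v)\<^esub> y \<ominus>\<^sub>V c (x \<oplus>\<^bsub>V\<restriction>(adj K V U v)\<^esub> y) \<odot>\<^sub>V v =
          (x \<ominus>\<^sub>V c x \<odot>\<^sub>V v) \<oplus>\<^bsub>V\<restriction>U\<^esub> (y \<ominus>\<^sub>V c y \<odot>\<^sub>V v)"
          using x cc lin_add[OF c(1), of x y] v
          by (simp add: a_minus_def lm_l_distr[OF V] ag_neg_add[OF VG] ag_ac[OF VG] ag_closed[OF VG] ag_neg[OF VG])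
      next
        have AV: "adj K V U v \<subseteq> carrier V" using submodD(1)[OF V] adj_submod[OF U v] by auto
        have cc: "c x \<odot>\<^sub>V v \<in> carrier V" "c x \<in> carrier K" if "x \<in> adj K V U v" for x
          using lin_closed[OF c(1)] that lm_smult[OF V _ v(1)] by auto
        fix a x assume a: "a \<in> carrier K" "x \<in> carrier (V\<restriction>(adj K V U v))"
        hence x: "x \<in> adj K V U v" "x \<in> carrier V" using AV by auto
        show "a \<odot>\<^bsub>V\<restriction>(adj K V U v)\<^esub> x \<ominus>\<^sub>V c (a \<odot>\<^bsub>V\<restriction>(adj K V U v)\<^esub> x) \<odot>\<^sub>V v =
          a \<odot>\<^bsub>V\<restriction>U\<^esub> (x \<ominus>\<^sub>V c x \<odot>\<^sub>V v)"
          using a x cc lin_smult[OF c(1), of a x] v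
          by (simp add: a_minus_def lm_r_distr[OF V] lm_assoc[OF V] lm_smult_neg[OF V] ag_neg[OF VG])
      qed (use c(2) in auto)

inductive flag where
  flag_zero: "flag {\<zero>\<^sub>V} 0"
| flag_step: "flag U n ==> v \<in> carrier V ==> v \<notin> U ==> flag (adj K V U v) (Suc n)"

lemma flag_submod: "flag U n ==> submodule U K V"
  by (induction rule: flag.induct) (auto intro: zero_submod[OF V] adj_submod)

text \<open>Intersecting a chain of subspaces of \<open>U\<close> with \<open>W\<close> gives a chain in which every step is trivial or
  adjoins one vector, and some step is trivial if \<open>W\<close> is a proper subspace.\<close>

lemma flag_subspace:
  assumes "flag U n" "submodule W K V" "W \<subseteq> U"
  shows "\<exists>m. flag W m \<and> m \<le> n \<and> (m = n \<longrightarrow> W = U)"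
  using assms
proof (induction arbitrary: W rule: flag.induct)
  case flag_zero
  then have "W = {\<zero>\<^sub>V}" using submodD(2)[OF V flag_zero(1)] by auto
  then show ?case using flag.flag_zero by auto
next
  case (flag_step U n v)
  have U: "submodule U K V" using flag_step.hyps(1) by (rule flag_submod)
  note W = submodD[OF V flag_step.prems(1)] and D = submodD[OF V U]
  note A = adj_submod[OF U flag_step.hyps(2)]
  have WU: "submodule (W \<inter> U) K V" by (rule submodI[OF V]) (use W D in auto)
  from flag_step.IH[OF WU] obtain m where m: "flag (W \<inter> U) m" "m \<le> n" "m = n \<longrightarrow> W \<inter> U = U" by auto
  show ?case
  proof (cases "W \<subseteq> U")
    case True
    hence "W \<inter> U = W" by auto
    with m show ?thesis by auto
  next
    case False
    then obtain w where w: "w \<in> W" "w \<notin> U" by auto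
    have wV: "w \<in> carrier V" using w W(1) by auto
    obtain c where c: "lin K (V\<restriction>(adj K V U v)) (reg K) c" "\<And>u. u \<in> U ==> c u = \<zero>\<^sub>K"
      "c v = \<one>\<^sub>K" "\<And>x. x \<in> adj K V U v ==> x \<ominus>\<^sub>V c x \<odot>\<^sub>V v \<in> U"
      using coord[OF U flag_step.hyps(2,3)] by blast
    have cK: "c x \<in> carrier K" if "x \<in> adj K V U v" for x using lin_closed[OF c(1)] that by simp
    have wa: "w \<in> adj K V U v" using w flag_step.prems(2) by auto
    have cw: "c w \<noteq> \<zero>\<^sub>K"
    proof
      assume "c w = \<zero>\<^sub>K"
      hence "w \<in> U" using c(4)[OF wa] wV flag_step.hyps(2) VG
        by (simp add: lm_zero_smult[OF V] a_minus_def ag_neg_zero ag_rzero)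
      thus False using w by simp
    qed
    have unit: "c w \<in> Units K" using cw cK[OF wa] field.field_Units[OF fld] by auto
    have i: "inv\<^bsub>K\<^esub> (c w) \<in> carrier K" using unit K by (simp add: monoid.Units_inv_closed ring.is_monoid)
    have inU: "x \<in> U" if "x \<in> adj K V U v" "c x = \<zero>\<^sub>K" for x
      using c(4)[OF that(1)] that submodD(1)[OF V A(1)] flag_step.hyps(2) VG
      by (auto simp: lm_zero_smult[OF V] a_minus_def ag_neg_zero ag_rzero)
    have eq: "W = adj K V (W \<inter> U) w"
    proof
      show "adj K V (W \<inter> U) w \<subseteq> W" unfolding adj_def using W(3,4) w by auto
      show "W \<subseteq> adj K V (W \<inter> U) w"
      proof
        fix x assume x: "x \<in> W"
        have xa: "x \<in> adj K V U v" using x flag_step.prems(2) by auto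
        define k where "k = c x \<otimes>\<^sub>K inv\<^bsub>K\<^esub> (c w)"
        have k: "k \<in> carrier K" unfolding k_def using cK[OF xa] i K by (simp add: ring.ring_simprules)
        have kw: "k \<odot>\<^sub>V w \<in> W" using W(4) k w by simp
        have kwa: "k \<odot>\<^sub>V w \<in> adj K V U v" using submodD(4)[OF V A(1) k wa] .
        have d: "x \<ominus>\<^sub>V k \<odot>\<^sub>V w \<in> adj K V U v" using submodD(6)[OF V A(1) xa kwa] .
        have "x = (x \<ominus>\<^sub>V k \<odot>\<^sub>V w) \<oplus>\<^sub>V k \<odot>\<^sub>V w"
          using x W(1) lm_smult[OF V k wV] VG by (simp add: ag_diff_add subset_iff)
        hence "c x = c (x \<ominus>\<^sub>V k \<odot>\<^sub>V w) \<oplus>\<^sub>K k \<otimes>\<^sub>K c w"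
          using lin_add[OF c(1), of "x \<ominus>\<^sub>V k \<odot>\<^sub>V w" "k \<odot>\<^sub>V w"] lin_smult[OF c(1) k, of w] d kwa wa by simp
        also have "k \<otimes>\<^sub>K c w = c x"
          unfolding k_def using K unit i cK[OF xa] cK[OF wa]
          by (simp add: monoid.m_assoc ring.is_monoid monoid.Units_l_inv monoid.r_one)
        finally have "c (x \<ominus>\<^sub>V k \<odot>\<^sub>V w) \<oplus>\<^sub>K c x = c x" by simp
        hence "c (x \<ominus>\<^sub>V k \<odot>\<^sub>V w) = \<zero>\<^sub>K"
          by (rule ag_add_left_zero[OF KG cK[OF d] cK[OF xa]])
        hence "x \<ominus>\<^sub>V k \<odot>\<^sub>V w \<in> W \<inter> U" using inU[OF d] W(6)[OF x kw] by simp
        with \<open>x = _\<close> k show "x \<in> adj K V (W \<inter> U) w" unfolding adj_def by blast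
      qed
    qed
    have "flag W (Suc m)" using flag.flag_step[OF m(1) wV] w eq by simp
    moreover have "W = adj K V U v" if "Suc m = Suc n"
    proof
      have "U \<subseteq> W" using that m(3) by auto
      show "adj K V U v \<subseteq> W"
      proof
        fix x assume x: "x \<in> adj K V U v"
        define k where "k = inv\<^bsub>K\<^esub> (c w)"
        have "w \<ominus>\<^sub>V c w \<odot>\<^sub>V v \<in> W" using c(4)[OF wa] \<open>U \<subseteq> W\<close> by auto
        hence "w \<ominus>\<^sub>V (w \<ominus>\<^sub>V c w \<odot>\<^sub>V v) \<in> W" using W(6) w by auto
        moreover have "w \<ominus>\<^sub>V (w \<ominus>\<^sub>V c w \<odot>\<^sub>V v) = c w \<odot>\<^sub>V v"
          using wV lm_smult[OF V cK[OF wa] flag_step.hyps(2)] VG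
          by (simp add: a_minus_def ag_neg_add ag_simps)
        ultimately have "k \<odot>\<^sub>V (c w \<odot>\<^sub>V v) \<in> W" using W(4) i unfolding k_def by simp
        moreover have "k \<odot>\<^sub>V (c w \<odot>\<^sub>V v) = v"
          using lm_assoc[OF V i cK[OF wa] flag_step.hyps(2)] unit K
          by (simp add: monoid.Units_l_inv ring.is_monoid lm_one[OF V flag_step.hyps(2)] k_def)
        ultimately have "v \<in> W" by simp
        with x \<open>U \<subseteq> W\<close> show "x \<in> W" unfolding adj_def using W(3,4) by auto
      qed
    qed (rule flag_step.prems(2))
    ultimately show ?thesis using m(2) by auto
  qed
qed

text \<open>The dimension; it enters only as a measure that decreases on proper subspaces.\<close>

definition dimS where "dimS U = (LEAST n. flag U n)"

lemma dimS_less: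
  assumes "flag U n" "submodule W K V" "W \<subseteq> U" "W \<noteq> U"
  shows "dimS W < dimS U"
proof -
  have "flag U (dimS U)" unfolding dimS_def using assms(1) by (rule LeastI)
  from flag_subspace[OF this assms(2,3)] assms(4) obtain m where "flag W m" "m < dimS U" by (auto simp: le_less)
  moreover have "dimS W \<le> m" unfolding dimS_def using \<open>flag W m\<close> by (rule Least_le)
  ultimately show ?thesis by simp
qed

lemma flag_cover:
  assumes "finite S" "S \<subseteq> carrier V"
  shows "\<exists>U n. flag U n \<and> S \<subseteq> U"
  using assms
proof (induction rule: finite_induct)
  case empty
  then show ?case using flag_zero by auto
next
  case (insert s S)
  then obtain U n where U: "flag U n" "S \<subseteq> U" by auto
  show ?case
  proof (cases "s \<in> U")
    case True with U show ?thesis by auto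
  next
    case False
    have "flag (adj K V U s) (Suc n)" using insert.prems False by (intro flag_step[OF U(1)]) auto
    moreover have "insert s S \<subseteq> adj K V U s" using adj_submod[OF flag_submod[OF U(1)], of s] insert.prems U(2) by auto
    ultimately show ?thesis by blast
  qed
qed

lemma fg_flag:
  assumes "fin_generated K V"
  obtains n where "flag (carrier V) n"
proof -
  obtain S where S: "finite S" "S \<subseteq> carrier V" "\<And>N. submodule N K V ==> S \<subseteq> N ==> N = carrier V"
    using assms by (auto simp: fin_generated_def)
  obtain U n where U: "flag U n" "S \<subseteq> U" using flag_cover[OF S(1,2)] by blast
  from S(3)[OF flag_submod[OF U(1)] U(2)] U(1) that show thesis by auto
qed

lemma flag_thru:
  assumes "flag U n"
  shows "summand K (reg K) (V\<restriction>U)"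
  using assms
proof (induction rule: flag.induct)
  case flag_zero
  show ?case by (rule thru_zero) auto
next
  case (flag_step U n v)
  have U: "submodule U K V" using flag_step.hyps(1) by (rule flag_submod)
  note A = adj_submod[OF U flag_step.hyps(2)] note v = flag_step.hyps(2)
  have UV: "U \<subseteq> carrier V" and AV: "adj K V U v \<subseteq> carrier V" using submodD(1)[OF V] U A by auto
  obtain c where c: "lin K (V\<restriction>(adj K V U v)) (reg K) c" "\<And>u. u \<in> U ==> c u = \<zero>\<^sub>K"
      "c v = \<one>\<^sub>K" "\<And>x. x \<in> adj K V U v ==> x \<ominus>\<^sub>V c x \<odot>\<^sub>V v \<in> U"
      using coord[OF U v flag_step.hyps(3)] by blast
  let ?A = "V\<restriction>(adj K V U v)"
  let ?U = "V\<restriction>U"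
  have lA: "left_module K ?A" and lU: "left_module K ?U" using sub_lm[OF V] A(1) U by auto
  have vl: "lin K (reg K) ?A (\<lambda>k. k \<odot>\<^sub>V v)"
    using cyclic_lin[OF lA, of v] A(3) by simp
  have cv: "c x \<odot>\<^sub>V v \<in> adj K V U v" if "x \<in> adj K V U v" for x
    using lin_closed[OF vl] lin_closed[OF c(1)] that by simp
  note pr = coord_pr[OF U v c(1,4)]
  have inc: "lin K ?U ?A (\<lambda>x. x)" using A(2) by (auto simp: lin_def)
  have "thru K (reg K) ?A ?A (\<lambda>x. x \<ominus>\<^sub>V c x \<odot>\<^sub>V v)"
    using thru_post[OF thru_pre[OF flag_step.IH pr] inc lA lU lA] .
  from thru_add[OF this c(1) vl]
  show ?case using cv ag_diff_add[OF VG] AV by (simp add: subset_iff)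
qed

lemma fg_iff_thru: "fin_generated K V \<longleftrightarrow> summand K (reg K) V"
proof
  assume "fin_generated K V"
  then obtain n where "flag (carrier V) n" by (rule fg_flag)
  from flag_thru[OF this] show "summand K (reg K) V" by simp
qed (rule thru_regular_fg[OF _ V])

end

locale fdspace = fspace +
  assumes fg: "fin_generated K V"
begin

lemma flag_carrier: "\<exists>n. flag (carrier V) n"
  using fg_flag[OF fg] by blast

lemma flag_sub: assumes "submodule U K V" shows "\<exists>n. flag U n"
  using flag_carrier flag_subspace[OF _ assms submodD(1)[OF V assms]] by blast

lemma dimS_mono:
  assumes "submodule U K V" "submodule W K V" "W \<subseteq> U" "dimS U \<le> dimS W"
  shows "W = U"
proof -
  obtain n where "flag U n" using flag_sub[OF assms(1)] by auto
  from dimS_less[OF this assms(2,3)] assms(4) show ?thesis by auto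
qed

lemma dimS_le: "submodule U K V ==> dimS U \<le> dimS (carrier V)"
  using dimS_less[OF _ _ submodD(1)[OF V]] flag_carrier by (metis le_less)

lemma sub_fdspace:
  assumes U: "submodule U K V"
  shows "fdspace K (V\<restriction>U)"
proof -
  obtain n where "flag U n" using flag_sub[OF U] by auto
  from thru_regular_fg[OF flag_thru[OF this] sub_lm[OF V U]] show ?thesis
    using sub_lm[OF V U] fld by (simp add: fdspace_def fspace_def fdspace_axioms_def)
qed

lemma extend_functional:
  assumes W: "submodule W K V" and l: "lin K (V\<restriction>W) (reg K) l"
  obtains m where "lin K V (reg K) m" "\<And>x. x \<in> W ==> m x = l x"
proof -
  have "\<exists>m. lin K V (reg K) m \<and> (\<forall>x\<in>W. m x = l x)"
    if "submodule U K V" "W \<subseteq> U" "lin K (V\<restriction>U) (reg K) l'" "\<forall>x\<in>W. l' x = l x" for U l'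
    using that
  proof (induction "dimS (carrier V) - dimS U" arbitrary: U l' rule: less_induct)
    case less
    note U = less.prems(1)
    show ?case
    proof (cases "U = carrier V")
      case True
      then show ?thesis using less.prems by auto
    next
      case False
      then obtain v where v: "v \<in> carrier V" "v \<notin> U" using submodD(1)[OF V U] by auto
      note A = adj_submod[OF U v(1)]
      obtain c where c: "lin K (V\<restriction>(adj K V U v)) (reg K) c" "\<And>u. u \<in> U ==> c u = \<zero>\<^sub>K"
        "c v = \<one>\<^sub>K" "\<And>x. x \<in> adj K V U v ==> x \<ominus>\<^sub>V c x \<odot>\<^sub>V v \<in> U"
        using coord[OF U v] by blast
      have AV: "adj K V U v \<subseteq> carrier V" and UV: "U \<subseteq> carrier V" using submodD(1)[OF V] A U by auto
      have cc: "c x \<odot>\<^sub>V v \<in> carrier V" "c x \<in> carrier K" if "x \<in> adj K V U v" for x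
        using lin_closed[OF c(1)] that lm_smult[OF V _ v(1)] by auto
      note pr = coord_pr[OF U v(1) c(1,4)]
      have "lin K (V\<restriction>(adj K V U v)) (reg K) (\<lambda>x. l' (x \<ominus>\<^sub>V c x \<odot>\<^sub>V v))"
        by (rule lin_comp[OF pr less.prems(3)])
      moreover have "\<forall>x\<in>W. l' (x \<ominus>\<^sub>V c x \<odot>\<^sub>V v) = l x"
      proof
        fix x assume x: "x \<in> W"
        hence "x \<in> U" "x \<in> carrier V" using less.prems(2) UV by auto
        hence "x \<ominus>\<^sub>V c x \<odot>\<^sub>V v = x"
          using v by (simp add: c(2) lm_zero_smult[OF V] a_minus_def ag_neg_zero[OF VG] ag_rzero[OF VG])
        thus "l' (x \<ominus>\<^sub>V c x \<odot>\<^sub>V v) = l x" using x less.prems(4) by simp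
      qed
      moreover have "dimS (carrier V) - dimS (adj K V U v) < dimS (carrier V) - dimS U"
      proof -
        obtain n where "flag (adj K V U v) n" using flag_sub[OF A(1)] by auto
        from dimS_less[OF this U A(2)] have "dimS U < dimS (adj K V U v)" using A(3) v by blast
        with dimS_le[OF A(1)] show ?thesis by linarith
      qed
      ultimately show ?thesis using less.hyps[OF _ A(1)] A(2) less.prems(2) by blast
    qed
  qed
  from this[OF W _ l] that show thesis by auto
qed

lemma separate:
  assumes W: "submodule W K V" and v: "v \<in> carrier V" "v \<notin> W"
  obtains m where "lin K V (reg K) m" "\<And>x. x \<in> W ==> m x = \<zero>\<^sub>K" "m v \<noteq> \<zero>\<^sub>K"
proof -
  note A = adj_submod[OF W v(1)]
  obtain c where c: "lin K (V\<restriction>(adj K V W v)) (reg K) c" "\<And>u. u \<in> W ==> c u = \<zero>\<^sub>K"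
        "c v = \<one>\<^sub>K" "\<And>x. x \<in> adj K V W v ==> x \<ominus>\<^sub>V c x \<odot>\<^sub>V v \<in> W" using coord[OF W v] by blast
  obtain m where m: "lin K V (reg K) m" "\<And>x. x \<in> adj K V W v ==> m x = c x"
    using extend_functional[OF A(1) c(1)] by blast
  have "\<one>\<^sub>K \<noteq> \<zero>\<^sub>K" using fld by (simp add: field_def domain_def domain_axioms_def)
  moreover have "m v = \<one>\<^sub>K" using m(2)[OF A(3)] c(3) by simp
  moreover have "m x = \<zero>\<^sub>K" if "x \<in> W" for x using m(2) A(2) c(2) that by auto
  ultimately show thesis using that[OF m(1)] by simp
qed

lemma lin_funpow: "lin K V V f ==> lin K V V (f ^^ n)"
  by (induction n) (auto intro: lin_id lin_comp simp: comp_def id_def)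

lemma surj_inj:
  assumes f: "lin K V V f" and s: "f ` carrier V = carrier V"
  shows "inj_on f (carrier V)"
proof (rule inj_if_ker[OF V V f])
  let ?k = "\<lambda>n. mod_ker V V (f ^^ n)"
  have sub: "submodule (?k n) K V" for n by (rule ker_submod[OF V V lin_funpow[OF f]])
  have mono: "?k n \<subseteq> ?k (Suc n)" for n
    by (auto simp: mod_ker_def lin_zero[OF f VG VG])
  have "\<exists>n. dimS (?k (Suc n)) \<le> dimS (?k n)"
  proof (rule ccontr)
    assume "\<not> ?thesis"
    then have "n \<le> dimS (?k n)" for n
      by (induction n) (auto simp: not_le intro: Suc_leI order_le_less_trans)
    from this[of "Suc (dimS (carrier V))"] dimS_le[OF sub[of "Suc (dimS (carrier V))"]] show False by simp
  qed
  then obtain n where n: "?k n = ?k (Suc n)" using dimS_mono[OF sub sub mono] by blast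
  have sn: "(f ^^ m) ` carrier V = carrier V" for m
  proof (induction m)
    case (Suc m)
    have "(f ^^ Suc m) ` carrier V = f ` ((f ^^ m) ` carrier V)" by (simp add: image_comp)
    thus ?case using Suc s by simp
  qed simp
  fix x assume x: "x \<in> carrier V" "f x = \<zero>\<^sub>V"
  obtain y where y: "y \<in> carrier V" "x = (f ^^ n) y" using x(1) sn[of n] by blast
  have "y \<in> ?k (Suc n)" using x y by (auto simp: mod_ker_def)
  hence "y \<in> ?k n" using n by simp
  thus "x = \<zero>\<^sub>V" using y by (simp add: mod_ker_def)
qed

lemma fitting:
  assumes f: "lin K V V f"
  obtains k where "f ` ((f ^^ k) ` carrier V) = (f ^^ k) ` carrier V" "inj_on f ((f ^^ k) ` carrier V)"
proof -
  let ?i = "\<lambda>n. (f ^^ n) ` carrier V"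
  have sub: "submodule (?i n) K V" for n by (rule image_submod[OF V V lin_funpow[OF f] carrier_submod[OF V]])
  have im: "f ` ?i n = ?i (Suc n)" for n by (auto simp: image_comp)
  have anti: "?i (Suc n) \<subseteq> ?i n" for n
    using lin_closed[OF f] by (simp only: funpow_Suc_right image_comp[symmetric]) auto
  obtain k where k: "\<And>n. dimS (?i k) \<le> dimS (?i n)"
    using ex_has_least_nat[of "\<lambda>_. True" 0 "\<lambda>n. dimS (?i n)"] by auto
  have e: "?i (Suc k) = ?i k" by (rule dimS_mono[OF sub sub anti k])
  interpret I: fdspace K "V\<restriction>(?i k)" using sub by (rule sub_fdspace)
  have "lin K (V\<restriction>(?i k)) (V\<restriction>(?i k)) f"
    using lin_sub[OF f submodD(1)[OF V sub]] im[of k] e submodD(1)[OF V sub, of k] by (subst lin_into_sub) auto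
  from I.surj_inj[OF this] im[of k] e that show thesis by simp
qed

end


section \<open>Powers of modules and finite-dimensional algebras\<close>

lemma restrict_scalars_simps [simp]:
  "carrier (restrict_scalars h X) = carrier X" "\<zero>\<^bsub>restrict_scalars h X\<^esub> = \<zero>\<^sub>X"
  "x \<oplus>\<^bsub>restrict_scalars h X\<^esub> y = x \<oplus>\<^sub>X y" "a \<odot>\<^bsub>restrict_scalars h X\<^esub> x = h a \<odot>\<^sub>X x"
  by (simp_all add: restrict_scalars_def)

lemma restrict_scalars_sub: "restrict_scalars h (X\<restriction>N) = (restrict_scalars h X)\<restriction>N"
  by (simp add: restrict_scalars_def)

lemma ag_cong:
  assumes "abelian_group X" "carrier Y = carrier X" "\<zero>\<^sub>Y = \<zero>\<^sub>X" "\<And>x y. x \<in> carrier X ==> y \<in> carrier X ==> x \<oplus>\<^sub>Y y = x \<oplus>\<^sub>X y"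
  shows "abelian_group Y"
proof (rule ag_intro)
  fix x assume "x \<in> carrier Y"
  thus "\<exists>y\<in>carrier Y. y \<oplus>\<^sub>Y x = \<zero>\<^sub>Y"
    using ag_lneg[OF assms(1), of x] ag_neg[OF assms(1), of x] assms(2-) by auto
qed (auto simp: assms(2-) ag_simps[OF assms(1)] ag_assoc[OF assms(1)] intro: ag_comm[OF assms(1)])

lemma restrict_scalars_lm:
  assumes X: "left_module S X" and R: "ring R"
    and h: "\<And>a. a \<in> carrier R ==> h a \<in> carrier S"
      "\<And>a b. a \<in> carrier R ==> b \<in> carrier R ==> h (a \<oplus>\<^sub>R b) = h a \<oplus>\<^sub>S h b"
      "\<And>a b. a \<in> carrier R ==> b \<in> carrier R ==> h (a \<otimes>\<^sub>R b) = h a \<otimes>\<^sub>S h b" "h \<one>\<^sub>R = \<one>\<^sub>S"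
  shows "left_module R (restrict_scalars h X)"
proof (rule lm_intro[OF R])
  show "abelian_group (restrict_scalars h X)" by (rule ag_cong[OF lm_ag[OF X]]) auto
qed (auto simp: h lm_smult[OF X] lm_l_distr[OF X] lm_r_distr[OF X] lm_assoc[OF X] lm_one[OF X])

lemma mod_power_simps [simp]:
  "carrier (mod_power X n) = {..<n} \<rightarrow>\<^sub>E carrier X" "\<zero>\<^bsub>mod_power X n\<^esub> = (\<lambda>i\<in>{..<n}. \<zero>\<^sub>X)"
  "f \<oplus>\<^bsub>mod_power X n\<^esub> g = (\<lambda>i\<in>{..<n}. f i \<oplus>\<^sub>X g i)"
  "a \<odot>\<^bsub>mod_power X n\<^esub> f = (\<lambda>i\<in>{..<n}. a \<odot>\<^sub>X f i)"
  by (simp_all add: mod_power_def)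

lemma ag_add_diff: "abelian_group X ==> x \<in> carrier X ==> y \<in> carrier X ==> (x \<oplus>\<^sub>X y) \<ominus>\<^sub>X x = y"
  by (simp add: a_minus_def ag_comm[of X x y] ag_assoc ag_simps)

lemma ag_cancel2: "abelian_group X ==> x \<in> carrier X ==> y \<in> carrier X ==> x \<oplus>\<^sub>X (y \<oplus>\<^sub>X \<ominus>\<^sub>X x) = y"
  using ag_add_diff[of X x y] by (simp add: a_minus_def ag_assoc ag_neg)

lemma PiE_mem': "f \<in> {..<n} \<rightarrow>\<^sub>E C ==> i < n ==> f i \<in> C"
  by (simp add: PiE_def Pi_def)

lemma PiE_eqI: "f \<in> {..<n} \<rightarrow>\<^sub>E C ==> g \<in> {..<n} \<rightarrow>\<^sub>E C ==> (\<And>i. i < n ==> f i = g i) ==> f = g"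
  for n :: nat
  by (rule PiE_ext) auto

lemma mod_power_lm:
  assumes X: "left_module R X"
  shows "left_module R (mod_power X n)"
proof (rule lm_intro[OF lm_ring[OF X]])
  note G = lm_ag[OF X]
  show "abelian_group (mod_power X n)"
  proof (rule ag_intro)
    fix f assume f: "f \<in> carrier (mod_power X n)"
    show "\<exists>g\<in>carrier (mod_power X n). g \<oplus>\<^bsub>mod_power X n\<^esub> f = \<zero>\<^bsub>mod_power X n\<^esub>"
    proof (rule bexI[of _ "\<lambda>i\<in>{..<n}. \<ominus>\<^sub>X (f i)"])
      show "(\<lambda>i\<in>{..<n}. \<ominus>\<^sub>X f i) \<oplus>\<^bsub>mod_power X n\<^esub> f = \<zero>\<^bsub>mod_power X n\<^esub>"
        using f by (auto simp: fun_eq_iff restrict_def ag_lneg[OF G] PiE_mem')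
    qed (use f in \<open>auto simp: ag_neg[OF G] PiE_mem'\<close>)
  next
    fix f assume f: "f \<in> carrier (mod_power X n)"
    show "\<zero>\<^bsub>mod_power X n\<^esub> \<oplus>\<^bsub>mod_power X n\<^esub> f = f"
      by (rule PiE_eqI[of _ n "carrier X"]) (use f in \<open>auto simp: ag_simps[OF G] PiE_mem'\<close>)
  next
    fix f g assume "f \<in> carrier (mod_power X n)" "g \<in> carrier (mod_power X n)"
    thus "f \<oplus>\<^bsub>mod_power X n\<^esub> g = g \<oplus>\<^bsub>mod_power X n\<^esub> f"
      by (simp, intro restrict_ext ag_comm[OF G]) (simp_all add: PiE_mem')
  next
    fix f g h assume "f \<in> carrier (mod_power X n)" "g \<in> carrier (mod_power X n)" "h \<in> carrier (mod_power X n)"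
    thus "f \<oplus>\<^bsub>mod_power X n\<^esub> g \<oplus>\<^bsub>mod_power X n\<^esub> h = f \<oplus>\<^bsub>mod_power X n\<^esub> (g \<oplus>\<^bsub>mod_power X n\<^esub> h)"
      by (simp, intro restrict_ext) (simp add: PiE_mem' ag_assoc[OF G])
  qed (simp_all add: ag_simps[OF G] PiE_mem')
next
  fix f assume f: "f \<in> carrier (mod_power X n)"
  show "\<one>\<^sub>R \<odot>\<^bsub>mod_power X n\<^esub> f = f"
    by (rule PiE_eqI[of _ n "carrier X"]) (use f in \<open>auto simp: lm_one[OF X] PiE_mem'\<close>)
next
  fix a f g assume "a \<in> carrier R" "f \<in> carrier (mod_power X n)" "g \<in> carrier (mod_power X n)"
  thus "a \<odot>\<^bsub>mod_power X n\<^esub> (f \<oplus>\<^bsub>mod_power X n\<^esub> g) = a \<odot>\<^bsub>mod_power X n\<^esub> f \<oplus>\<^bsub>mod_power X n\<^esub> a \<odot>\<^bsub>mod_power X n\<^esub> g"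
    by (simp, intro restrict_ext) (simp add: PiE_mem' lm_r_distr[OF X])
next
  fix a b f assume ab: "a \<in> carrier R" "b \<in> carrier R" "f \<in> carrier (mod_power X n)"
  show "(a \<oplus>\<^sub>R b) \<odot>\<^bsub>mod_power X n\<^esub> f = a \<odot>\<^bsub>mod_power X n\<^esub> f \<oplus>\<^bsub>mod_power X n\<^esub> b \<odot>\<^bsub>mod_power X n\<^esub> f"
    using ab by (simp, intro restrict_ext) (simp add: PiE_mem' lm_l_distr[OF X])
  show "(a \<otimes>\<^sub>R b) \<odot>\<^bsub>mod_power X n\<^esub> f = a \<odot>\<^bsub>mod_power X n\<^esub> (b \<odot>\<^bsub>mod_power X n\<^esub> f)"
    using ab by (simp, intro restrict_ext) (simp add: PiE_mem' lm_assoc[OF X])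
qed (simp add: PiE_mem' lm_smult[OF X])

lemma mod_power_thru:
  assumes X: "left_module R X"
  shows "thru R X (mod_power X n) (mod_power X n) (\<lambda>f. f)"
proof -
  note G = lm_ag[OF X]
  have "thru R X (mod_power X n) (mod_power X n) (\<lambda>f. \<lambda>i\<in>{..<n}. if i < k then f i else \<zero>\<^sub>X)" if "k \<le> n" for k
    using that
  proof (induction k)
    case 0
    show ?case by (rule thru_zero) (simp add: restrict_def)
  next
    case (Suc k)
    have k: "k < n" using Suc.prems by simp
    have u: "lin R (mod_power X n) X (\<lambda>f. f k)" by (rule linI) (use k in \<open>auto simp: PiE_mem'\<close>)
    have v: "lin R X (mod_power X n) (\<lambda>x. \<lambda>i\<in>{..<n}. if i = k then x else \<zero>\<^sub>X)"
    proof (rule linI)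
      fix x y assume "x \<in> carrier X" "y \<in> carrier X"
      show "(\<lambda>i\<in>{..<n}. if i = k then x \<oplus>\<^sub>X y else \<zero>\<^sub>X) =
          (\<lambda>i\<in>{..<n}. if i = k then x else \<zero>\<^sub>X) \<oplus>\<^bsub>mod_power X n\<^esub> (\<lambda>i\<in>{..<n}. if i = k then y else \<zero>\<^sub>X)"
        by (simp, intro restrict_ext) (simp add: ag_simps[OF G])
    next
      fix a x assume "a \<in> carrier R" "x \<in> carrier X"
      thus "(\<lambda>i\<in>{..<n}. if i = k then a \<odot>\<^sub>X x else \<zero>\<^sub>X) = a \<odot>\<^bsub>mod_power X n\<^esub> (\<lambda>i\<in>{..<n}. if i = k then x else \<zero>\<^sub>X)"
        by (simp, intro restrict_ext) (simp add: lm_simps[OF X])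
    qed (simp add: ag_simps[OF G])
    show ?case
    proof (rule thru_add[OF Suc.IH u v])
      fix f assume "f \<in> carrier (mod_power X n)"
      thus "(\<lambda>i\<in>{..<n}. if i < Suc k then f i else \<zero>\<^sub>X) =
        (\<lambda>i\<in>{..<n}. if i < k then f i else \<zero>\<^sub>X) \<oplus>\<^bsub>mod_power X n\<^esub> (\<lambda>i\<in>{..<n}. if i = k then f k else \<zero>\<^sub>X)"
        by (auto simp: fun_eq_iff restrict_def ag_simps[OF G] less_Suc_eq PiE_mem')
    qed (use Suc in simp)
  qed
  from this[of n] show ?thesis
  proof (rule thru_cong)
    fix f assume "f \<in> carrier (mod_power X n)"
    thus "f = (\<lambda>i\<in>{..<n}. if i < n then f i else \<zero>\<^sub>X)"
      by (intro PiE_eqI[of _ n "carrier X"]) (auto simp: PiE_mem')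
  qed simp
qed

lemma thru_power:
  assumes th: "thru R M X Y h" and X: "left_module R X" and Y: "left_module R Y" and M: "left_module R M"
  shows "\<exists>n u v. lin R X (mod_power M n) u \<and> lin R (mod_power M n) Y v \<and> (\<forall>x\<in>carrier X. h x = v (u x))"
  using th
proof (induction rule: thru.induct)
  case (thru_zero h)
  have "lin R X (mod_power M 0) (\<lambda>x. \<zero>\<^bsub>mod_power M 0\<^esub>)" by (rule lin_const_zero[OF mod_power_lm[OF M]])
  moreover have "lin R (mod_power M 0) Y (\<lambda>x. \<zero>\<^sub>Y)" by (rule lin_const_zero[OF Y])
  ultimately show ?case using thru_zero by blast
next
  case (thru_add g u v h)
  then obtain n u' v' where IH: "lin R X (mod_power M n) u'" "lin R (mod_power M n) Y v'" "\<forall>x\<in>carrier X. g x = v' (u' x)"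
    by blast
  note uv = lin_closed[OF IH(1)] lin_closed[OF thru_add.hyps(2)]
  have m1: "u' x i \<in> carrier M" if "x \<in> carrier X" "i < n" for x i using uv(1)[OF that(1)] that(2) by (auto simp: PiE_mem')
  have ex: "u' x i = undefined" if "x \<in> carrier X" "\<not> i < n" for x i using uv(1)[OF that(1)] that(2) by (auto simp: PiE_def extensional_def)
  have U: "lin R X (mod_power M (Suc n)) (\<lambda>x. (u' x)(n := u x))"
  proof (rule linI)
    fix x assume "x \<in> carrier X"
    thus "(u' x)(n := u x) \<in> carrier (mod_power M (Suc n))"
      using m1 ex uv(2) by (auto simp: PiE_def extensional_def less_Suc_eq)
  next
    fix x y assume xy: "x \<in> carrier X" "y \<in> carrier X"
    show "(u' (x \<oplus>\<^sub>X y))(n := u (x \<oplus>\<^sub>X y)) = (u' x)(n := u x) \<oplus>\<^bsub>mod_power M (Suc n)\<^esub> (u' y)(n := u y)"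
      by (rule ext) (simp add: restrict_def lin_add[OF IH(1) xy] lin_add[OF thru_add.hyps(2) xy] less_Suc_eq)
  next
    fix a x assume ax: "a \<in> carrier R" "x \<in> carrier X"
    show "(u' (a \<odot>\<^sub>X x))(n := u (a \<odot>\<^sub>X x)) = a \<odot>\<^bsub>mod_power M (Suc n)\<^esub> (u' x)(n := u x)"
      by (rule ext) (simp add: restrict_def lin_smult[OF IH(1) ax] lin_smult[OF thru_add.hyps(2) ax] less_Suc_eq)
  qed
  have rs: "lin R (mod_power M (Suc n)) (mod_power M n) (\<lambda>f. restrict f {..<n})"
  proof (rule linI)
    fix f g assume "f \<in> carrier (mod_power M (Suc n))" "g \<in> carrier (mod_power M (Suc n))"
    show "restrict (f \<oplus>\<^bsub>mod_power M (Suc n)\<^esub> g) {..<n} = restrict f {..<n} \<oplus>\<^bsub>mod_power M n\<^esub> restrict g {..<n}"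
      by (rule ext) (simp add: restrict_def)
  next
    fix a f assume "f \<in> carrier (mod_power M (Suc n))"
    show "restrict (a \<odot>\<^bsub>mod_power M (Suc n)\<^esub> f) {..<n} = a \<odot>\<^bsub>mod_power M n\<^esub> restrict f {..<n}"
      by (rule ext) (simp add: restrict_def)
  qed (simp add: PiE_mem')
  have pn: "lin R (mod_power M (Suc n)) M (\<lambda>f. f n)"
    by (rule linI) (auto simp: PiE_mem')
  have W: "lin R (mod_power M (Suc n)) Y (\<lambda>f. v' (restrict f {..<n}) \<oplus>\<^sub>Y v (f n))"
    by (rule lin_plus[OF Y lin_comp[OF rs IH(2)] lin_comp[OF pn thru_add.hyps(3)]])
  have "restrict ((u' x)(n := u x)) {..<n} = u' x" if "x \<in> carrier X" for x
    using ex[OF that] by (auto simp: fun_eq_iff restrict_def)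
  then have "\<forall>x\<in>carrier X. h x = v' (restrict ((u' x)(n := u x)) {..<n}) \<oplus>\<^sub>Y v (((u' x)(n := u x)) n)"
    using thru_add.hyps(4) IH(3) by simp
  with U W show ?case by blast
qed

text \<open>A decomposition of \<open>M\<^sup>n\<close> gives a projection onto the summand. Conversely, if \<open>v \<circ> u\<close> is the identity of
  \<open>X\<close>, then \<open>M\<^sup>n\<close> is the direct sum of the image of \<open>u\<close> and the kernel of \<open>v\<close>.\<close>

lemma in_add_iff:
  assumes M: "left_module R M" and X: "left_module R X"
  shows "in_add R M X \<longleftrightarrow> summand R M X"
proof
  assume "in_add R M X"
  then obtain n S T where S: "submodule S R (mod_power M n)" "submodule T R (mod_power M n)"
    "S \<inter> T = {\<zero>\<^bsub>mod_power M n\<^esub>}" "S <+>\<^bsub>mod_power M n\<^esub> T = carrier (mod_power M n)"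
    "mod_iso R X (mod_power M n\<restriction>S)"
    unfolding in_add_def by blast
  let ?P = "mod_power M n"
  have P: "left_module R ?P" by (rule mod_power_lm[OF M])
  note G = lm_ag[OF P] note DS = submodD[OF P S(1)] note DT = submodD[OF P S(2)]
  have LS: "left_module R (?P\<restriction>S)" by (rule sub_lm[OF P S(1)])
  have ex: "\<exists>s\<in>S. x \<ominus>\<^sub>?P s \<in> T" if "x \<in> carrier ?P" for x
  proof -
    have "x \<in> S <+>\<^sub>?P T" using that by (simp only: S(4))
    then obtain s t where st: "s \<in> S" "t \<in> T" "x = s \<oplus>\<^sub>?P t" unfolding set_add_def' by blast
    have c: "s \<in> carrier ?P" "t \<in> carrier ?P" using st DS(1) DT(1) by auto
    have "x \<ominus>\<^sub>?P s = t" unfolding st(3) by (rule ag_add_diff[OF G c])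
    hence "x \<ominus>\<^sub>?P s \<in> T" using st(2) by (simp only:)
    thus ?thesis by (rule bexI[OF _ st(1)])
  qed
  have uniq: "s = s'" if "s \<in> S" "s' \<in> S" "x \<in> carrier ?P" "x \<ominus>\<^sub>?P s \<in> T" "x \<ominus>\<^sub>?P s' \<in> T" for x s s'
  proof -
    have c: "s \<in> carrier ?P" "s' \<in> carrier ?P" using that DS(1) by auto
    have "(x \<ominus>\<^sub>?P s') \<ominus>\<^sub>?P (x \<ominus>\<^sub>?P s) = s \<ominus>\<^sub>?P s'"
      using that(3) c by (simp del: mod_power_simps add: a_minus_def ag_neg_add[OF G] ag_simps[OF G] ag_ac[OF G] ag_cancel2[OF G])
    moreover have "(x \<ominus>\<^sub>?P s') \<ominus>\<^sub>?P (x \<ominus>\<^sub>?P s) \<in> T" by (rule DT(6)[OF that(5,4)])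
    moreover have "s \<ominus>\<^sub>?P s' \<in> S" by (rule DS(6)[OF that(1,2)])
    ultimately have "s \<ominus>\<^sub>?P s' = \<zero>\<^sub>?P" using S(3) by (simp del: mod_power_simps) blast
    thus ?thesis using ag_diff_zero[OF G c] by simp
  qed
  define p where "p x = (SOME s. s \<in> S \<and> x \<ominus>\<^sub>?P s \<in> T)" for x
  have p: "p x \<in> S \<and> x \<ominus>\<^sub>?P p x \<in> T" if "x \<in> carrier ?P" for x
  proof -
    have "\<exists>s. s \<in> S \<and> x \<ominus>\<^sub>?P s \<in> T" using ex[OF that] by auto
    thus ?thesis unfolding p_def by (rule someI_ex)
  qed
  have peq: "p x = s" if "x \<in> carrier ?P" "s \<in> S" "x \<ominus>\<^sub>?P s \<in> T" for x s
    using uniq[of "p x" s x] p[OF that(1)] that by simp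
  have pc: "p x \<in> carrier ?P" if "x \<in> carrier ?P" for x using p[OF that] DS(1) by auto
  have pl: "lin R ?P (?P\<restriction>S) p"
  proof (rule linI)
    fix x assume "x \<in> carrier ?P"
    thus "p x \<in> carrier (?P\<restriction>S)" using p by simp
  next
    fix x y assume xy: "x \<in> carrier ?P" "y \<in> carrier ?P"
    have "(x \<oplus>\<^sub>?P y) \<ominus>\<^sub>?P (p x \<oplus>\<^sub>?P p y) = (x \<ominus>\<^sub>?P p x) \<oplus>\<^sub>?P (y \<ominus>\<^sub>?P p y)"
      using xy pc by (simp del: mod_power_simps add: a_minus_def ag_neg_add[OF G] ag_simps[OF G] ag_ac[OF G])
    moreover have "\<dots> \<in> T" using DT(3) p xy by blast
    ultimately have "p (x \<oplus>\<^sub>?P y) = p x \<oplus>\<^sub>?P p y"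
      using p xy DS(3) ag_closed[OF G] by (intro peq) auto
    thus "p (x \<oplus>\<^sub>?P y) = p x \<oplus>\<^bsub>?P\<restriction>S\<^esub> p y" by simp
  next
    fix a x assume ax: "a \<in> carrier R" "x \<in> carrier ?P"
    have "a \<odot>\<^sub>?P x \<ominus>\<^sub>?P (a \<odot>\<^sub>?P p x) = a \<odot>\<^sub>?P (x \<ominus>\<^sub>?P p x)"
      using ax pc by (simp del: mod_power_simps add: a_minus_def lm_r_distr[OF P] lm_smult_neg[OF P] ag_simps[OF G])
    moreover have "\<dots> \<in> T" using DT(4) p ax by blast
    ultimately have "p (a \<odot>\<^sub>?P x) = a \<odot>\<^sub>?P p x"
      using p ax DS(4) lm_smult[OF P] by (intro peq) auto
    thus "p (a \<odot>\<^sub>?P x) = a \<odot>\<^bsub>?P\<restriction>S\<^esub> p x" by simp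
  qed
  have ps: "p s = s" if "s \<in> S" for s
  proof (rule peq)
    show "s \<in> carrier ?P" using that DS(1) by auto
    then show "s \<ominus>\<^sub>?P s \<in> T" using DT(2) ag_diff_zero[OF G, of s s] by (simp del: mod_power_simps)
  qed (rule that)
  have inc: "lin R (?P\<restriction>S) ?P (\<lambda>x. x)" by (rule lin_sub[OF lin_id DS(1)])
  have "summand R M (?P\<restriction>S)"
    by (rule thru_transfer[OF mod_power_thru[OF M] inc pl _ P LS]) (use ps in simp)
  then show "summand R M X" using S(5) by (intro thru_iso[OF _ _ LS X]) auto
next
  assume "summand R M X"
  then obtain n u v where uv: "lin R X (mod_power M n) u" "lin R (mod_power M n) X v" "\<forall>x\<in>carrier X. x = v (u x)"
    using thru_power[OF _ X X M] by blast
  let ?P = "mod_power M n"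
  have P: "left_module R ?P" by (rule mod_power_lm[OF M])
  note G = lm_ag[OF P] and GX = lm_ag[OF X]
  let ?S = "u ` carrier X" and ?T = "mod_ker ?P X v"
  have S: "submodule ?S R ?P" by (rule image_submod[OF X P uv(1) carrier_submod[OF X]])
  have T: "submodule ?T R ?P" by (rule ker_submod[OF P X uv(2)])
  have "?S \<inter> ?T = {\<zero>\<^sub>?P}"
  proof
    show "?S \<inter> ?T \<subseteq> {\<zero>\<^sub>?P}"
      using uv(3) lin_zero[OF uv(1) GX G] by (auto simp del: mod_power_simps simp: mod_ker_def)
    show "{\<zero>\<^sub>?P} \<subseteq> ?S \<inter> ?T" using submodD(2)[OF P S] submodD(2)[OF P T] by blast
  qed
  moreover have "?S <+>\<^sub>?P ?T = carrier ?P"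
  proof
    show "?S <+>\<^sub>?P ?T \<subseteq> carrier ?P"
      using submodD(1)[OF P S] submodD(1)[OF P T] ag_closed[OF G] by (auto simp del: mod_power_simps simp: set_add_def')
    show "carrier ?P \<subseteq> ?S <+>\<^sub>?P ?T"
    proof
      fix f assume f: "f \<in> carrier ?P"
      have c: "u (v f) \<in> carrier ?P" "v f \<in> carrier X" using f lin_closed[OF uv(1)] lin_closed[OF uv(2)] by blast+
      have "v (f \<ominus>\<^sub>?P u (v f)) = v f \<ominus>\<^sub>X v (u (v f))" by (rule lin_diff[OF uv(2) G GX f c(1)])
      also have "v (u (v f)) = v f" using uv(3) c by simp
      also have "v f \<ominus>\<^sub>X v f = \<zero>\<^sub>X" using ag_diff_zero[OF GX c(2,2)] by simp
      finally have "f \<ominus>\<^sub>?P u (v f) \<in> ?T" using ag_diff[OF G f c(1)] by (simp del: mod_power_simps add: mod_ker_def)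
      moreover have "f = u (v f) \<oplus>\<^sub>?P (f \<ominus>\<^sub>?P u (v f))"
        using ag_diff_add[OF G f c(1)] ag_comm[OF G c(1) ag_diff[OF G f c(1)]] by (simp del: mod_power_simps)
      ultimately show "f \<in> ?S <+>\<^sub>?P ?T" using c(2) unfolding set_add_def' by blast
    qed
  qed
  moreover have "mod_iso R X (?P\<restriction>?S)"
  proof (rule mod_isoI[OF X])
    show "lin R X (?P\<restriction>?S) u"
      using uv(1) submodD(1)[OF P S] by (subst lin_into_sub) auto
    show "bij_betw u (carrier X) (carrier (?P\<restriction>?S))"
      using uv(3) by (auto simp: bij_betw_def intro!: inj_onI) metis
  qed
  ultimately show "in_add R M X" unfolding in_add_def using S T by blast
qed

lemma transport:
  fixes X :: "('a, 'm) module" and u :: "'m \<Rightarrow> 'n"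
  assumes X: "left_module R X" and inj: "inj_on u (carrier X)"
  obtains X' :: "('a, 'n) module" where "left_module R X'" "lin R X X' u" "bij_betw u (carrier X) (carrier X')"
proof -
  let ?i = "inv_into (carrier X) u"
  have i: "?i (u x) = x" if "x \<in> carrier X" for x using inj that by (rule inv_into_f_f)
  define X' :: "('a, 'n) module" where "X' = \<lparr>carrier = u ` carrier X, monoid.mult = undefined, monoid.one = undefined,
    ring.zero = u \<zero>\<^sub>X, ring.add = (\<lambda>a b. u (?i a \<oplus>\<^sub>X ?i b)), smult = (\<lambda>r a. u (r \<odot>\<^sub>X ?i a))\<rparr>"
  have s: "carrier X' = u ` carrier X" "\<zero>\<^sub>X' = u \<zero>\<^sub>X"
    "\<And>x y. x \<in> carrier X ==> y \<in> carrier X ==> u x \<oplus>\<^sub>X' u y = u (x \<oplus>\<^sub>X y)"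
    "\<And>r x. x \<in> carrier X ==> r \<odot>\<^sub>X' u x = u (r \<odot>\<^sub>X x)" by (simp_all add: X'_def i)
  note G = lm_ag[OF X]
  have "left_module R X'"
  proof (rule lm_intro[OF lm_ring[OF X]])
    show "abelian_group X'"
    proof (rule ag_intro)
      fix a assume "a \<in> carrier X'"
      then obtain x where x: "x \<in> carrier X" "a = u x" by (auto simp: s)
      show "\<exists>b\<in>carrier X'. b \<oplus>\<^sub>X' a = \<zero>\<^sub>X'"
        by (rule bexI[of _ "u (\<ominus>\<^sub>X x)"]) (use x in \<open>auto simp: s ag_simps[OF G]\<close>)
    qed (auto simp: s ag_simps[OF G] ag_assoc[OF G], metis ag_comm[OF G])
  qed (auto simp: s lm_smult[OF X] lm_l_distr[OF X] lm_r_distr[OF X] lm_assoc[OF X] lm_one[OF X] ag_closed[OF G])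
  moreover have "lin R X X' u" by (rule linI) (auto simp: s)
  moreover have "bij_betw u (carrier X) (carrier X')" using inj by (simp add: bij_betw_def s)
  ultimately show thesis using that by blast
qed

lemma fg_image:
  assumes X: "left_module R X" and Y: "left_module R Y" and f: "lin R X Y f" "f ` carrier X = carrier Y"
    and fg: "fin_generated R X"
  shows "fin_generated R Y"
proof -
  obtain S where S: "finite S" "S \<subseteq> carrier X" "\<And>N. submodule N R X ==> S \<subseteq> N ==> N = carrier X"
    using fg by (auto simp: fin_generated_def)
  show ?thesis
  proof (rule fgI[of "f ` S", OF _ _ _ Y])
    fix N assume N: "submodule N R Y" "f ` S \<subseteq> N"
    have "{x \<in> carrier X. f x \<in> N} = carrier X"
      by (rule S(3)[OF preimage_submod[OF X Y f(1) N(1)]]) (use N(2) S(2) in auto)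
    thus "carrier Y \<subseteq> N" unfolding f(2)[symmetric] by blast
  qed (use S f in auto)
qed

lemma opp_simps [simp]:
  "carrier A\<^sup>o = carrier A" "\<zero>\<^bsub>A\<^sup>o\<^esub> = \<zero>\<^sub>A" "\<one>\<^bsub>A\<^sup>o\<^esub> = \<one>\<^sub>A"
  "x \<oplus>\<^bsub>A\<^sup>o\<^esub> y = x \<oplus>\<^sub>A y" "x \<otimes>\<^bsub>A\<^sup>o\<^esub> y = y \<otimes>\<^sub>A x" "k \<odot>\<^bsub>A\<^sup>o\<^esub> y = k \<odot>\<^sub>A y"
  "A\<^sup>o\<^sup>o = A"
  by (simp_all add: opp_algebra_def)

text \<open>The vector space underlying a module: \<open>K\<close> acts through \<open>k \<mapsto> k 1\<close>.\<close>

abbreviation kv where "kv R X \<equiv> restrict_scalars (\<lambda>k. k \<odot>\<^sub>R \<one>\<^sub>R) X"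

locale fdalg = fixes K :: "'k ring" and R :: "('k, 'a) module"
  assumes alg: "k_algebra K R" and fdR: "fin_generated K (kv R (reg R))"
begin

lemma fld: "field K" and R: "ring R" and KR: "Module.module K R"
  using alg by (simp_all add: k_algebra_def)

lemma K: "ring K" using fld by (simp add: field_def domain_def cring_def)

lemma RG: "abelian_group R" using R by (rule ring.is_abelian_group)
lemma KG: "abelian_group K" using K by (rule ring.is_abelian_group)
lemma oneR: "\<one>\<^sub>R \<in> carrier R" using R by (rule ring.ring_simprules(6))
lemma oneK: "\<one>\<^sub>K \<in> carrier K" using K by (rule ring.ring_simprules(6))
lemma regR: "left_module R (reg R)" using R by (rule regular_lm)
lemma regK: "left_module K (reg K)" using K by (rule regular_lm)
lemma multR: "a \<in> carrier R ==> b \<in> carrier R ==> a \<otimes>\<^sub>R b \<in> carrier R" using R by (simp add: ring.ring_simprules(5))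

lemma io: "k \<in> carrier K ==> k \<odot>\<^sub>R \<one>\<^sub>R \<in> carrier R"
  using KR oneR by (simp add: module.smult_closed)

lemma io_mult:
  assumes "k \<in> carrier K" "a \<in> carrier R"
  shows "(k \<odot>\<^sub>R \<one>\<^sub>R) \<otimes>\<^sub>R a = k \<odot>\<^sub>R a" "a \<otimes>\<^sub>R (k \<odot>\<^sub>R \<one>\<^sub>R) = k \<odot>\<^sub>R a"
  using alg assms oneR R unfolding k_algebra_def by (simp_all add: ring.ring_simprules(12) monoid.r_one ring.is_monoid)

lemma io_central: "k \<in> carrier K ==> a \<in> carrier R ==> a \<otimes>\<^sub>R (k \<odot>\<^sub>R \<one>\<^sub>R) = (k \<odot>\<^sub>R \<one>\<^sub>R) \<otimes>\<^sub>R a"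
  by (simp add: io_mult)

lemma kv_lm: assumes X: "left_module R X" shows "left_module K (kv R X)"
proof (rule restrict_scalars_lm[OF X K])
  fix a b assume ab: "a \<in> carrier K" "b \<in> carrier K"
  show "a \<odot>\<^sub>R \<one>\<^sub>R \<in> carrier R" using ab io by simp
  show "(a \<oplus>\<^sub>K b) \<odot>\<^sub>R \<one>\<^sub>R = a \<odot>\<^sub>R \<one>\<^sub>R \<oplus>\<^sub>R b \<odot>\<^sub>R \<one>\<^sub>R"
    using KR oneR ab by (simp add: module.smult_l_distr)
  show "(a \<otimes>\<^sub>K b) \<odot>\<^sub>R \<one>\<^sub>R = a \<odot>\<^sub>R \<one>\<^sub>R \<otimes>\<^sub>R (b \<odot>\<^sub>R \<one>\<^sub>R)"
    using KR oneR ab io by (simp add: module.smult_assoc1 io_mult(1))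
qed (use KR oneR in \<open>simp_all add: module.smult_one\<close>)

lemma kv_lin: "lin R X Y f ==> lin K (kv R X) (kv R Y) f"
  by (auto simp: lin_def io)

lemma kv_submod:
  assumes X: "left_module R X" and N: "submodule N R X" shows "submodule N K (kv R X)"
  by (rule submodI[OF kv_lm[OF X]]) (use submodD[OF X N] io in auto)

lemma kv_fgI:
  assumes X: "left_module R X" and fg: "fin_generated K (kv R X)"
  shows "fin_generated R X"
proof -
  obtain S where S: "finite S" "S \<subseteq> carrier X" "\<And>N. submodule N K (kv R X) ==> S \<subseteq> N ==> N = carrier X"
    using fg by (auto simp: fin_generated_def)
  show ?thesis by (rule fgI[OF S(1,2) _ X]) (use S(3)[OF kv_submod[OF X]] in auto)
qed

lemma kv_fgD:
  assumes X: "left_module R X" and fg: "fin_generated R X"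
  shows "fin_generated K (kv R X)"
proof -
  note V = kv_lm[OF X] and RV = kv_lm[OF regR]
  obtain S where S: "finite S" "S \<subseteq> carrier X" "\<And>N. submodule N R X ==> S \<subseteq> N ==> N = carrier X"
    using fg by (auto simp: fin_generated_def)
  obtain B where B: "finite B" "B \<subseteq> carrier R" "\<And>N. submodule N K (kv R (reg R)) ==> B \<subseteq> N ==> N = carrier R"
    using fdR by (auto simp: fin_generated_def)
  let ?T = "(\<lambda>(b, s). b \<odot>\<^sub>X s) ` (B \<times> S)"
  show ?thesis
  proof (rule fgI[OF _ _ _ V])
    show "finite ?T" using S(1) B(1) by simp
    show "?T \<subseteq> carrier (kv R X)" using S(2) B(2) lm_smult[OF X] by auto
    fix N assume N: "submodule N K (kv R X)" "?T \<subseteq> N"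
    note D = submodD[OF V N(1), simplified]
    have rs: "r \<odot>\<^sub>X s \<in> N" if "r \<in> carrier R" "s \<in> S" for r s
    proof -
      have s: "s \<in> carrier X" using that S(2) by auto
      have "lin K (kv R (reg R)) (kv R X) (\<lambda>r. r \<odot>\<^sub>X s)" by (rule kv_lin[OF cyclic_lin[OF X s]])
      from preimage_submod[OF RV V this N(1)]
      have "{x \<in> carrier R. x \<odot>\<^sub>X s \<in> N} = carrier R" by (intro B(3)) (use B(2) N(2) that in auto)
      thus ?thesis using that by auto
    qed
    let ?N = "{x \<in> N. \<forall>r\<in>carrier R. r \<odot>\<^sub>X x \<in> N}"
    have NX: "x \<in> carrier X" if "x \<in> N" for x using that D(1) by auto
    have "submodule ?N R X"
    proof (rule submodI[OF X])
      fix a x assume "a \<in> carrier R" "x \<in> ?N"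
      thus "a \<odot>\<^sub>X x \<in> ?N" using lm_assoc[OF X, symmetric] NX multR by auto
    qed (use D(1-3) NX in \<open>auto simp: lm_smult_zero[OF X] lm_r_distr[OF X]\<close>)
    moreover have "S \<subseteq> ?N"
    proof
      fix s assume s: "s \<in> S"
      hence "s \<in> carrier X" using S(2) by auto
      hence "s \<in> N" using rs[OF oneR s] by (simp add: lm_one[OF X])
      thus "s \<in> ?N" using rs s by simp
    qed
    ultimately have "?N = carrier X" by (rule S(3))
    thus "carrier (kv R X) \<subseteq> N" by auto
  qed
qed

lemma fd: "left_module R X ==> fin_generated R X ==> fdspace K (kv R X)"
  by (simp add: fdspace_def fspace_def fdspace_axioms_def kv_lm kv_fgD fld)

lemma fg_sub:
  fixes X :: "('a, 'm) module"
  assumes X: "left_module R X" and fg: "fin_generated R X" and N: "submodule N R X"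
  shows "fin_generated R (X\<restriction>N)"
proof -
  have "fdspace K ((kv R X)\<restriction>N)" by (rule fdspace.sub_fdspace[OF fd[OF X fg] kv_submod[OF X N]])
  then show ?thesis
    by (intro kv_fgI[OF sub_lm[OF X N]]) (simp add: fdspace_def fdspace_axioms_def restrict_scalars_sub)
qed

lemma fg_thru:
  fixes X :: "('a, 'm) module" and M :: "('a, 'n) module"
  assumes th: "summand R M X" and X: "left_module R X" and M: "left_module R M" and fg: "fin_generated R M"
  shows "fin_generated R X"
proof -
  have kt: "thru K (kv R M) (kv R X) (kv R X) h" if "thru R M X X h" for h
    using that
  proof (induction rule: thru.induct)
    case (thru_zero h)
    then show ?case by (intro thru.thru_zero) auto
  next
    case (thru_add g u v h)
    show ?case by (rule thru.thru_add[OF thru_add.IH kv_lin[OF thru_add.hyps(2)] kv_lin[OF thru_add.hyps(3)]]) (use thru_add in auto)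
  qed
  interpret M: fdspace K "kv R M" by (rule fd[OF M fg])
  have "summand K (reg K) (kv R M)" using M.fg by (simp add: M.fg_iff_thru)
  from thru_trans[OF kt[OF th] this kv_lm[OF X] kv_lm[OF X] kv_lm[OF M]]
  show ?thesis by (intro kv_fgI[OF X] thru_regular_fg kv_lm[OF X])
qed

text \<open>Coordinates with respect to a finite spanning set over \<open>K\<close> embed \<open>X\<close> into the type of the
  representatives.\<close>

lemma rep:
  fixes X :: "('a, 'm) module"
  assumes X: "left_module R X" and fg: "fin_generated R X"
  obtains X' f g where "X' \<in> fg_mod R" "lin R X X' f" "lin R X' X g"
    "\<And>x. x \<in> carrier X ==> g (f x) = x" "\<And>y. y \<in> carrier X' ==> f (g y) = y"
proof -
  interpret X: fdspace K "kv R X" by (rule fd[OF X fg])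
  have "summand K (reg K) (kv R X)" using X.fg by (simp add: X.fg_iff_thru)
  from thru_power[OF this kv_lm[OF X] kv_lm[OF X] regK] obtain n and u :: "'m \<Rightarrow> nat \<Rightarrow> 'k" and v
    where "\<forall>x\<in>carrier (kv R X). x = v (u x)" by blast
  hence "\<forall>x\<in>carrier X. v (u x) = x" by simp
  hence "inj_on u (carrier X)" by (intro inj_on_inverseI[of _ v]) simp
  from transport[OF X this] obtain X' :: "('a, nat \<Rightarrow> 'k) module"
    where X': "left_module R X'" "lin R X X' u" "bij_betw u (carrier X) (carrier X')" by blast
  have "u ` carrier X = carrier X'" using X'(3) by (simp add: bij_betw_def)
  from fg_image[OF X X'(1,2) this fg] have "X' \<in> fg_mod R" using X'(1) by (simp add: fg_mod_def)
  moreover from lin_inverse[OF X X'] obtain g where "lin R X' X g" "\<And>x. x \<in> carrier X ==> g (u x) = x"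
    "\<And>y. y \<in> carrier X' ==> u (g y) = y" by blast
  ultimately show thesis using that X'(2) by blast
qed

lemma opp_alg: "fdalg K R\<^sup>o"
proof
  have "ring R\<^sup>o"
  proof (rule ringI)
    show "abelian_group R\<^sup>o" by (rule ag_cong[OF RG]) auto
    show "Group.monoid R\<^sup>o"
      by (rule Group.monoidI) (use R in \<open>auto simp: ring.ring_simprules(5,6,11,12) monoid.r_one ring.is_monoid\<close>)
  qed (use R in \<open>auto simp: ring.ring_simprules(13,23)\<close>)
  moreover have "Module.module K R\<^sup>o"
  proof (rule moduleI)
    show "abelian_group R\<^sup>o" by (rule ag_cong[OF RG]) auto
  qed (use KR fld in \<open>auto simp: field_def domain_def module.smult_closed module.smult_l_distr module.smult_r_distr module.smult_assoc1 module.smult_one\<close>)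
  ultimately show "k_algebra K R\<^sup>o" using alg by (simp add: k_algebra_def)
  have "lin K (kv R (reg R)) (kv R\<^sup>o (reg R\<^sup>o)) (\<lambda>x. x)"
    by (rule linI) (auto simp: io_central)
  moreover have "left_module K (kv R\<^sup>o (reg R\<^sup>o))"
  proof (rule lm_intro[OF K])
    show "abelian_group (kv R\<^sup>o (reg R\<^sup>o))" by (rule ag_cong[OF RG]) auto
  qed (use lm_smult[OF kv_lm[OF regR]] lm_l_distr[OF kv_lm[OF regR]] lm_r_distr[OF kv_lm[OF regR]]
        lm_assoc[OF kv_lm[OF regR]] lm_one[OF kv_lm[OF regR]] K oneK ag_closed[OF KG] ag_closed[OF RG] in \<open>auto simp: io_central ring.ring_simprules(5) multR io\<close>)
  ultimately show "fin_generated K (kv R\<^sup>o (reg R\<^sup>o))"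
    by (intro fg_image[OF kv_lm[OF regR] _ _ _ fdR, where f = "\<lambda>x. x"]) simp_all
qed

end


section \<open>Duality\<close>

lemma dual_opp [simp]: "dual_module K R\<^sup>o X = dual_module K R X"
  by (simp add: dual_module_def)

lemma dual_simps [simp]:
  "carrier (dual_module K R X) = mod_hom K (kv R X) (reg K)"
  "\<zero>\<^bsub>dual_module K R X\<^esub> = (\<lambda>x\<in>carrier X. \<zero>\<^sub>K)"
  "p \<oplus>\<^bsub>dual_module K R X\<^esub> q = (\<lambda>x\<in>carrier X. p x \<oplus>\<^sub>K q x)"
  "a \<odot>\<^bsub>dual_module K R X\<^esub> p = (\<lambda>x\<in>carrier X. p (a \<odot>\<^sub>X x))"
  by (simp_all add: dual_module_def hom_module_def hom_group_def)

abbreviation proj where "proj R P \<equiv> summand R (reg R) P"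

lemma lin_regular:
  assumes "ring R" "lin R (reg R) X v" "r \<in> carrier R"
  shows "v r = r \<odot>\<^sub>X v \<one>\<^sub>R"
  using lin_smult[OF assms(2,3), of "\<one>\<^sub>R"] assms by (simp add: ring.ring_simprules(6) monoid.r_one ring.is_monoid)

text \<open>A homomorphism from the regular module is given by the image of \<open>1\<close>, which can be lifted.\<close>

lemma thru_lift:
  assumes th: "thru R (reg R) P P h"
    and P: "left_module R P" and X: "left_module R X" and Y: "left_module R Y"
    and f: "lin R P Y f" and g: "lin R X Y g" "g ` carrier X = carrier Y"
  shows "\<exists>l. lin R P X l \<and> (\<forall>p\<in>carrier P. g (l p) = f (h p))"
  using th
proof (induction rule: thru.induct)
  case (thru_zero h)
  have "lin R P X (\<lambda>p. \<zero>\<^sub>X)" by (rule lin_const_zero[OF X])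
  moreover have "g \<zero>\<^sub>X = f \<zero>\<^sub>P" by (simp add: lm_lin_zero[OF g(1) X Y] lm_lin_zero[OF f P Y])
  ultimately show ?case using thru_zero by auto
next
  case (thru_add h' u v h)
  then obtain l where l: "lin R P X l" "\<forall>p\<in>carrier P. g (l p) = f (h' p)" by blast
  have R: "ring R" by (rule lm_ring[OF X])
  have v1: "v \<one>\<^sub>R \<in> carrier P" using lin_closed[OF thru_add.hyps(3)] R by (simp add: ring.ring_simprules(6))
  have "f (v \<one>\<^sub>R) \<in> g ` carrier X" using lin_closed[OF f v1] g(2) by simp
  then obtain x where x: "x \<in> carrier X" "g x = f (v \<one>\<^sub>R)" by auto
  have cx: "lin R P X (\<lambda>p. u p \<odot>\<^sub>X x)" by (rule lin_comp[OF thru_add.hyps(2) cyclic_lin[OF X x(1)]])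
  have "lin R P X (\<lambda>p. l p \<oplus>\<^sub>X u p \<odot>\<^sub>X x)" by (rule lin_plus[OF X l(1) cx])
  moreover have "g (l p \<oplus>\<^sub>X u p \<odot>\<^sub>X x) = f (h p)" if p: "p \<in> carrier P" for p
  proof -
    have u: "u p \<in> carrier R" using lin_closed[OF thru_add.hyps(2) p] by simp
    have h': "h' p \<in> carrier P" using thru_lin[OF thru_add.hyps(1) P P] p by (rule lin_closed)
    have "g (l p \<oplus>\<^sub>X u p \<odot>\<^sub>X x) = f (h' p) \<oplus>\<^sub>Y u p \<odot>\<^sub>Y f (v \<one>\<^sub>R)"
      using l(2) p by (simp add: lin_add[OF g(1) lin_closed[OF l(1) p] lin_closed[OF cx p]] lin_smult[OF g(1) u x(1)] x(2))
    also have "u p \<odot>\<^sub>Y f (v \<one>\<^sub>R) = f (v (u p))"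
      by (simp add: lin_smult[OF f u v1, symmetric] lin_regular[OF R thru_add.hyps(3) u])
    also have "f (h' p) \<oplus>\<^sub>Y f (v (u p)) = f (h p)"
      using thru_add.hyps(4)[OF p] lin_add[OF f h', of "v (u p)"] lin_closed[OF thru_add.hyps(3), of "u p"] u by simp
    finally show ?thesis .
  qed
  ultimately show ?case by blast
qed

lemma proj_lift:
  assumes "proj R P" "left_module R P" "left_module R X" "left_module R Y"
    and "lin R P Y f" "lin R X Y g" "g ` carrier X = carrier Y"
  obtains l where "lin R P X l" "\<And>p. p \<in> carrier P ==> g (l p) = f p"
  using thru_lift[OF assms] by blast

lemma fg_free_cover:
  assumes X: "left_module R X" and fg: "fin_generated R X"
  obtains n w where "lin R (mod_power (reg R) n) X w" "w ` carrier (mod_power (reg R) n) = carrier X"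
proof -
  obtain S where S: "finite S" "S \<subseteq> carrier X" "\<And>N. submodule N R X ==> S \<subseteq> N ==> N = carrier X"
    using fg by (auto simp: fin_generated_def)
  then obtain n and s :: "nat \<Rightarrow> _" where sn: "S = s ` {i. i < n}" unfolding finite_conv_nat_seg_image by blast
  have sX: "s i \<in> carrier X" if "i < n" for i using S(2) sn that by auto
  have R: "ring R" by (rule lm_ring[OF X])
  let ?F = "mod_power (reg R) n"
  have F: "left_module R ?F" by (rule mod_power_lm[OF regular_lm[OF R]])
  define w where "w m f = rec_nat \<zero>\<^sub>X (\<lambda>k acc. acc \<oplus>\<^sub>X f k \<odot>\<^sub>X s k) m" for m and f :: "nat \<Rightarrow> _"
  have w: "lin R ?F X (w m)" if "m \<le> n" for m
    using that
  proof (induction m)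
    case 0
    show ?case using lin_const_zero[OF X] by (simp add: w_def[abs_def])
  next
    case (Suc m)
    have "lin R ?F (reg R) (\<lambda>f. f m)" by (rule linI) (use Suc.prems in \<open>auto simp: PiE_mem'\<close>)
    from lin_comp[OF this cyclic_lin[OF X sX]] Suc
    have "lin R ?F X (\<lambda>f. w m f \<oplus>\<^sub>X f m \<odot>\<^sub>X s m)" by (intro lin_plus[OF X]) auto
    thus ?case by (simp add: w_def[abs_def])
  qed
  have zero: "\<zero>\<^sub>R \<in> carrier R" and one: "\<one>\<^sub>R \<in> carrier R" using R by (auto simp: ring.ring_simprules)
  have "S \<subseteq> w n ` carrier ?F"
  proof
    fix x assume "x \<in> S"
    then obtain i where i: "i < n" "x = s i" using sn by auto
    define e where "e = (\<lambda>j\<in>{..<n}. if j = i then \<one>\<^sub>R else \<zero>\<^sub>R)"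
    have ej: "e j = (if j = i then \<one>\<^sub>R else \<zero>\<^sub>R)" if "j < n" for j using that by (simp add: e_def)
    have "w m e = (if i < m then s i else \<zero>\<^sub>X)" if "m \<le> n" for m
      using that
    proof (induction m)
      case (Suc m)
      have "w (Suc m) e = w m e \<oplus>\<^sub>X e m \<odot>\<^sub>X s m" by (simp add: w_def)
      then show ?case using Suc i sX[of m] sX[of i]
        by (auto simp: ej lm_one[OF X] lm_zero_smult[OF X] ag_simps[OF lm_ag[OF X]] less_Suc_eq)
    qed (simp add: w_def)
    from this[of n] i have "x = w n e" by simp
    moreover have "e \<in> carrier ?F" using zero one by (simp add: e_def)
    ultimately show "x \<in> w n ` carrier ?F" by blast
  qed
  from S(3)[OF image_submod[OF F X w[OF order_refl] carrier_submod[OF F]] this]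
  show thesis using w[OF order_refl] that by blast
qed

context fdalg begin

abbreviation D where "D X \<equiv> dual_module K R X"

lemma dual_lin: "p \<in> carrier (D X) ==> lin K (kv R X) (reg K) p"
  by (simp add: mod_hom_iff)

lemma dual_closed: "p \<in> carrier (D X) ==> x \<in> carrier X ==> p x \<in> carrier K"
  using lin_closed[OF dual_lin] by simp

lemma dual_add: "p \<in> carrier (D X) ==> x \<in> carrier X ==> y \<in> carrier X ==> p (x \<oplus>\<^sub>X y) = p x \<oplus>\<^sub>K p y"
  using lin_add[OF dual_lin] by simp

lemma dual_scal: "p \<in> carrier (D X) ==> x \<in> carrier X ==> k \<in> carrier K ==> p ((k \<odot>\<^sub>R \<one>\<^sub>R) \<odot>\<^sub>X x) = k \<otimes>\<^sub>K p x"
  using lin_smult[OF dual_lin, of p X k x] by simp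

lemma dual_zero: "p \<in> carrier (D X) ==> left_module R X ==> p \<zero>\<^sub>X = \<zero>\<^sub>K"
  using lin_zero[OF dual_lin, of p X] lm_ag[OF kv_lm, of X] regular_ag[OF K] by simp

lemma dualI:
  assumes "left_module R X" "lin K (kv R X) (reg K) p"
  shows "restrict p (carrier X) \<in> carrier (D X)"
  using lin_restrict[OF kv_lm[OF assms(1)], of "reg K" p] assms(2) by (simp add: mod_hom_iff)

lemma dual_eqI:
  assumes "p \<in> carrier (D X)" "q \<in> carrier (D X)" "\<And>x. x \<in> carrier X ==> p x = q x"
  shows "p = q"
  by (rule extensionalityI[of _ "carrier X"]) (use assms in \<open>auto simp: mod_hom_iff\<close>)

lemma smult_kv_lin:
  assumes X: "left_module R X" and a: "a \<in> carrier R"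
  shows "lin K (kv R X) (kv R X) (\<lambda>x. a \<odot>\<^sub>X x)"
  by (rule linI) (auto simp: lm_smult[OF X a] lm_r_distr[OF X a] lm_assoc[OF X, symmetric] a io io_central)

lemma dual_lm:
  assumes X: "left_module R X"
  shows "left_module R\<^sup>o (D X)"
proof (rule lm_intro)
  show "ring R\<^sup>o" using fdalg.R[OF opp_alg] .
  note KX = kv_lm[OF X]
  show "abelian_group (D X)"
  proof (rule ag_intro)
    fix p q assume pq: "p \<in> carrier (D X)" "q \<in> carrier (D X)"
    show "p \<oplus>\<^bsub>D X\<^esub> q \<in> carrier (D X)"
      using dualI[OF X lin_plus[OF regK dual_lin[OF pq(1)] dual_lin[OF pq(2)]]] by simp
    show "p \<oplus>\<^bsub>D X\<^esub> q = q \<oplus>\<^bsub>D X\<^esub> p"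
      by (simp, intro restrict_ext ag_comm[OF KG] dual_closed[OF pq(1)] dual_closed[OF pq(2)])
  next
    show "\<zero>\<^bsub>D X\<^esub> \<in> carrier (D X)" using dualI[OF X lin_const_zero[OF regK]] by simp
  next
    fix p q r assume pq: "p \<in> carrier (D X)" "q \<in> carrier (D X)" "r \<in> carrier (D X)"
    show "p \<oplus>\<^bsub>D X\<^esub> q \<oplus>\<^bsub>D X\<^esub> r = p \<oplus>\<^bsub>D X\<^esub> (q \<oplus>\<^bsub>D X\<^esub> r)"
      by (simp, intro restrict_ext) (simp add: ag_assoc[OF KG] dual_closed[OF pq(1)] dual_closed[OF pq(2)] dual_closed[OF pq(3)])
  next
    fix p assume p: "p \<in> carrier (D X)"
    show "\<zero>\<^bsub>D X\<^esub> \<oplus>\<^bsub>D X\<^esub> p = p"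
    proof (rule extensionalityI[of _ "carrier X"])
      show "p \<in> extensional (carrier X)" using p by (simp add: mod_hom_iff)
    qed (auto simp: ag_lzero[OF KG] dual_closed[OF p])
    show "\<exists>q\<in>carrier (D X). q \<oplus>\<^bsub>D X\<^esub> p = \<zero>\<^bsub>D X\<^esub>"
    proof (rule bexI)
      show "restrict (\<lambda>x. \<ominus>\<^bsub>reg K\<^esub> (p x)) (carrier X) \<in> carrier (D X)"
        by (rule dualI[OF X lin_uminus[OF regK dual_lin[OF p]]])
      show "restrict (\<lambda>x. \<ominus>\<^bsub>reg K\<^esub> (p x)) (carrier X) \<oplus>\<^bsub>D X\<^esub> p = \<zero>\<^bsub>D X\<^esub>"
        by (simp, intro restrict_ext) (use ag_lneg[OF regular_ag[OF K]] dual_closed[OF p] in simp)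
    qed
  qed
next
  fix a p assume "a \<in> carrier R\<^sup>o" and p: "p \<in> carrier (D X)"
  then have a: "a \<in> carrier R" by simp
  show "a \<odot>\<^bsub>D X\<^esub> p \<in> carrier (D X)"
    using dualI[OF X lin_comp[OF smult_kv_lin[OF X a] dual_lin[OF p]]] by simp
next
  fix a b p assume "a \<in> carrier R\<^sup>o" "b \<in> carrier R\<^sup>o" and p: "p \<in> carrier (D X)"
  then have a: "a \<in> carrier R" "b \<in> carrier R" by simp_all
  show "(a \<oplus>\<^bsub>R\<^sup>o\<^esub> b) \<odot>\<^bsub>D X\<^esub> p = a \<odot>\<^bsub>D X\<^esub> p \<oplus>\<^bsub>D X\<^esub> b \<odot>\<^bsub>D X\<^esub> p"
    by (simp, intro restrict_ext) (simp add: a lm_l_distr[OF X] dual_add[OF p] lm_smult[OF X])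
  show "(a \<otimes>\<^bsub>R\<^sup>o\<^esub> b) \<odot>\<^bsub>D X\<^esub> p = a \<odot>\<^bsub>D X\<^esub> (b \<odot>\<^bsub>D X\<^esub> p)"
    by (simp, intro restrict_ext) (simp add: a lm_assoc[OF X] lm_smult[OF X])
next
  fix a p q assume "a \<in> carrier R\<^sup>o" and pq: "p \<in> carrier (D X)" "q \<in> carrier (D X)"
  then have a: "a \<in> carrier R" by simp
  show "a \<odot>\<^bsub>D X\<^esub> (p \<oplus>\<^bsub>D X\<^esub> q) = a \<odot>\<^bsub>D X\<^esub> p \<oplus>\<^bsub>D X\<^esub> a \<odot>\<^bsub>D X\<^esub> q"
    by (simp, intro restrict_ext) (simp add: a lm_smult[OF X])
next
  fix p assume p: "p \<in> carrier (D X)"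
  show "\<one>\<^bsub>R\<^sup>o\<^esub> \<odot>\<^bsub>D X\<^esub> p = p"
  proof (rule extensionalityI[of _ "carrier X"])
    show "p \<in> extensional (carrier X)" using p by (simp add: mod_hom_iff)
  qed (auto simp: lm_one[OF X])
qed

lemma dual_lm': "left_module R\<^sup>o X ==> left_module R (D X)"
  using fdalg.dual_lm[OF opp_alg, of X] by simp

definition dmap where "dmap X f p = (\<lambda>x\<in>carrier X. p (f x))"

lemma dmap_closed: "lin R X Y f ==> left_module R X ==> p \<in> carrier (D Y) ==> dmap X f p \<in> carrier (D X)"
  unfolding dmap_def by (rule dualI) (auto intro: lin_comp[OF kv_lin dual_lin])

lemma dmap_lin:
  assumes f: "lin R X Y f" and X: "left_module R X"
  shows "lin R\<^sup>o (D Y) (D X) (dmap X f)"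
proof (rule linI)
  fix p assume "p \<in> carrier (D Y)"
  thus "dmap X f p \<in> carrier (D X)" by (rule dmap_closed[OF f X])
next
  fix p q
  show "dmap X f (p \<oplus>\<^bsub>D Y\<^esub> q) = dmap X f p \<oplus>\<^bsub>D X\<^esub> dmap X f q"
    unfolding dmap_def by (simp, intro restrict_ext) (simp add: lin_closed[OF f])
next
  fix a p assume "a \<in> carrier R\<^sup>o"
  thus "dmap X f (a \<odot>\<^bsub>D Y\<^esub> p) = a \<odot>\<^bsub>D X\<^esub> dmap X f p"
    unfolding dmap_def by (simp, intro restrict_ext) (simp add: lin_closed[OF f] lin_smult[OF f] lm_smult[OF X])
qed

lemma thru_dual:
  assumes th: "thru R M X Y h" and X: "left_module R X" and Y: "left_module R Y" and M: "left_module R M"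
  shows "thru R\<^sup>o (D M) (D Y) (D X) (dmap X h)"
  using th
proof (induction rule: thru.induct)
  case (thru_zero h)
  show ?case
  proof (rule thru.thru_zero)
    fix p assume p: "p \<in> carrier (D Y)"
    show "dmap X h p = \<zero>\<^bsub>D X\<^esub>"
      unfolding dmap_def by (simp, intro restrict_ext) (simp add: thru_zero dual_zero[OF p Y])
  qed
next
  case (thru_add g u v h)
  show ?case
  proof (rule thru.thru_add[OF thru_add.IH dmap_lin[OF thru_add.hyps(3) M] dmap_lin[OF thru_add.hyps(2) X]])
    fix p assume p: "p \<in> carrier (D Y)"
    show "dmap X h p = dmap X g p \<oplus>\<^bsub>D X\<^esub> dmap X u (dmap M v p)"
      unfolding dmap_def
      by (simp, intro restrict_ext)
         (simp add: thru_add.hyps(4) lin_closed[OF thru_add.hyps(2)] lin_closed[OF thru_add.hyps(3)]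
           dual_add[OF p] lin_closed[OF thru_lin[OF thru_add.hyps(1) X Y]])
  qed
qed

lemma thru_dual_id:
  assumes th: "summand R M X" and X: "left_module R X" and M: "left_module R M"
  shows "summand R\<^sup>o (D M) (D X)"
proof (rule thru_cong[OF thru_dual[OF th X X M]])
  fix p assume "p \<in> carrier (D X)"
  thus "p = dmap X (\<lambda>x. x) p" unfolding dmap_def by (simp add: mod_hom_iff extensional_restrict)
qed

lemma separate_dual:
  assumes X: "left_module R X" and fg: "fin_generated R X" and N: "submodule N R X" and x: "x \<in> carrier X" "x \<notin> N"
  obtains p where "p \<in> carrier (D X)" "\<And>y. y \<in> N ==> p y = \<zero>\<^sub>K" "p x \<noteq> \<zero>\<^sub>K"
proof -
  interpret X: fdspace K "kv R X" by (rule fd[OF X fg])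
  obtain m where m: "lin K (kv R X) (reg K) m" "\<And>y. y \<in> N ==> m y = \<zero>\<^sub>K" "m x \<noteq> \<zero>\<^sub>K"
    using X.separate[OF kv_submod[OF X N], of x] x by auto
  have "restrict m (carrier X) y = m y" if "y \<in> carrier X" for y using that by simp
  with m x submodD(1)[OF X N] that[OF dualI[OF X m(1)]] show thesis by (simp add: subset_iff)
qed

lemma extend_dual:
  assumes X: "left_module R X" and fg: "fin_generated R X" and N: "submodule N R X" and p: "p \<in> carrier (D (X\<restriction>N))"
  obtains q where "q \<in> carrier (D X)" "\<And>y. y \<in> N ==> q y = p y"
proof -
  interpret X: fdspace K "kv R X" by (rule fd[OF X fg])
  have "lin K ((kv R X)\<restriction>N) (reg K) p"
    using dual_lin[OF p] by (simp add: restrict_scalars_sub)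
  from X.extend_functional[OF kv_submod[OF X N] this] obtain m where
    m: "lin K (kv R X) (reg K) m" "\<And>x. x \<in> N ==> m x = p x" by blast
  with submodD(1)[OF X N] that[OF dualI[OF X m(1)]] show thesis by (simp add: subset_iff)
qed

definition evm where "evm X x = (\<lambda>p\<in>carrier (D X). p x)"

lemma evm_lin:
  assumes X: "left_module R X"
  shows "lin R X (D (D X)) (evm X)"
proof (rule linI)
  fix x assume x: "x \<in> carrier X"
  have "lin K (kv R\<^sup>o (D X)) (reg K) (\<lambda>p. p x)"
    by (rule linI) (use x in \<open>auto simp: dual_closed[unfolded dual_simps] dual_scal[unfolded dual_simps]\<close>)
  from fdalg.dualI[OF opp_alg dual_lm[OF X] this]
  show "evm X x \<in> carrier (D (D X))" by (simp add: evm_def)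
next
  fix x y assume "x \<in> carrier X" "y \<in> carrier X"
  thus "evm X (x \<oplus>\<^sub>X y) = evm X x \<oplus>\<^bsub>D (D X)\<^esub> evm X y"
    unfolding evm_def dual_simps(3)[of K R "D X"] by (intro restrict_ext) (simp add: dual_add del: dual_simps(1))
next
  fix a x assume ax: "a \<in> carrier R" "x \<in> carrier X"
  have "a \<odot>\<^bsub>D X\<^esub> p \<in> carrier (D X)" if "p \<in> carrier (D X)" for p
    using lm_smult[OF dual_lm[OF X] _ that] ax by simp
  thus "evm X (a \<odot>\<^sub>X x) = a \<odot>\<^bsub>D (D X)\<^esub> evm X x"
    unfolding evm_def dual_simps(4)[of K R "D X"] using ax by (intro restrict_ext) (simp del: dual_simps(1))
qed

text \<open>Write the identity of \<open>X\<close> as \<open>y \<mapsto> \<Sum> u\<^sub>i(y) v\<^sub>i 1\<close> with functionals \<open>u\<^sub>i\<close>. A functional \<open>P\<close> on the dual is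
  then the evaluation at \<open>\<Sum> P(u\<^sub>i) v\<^sub>i 1\<close>.\<close>

lemma evm_bij:
  assumes X: "left_module R X" and fg: "fin_generated R X"
  shows "bij_betw (evm X) (carrier X) (carrier (D (D X)))"
  unfolding bij_betw_def
proof
  have DD: "left_module R (D (D X))" by (rule dual_lm'[OF dual_lm[OF X]])
  show "inj_on (evm X) (carrier X)"
  proof (rule inj_if_ker[OF X DD evm_lin[OF X]])
    fix x assume x: "x \<in> carrier X" "evm X x = \<zero>\<^bsub>D (D X)\<^esub>"
    show "x = \<zero>\<^sub>X"
    proof (rule ccontr)
      assume "x \<noteq> \<zero>\<^sub>X"
      then obtain p where p: "p \<in> carrier (D X)" "p x \<noteq> \<zero>\<^sub>K"
        using separate_dual[OF X fg zero_submod[OF X] x(1)] by auto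
      have "evm X x p = \<zero>\<^sub>K" using x(2) p(1) by simp
      with p show False by (simp add: evm_def)
    qed
  qed
  show "evm X ` carrier X = carrier (D (D X))"
  proof
    show "evm X ` carrier X \<subseteq> carrier (D (D X))" using lin_closed[OF evm_lin[OF X]] by auto
    show "carrier (D (D X)) \<subseteq> evm X ` carrier X"
    proof
      fix P assume P: "P \<in> carrier (D (D X))"
      note opd = fdalg.dual_add[OF opp_alg, of P "D X", simplified dual_opp, OF P]
        fdalg.dual_scal[OF opp_alg, of P "D X", simplified dual_opp opp_simps, OF P]
        fdalg.dual_closed[OF opp_alg, of P "D X", simplified dual_opp, OF P]
        fdalg.dual_zero[OF opp_alg, of P "D X", simplified dual_opp, OF P dual_lm[OF X]]
      interpret X: fdspace K "kv R X" by (rule fd[OF X fg])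
      have "\<exists>x\<in>carrier X. \<forall>p\<in>carrier (D X). P (\<lambda>y\<in>carrier X. p (h y)) = p x"
        if "thru K (reg K) (kv R X) (kv R X) h" for h
        using that
      proof (induction rule: thru.induct)
        case (thru_zero h)
        have "P (\<lambda>y\<in>carrier X. p (h y)) = p \<zero>\<^sub>X" if p: "p \<in> carrier (D X)" for p
        proof -
          have "(\<lambda>y\<in>carrier X. p (h y)) = \<zero>\<^bsub>D X\<^esub>" using thru_zero dual_zero[OF p X] by (simp cong: restrict_cong)
          thus ?thesis using opd(4) dual_zero[OF p X] by simp
        qed
        thus ?case using lm_zero[OF X] by blast
      next
        case (thru_add g u v h)
        then obtain x where x: "x \<in> carrier X" "\<forall>p\<in>carrier (D X). P (\<lambda>y\<in>carrier X. p (g y)) = p x" by blast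
        have gl: "lin K (kv R X) (kv R X) g" by (rule thru_lin[OF thru_add.hyps(1) X.V X.V])
        have v1: "v \<one>\<^sub>K \<in> carrier X" using lin_closed[OF thru_add.hyps(3)] oneK by simp
        define u' where "u' = restrict u (carrier X)"
        have u': "u' \<in> carrier (D X)" unfolding u'_def by (rule dualI[OF X thru_add.hyps(2)])
        have Pu: "P u' \<in> carrier K" by (rule opd(3)[OF u'])
        define x' where "x' = x \<oplus>\<^sub>X (P u' \<odot>\<^sub>R \<one>\<^sub>R) \<odot>\<^sub>X v \<one>\<^sub>K"
        have sv: "(P u' \<odot>\<^sub>R \<one>\<^sub>R) \<odot>\<^sub>X v \<one>\<^sub>K \<in> carrier X" by (rule lm_smult[OF X io[OF Pu] v1])
        have "x' \<in> carrier X" unfolding x'_def by (rule lm_closed[OF X x(1) sv])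
        moreover have "P (\<lambda>y\<in>carrier X. p (h y)) = p x'" if p: "p \<in> carrier (D X)" for p
        proof -
          have uc: "u y \<in> carrier K" if "y \<in> carrier X" for y using lin_closed[OF thru_add.hyps(2)] that by simp
          have pv: "p (v \<one>\<^sub>K) \<in> carrier K" by (rule dual_closed[OF p v1])
          let ?s = "(p (v \<one>\<^sub>K) \<odot>\<^sub>R \<one>\<^sub>R) \<odot>\<^bsub>D X\<^esub> u'"
          let ?t = "(\<lambda>y\<in>carrier X. p (g y))"
          have t: "?t \<in> carrier (D X)" by (rule dualI[OF X lin_comp[OF gl dual_lin[OF p]]])
          have s: "?s \<in> carrier (D X)" using lm_smult[OF dual_lm[OF X] _ u'] io[OF pv] by simp
          have "(\<lambda>y\<in>carrier X. p (h y)) = ?t \<oplus>\<^bsub>D X\<^esub> ?s"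
          proof (simp only: dual_simps(3), rule restrict_ext)
            fix y assume y: "y \<in> carrier X"
            have "v (u y) = (u y \<odot>\<^sub>R \<one>\<^sub>R) \<odot>\<^sub>X v \<one>\<^sub>K"
              using lin_regular[OF K thru_add.hyps(3) uc[OF y]] by simp
            hence "p (h y) = p (g y) \<oplus>\<^sub>K u y \<otimes>\<^sub>K p (v \<one>\<^sub>K)"
              using thru_add.hyps(4)[of y] y lin_closed[OF gl, of y] dual_add[OF p, of "g y"] lm_smult[OF X io[OF uc[OF y]] v1]
                dual_scal[OF p v1 uc[OF y]] by simp
            also have "u y \<otimes>\<^sub>K p (v \<one>\<^sub>K) = ?s y"
              using y dual_scal[OF u' y pv] fld uc[OF y] pv lm_smult[OF X io[OF pv] y]
              by (simp add: u'_def field_def domain_def cring.cring_simprules(14))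
            finally show "p (h y) = ?t y \<oplus>\<^sub>K ?s y" using y by simp
          qed
          hence "P (\<lambda>y\<in>carrier X. p (h y)) = P ?t \<oplus>\<^sub>K P ?s" using opd(1)[OF t s] by simp
          also have "P ?t = p x" using x(2) p by simp
          also have "P ?s = p (v \<one>\<^sub>K) \<otimes>\<^sub>K P u'" by (rule opd(2)[OF u' pv])
          also have "\<dots> = P u' \<otimes>\<^sub>K p (v \<one>\<^sub>K)" using fld Pu pv by (simp add: field_def domain_def cring.cring_simprules(14))
          also have "\<dots> = p ((P u' \<odot>\<^sub>R \<one>\<^sub>R) \<odot>\<^sub>X v \<one>\<^sub>K)" by (rule dual_scal[OF p v1 Pu, symmetric])
          also have "p x \<oplus>\<^sub>K \<dots> = p x'" unfolding x'_def by (rule dual_add[OF p x(1) sv, symmetric])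
          finally show ?thesis .
        qed
        ultimately show ?case by blast
      qed
      from this[of "\<lambda>x. x"] X.fg obtain x where x: "x \<in> carrier X" "\<forall>p\<in>carrier (D X). P (\<lambda>y\<in>carrier X. p y) = p x"
        by (auto simp: X.fg_iff_thru)
      have "P = evm X x"
      proof (rule fdalg.dual_eqI[OF opp_alg, of P "D X"])
        show "P \<in> carrier (dual_module K R\<^sup>o (D X))" using P by simp
        show "evm X x \<in> carrier (dual_module K R\<^sup>o (D X))" using lin_closed[OF evm_lin[OF X] x(1)] by simp
        fix p assume p: "p \<in> carrier (D X)"
        have e: "(\<lambda>y\<in>carrier X. p y) = p" using p by (simp add: mod_hom_iff extensional_restrict)
        have "P (\<lambda>y\<in>carrier X. p y) = p x" using x(2) p by blast
        with e have "P p = p x" by (simp only: e)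
        thus "P p = evm X x p" using p unfolding evm_def by (simp only: restrict_apply')
      qed
      with x show "P \<in> evm X ` carrier X" by blast
    qed
  qed
qed

lemma bidual_iso: "left_module R X ==> fin_generated R X ==> mod_iso R X (D (D X))"
  by (rule mod_isoI[OF _ evm_lin evm_bij])

lemma dual_fg:
  assumes X: "left_module R X" and fg: "fin_generated R X"
  shows "fin_generated R\<^sup>o (D X)"
proof (rule fdalg.kv_fgI[OF opp_alg dual_lm[OF X]])
  interpret X: fdspace K "kv R X" by (rule fd[OF X fg])
  let ?V = "kv R\<^sup>o (D X)"
  have V: "left_module K ?V" by (rule fdalg.kv_lm[OF opp_alg dual_lm[OF X]])
  have "thru K (reg K) ?V ?V (\<lambda>p. \<lambda>y\<in>carrier X. p (h y))"
    if "thru K (reg K) (kv R X) (kv R X) h" for h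
    using that
  proof (induction rule: thru.induct)
    case (thru_zero h)
    show ?case
    proof (rule thru.thru_zero)
      fix p assume "p \<in> carrier ?V"
      hence p: "p \<in> carrier (D X)" by simp
      show "(\<lambda>y\<in>carrier X. p (h y)) = \<zero>\<^sub>?V" using thru_zero dual_zero[OF p X] by (simp cong: restrict_cong)
    qed
  next
    case (thru_add g u v h)
    have gl: "lin K (kv R X) (kv R X) g" by (rule thru_lin[OF thru_add.hyps(1) X.V X.V])
    have v1: "v \<one>\<^sub>K \<in> carrier X" using lin_closed[OF thru_add.hyps(3)] oneK by simp
    define u' where "u' = restrict u (carrier X)"
    have u': "u' \<in> carrier (D X)" unfolding u'_def by (rule dualI[OF X thru_add.hyps(2)])
    have "lin K ?V (reg K) (\<lambda>p. p (v \<one>\<^sub>K))"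
      by (rule linI) (use v1 in \<open>auto simp: dual_closed[unfolded dual_simps] dual_scal[unfolded dual_simps]\<close>)
    moreover have "lin K (reg K) ?V (\<lambda>k. k \<odot>\<^sub>?V u')" by (rule cyclic_lin[OF V]) (use u' in simp)
    ultimately show ?case
    proof (rule thru.thru_add[OF thru_add.IH])
      fix p assume "p \<in> carrier ?V"
      hence p: "p \<in> carrier (D X)" by simp
      have uc: "u y \<in> carrier K" if "y \<in> carrier X" for y using lin_closed[OF thru_add.hyps(2)] that by simp
      have pv: "p (v \<one>\<^sub>K) \<in> carrier K" by (rule dual_closed[OF p v1])
      show "(\<lambda>y\<in>carrier X. p (h y)) = (\<lambda>y\<in>carrier X. p (g y)) \<oplus>\<^sub>?V p (v \<one>\<^sub>K) \<odot>\<^sub>?V u'"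
      proof (simp only: restrict_scalars_simps dual_simps(3,4) opp_simps, rule restrict_ext)
        fix y assume y: "y \<in> carrier X"
        have "v (u y) = (u y \<odot>\<^sub>R \<one>\<^sub>R) \<odot>\<^sub>X v \<one>\<^sub>K"
          using lin_regular[OF K thru_add.hyps(3) uc[OF y]] by simp
        hence "p (h y) = p (g y) \<oplus>\<^sub>K u y \<otimes>\<^sub>K p (v \<one>\<^sub>K)"
          using thru_add.hyps(4)[of y] y lin_closed[OF gl, of y] dual_add[OF p, of "g y"] lm_smult[OF X io[OF uc[OF y]] v1]
            dual_scal[OF p v1 uc[OF y]] by simp
        also have "u y \<otimes>\<^sub>K p (v \<one>\<^sub>K) = u' ((p (v \<one>\<^sub>K) \<odot>\<^sub>R \<one>\<^sub>R) \<odot>\<^sub>X y)"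
          using y dual_scal[OF u' y pv] fld uc[OF y] pv
          by (simp add: u'_def field_def domain_def cring.cring_simprules(14))
        finally show "p (h y) = (\<lambda>y\<in>carrier X. p (g y)) y \<oplus>\<^sub>K (\<lambda>x\<in>carrier X. u' ((p (v \<one>\<^sub>K) \<odot>\<^sub>R \<one>\<^sub>R) \<odot>\<^sub>X x)) y"
          using y by simp
      qed
    qed
  qed
  from this[of "\<lambda>x. x"] X.fg have "thru K (reg K) ?V ?V (\<lambda>p. \<lambda>y\<in>carrier X. p y)"
    by (simp add: X.fg_iff_thru)
  hence "thru K (reg K) ?V ?V (\<lambda>p. p)"
    by (rule thru_cong) (simp add: mod_hom_iff extensional_restrict)
  thus "fin_generated K ?V" by (rule thru_regular_fg[OF _ V])
qed

end


section \<open>Projective covers and injective modules\<close>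

lemma set_add_eq:
  assumes X: "left_module R X" and N: "submodule N R X" and Y: "left_module R Y" and g: "lin R X Y g"
  shows "N <+>\<^sub>X mod_ker X Y g = carrier X \<longleftrightarrow> g ` N = g ` carrier X"
proof
  note G = lm_ag[OF X] and D = submodD[OF X N]
  assume e: "N <+>\<^sub>X mod_ker X Y g = carrier X"
  show "g ` N = g ` carrier X"
  proof
    show "g ` N \<subseteq> g ` carrier X" using D(1) by auto
    show "g ` carrier X \<subseteq> g ` N"
    proof
      fix y assume "y \<in> g ` carrier X"
      then obtain x where x: "x \<in> carrier X" "y = g x" by auto
      then have "x \<in> N <+>\<^sub>X mod_ker X Y g" using e by simp
      then obtain n k where nk: "n \<in> N" "k \<in> mod_ker X Y g" "x = n \<oplus>\<^sub>X k" unfolding set_add_def' by blast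
      then have "k \<in> carrier X" "g k = \<zero>\<^sub>Y" "n \<in> carrier X" using D(1) by (auto simp: mod_ker_def)
      then have "y = g n" using x nk lin_closed[OF g] by (simp add: lin_add[OF g] ag_rzero[OF lm_ag[OF Y]])
      thus "y \<in> g ` N" using nk by blast
    qed
  qed
next
  note G = lm_ag[OF X] and D = submodD[OF X N]
  assume e: "g ` N = g ` carrier X"
  show "N <+>\<^sub>X mod_ker X Y g = carrier X"
  proof
    show "N <+>\<^sub>X mod_ker X Y g \<subseteq> carrier X"
      using D(1) ag_closed[OF G] by (auto simp: set_add_def' mod_ker_def)
    show "carrier X \<subseteq> N <+>\<^sub>X mod_ker X Y g"
    proof
      fix x assume x: "x \<in> carrier X"
      hence "g x \<in> g ` N" using e by blast
      then obtain n where n: "n \<in> N" "g x = g n" by auto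
      have nX: "n \<in> carrier X" using n D(1) by auto
      have "x \<ominus>\<^sub>X n \<in> mod_ker X Y g" by (rule lin_surj_sum[OF X Y g x nX n(2)])
      moreover have "x = n \<oplus>\<^sub>X (x \<ominus>\<^sub>X n)"
        using ag_diff_add[OF G x nX] ag_comm[OF G nX ag_diff[OF G x nX]] by simp
      ultimately show "x \<in> N <+>\<^sub>X mod_ker X Y g" unfolding set_add_def' using n(1) by blast
    qed
  qed
qed

lemma fg_modD: "X \<in> fg_mod R ==> left_module R X" "X \<in> fg_mod R ==> fin_generated R X"
  by (simp_all add: fg_mod_def)

lemma restrict_mod_hom: "left_module R X ==> lin R X Y f ==> restrict f (carrier X) \<in> mod_hom R X Y"
  by (simp add: mod_hom_iff lin_restrict)

lemma mod_hom_lin: "f \<in> mod_hom R X Y ==> lin R X Y f"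
  by (simp add: mod_hom_iff)

lemma lin_funpow': "lin R V V f ==> lin R V V (f ^^ n)"
  by (induction n) (auto intro: lin_id lin_comp simp: comp_def id_def)

context fdalg begin

lemma fg_dim_less:
  fixes X :: "('a, 'm) module"
  assumes X: "left_module R X" and fg: "fin_generated R X" and N: "submodule N R X" and U: "submodule U R X"
    and NU: "N \<subseteq> U" "N \<noteq> U"
  shows "fspace.dimS K (kv R X) N < fspace.dimS K (kv R X) U"
proof -
  interpret X: fdspace K "kv R X" by (rule fd[OF X fg])
  show ?thesis
    using X.dimS_mono[OF kv_submod[OF X U] kv_submod[OF X N] NU(1)] NU(2) by (meson not_le)
qed

lemma surj_endo_inj:
  fixes X :: "('a, 'm) module"
  assumes X: "left_module R X" and fg: "fin_generated R X" and f: "lin R X X f" "f ` carrier X = carrier X"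
  shows "bij_betw f (carrier X) (carrier X)"
proof -
  interpret X: fdspace K "kv R X" by (rule fd[OF X fg])
  show ?thesis using X.surj_inj[OF kv_lin[OF f(1)]] f(2) by (simp add: bij_betw_def)
qed

text \<open>Fitting's lemma: a high power of \<open>f\<close> is bijective on its own image, so that the image is a direct
  summand.\<close>

lemma fitting_retract:
  fixes X :: "('a, 'm) module"
  assumes X: "left_module R X" and fg: "fin_generated R X" and f: "lin R X X f"
  obtains n r S where "S = (f ^^ n) ` carrier X" "submodule S R X" "f ` S = S" "lin R X (X\<restriction>S) r"
    "\<And>x. x \<in> S ==> r x = x"
proof -
  interpret X: fdspace K "kv R X" by (rule fd[OF X fg])
  obtain n where n: "f ` ((f ^^ n) ` carrier X) = (f ^^ n) ` carrier X" "inj_on f ((f ^^ n) ` carrier X)"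
    using X.fitting[OF kv_lin[OF f]] by auto
  define S where "S = (f ^^ n) ` carrier X"
  have S: "submodule S R X" unfolding S_def by (rule image_submod[OF X X lin_funpow'[OF f] carrier_submod[OF X]])
  note D = submodD[OF X S]
  have fS: "f ` S = S" "inj_on f S" using n by (simp_all add: S_def)
  have fmS: "(f ^^ m) ` S = S \<and> inj_on (f ^^ m) S" for m
  proof (induction m)
    case (Suc m)
    have "(f ^^ Suc m) ` S = f ` ((f ^^ m) ` S)" by (simp add: image_comp)
    moreover have "inj_on (f ^^ Suc m) S" using comp_inj_on[of "f ^^ m" S f] Suc fS by (simp add: comp_def)
    ultimately show ?case using Suc fS by (simp del: funpow.simps)
  qed simp
  have LS: "left_module R (X\<restriction>S)" by (rule sub_lm[OF X S])
  have fl: "lin R (X\<restriction>S) (X\<restriction>S) (f ^^ n)"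
    using lin_sub[OF lin_funpow'[OF f] D(1)] fmS[of n] by (subst lin_into_sub[OF D(1)]) auto
  have "bij_betw (f ^^ n) (carrier (X\<restriction>S)) (carrier (X\<restriction>S))"
    using fmS[of n] by (simp add: bij_betw_def)
  then obtain g where g0: "lin R (X\<restriction>S) (X\<restriction>S) g"
    "\<And>x. x \<in> carrier (X\<restriction>S) ==> g ((f ^^ n) x) = x"
    by (rule lin_inverse[OF LS LS fl]) (rule that; assumption)
  then have g: "lin R (X\<restriction>S) (X\<restriction>S) g" "\<And>x. x \<in> S ==> g ((f ^^ n) x) = x" by simp_all
  have "lin R X (X\<restriction>S) (f ^^ n)"
    using lin_funpow'[OF f] by (subst lin_into_sub[OF D(1)]) (auto simp: S_def)
  from lin_comp[OF this g(1)] show thesis using that[of S n "\<lambda>x. g ((f ^^ n) x)"] S_def S fS(1) g(2) by auto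
qed

lemma regR_fg: "fin_generated R (reg R)"
  by (rule kv_fgI[OF regR fdR])

lemma power_fg: "left_module R M ==> fin_generated R M ==> fin_generated R (mod_power M n)" for M :: "('a, 'm) module"
  by (rule fg_thru[OF mod_power_thru mod_power_lm])

lemma proj_cover_exists0:
  assumes X: "left_module R X" and fg: "fin_generated R X"
  obtains P w where "P \<in> fg_mod R" "proj R P" "lin R P X w" "w ` carrier P = carrier X"
proof -
  obtain n w where w: "lin R (mod_power (reg R) n) X w" "w ` carrier (mod_power (reg R) n) = carrier X"
    by (rule fg_free_cover[OF X fg])
  let ?F = "mod_power (reg R) n"
  have F: "left_module R ?F" by (rule mod_power_lm[OF regR])
  obtain P f g where P: "P \<in> fg_mod R" "lin R ?F P f" "lin R P ?F g"
    "\<And>x. x \<in> carrier ?F ==> g (f x) = x" "\<And>y. y \<in> carrier P ==> f (g y) = y"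
    by (rule rep[OF F power_fg[OF regR regR_fg]]) (rule that; assumption)
  have "proj R P" by (rule thru_transfer[OF mod_power_thru[OF regR] P(3,2,5) F fg_modD(1)[OF P(1)]])
  moreover have "lin R P X (\<lambda>x. w (g x))" by (rule lin_comp[OF P(3) w(1)])
  moreover have "(\<lambda>x. w (g x)) ` carrier P = carrier X"
  proof -
    have "g ` carrier P = carrier ?F"
    proof
      show "g ` carrier P \<subseteq> carrier ?F" using lin_closed[OF P(3)] by blast
      show "carrier ?F \<subseteq> g ` carrier P"
      proof
        fix x assume x: "x \<in> carrier ?F"
        show "x \<in> g ` carrier P" by (rule image_eqI[of _ _ "f x"]) (simp_all only: P(4)[OF x] lin_closed[OF P(2) x])
      qed
    qed
    with w(2) show ?thesis by (metis image_image)
  qed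
  ultimately show thesis using that P(1) by blast
qed

text \<open>Lifting the identity along a surjection from a free module exhibits a projective module as a direct
  summand.\<close>

lemma projective_iff: "projective R P \<longleftrightarrow> P \<in> fg_mod R \<and> proj R P"
proof
  assume p: "projective R P"
  hence P: "P \<in> fg_mod R" by (simp add: projective_def)
  note L = fg_modD[OF P]
  obtain F w where F: "F \<in> fg_mod R" "proj R F" "lin R F P w" "w ` carrier F = carrier P"
    by (rule proj_cover_exists0[OF L]) (rule that; assumption)
  note LF = fg_modD[OF F(1)]
  have "restrict w (carrier F) \<in> mod_hom R F P" by (rule restrict_mod_hom[OF LF(1) F(3)])
  moreover have "restrict (\<lambda>x. x) (carrier P) \<in> mod_hom R P P" by (rule restrict_mod_hom[OF L(1) lin_id])
  moreover have "restrict w (carrier F) ` carrier F = carrier P" using F(4) by simp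
  ultimately obtain h where h: "h \<in> mod_hom R P F" "\<forall>p\<in>carrier P. restrict w (carrier F) (h p) = restrict (\<lambda>x. x) (carrier P) p"
    using p F(1) P unfolding projective_def by blast
  have hl: "lin R P F h" using h(1) by (rule mod_hom_lin)
  have "proj R P" by (rule thru_transfer[OF F(2) hl F(3) _ LF(1) L(1)]) (use h(2) lin_closed[OF hl] in auto)
  with P show "P \<in> fg_mod R \<and> proj R P" by simp
next
  assume p: "P \<in> fg_mod R \<and> proj R P"
  hence L: "left_module R P" using fg_modD by blast
  show "projective R P"
    unfolding projective_def
  proof (intro conjI ballI impI)
    fix X Y g f assume XY: "X \<in> fg_mod R" "Y \<in> fg_mod R" "g \<in> mod_hom R X Y" "f \<in> mod_hom R P Y" "g ` carrier X = carrier Y"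
    obtain l where l: "lin R P X l" "\<And>p. p \<in> carrier P ==> g (l p) = f p"
      using proj_lift[OF _ L fg_modD(1)[OF XY(1)] fg_modD(1)[OF XY(2)] mod_hom_lin[OF XY(4)] mod_hom_lin[OF XY(3)] XY(5)] p by blast
    show "\<exists>h\<in>mod_hom R P X. \<forall>p\<in>carrier P. g (h p) = f p"
      by (rule bexI[OF _ restrict_mod_hom[OF L l(1)]]) (use l(2) in simp)
  qed (use p in simp)
qed

lemma projective_cover_iff:
  assumes X: "left_module R X"
  shows "projective_cover R P g X \<longleftrightarrow> P \<in> fg_mod R \<and> proj R P \<and> g \<in> mod_hom R P X \<and> g ` carrier P = carrier X \<and>
    (\<forall>N. submodule N R P \<longrightarrow> g ` N = carrier X \<longrightarrow> N = carrier P)"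
proof -
  have "N <+>\<^sub>P mod_ker P X g = carrier P \<longleftrightarrow> g ` N = carrier X"
    if "P \<in> fg_mod R" "g \<in> mod_hom R P X" "g ` carrier P = carrier X" "submodule N R P" for N
    using set_add_eq[OF fg_modD(1)[OF that(1)] that(4) X mod_hom_lin[OF that(2)]] that(3) by simp
  hence "(submodule N R P \<and> N <+>\<^sub>P mod_ker P X g = carrier P \<longrightarrow> N = carrier P) \<longleftrightarrow>
      (submodule N R P \<longrightarrow> g ` N = carrier X \<longrightarrow> N = carrier P)"
    if "P \<in> fg_mod R" "g \<in> mod_hom R P X" "g ` carrier P = carrier X" for N
    using that by metis
  thus ?thesis unfolding projective_cover_def projective_iff by (simp cong: conj_cong)
qed

text \<open>Take a projective module over \<open>X\<close> and among its direct summands that still map onto \<open>X\<close> one of least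
  dimension. If a smaller submodule maps onto \<open>X\<close>, then some endomorphism over \<open>X\<close> has its values there, and
  Fitting's lemma splits off a smaller summand.\<close>

lemma projective_cover_exists:
  assumes X: "left_module R X" and fg: "fin_generated R X"
  obtains P g where "projective_cover R P g X"
proof -
  obtain P0 w where P0: "P0 \<in> fg_mod R" "proj R P0" "lin R P0 X w" "w ` carrier P0 = carrier X"
    by (rule proj_cover_exists0[OF X fg]) (rule that; assumption)
  note L0 = fg_modD[OF P0(1)]
  let ?Q = "\<lambda>S. submodule S R P0 \<and> w ` S = carrier X \<and> (\<exists>r. lin R P0 (P0\<restriction>S) r \<and> (\<forall>x\<in>S. r x = x))"
  have "lin R P0 (P0\<restriction>(carrier P0)) (\<lambda>x. x)" using lin_id by (simp add: lin_into_sub)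
  hence "?Q (carrier P0)" using carrier_submod[OF L0(1)] P0(4) by blast
  from ex_has_least_nat[of ?Q, OF this, of "fspace.dimS K (kv R P0)"]
  obtain S where S: "?Q S" and least: "\<And>S'. ?Q S' ==> fspace.dimS K (kv R P0) S \<le> fspace.dimS K (kv R P0) S'"
    by (elim exE conjE) blast
  have Sm: "submodule S R P0" and wS: "w ` S = carrier X" using S by auto
  obtain r where r: "lin R P0 (P0\<restriction>S) r" "\<And>x. x \<in> S ==> r x = x" using S by blast
  let ?P = "P0\<restriction>S" and ?w = "restrict w S"
  note D0 = submodD[OF L0(1) Sm] and LP = sub_lm[OF L0(1) Sm] and FP = fg_sub[OF L0 Sm]
  have wP: "lin R ?P X w" by (rule lin_sub[OF P0(3) D0(1)])
  have pP: "proj R ?P"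
    by (rule thru_transfer[OF P0(2) lin_sub[OF lin_id D0(1)] r(1) _ L0(1) LP]) (use r(2) in simp)
  have min: "N = S" if N: "submodule N R ?P" "w ` N = carrier X" for N
  proof -
    note DN = submodD[OF LP N(1)] and LN = sub_lm[OF LP N(1)]
    obtain h where h: "lin R ?P (?P\<restriction>N) h" "\<And>p. p \<in> carrier ?P ==> w (h p) = w p"
      using proj_lift[OF pP LP LN X wP lin_sub[OF wP DN(1)]] N(2) by auto
    have hP: "lin R ?P ?P h" by (rule conjunct1[OF iffD1[OF lin_into_sub[OF DN(1)] h(1)]])
    have hN: "\<And>p. p \<in> S ==> h p \<in> N" using lin_closed[OF h(1)] by simp
    obtain n s T where T: "T = (h ^^ n) ` carrier ?P" "submodule T R ?P" "h ` T = T" "lin R ?P (?P\<restriction>T) s"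
      "\<And>x. x \<in> T ==> s x = x" by (rule fitting_retract[OF LP FP hP]) (rule that; assumption)
    have TS: "T \<subseteq> S" using submodD(1)[OF LP T(2)] by simp
    have "h ` T \<subseteq> N" using hN TS by auto
    hence TN: "T \<subseteq> N" by (simp only: T(3))
    have T0: "submodule T R P0"
      by (rule submodI[OF L0(1)]) (use TS D0 submodD[OF LP T(2)] in auto)
    have wh: "w ((h ^^ m) p) = w p" if "p \<in> S" for m p
      by (induction m) (use that h(2) lin_closed[OF lin_funpow'[OF hP]] in auto)
    have "w ` T = w ` S" unfolding T(1) using wh by (auto simp: image_image)
    hence wT: "w ` T = carrier X" by (simp only: wS)
    have sr: "lin R P0 (P0\<restriction>T) (\<lambda>x. s (r x))" "\<forall>x\<in>T. s (r x) = x"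
      using lin_comp[OF r(1) T(4)] r(2) T(5) TS by (simp, simp add: subset_iff)
    have "?Q T" by (intro conjI T0 wT exI[of _ "\<lambda>x. s (r x)"] sr)
    from least[OF this] have "T = S" using fg_dim_less[OF L0 T0 Sm TS] by (meson leD)
    thus ?thesis using TN DN(1) by simp
  qed
  have "projective_cover R ?P ?w X"
    unfolding projective_cover_iff[OF X]
  proof (intro conjI allI impI)
    show "?P \<in> fg_mod R" using LP FP by (simp add: fg_mod_def)
    show "?w \<in> mod_hom R ?P X" using restrict_mod_hom[OF LP wP] by simp
    show "?w ` carrier ?P = carrier X" using wS by simp
    fix N assume N: "submodule N R ?P" "?w ` N = carrier X"
    have "?w ` N = w ` N" using submodD(1)[OF LP N(1)] by (intro image_cong) auto
    with min[OF N(1)] N(2) show "N = carrier ?P" by simp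
  qed (rule pP)
  with that show thesis by blast
qed

abbreviation DR where "DR \<equiv> D (reg R\<^sup>o)"

lemma DR_lm: "left_module R DR"
  by (rule dual_lm'[OF fdalg.regR[OF opp_alg]])

lemma DR_fg: "fin_generated R DR"
  using fdalg.dual_fg[OF opp_alg fdalg.regR[OF opp_alg] fdalg.regR_fg[OF opp_alg]] by simp

text \<open>A functional on \<open>X\<close> is the same as a homomorphism from \<open>X\<close> to the dual of the regular module.\<close>

lemma functional_hom:
  assumes X: "left_module R X" and p: "p \<in> carrier (D X)"
  shows "lin R X DR (\<lambda>x. \<lambda>a\<in>carrier R. p (a \<odot>\<^sub>X x))"
proof (rule linI)
  fix x assume x: "x \<in> carrier X"
  have "lin K (kv R (reg R)) (reg K) (\<lambda>a. p (a \<odot>\<^sub>X x))"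
    by (rule lin_comp[OF kv_lin[OF cyclic_lin[OF X x]] dual_lin[OF p]])
  hence "lin K (kv R\<^sup>o (reg R\<^sup>o)) (reg K) (\<lambda>a. p (a \<odot>\<^sub>X x))"
    by (auto simp: lin_def io_central)
  from fdalg.dualI[OF opp_alg fdalg.regR[OF opp_alg] this]
  show "(\<lambda>a\<in>carrier R. p (a \<odot>\<^sub>X x)) \<in> carrier DR" by simp
next
  fix x y assume xy: "x \<in> carrier X" "y \<in> carrier X"
  show "(\<lambda>a\<in>carrier R. p (a \<odot>\<^sub>X (x \<oplus>\<^sub>X y))) =
      (\<lambda>a\<in>carrier R. p (a \<odot>\<^sub>X x)) \<oplus>\<^sub>DR (\<lambda>a\<in>carrier R. p (a \<odot>\<^sub>X y))"
    by (simp only: dual_simps regular_simps opp_simps, rule restrict_ext) (simp add: lm_r_distr[OF X _ xy] dual_add[OF p] lm_smult[OF X _ xy(1)] lm_smult[OF X _ xy(2)])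
next
  fix b x assume bx: "b \<in> carrier R" "x \<in> carrier X"
  show "(\<lambda>a\<in>carrier R. p (a \<odot>\<^sub>X (b \<odot>\<^sub>X x))) = b \<odot>\<^sub>DR (\<lambda>a\<in>carrier R. p (a \<odot>\<^sub>X x))"
    by (simp only: dual_simps regular_simps opp_simps, rule restrict_ext) (simp add: bx multR lm_assoc[OF X _ bx])
qed

text \<open>A homomorphism to the dual of the regular module is a functional, and functionals extend from
  subspaces.\<close>

lemma thru_extend:
  fixes X :: "('a, 'm) module" and Y :: "('a, 'n) module" and J :: "('a, 'j) module"
  assumes th: "thru R DR J J h" and J: "left_module R J" and X: "left_module R X" and Y: "left_module R Y" and fgY: "fin_generated R Y"
    and f: "lin R X J f" and g: "lin R X Y g" "inj_on g (carrier X)"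
  shows "\<exists>l. lin R Y J l \<and> (\<forall>x\<in>carrier X. l (g x) = h (f x))"
  using th
proof (induction rule: thru.induct)
  case (thru_zero h)
  have "lin R Y J (\<lambda>p. \<zero>\<^sub>J)" by (rule lin_const_zero[OF J])
  then show ?case using thru_zero lin_closed[OF f] by (intro exI[of _ "\<lambda>p. \<zero>\<^sub>J"]) simp
next
  case (thru_add h' u v h)
  then obtain l where l: "lin R Y J l" "\<forall>x\<in>carrier X. l (g x) = h' (f x)" by blast
  have uf: "lin R X DR (\<lambda>x. u (f x))" by (rule lin_comp[OF f thru_add.hyps(2)])
  let ?W = "g ` carrier X"
  have W: "submodule ?W R Y" by (rule image_submod[OF X Y g(1) carrier_submod[OF X]])
  have LW: "left_module R (Y\<restriction>?W)" by (rule sub_lm[OF Y W])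
  have "lin R X (Y\<restriction>?W) g" using g(1) by (subst lin_into_sub[OF submodD(1)[OF Y W]]) auto
  moreover have "bij_betw g (carrier X) (carrier (Y\<restriction>?W))" using g(2) by (simp add: bij_betw_def)
  ultimately obtain gi where gi: "lin R (Y\<restriction>?W) X gi" "\<And>x. x \<in> carrier X ==> gi (g x) = x"
    using lin_inverse[OF X LW] by metis
  have ev1: "lin K (kv R DR) (reg K) (\<lambda>q. q \<one>\<^sub>R)"
  proof (rule linI)
    fix q assume "q \<in> carrier (kv R DR)"
    thus "q \<one>\<^sub>R \<in> carrier (reg K)"
      using fdalg.dual_closed[OF opp_alg, of q "reg R\<^sup>o" "\<one>\<^sub>R"] oneR by simp
  next
    fix a q assume a: "a \<in> carrier K" and "q \<in> carrier (kv R DR)"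
    thus "(a \<odot>\<^bsub>kv R DR\<^esub> q) \<one>\<^sub>R = a \<odot>\<^bsub>reg K\<^esub> (q \<one>\<^sub>R)"
      using fdalg.dual_scal[OF opp_alg, of q "reg R\<^sup>o" "\<one>\<^sub>R" a] oneR io[OF a] by (simp add: io_central)
  qed (simp add: oneR)
  have lam: "lin K (kv R (Y\<restriction>?W)) (reg K) (\<lambda>y. (u (f (gi y))) \<one>\<^sub>R)"
    by (rule lin_comp[OF kv_lin[OF lin_comp[OF gi(1) uf]] ev1])
  obtain q where q: "q \<in> carrier (D Y)" "\<And>y. y \<in> ?W ==> q y = restrict (\<lambda>y. (u (f (gi y))) \<one>\<^sub>R) (carrier (Y\<restriction>?W)) y"
    using extend_dual[OF Y fgY W dualI[OF LW lam]] by blast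
  let ?m = "\<lambda>y. \<lambda>a\<in>carrier R. q (a \<odot>\<^sub>Y y)"
  have ml: "lin R Y DR ?m" by (rule functional_hom[OF Y q(1)])
  have mg: "?m (g x) = u (f x)" if x: "x \<in> carrier X" for x
  proof (rule fdalg.dual_eqI[OF opp_alg, of _ "reg R\<^sup>o"])
    have gx: "g x \<in> carrier Y" using lin_closed[OF g(1) x] .
    show "?m (g x) \<in> carrier (dual_module K R\<^sup>o (reg R\<^sup>o))"
      using lin_closed[OF ml gx] by (simp del: dual_simps)
    show uc: "u (f x) \<in> carrier (dual_module K R\<^sup>o (reg R\<^sup>o))"
      using lin_closed[OF uf x] by (simp del: dual_simps)
    fix a assume "a \<in> carrier (reg R\<^sup>o)"
    hence a: "a \<in> carrier R" by simp
    have ax: "a \<odot>\<^sub>X x \<in> carrier X" by (rule lm_smult[OF X a x])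
    have "?m (g x) a = q (g (a \<odot>\<^sub>X x))" using a by (simp add: lin_smult[OF g(1) a x])
    also have "\<dots> = u (f (a \<odot>\<^sub>X x)) \<one>\<^sub>R" using q(2)[of "g (a \<odot>\<^sub>X x)"] ax gi(2)[OF ax] by simp
    also have "u (f (a \<odot>\<^sub>X x)) = a \<odot>\<^sub>DR u (f x)" by (rule lin_smult[OF uf a x])
    also have "(a \<odot>\<^sub>DR u (f x)) \<one>\<^sub>R = u (f x) a" using a oneR R by (simp add: ring.ring_simprules(12))
    finally show "?m (g x) a = u (f x) a" .
  qed
  have "lin R Y J (\<lambda>y. l y \<oplus>\<^sub>J v (?m y))" by (rule lin_plus[OF J l(1) lin_comp[OF ml thru_add.hyps(3)]])
  moreover have "\<forall>x\<in>carrier X. l (g x) \<oplus>\<^sub>J v (?m (g x)) = h (f x)"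
    using mg l(2) thru_add.hyps(4) lin_closed[OF f] by simp
  ultimately show ?case by (intro exI[of _ "\<lambda>y. l y \<oplus>\<^sub>J v (?m y)"]) simp
qed

abbreviation inje where "inje J \<equiv> summand R DR J"

text \<open>Dualise a free cover of the dual of \<open>X\<close>.\<close>

lemma inj_env_exists0:
  fixes X :: "('a, 'm) module"
  assumes X: "left_module R X" and fg: "fin_generated R X"
  obtains J w where "J \<in> fg_mod R" "inje J" "lin R X J w" "inj_on w (carrier X)"
proof -
  note DX = dual_lm[OF X] dual_fg[OF X fg]
  obtain n w where w: "lin R\<^sup>o (mod_power (reg R\<^sup>o) n) (D X) w"
    "w ` carrier (mod_power (reg R\<^sup>o) n) = carrier (D X)"
    by (rule fg_free_cover[OF DX])
  let ?F = "mod_power (reg R\<^sup>o) n"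
  note regO = fdalg.regR[OF opp_alg]
  have F: "left_module R\<^sup>o ?F" by (rule mod_power_lm[OF regO])
  have DF: "left_module R (D ?F)" by (rule dual_lm'[OF F])
  have tDF: "summand R DR (D ?F)"
    using fdalg.thru_dual_id[OF opp_alg mod_power_thru[OF regO] F regO] by simp
  have fgDF: "fin_generated R (D ?F)" by (rule fg_thru[OF tDF DF DR_lm DR_fg])
  have wl: "lin R (D (D X)) (D ?F) (fdalg.dmap ?F w)"
    using fdalg.dmap_lin[OF opp_alg w(1) F] by simp
  have DDX: "left_module R (D (D X))" by (rule dual_lm'[OF DX(1)])
  have wi: "inj_on (fdalg.dmap ?F w) (carrier (D (D X)))"
  proof (rule inj_onI)
    fix P Q assume PQ: "P \<in> carrier (D (D X))" "Q \<in> carrier (D (D X))" "fdalg.dmap ?F w P = fdalg.dmap ?F w Q"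
    show "P = Q"
    proof (rule fdalg.dual_eqI[OF opp_alg, of _ "D X"])
      fix x assume "x \<in> carrier (D X)"
      then obtain y where y: "y \<in> carrier ?F" "x = w y" using w(2) by blast
      have "fdalg.dmap ?F w P y = fdalg.dmap ?F w Q y" using PQ(3) by simp
      thus "P x = Q x" using y unfolding fdalg.dmap_def[OF opp_alg] by simp
    qed (use PQ in \<open>simp_all del: dual_simps\<close>)
  qed
  obtain J f g where J: "J \<in> fg_mod R" "lin R (D ?F) J f" "lin R J (D ?F) g"
    "\<And>x. x \<in> carrier (D ?F) ==> g (f x) = x" "\<And>y. y \<in> carrier J ==> f (g y) = y"
    by (rule rep[OF DF fgDF]) (rule that; assumption)
  have "inje J" by (rule thru_transfer[OF tDF J(3,2,5) DF fg_modD(1)[OF J(1)]])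
  moreover have "lin R X J (\<lambda>x. f (fdalg.dmap ?F w (evm X x)))"
    by (rule lin_comp[OF lin_comp[OF evm_lin[OF X] wl] J(2)])
  moreover have "inj_on (\<lambda>x. f (fdalg.dmap ?F w (evm X x))) (carrier X)"
  proof (rule inj_onI)
    fix x y assume xy: "x \<in> carrier X" "y \<in> carrier X" "f (fdalg.dmap ?F w (evm X x)) = f (fdalg.dmap ?F w (evm X y))"
    note ex = lin_closed[OF evm_lin[OF X] xy(1)] and ey = lin_closed[OF evm_lin[OF X] xy(2)]
    have "fdalg.dmap ?F w (evm X x) = fdalg.dmap ?F w (evm X y)"
      using arg_cong[OF xy(3), of g] J(4)[OF lin_closed[OF wl ex]] J(4)[OF lin_closed[OF wl ey]] by simp
    hence "evm X x = evm X y" by (rule inj_onD[OF wi _ ex ey])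
    thus "x = y" by (rule inj_onD[OF bij_betw_imp_inj_on[OF evm_bij[OF X fg]] _ xy(1,2)])
  qed
  ultimately show thesis using that J(1) by blast
qed

lemma injective_iff: "injective R J \<longleftrightarrow> J \<in> fg_mod R \<and> inje J"
proof
  assume i: "injective R J"
  hence J: "J \<in> fg_mod R" by (simp add: injective_def)
  note L = fg_modD[OF J]
  obtain F w where F: "F \<in> fg_mod R" "inje F" "lin R J F w" "inj_on w (carrier J)"
    by (rule inj_env_exists0[OF L]) (rule that; assumption)
  note LF = fg_modD[OF F(1)]
  have "restrict w (carrier J) \<in> mod_hom R J F" by (rule restrict_mod_hom[OF L(1) F(3)])
  moreover have "restrict (\<lambda>x. x) (carrier J) \<in> mod_hom R J J" by (rule restrict_mod_hom[OF L(1) lin_id])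
  moreover have "inj_on (restrict w (carrier J)) (carrier J)" using F(4) by (simp add: inj_on_restrict_eq)
  ultimately obtain h where h: "h \<in> mod_hom R F J" "\<forall>x\<in>carrier J. h (restrict w (carrier J) x) = restrict (\<lambda>x. x) (carrier J) x"
    using i F(1) J unfolding injective_def by blast
  have hl: "lin R F J h" using h(1) by (rule mod_hom_lin)
  have "inje J" by (rule thru_transfer[OF F(2,3) hl _ LF(1) L(1)]) (use h(2) in auto)
  with J show "J \<in> fg_mod R \<and> inje J" by simp
next
  assume p: "J \<in> fg_mod R \<and> inje J"
  hence L: "left_module R J" using fg_modD by blast
  show "injective R J"
    unfolding injective_def
  proof (intro conjI ballI impI)
    fix X Y g f assume XY: "X \<in> fg_mod R" "Y \<in> fg_mod R" "g \<in> mod_hom R X Y" "f \<in> mod_hom R X J" "inj_on g (carrier X)"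
    obtain l where l: "lin R Y J l" "\<forall>x\<in>carrier X. l (g x) = f x"
      using thru_extend[OF _ L fg_modD(1)[OF XY(1)] fg_modD[OF XY(2)] mod_hom_lin[OF XY(4)] mod_hom_lin[OF XY(3)] XY(5)] p by blast
    show "\<exists>h\<in>mod_hom R Y J. \<forall>x\<in>carrier X. h (g x) = f x"
      by (rule bexI[OF _ restrict_mod_hom[OF fg_modD(1)[OF XY(2)] l(1)]]) (use l(2) lin_closed[OF mod_hom_lin[OF XY(3)]] in simp)
  qed (use p in simp)
qed

end


section \<open>Quotient modules and vanishing of extensions\<close>

lemma coset_mem: "y \<in> N +>\<^sub>X x \<longleftrightarrow> (\<exists>n\<in>N. y = n \<oplus>\<^sub>X x)"
  by (auto simp: a_r_coset_def')

definition addsub where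
  "addsub N X \<longleftrightarrow> abelian_group X \<and> N \<subseteq> carrier X \<and> \<zero>\<^sub>X \<in> N \<and> (\<forall>x\<in>N. \<forall>y\<in>N. x \<oplus>\<^sub>X y \<in> N) \<and> (\<forall>x\<in>N. \<ominus>\<^sub>X x \<in> N)"

lemma submod_addsub: "left_module R X ==> submodule N R X ==> addsub N X"
  unfolding addsub_def by (intro conjI ballI lm_ag submodD)

lemma coset_eq:
  assumes N: "addsub N X" and x: "x \<in> carrier X" "y \<in> carrier X"
  shows "N +>\<^sub>X x = N +>\<^sub>X y \<longleftrightarrow> x \<ominus>\<^sub>X y \<in> N"
proof
  have G: "abelian_group X" and NX: "N \<subseteq> carrier X" and z: "\<zero>\<^sub>X \<in> N" using N by (auto simp: addsub_def)
  assume e: "N +>\<^sub>X x = N +>\<^sub>X y"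
  have "x \<in> N +>\<^sub>X x" unfolding coset_mem using z ag_lzero[OF G x(1)] by force
  then obtain n where n: "n \<in> N" "x = n \<oplus>\<^sub>X y" unfolding e coset_mem by blast
  have "x \<ominus>\<^sub>X y = n" using n NX x ag_add_diff[OF G x(2), of n] ag_comm[OF G x(2), of n] by auto
  with n show "x \<ominus>\<^sub>X y \<in> N" by simp
next
  have G: "abelian_group X" and NX: "N \<subseteq> carrier X" and ad: "\<And>x y. x \<in> N ==> y \<in> N ==> x \<oplus>\<^sub>X y \<in> N"
    and ne: "\<And>x. x \<in> N ==> \<ominus>\<^sub>X x \<in> N" using N by (auto simp: addsub_def)
  have *: "N +>\<^sub>X x \<subseteq> N +>\<^sub>X y" if "x \<in> carrier X" "y \<in> carrier X" "x \<ominus>\<^sub>X y \<in> N" for x y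
  proof
    fix z assume "z \<in> N +>\<^sub>X x"
    then obtain n where n: "n \<in> N" "z = n \<oplus>\<^sub>X x" unfolding coset_mem by blast
    have "z = n \<oplus>\<^sub>X ((x \<ominus>\<^sub>X y) \<oplus>\<^sub>X y)" using n that by (simp add: ag_diff_add[OF G])
    hence "z = (n \<oplus>\<^sub>X (x \<ominus>\<^sub>X y)) \<oplus>\<^sub>X y" using n NX that ag_diff[OF G] by (simp add: ag_assoc[OF G] subset_iff)
    thus "z \<in> N +>\<^sub>X y" unfolding coset_mem using ad n that by blast
  qed
  assume d: "x \<ominus>\<^sub>X y \<in> N"
  have "y \<ominus>\<^sub>X x = \<ominus>\<^sub>X (x \<ominus>\<^sub>X y)"
    using x by (simp add: a_minus_def ag_neg_add[OF G] ag_simps[OF G] ag_comm[OF G])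
  hence "y \<ominus>\<^sub>X x \<in> N" using ne d by simp
  with d * x show "N +>\<^sub>X x = N +>\<^sub>X y" by blast
qed

lemma coset_zero:
  assumes N: "addsub N X" shows "N +>\<^sub>X \<zero>\<^sub>X = N"
proof -
  have G: "abelian_group X" and NX: "N \<subseteq> carrier X" using N by (auto simp: addsub_def)
  show ?thesis using NX ag_rzero[OF G] by (auto simp: coset_mem subset_iff) 
qed

lemma coset_eq_zero:
  assumes N: "addsub N X" and x: "x \<in> carrier X"
  shows "N +>\<^sub>X x = N \<longleftrightarrow> x \<in> N"
proof -
  have G: "abelian_group X" using N by (simp add: addsub_def)
  have "x \<ominus>\<^sub>X \<zero>\<^sub>X = x" using x by (simp add: a_minus_def ag_neg_zero[OF G] ag_rzero[OF G])
  thus ?thesis using coset_eq[OF N x ag_zero[OF G]] coset_zero[OF N] by simp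
qed

lemma coset_self: "addsub N X ==> x \<in> carrier X ==> x \<in> N +>\<^sub>X x"
  unfolding coset_mem addsub_def by (intro bexI[of _ "\<zero>\<^sub>X"]) (auto simp: ag_lzero)

lemma coset_carrier: "a_rcosets\<^bsub>X\<^esub> N = (\<lambda>x. N +>\<^sub>X x) ` carrier X"
  by (auto simp: A_RCOSETS_def')

lemma coset_sub: "addsub N X ==> x \<in> carrier X ==> y \<in> N +>\<^sub>X x ==> y \<in> carrier X \<and> y \<ominus>\<^sub>X x \<in> N"
  unfolding coset_mem addsub_def
  by (auto simp: ag_closed subset_iff) (metis ag_add_diff ag_comm)

text \<open>The operations of a quotient are unions over all representatives of a coset. Such a union is the coset
  of the image of any one of them.\<close>

lemma coset_lift:
  assumes N: "addsub N X" and x: "x \<in> carrier X" and M: "addsub N' Y"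
    and r: "\<And>y. y \<in> carrier X ==> y \<ominus>\<^sub>X x \<in> N ==> r y \<in> carrier Y \<and> r y \<ominus>\<^sub>Y r x \<in> N'"
  shows "(\<Union>y\<in>N +>\<^sub>X x. N' +>\<^sub>Y r y) = N' +>\<^sub>Y r x"
proof -
  have G: "abelian_group X" using N by (simp add: addsub_def)
  have "x \<ominus>\<^sub>X x \<in> N" using N x ag_diff_zero[OF G x x] by (simp add: addsub_def)
  hence rx: "r x \<in> carrier Y" using r[OF x] by simp
  have "N' +>\<^sub>Y r y = N' +>\<^sub>Y r x" if "y \<in> N +>\<^sub>X x" for y
    using coset_eq[OF M _ rx, of "r y"] r[of y] coset_sub[OF N x that] by simp
  thus ?thesis using coset_self[OF N x] by blast
qed

lemma coset_add:
  assumes N: "addsub N X" and x: "x \<in> carrier X" "y \<in> carrier X"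
  shows "(N +>\<^sub>X x) <+>\<^sub>X (N +>\<^sub>X y) = N +>\<^sub>X (x \<oplus>\<^sub>X y)"
proof -
  have G: "abelian_group X" and NX: "N \<subseteq> carrier X" and z: "\<zero>\<^sub>X \<in> N" and ad: "\<And>x y. x \<in> N ==> y \<in> N ==> x \<oplus>\<^sub>X y \<in> N"
    using N by (auto simp: addsub_def)
  show ?thesis
  proof (intro equalityI subsetI)
    fix w assume "w \<in> (N +>\<^sub>X x) <+>\<^sub>X (N +>\<^sub>X y)"
    then obtain n m where nm: "n \<in> N" "m \<in> N" "w = (n \<oplus>\<^sub>X x) \<oplus>\<^sub>X (m \<oplus>\<^sub>X y)"
      unfolding set_add_def' by (auto simp: coset_mem)
    have "w = (n \<oplus>\<^sub>X m) \<oplus>\<^sub>X (x \<oplus>\<^sub>X y)" using nm NX x by (simp add: subset_iff ag_closed[OF G] ag_ac[OF G])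
    thus "w \<in> N +>\<^sub>X (x \<oplus>\<^sub>X y)" unfolding coset_mem using ad nm by blast
  next
    fix w assume "w \<in> N +>\<^sub>X (x \<oplus>\<^sub>X y)"
    then obtain n where n: "n \<in> N" "w = n \<oplus>\<^sub>X (x \<oplus>\<^sub>X y)" unfolding coset_mem by blast
    have "w = (n \<oplus>\<^sub>X x) \<oplus>\<^sub>X y" using n NX x by (simp add: subset_iff ag_assoc[OF G])
    moreover have "n \<oplus>\<^sub>X x \<in> N +>\<^sub>X x" unfolding coset_mem using n by blast
    ultimately show "w \<in> (N +>\<^sub>X x) <+>\<^sub>X (N +>\<^sub>X y)" unfolding set_add_def' using coset_self[OF N x(2)] by blast
  qed
qed

lemma quot_simps [simp]:
  "carrier (quot_module X N) = (\<lambda>x. N +>\<^sub>X x) ` carrier X" "\<zero>\<^bsub>quot_module X N\<^esub> = N"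
  "C \<oplus>\<^bsub>quot_module X N\<^esub> C' = C <+>\<^sub>X C'" "a \<odot>\<^bsub>quot_module X N\<^esub> C = (\<Union>x\<in>C. N +>\<^sub>X (a \<odot>\<^sub>X x))"
  by (simp_all add: quot_module_def coset_carrier)

lemma quot_ops:
  assumes X: "left_module R X" and N: "submodule N R X"
  shows "x \<in> carrier X ==> y \<in> carrier X ==> (N +>\<^sub>X x) <+>\<^sub>X (N +>\<^sub>X y) = N +>\<^sub>X (x \<oplus>\<^sub>X y)"
    and "a \<in> carrier R ==> x \<in> carrier X ==> (\<Union>y\<in>N +>\<^sub>X x. N +>\<^sub>X (a \<odot>\<^sub>X y)) = N +>\<^sub>X (a \<odot>\<^sub>X x)"
proof -
  note S = submod_addsub[OF X N] and G = lm_ag[OF X] and D = submodD[OF X N]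
  show "x \<in> carrier X ==> y \<in> carrier X ==> (N +>\<^sub>X x) <+>\<^sub>X (N +>\<^sub>X y) = N +>\<^sub>X (x \<oplus>\<^sub>X y)"
    by (rule coset_add[OF S])
  assume a: "a \<in> carrier R" and x: "x \<in> carrier X"
  show "(\<Union>y\<in>N +>\<^sub>X x. N +>\<^sub>X (a \<odot>\<^sub>X y)) = N +>\<^sub>X (a \<odot>\<^sub>X x)"
  proof (rule coset_lift[OF S x S])
    fix y assume y: "y \<in> carrier X" "y \<ominus>\<^sub>X x \<in> N"
    have "a \<odot>\<^sub>X y \<ominus>\<^sub>X a \<odot>\<^sub>X x = a \<odot>\<^sub>X (y \<ominus>\<^sub>X x)"
      using a x y by (simp add: a_minus_def lm_r_distr[OF X] lm_smult_neg[OF X] ag_neg[OF G])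
    thus "a \<odot>\<^sub>X y \<in> carrier X \<and> a \<odot>\<^sub>X y \<ominus>\<^sub>X a \<odot>\<^sub>X x \<in> N" using D(4)[OF a y(2)] lm_smult[OF X a y(1)] by simp
  qed
qed

lemma quot_lm:
  assumes X: "left_module R X" and N: "submodule N R X"
  shows "left_module R (quot_module X N)"
proof (rule lm_intro[OF lm_ring[OF X]])
  note G = lm_ag[OF X] and q = quot_ops[OF X N] and S = submod_addsub[OF X N]
  show "abelian_group (quot_module X N)"
  proof (rule ag_intro)
    show "\<zero>\<^bsub>quot_module X N\<^esub> \<in> carrier (quot_module X N)" using coset_zero[OF S] ag_zero[OF G] by force
    fix C assume "C \<in> carrier (quot_module X N)"
    then obtain x where x: "x \<in> carrier X" "C = N +>\<^sub>X x" by auto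
    show "\<exists>D\<in>carrier (quot_module X N). D \<oplus>\<^bsub>quot_module X N\<^esub> C = \<zero>\<^bsub>quot_module X N\<^esub>"
      by (rule bexI[of _ "N +>\<^sub>X (\<ominus>\<^sub>X x)"]) (use x in \<open>auto simp: q ag_simps[OF G] coset_zero[OF S]\<close>)
    show "\<zero>\<^bsub>quot_module X N\<^esub> \<oplus>\<^bsub>quot_module X N\<^esub> C = C"
      using q(1)[OF ag_zero[OF G] x(1)] x by (simp add: coset_zero[OF S] ag_lzero[OF G])
    fix D assume "D \<in> carrier (quot_module X N)"
    then obtain y where y: "y \<in> carrier X" "D = N +>\<^sub>X y" by auto
    show "C \<oplus>\<^bsub>quot_module X N\<^esub> D = D \<oplus>\<^bsub>quot_module X N\<^esub> C" using x y by (simp add: q(1) ag_comm[OF G])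
  qed (auto simp: q ag_simps[OF G] ag_assoc[OF G])
next
  fix a b C assume ab: "a \<in> carrier R" "b \<in> carrier R" and "C \<in> carrier (quot_module X N)"
  then obtain x where x: "x \<in> carrier X" "C = N +>\<^sub>X x" by auto
  show "(a \<otimes>\<^sub>R b) \<odot>\<^bsub>quot_module X N\<^esub> C = a \<odot>\<^bsub>quot_module X N\<^esub> (b \<odot>\<^bsub>quot_module X N\<^esub> C)"
    unfolding x(2) quot_simps quot_ops(2)[OF X N ab(2) x(1)] quot_ops(2)[OF X N ab(1) lm_smult[OF X ab(2) x(1)]]
      quot_ops(2)[OF X N ring.ring_simprules(5)[OF lm_ring[OF X] ab] x(1)] lm_assoc[OF X ab x(1)] by (rule refl)
next
  fix C assume "C \<in> carrier (quot_module X N)"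
  then obtain x where x: "x \<in> carrier X" "C = N +>\<^sub>X x" by auto
  show "\<one>\<^sub>R \<odot>\<^bsub>quot_module X N\<^esub> C = C"
    unfolding x(2) quot_simps quot_ops(2)[OF X N ring.ring_simprules(6)[OF lm_ring[OF X]] x(1)] lm_one[OF X x(1)] by (rule refl)
qed (clarsimp simp: quot_ops[OF X N] ag_closed[OF ring.is_abelian_group[OF lm_ring[OF X]]] lm_smult[OF X] lm_l_distr[OF X] lm_r_distr[OF X] lm_closed[OF X])+

lemma quot_proj:
  assumes X: "left_module R X" and N: "submodule N R X"
  shows "lin R X (quot_module X N) (\<lambda>x. N +>\<^sub>X x)"
    and "\<And>x. x \<in> carrier X ==> N +>\<^sub>X x = \<zero>\<^bsub>quot_module X N\<^esub> \<longleftrightarrow> x \<in> N"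
  by (rule linI) (auto simp: quot_ops[OF X N] coset_eq_zero[OF submod_addsub[OF X N]])

text \<open>For projective \<open>P\<close> this is the vanishing of \<open>Ext\<^sup>1(P/L, N)\<close>.\<close>

definition extends where
  "extends R L P N \<longleftrightarrow> (\<forall>f. lin R (P\<restriction>L) N f \<longrightarrow> (\<exists>F. lin R P N F \<and> (\<forall>x\<in>L. F x = f x)))"

lemma coboundaries_conv:
  "ext_coboundaries R P d 1 N = (\<lambda>f. compose (carrier (P 1)) f (d 1)) ` mod_hom R (P 0) N"
  by (simp add: ext_coboundaries_def)

lemma ext1_iff_coboundaries:
  fixes M N :: "('a, nat \<Rightarrow> 'k) module"
  assumes N: "left_module R N" and Pd: "projective_resolution R M P d" "(SOME (P, d). projective_resolution R M P d) = (P, d)"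
    and P: "\<And>n. left_module R (P n)"
  shows "trivial_group (Ext R 1 M N) \<longleftrightarrow> ext_cocycles R P d 1 N \<subseteq> ext_coboundaries R P d 1 N"
proof -
  define Z where "Z = ext_cocycles R P d 1 N"
  define B where "B = ext_coboundaries R P d 1 N"
  define G where "G = (hom_group R (P 1) N)\<restriction>Z"
  have E: "Ext R 1 M N = G Mod B" by (simp add: Ext_def Pd(2) G_def Z_def B_def)
  note NG = lm_ag[OF N]
  have d: "lin R (P (Suc n)) (P n) (d (Suc n))" for n using Pd(1) by (simp add: projective_resolution_def mod_hom_iff)
  have dd: "d 1 (d 2 x) = \<zero>\<^bsub>P 0\<^esub>" if "x \<in> carrier (P 2)" for x
  proof -
    have "d (Suc (Suc 0)) ` carrier (P (Suc (Suc 0))) = mod_ker (P (Suc 0)) (P 0) (d (Suc 0))"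
      using Pd(1) unfolding projective_resolution_def by blast
    thus ?thesis using that by (auto simp: mod_ker_def numeral_2_eq_2)
  qed
  have Gs: "carrier G = Z" "\<one>\<^sub>G = (\<lambda>x\<in>carrier (P 1). \<zero>\<^sub>N)" "\<And>f g. f \<otimes>\<^sub>G g = (\<lambda>x\<in>carrier (P 1). f x \<oplus>\<^sub>N g x)"
    by (simp_all add: G_def hom_group_def)
  have Zlin: "f \<in> Z \<longleftrightarrow> f \<in> extensional (carrier (P 1)) \<and> lin R (P 1) N f \<and> (\<forall>x\<in>carrier (P 2). f (d 2 x) = \<zero>\<^sub>N)" for f
    by (auto simp: Z_def ext_cocycles_def mod_hom_iff numeral_2_eq_2)
  have d2: "d 2 x \<in> carrier (P 1)" if "x \<in> carrier (P 2)" for x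
    using lin_closed[OF d[of 1]] that by (simp add: numeral_2_eq_2)
  have restr: "(\<lambda>x\<in>carrier (P 1). f x) \<in> Z" if "lin R (P 1) N f" "\<And>x. x \<in> carrier (P 2) ==> f (d 2 x) = \<zero>\<^sub>N" for f
    unfolding Zlin using that d2 by (simp add: lin_restrict[OF P])
  have Zc: "f x \<in> carrier N" if "f \<in> Z" "x \<in> carrier (P 1)" for f x
    using that lin_closed[of R "P 1" N f x] unfolding Zlin by blast
  have Zm: "f \<otimes>\<^sub>G g \<in> Z" if "f \<in> Z" "g \<in> Z" for f g
    unfolding Gs using that by (intro restr lin_plus[OF N]) (auto simp: Zlin ag_simps[OF NG])
  have Z1: "\<one>\<^sub>G \<in> Z" unfolding Gs by (intro restr lin_const_zero[OF N]) simp
  have G: "comm_group G"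
  proof (rule comm_groupI)
    fix f assume f: "f \<in> carrier G"
    have "(\<lambda>x\<in>carrier (P 1). \<ominus>\<^sub>N (f x)) \<in> Z"
      using f by (intro restr lin_uminus[OF N]) (auto simp: Zlin Gs(1) ag_neg_zero[OF NG])
    moreover have "(\<lambda>x\<in>carrier (P 1). \<ominus>\<^sub>N (f x)) \<otimes>\<^sub>G f = \<one>\<^sub>G"
      unfolding Gs by (intro restrict_ext) (use Zc f in \<open>simp add: Gs(1) ag_lneg[OF NG]\<close>)
    ultimately show "\<exists>g\<in>carrier G. g \<otimes>\<^sub>G f = \<one>\<^sub>G" unfolding Gs(1) by blast
    show "\<one>\<^sub>G \<otimes>\<^sub>G f = f"
      using f Zc by (intro extensionalityI[of _ "carrier (P 1)"]) (auto simp: Gs Zlin ag_lzero[OF NG])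
    fix g assume g: "g \<in> carrier G"
    show "f \<otimes>\<^sub>G g = g \<otimes>\<^sub>G f" unfolding Gs by (intro restrict_ext ag_comm[OF NG]) (use Zc f g in \<open>auto simp: Gs(1)\<close>)
    show "f \<otimes>\<^sub>G g \<in> carrier G" using Zm f g by (simp add: Gs(1))
    fix h assume h: "h \<in> carrier G"
    show "f \<otimes>\<^sub>G g \<otimes>\<^sub>G h = f \<otimes>\<^sub>G (g \<otimes>\<^sub>G h)"
      unfolding Gs by (intro restrict_ext) (use Zc f g h in \<open>simp add: Gs(1) ag_assoc[OF NG]\<close>)
  qed (use Z1 Gs(1) in simp)
  interpret G: comm_group G by (rule G)
  have Bel: "b \<in> B \<longleftrightarrow> (\<exists>F. lin R (P 0) N F \<and> b = (\<lambda>x\<in>carrier (P 1). F (d 1 x)))" for b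
  proof
    assume "b \<in> B"
    then obtain F where "F \<in> mod_hom R (P 0) N" "b = compose (carrier (P 1)) F (d 1)" unfolding B_def coboundaries_conv by blast
    thus "\<exists>F. lin R (P 0) N F \<and> b = (\<lambda>x\<in>carrier (P 1). F (d 1 x))" by (auto simp: mod_hom_iff compose_def)
  next
    assume "\<exists>F. lin R (P 0) N F \<and> b = (\<lambda>x\<in>carrier (P 1). F (d 1 x))"
    then obtain F where F: "lin R (P 0) N F" "b = (\<lambda>x\<in>carrier (P 1). F (d 1 x))" by blast
    have "b = compose (carrier (P 1)) (restrict F (carrier (P 0))) (d 1)"
      unfolding F(2) compose_def using lin_closed[OF d[of 0]] by (intro restrict_ext) simp
    thus "b \<in> B" unfolding B_def coboundaries_conv using restrict_mod_hom[OF P F(1)] by blast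
  qed
  have BZ: "B \<subseteq> Z"
  proof
    fix b assume "b \<in> B"
    then obtain F where F: "lin R (P 0) N F" "b = (\<lambda>x\<in>carrier (P 1). F (d 1 x))" unfolding Bel by blast
    show "b \<in> Z" unfolding F(2)
      using lin_comp[OF d[of 0] F(1)] dd lin_zero[OF F(1) lm_ag[OF P] NG] by (intro restr) auto
  qed
  have B1: "\<one>\<^sub>G \<in> B" unfolding Bel Gs using lin_const_zero[OF N] by blast
  show ?thesis
    unfolding Z_def[symmetric] B_def[symmetric]
  proof
    assume "trivial_group (Ext R 1 M N)"
    hence t: "carrier (G Mod B) = {\<one>\<^bsub>G Mod B\<^esub>}" unfolding E trivial_group_def by simp
    show "Z \<subseteq> B"
    proof
      fix f assume f: "f \<in> Z"
      have "B #>\<^bsub>G\<^esub> f \<in> carrier (G Mod B)" using f by (auto simp: carrier_FactGroup Gs(1))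
      hence "B #>\<^bsub>G\<^esub> f = B" using t by (simp add: FactGroup_def)
      moreover have "f \<in> B #>\<^bsub>G\<^esub> f" unfolding r_coset_def using B1 G.l_one[of f] f Gs(1) by force
      ultimately show "f \<in> B" by simp
    qed
  next
    assume "Z \<subseteq> B"
    hence BG: "B = carrier G" using BZ Gs(1) by blast
    have "carrier G \<lhd> G" using G.subgroup_self G.subgroup_imp_normal by blast
    hence "group (G Mod B)" unfolding BG by (rule normal.factorgroup_is_group)
    moreover have "carrier (G Mod B) = {\<one>\<^bsub>G Mod B\<^esub>}"
      unfolding BG carrier_FactGroup using G.coset_join2[OF _ G.subgroup_self] G.one_closed
      by (auto simp: FactGroup_def image_iff)
    ultimately show "trivial_group (Ext R 1 M N)" unfolding E trivial_group_def by simp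
  qed
qed

context fdalg begin

lemma resolution_exists:
  assumes M: "M \<in> fg_mod R"
  shows "\<exists>P d. projective_resolution R M P d"
proof -
  define c where "c X = (SOME Pg. fst Pg \<in> fg_mod R \<and> proj R (fst Pg) \<and> lin R (fst Pg) X (snd Pg) \<and> snd Pg ` carrier (fst Pg) = carrier X)"
    for X :: "('a, nat \<Rightarrow> 'k) module"
  have c: "fst (c X) \<in> fg_mod R \<and> proj R (fst (c X)) \<and> lin R (fst (c X)) X (snd (c X)) \<and> snd (c X) ` carrier (fst (c X)) = carrier X"
    if X: "X \<in> fg_mod R" for X :: "('a, nat \<Rightarrow> 'k) module"
  proof -
    obtain P g where "P \<in> fg_mod R" "proj R P" "lin R P X g" "g ` carrier P = carrier X"
      by (rule proj_cover_exists0[OF fg_modD[OF X]]) (rule that; assumption)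
    hence "\<exists>Pg. fst Pg \<in> fg_mod R \<and> proj R (fst Pg) \<and> lin R (fst Pg) X (snd Pg) \<and> snd Pg ` carrier (fst Pg) = carrier X"
      by (intro exI[of _ "(P, g)"]) simp
    thus ?thesis unfolding c_def by (rule someI_ex)
  qed
  define X where "X = rec_nat M (\<lambda>_ X. (fst (c X))\<restriction>(mod_ker (fst (c X)) X (snd (c X))))"
  define P where "P n = fst (c (X n))" for n
  define g where "g n = snd (c (X n))" for n
  have X0: "X 0 = M" and XS: "X (Suc n) = (P n)\<restriction>(mod_ker (P n) (X n) (g n))" for n
    by (simp_all add: X_def P_def g_def)
  have Xf: "X n \<in> fg_mod R" for n
  proof (induction n)
    case (Suc n)
    note cn = c[OF Suc] and L = fg_modD[OF conjunct1[OF c[OF Suc]]]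
    have "submodule (mod_ker (P n) (X n) (g n)) R (P n)"
      using ker_submod[OF L(1) fg_modD(1)[OF Suc]] cn by (simp add: P_def g_def)
    then show ?case unfolding XS using fg_sub[OF L] sub_lm[OF L(1)] by (simp add: fg_mod_def P_def)
  qed (simp add: X0 M)
  have P: "P n \<in> fg_mod R" "proj R (P n)" and g: "lin R (P n) (X n) (g n)" "g n ` carrier (P n) = carrier (X n)" for n
    using c[OF Xf, of n] by (simp_all add: P_def g_def)
  note LP = fg_modD(1)[OF P(1)]
  define d where "d n = restrict (g n) (carrier (P n))" for n
  have kx: "mod_ker (P n) (X n) (g n) \<subseteq> carrier (P n)" for n by (auto simp: mod_ker_def)
  have "projective_resolution R M P d"
    unfolding projective_resolution_def
  proof (intro conjI allI)
    fix n
    show "projective R (P n)" using P by (simp add: projective_iff)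
    have "lin R (P (Suc n)) (P n) (g (Suc n))" using g(1)[of "Suc n"] unfolding XS by (subst (asm) lin_into_sub[OF kx]) simp
    thus "d (Suc n) \<in> mod_hom R (P (Suc n)) (P n)" unfolding d_def by (rule restrict_mod_hom[OF LP])
    have "d (Suc (Suc n)) ` carrier (P (Suc (Suc n))) = carrier (X (Suc (Suc n)))" using g(2) by (simp add: d_def)
    also have "\<dots> = mod_ker (P (Suc n)) (P n) (d (Suc n))" unfolding XS(1)[of "Suc n"] by (auto simp: mod_ker_def XS d_def)
    finally show "d (Suc (Suc n)) ` carrier (P (Suc (Suc n))) = mod_ker (P (Suc n)) (P n) (d (Suc n))" .
  next
    show "d 0 \<in> mod_hom R (P 0) M" using restrict_mod_hom[OF LP g(1)] by (simp add: d_def X0[symmetric])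
    show "d 0 ` carrier (P 0) = carrier M" using g(2)[of 0] by (simp add: d_def X0)
    have "d 1 ` carrier (P 1) = carrier (X 1)" using g(2)[of 1] by (simp add: d_def)
    also have "\<dots> = mod_ker (P 0) M (d 0)" using XS[of 0] by (auto simp: mod_ker_def d_def X0)
    finally show "d 1 ` carrier (P 1) = mod_ker (P 0) M (d 0)" .
  qed
  thus ?thesis by blast
qed

text \<open>A cocycle vanishes on the image of \<open>P\<^sub>2\<close>, so it is a homomorphism on the kernel of \<open>P\<^sub>0 \<rightarrow> M\<close>, and it
  is a coboundary iff this homomorphism extends to \<open>P\<^sub>0\<close>.\<close>

lemma ext1_iff_extends:
  assumes M: "M \<in> fg_mod R" and N: "N \<in> fg_mod R"
  obtains P g where "P \<in> fg_mod R" "proj R P" "lin R P M g" "g ` carrier P = carrier M"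
    "trivial_group (Ext R 1 M N) \<longleftrightarrow> extends R (mod_ker P M g) P N"
proof -
  obtain P d where s: "(SOME (P, d). projective_resolution R M P d) = (P, d)" by (metis surj_pair)
  have "\<exists>Pd. (case Pd of (P, d) \<Rightarrow> projective_resolution R M P d)" using resolution_exists[OF M] by simp
  from someI_ex[OF this] have Pd: "projective_resolution R M P d" by (simp add: s)
  have P: "P n \<in> fg_mod R" "proj R (P n)" for n
    using Pd by (simp_all add: projective_resolution_def projective_iff)
  note LP = fg_modD(1)[OF P(1)] and LN = fg_modD(1)[OF N] and LM = fg_modD(1)[OF M]
  have d0: "lin R (P 0) M (d 0)" "d 0 ` carrier (P 0) = carrier M"
    and d1: "lin R (P 1) (P 0) (d 1)" "d 1 ` carrier (P 1) = mod_ker (P 0) M (d 0)"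
    and d2: "d 2 ` carrier (P 2) = mod_ker (P 1) (P 0) (d 1)"
    using Pd by (simp_all add: projective_resolution_def mod_hom_iff numeral_2_eq_2)
  let ?L = "mod_ker (P 0) M (d 0)"
  have L: "submodule ?L R (P 0)" by (rule ker_submod[OF LP LM d0(1)])
  note LL = sub_lm[OF LP L]
  have d1L: "lin R (P 1) ((P 0)\<restriction>?L) (d 1)"
    using d1 submodD(1)[OF LP L] by (subst lin_into_sub) auto
  have "(ext_cocycles R P d 1 N \<subseteq> ext_coboundaries R P d 1 N) \<longleftrightarrow> extends R ?L (P 0) N"
  proof
    assume a: "ext_cocycles R P d 1 N \<subseteq> ext_coboundaries R P d 1 N"
    show "extends R ?L (P 0) N"
      unfolding extends_def
    proof (intro allI impI)
      fix f assume f: "lin R ((P 0)\<restriction>?L) N f"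
      let ?z = "restrict (\<lambda>x. f (d 1 x)) (carrier (P 1))"
      have "?z \<in> mod_hom R (P 1) N" by (rule restrict_mod_hom[OF LP lin_comp[OF d1L f]])
      moreover have "?z (d 2 x) = \<zero>\<^sub>N" if "x \<in> carrier (P 2)" for x
      proof -
        have "d 2 x \<in> mod_ker (P 1) (P 0) (d 1)" using that by (simp only: d2[symmetric] image_eqI)
        thus ?thesis using lm_lin_zero[OF f LL LN] by (simp add: mod_ker_def)
      qed
      ultimately have "?z \<in> ext_cocycles R P d 1 N" by (simp add: ext_cocycles_def numeral_2_eq_2)
      with a have "?z \<in> ext_coboundaries R P d 1 N" by blast
      then obtain F where F: "F \<in> mod_hom R (P 0) N" "?z = compose (carrier (P 1)) F (d 1)" unfolding coboundaries_conv by blast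
      have "F x = f x" if "x \<in> ?L" for x
      proof -
        have "x \<in> d 1 ` carrier (P 1)" using that by (simp only: d1(2))
        then obtain p where p: "p \<in> carrier (P 1)" "x = d 1 p" by blast
        from fun_cong[OF F(2), of p] show ?thesis using p by (simp add: compose_def)
      qed
      with F(1) show "\<exists>F. lin R (P 0) N F \<and> (\<forall>x\<in>?L. F x = f x)" by (auto simp: mod_hom_iff)
    qed
  next
    assume e: "extends R ?L (P 0) N"
    show "ext_cocycles R P d 1 N \<subseteq> ext_coboundaries R P d 1 N"
    proof
      fix z assume z: "z \<in> ext_cocycles R P d 1 N"
      hence zl: "lin R (P 1) N z" and zx: "z \<in> extensional (carrier (P 1))" and zd: "\<And>x. x \<in> carrier (P 2) ==> z (d 2 x) = \<zero>\<^sub>N"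
        by (simp_all add: ext_cocycles_def mod_hom_iff numeral_2_eq_2)
      have "z x = \<zero>\<^sub>N" if "x \<in> carrier (P 1)" "d 1 x = \<zero>\<^bsub>(P 0)\<restriction>?L\<^esub>" for x
      proof -
        have "x \<in> d 2 ` carrier (P 2)" unfolding d2 mod_ker_def using that by simp
        thus ?thesis using zd by auto
      qed
      moreover have "d 1 ` carrier (P 1) = carrier ((P 0)\<restriction>?L)" using d1(2) by simp
      ultimately obtain f where f: "lin R ((P 0)\<restriction>?L) N f" "\<And>x. x \<in> carrier (P 1) ==> f (d 1 x) = z x"
        using lin_factor[OF LP LN LL d1L _ zl] by metis
      from e f(1) obtain F where F: "lin R (P 0) N F" "\<forall>x\<in>?L. F x = f x" unfolding extends_def by blast
      have dc: "d 1 x \<in> ?L" "d 1 x \<in> carrier (P 0)" if "x \<in> carrier (P 1)" for x using that d1 lin_closed[OF d1(1)] by auto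
      have "z = compose (carrier (P 1)) (restrict F (carrier (P 0))) (d 1)"
        by (rule extensionalityI[OF zx]) (use F(2) f(2) dc in \<open>auto simp: compose_def\<close>)
      thus "z \<in> ext_coboundaries R P d 1 N" unfolding coboundaries_conv using restrict_mod_hom[OF LP F(1)] by blast
    qed
  qed
  with ext1_iff_coboundaries[OF LN Pd s LP] have "trivial_group (Ext R 1 M N) \<longleftrightarrow> extends R ?L (P 0) N" by simp
  with that P[of 0] d0 show thesis by blast
qed

end

lemma extends_post:
  assumes e: "extends R L P M" and P: "left_module R P" and L: "submodule L R P" and M: "left_module R M" and Z: "left_module R Z"
    and th: "summand R M Z"
  shows "extends R L P Z"
proof -
  note LL = sub_lm[OF P L]
  have "\<exists>F. lin R P Z F \<and> (\<forall>x\<in>L. F x = h (f x))" if "thru R M Z Z h" "lin R (P\<restriction>L) Z f" for h f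
    using that
  proof (induction rule: thru.induct)
    case (thru_zero h)
    then show ?case using lin_const_zero[OF Z, of P] lin_closed[OF thru_zero(2)] by (intro exI[of _ "\<lambda>x. \<zero>\<^sub>Z"]) simp
  next
    case (thru_add g u v h)
    then obtain F where F: "lin R P Z F" "\<forall>x\<in>L. F x = g (f x)" by blast
    have "lin R (P\<restriction>L) M (\<lambda>x. u (f x))" by (rule lin_comp[OF thru_add.prems thru_add.hyps(2)])
    with e obtain G where G: "lin R P M G" "\<forall>x\<in>L. G x = u (f x)" unfolding extends_def by blast
    have "lin R P Z (\<lambda>x. F x \<oplus>\<^sub>Z v (G x))" by (rule lin_plus[OF Z F(1) lin_comp[OF G(1) thru_add.hyps(3)]])
    moreover have "\<forall>x\<in>L. F x \<oplus>\<^sub>Z v (G x) = h (f x)"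
      using F(2) G(2) thru_add.hyps(4) lin_closed[OF thru_add.prems] by simp
    ultimately show ?case by (intro exI[of _ "\<lambda>x. F x \<oplus>\<^sub>Z v (G x)"]) simp
  qed
  from this[OF th] show ?thesis unfolding extends_def by blast
qed

text \<open>Lifting the composites \<open>X \<rightarrow> M \<rightarrow> X\<close> to the projective modules gives an endomorphism \<open>w\<close> of \<open>Q\<close> over the
  identity of \<open>X\<close> such that \<open>f \<circ> w\<close> extends. The difference between \<open>w\<close> and the identity has its values in
  the kernel of \<open>c\<close>, where \<open>f\<close> is defined.\<close>

lemma extends_pre:
  assumes e: "extends R (mod_ker P M g) P Z" and P: "left_module R P" "proj R P" and g: "lin R P M g" "g ` carrier P = carrier M"
    and M: "left_module R M" and Z: "left_module R Z" and X: "left_module R X" and th: "summand R M X"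
    and Q: "left_module R Q" "proj R Q" and c: "lin R Q X c" "c ` carrier Q = carrier X"
  shows "extends R (mod_ker Q X c) Q Z"
  unfolding extends_def
proof (intro allI impI)
  let ?L = "mod_ker Q X c" and ?Y = "mod_ker P M g"
  have L: "submodule ?L R Q" by (rule ker_submod[OF Q(1) X c(1)])
  have Y: "submodule ?Y R P" by (rule ker_submod[OF P(1) M g(1)])
  fix f assume f: "lin R (Q\<restriction>?L) Z f"
  have "\<exists>w F. lin R Q Q w \<and> lin R Q Z F \<and> (\<forall>q\<in>carrier Q. c (w q) = h (c q)) \<and> (\<forall>x\<in>?L. F x = f (w x))" if "thru R M X X h" for h
    using that
  proof (induction rule: thru.induct)
    case (thru_zero h)
    have "f \<zero>\<^sub>Q = \<zero>\<^sub>Z" using lm_lin_zero[OF f sub_lm[OF Q(1) L] Z] by simp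
    moreover have "c \<zero>\<^sub>Q = \<zero>\<^sub>X" by (rule lm_lin_zero[OF c(1) Q(1) X])
    ultimately show ?case
      using lin_const_zero[OF Q(1), of Q] lin_const_zero[OF Z, of Q] thru_zero lin_closed[OF c(1)]
      by (intro exI[of _ "\<lambda>x. \<zero>\<^sub>Q"] exI[of _ "\<lambda>x. \<zero>\<^sub>Z"]) simp
  next
    case (thru_add h' u v h)
    then obtain w F where w: "lin R Q Q w" "lin R Q Z F" "\<forall>q\<in>carrier Q. c (w q) = h' (c q)" "\<forall>x\<in>?L. F x = f (w x)" by blast
    obtain u' where u': "lin R Q P u'" "\<And>q. q \<in> carrier Q ==> g (u' q) = u (c q)"
      using proj_lift[OF Q(2,1) P(1) M lin_comp[OF c(1) thru_add.hyps(2)] g] by blast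
    obtain v' where v': "lin R P Q v'" "\<And>p. p \<in> carrier P ==> c (v' p) = v (g p)"
      using proj_lift[OF P(2,1) Q(1) X lin_comp[OF g(1) thru_add.hyps(3)] c] by blast
    have v'Y: "v' y \<in> ?L" if "y \<in> ?Y" for y
      using that v' lin_closed[OF v'(1)] lm_lin_zero[OF thru_add.hyps(3) M X] by (simp add: mod_ker_def)
    have u'L: "u' x \<in> ?Y" if "x \<in> ?L" for x
      using that u' lin_closed[OF u'(1)] lm_lin_zero[OF thru_add.hyps(2) X M] by (simp add: mod_ker_def)
    have "lin R (P\<restriction>?Y) (Q\<restriction>?L) v'"
      using lin_sub[OF v'(1) submodD(1)[OF P(1) Y]] v'Y by (subst lin_into_sub[OF submodD(1)[OF Q(1) L]]) simp
    from lin_comp[OF this f] e obtain G where G: "lin R P Z G" "\<forall>y\<in>?Y. G y = f (v' y)" unfolding extends_def by blast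
    have vu: "lin R Q Q (\<lambda>q. v' (u' q))" by (rule lin_comp[OF u'(1) v'(1)])
    have wl: "lin R Q Q (\<lambda>q. w q \<oplus>\<^sub>Q v' (u' q))" by (rule lin_plus[OF Q(1) w(1) vu])
    have Fl: "lin R Q Z (\<lambda>q. F q \<oplus>\<^sub>Z G (u' q))" by (rule lin_plus[OF Z w(2) lin_comp[OF u'(1) G(1)]])
    have "c (w q \<oplus>\<^sub>Q v' (u' q)) = h (c q)" if q: "q \<in> carrier Q" for q
      using lin_add[OF c(1) lin_closed[OF w(1) q] lin_closed[OF vu q]] w(3) v'(2)[OF lin_closed[OF u'(1) q]] u'(2)[OF q]
        thru_add.hyps(4)[OF lin_closed[OF c(1) q]] q by simp
    moreover have "F x \<oplus>\<^sub>Z G (u' x) = f (w x \<oplus>\<^sub>Q v' (u' x))" if x: "x \<in> ?L" for x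
    proof -
      have xq: "x \<in> carrier Q" using x by (simp add: mod_ker_def)
      have "w x \<in> ?L"
        using x w(3) xq lin_closed[OF w(1) xq] lm_lin_zero[OF thru_lin[OF thru_add.hyps(1) X X] X X] by (simp add: mod_ker_def)
      thus ?thesis using lin_add[OF f, of "w x" "v' (u' x)"] v'Y[OF u'L[OF x]] w(4) G(2) u'L[OF x] x by simp
    qed
    ultimately show ?case using wl Fl
      by (intro exI[of _ "\<lambda>q. w q \<oplus>\<^sub>Q v' (u' q)"] exI[of _ "\<lambda>q. F q \<oplus>\<^sub>Z G (u' q)"]) simp
  qed
  from this[OF th] obtain w F where w: "lin R Q Q w" "lin R Q Z F" "\<forall>q\<in>carrier Q. c (w q) = c q" "\<forall>x\<in>?L. F x = f (w x)" by blast
  \<comment> \<open>w differs from the identity by a map into the kernel\<close>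
  have d: "lin R Q Q (\<lambda>q. q \<ominus>\<^sub>Q w q)" by (rule lin_minus[OF Q(1) lin_id w(1)])
  have dL: "q \<ominus>\<^sub>Q w q \<in> ?L" if "q \<in> carrier Q" for q
    using lin_surj_sum[OF Q(1) X c(1) that lin_closed[OF w(1) that]] w(3) that by simp
  have "lin R Q (Q\<restriction>?L) (\<lambda>q. q \<ominus>\<^sub>Q w q)" using d dL by (subst lin_into_sub[OF submodD(1)[OF Q(1) L]]) simp
  from lin_plus[OF Z w(2) lin_comp[OF this f]] have "lin R Q Z (\<lambda>q. F q \<oplus>\<^sub>Z f (q \<ominus>\<^sub>Q w q))" .
  moreover have "F x \<oplus>\<^sub>Z f (x \<ominus>\<^sub>Q w x) = f x" if x: "x \<in> ?L" for x
  proof -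
    have xq: "x \<in> carrier Q" and wq: "w x \<in> carrier Q" using x lin_closed[OF w(1)] by (auto simp: mod_ker_def)
    have wL: "w x \<in> ?L" using x w(3) xq wq by (simp add: mod_ker_def)
    have "f (w x \<oplus>\<^sub>Q (x \<ominus>\<^sub>Q w x)) = f (w x) \<oplus>\<^sub>Z f (x \<ominus>\<^sub>Q w x)"
      using lin_add[OF f, of "w x" "x \<ominus>\<^sub>Q w x"] wL dL[OF xq] by simp
    moreover have "w x \<oplus>\<^sub>Q (x \<ominus>\<^sub>Q w x) = x"
      using ag_diff_add[OF lm_ag[OF Q(1)] xq wq] ag_comm[OF lm_ag[OF Q(1)] wq ag_diff[OF lm_ag[OF Q(1)] xq wq]] by simp
    ultimately show ?thesis using w(4) x by simp
  qed
  ultimately show "\<exists>F. lin R Q Z F \<and> (\<forall>x\<in>?L. F x = f x)" by blast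
qed


section \<open>Transposes and syzygies of projective presentations\<close>

lemma star_simps [simp]:
  "carrier (star R X) = mod_hom R X (reg R)"
  "\<zero>\<^bsub>star R X\<^esub> = (\<lambda>x\<in>carrier X. \<zero>\<^sub>R)"
  "p \<oplus>\<^bsub>star R X\<^esub> q = (\<lambda>x\<in>carrier X. p x \<oplus>\<^sub>R q x)"
  "a \<odot>\<^bsub>star R X\<^esub> p = (\<lambda>x\<in>carrier X. p x \<otimes>\<^sub>R a)"
  by (simp_all add: star_module_def hom_module_def hom_group_def)

text \<open>\<open>T\<close> is the cokernel of \<open>Hom(P\<^sub>0, R) \<rightarrow> Hom(P\<^sub>1, R)\<close>, given by the surjection \<open>q\<close> and its kernel.\<close>

definition is_tr where
  "is_tr R P1 f P0 T q \<longleftrightarrow> left_module R\<^sup>o T \<and> lin R\<^sup>o (star R P1) T q \<and>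
     q ` carrier (star R P1) = carrier T \<and>
     (\<forall>k\<in>carrier (star R P1). q k = \<zero>\<^sub>T \<longleftrightarrow> (\<exists>l\<in>carrier (star R P0). \<forall>x\<in>carrier P1. k x = l (f x)))"

text \<open>A projective presentation of \<open>Z\<close>, not necessarily minimal, together with its transpose.\<close>

definition pres where
  "pres R P1 f P0 g Z T q \<longleftrightarrow> left_module R P1 \<and> proj R P1 \<and> left_module R P0 \<and> proj R P0 \<and> left_module R Z \<and>
     lin R P1 P0 f \<and> lin R P0 Z g \<and> g ` carrier P0 = carrier Z \<and> f ` carrier P1 = mod_ker P0 Z g \<and> is_tr R P1 f P0 T q"

lemma presD:
  assumes "pres R P1 f P0 g Z T q"
  shows "left_module R P1" "proj R P1" "left_module R P0" "proj R P0" "left_module R Z" "lin R P1 P0 f" "lin R P0 Z g"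
    "g ` carrier P0 = carrier Z" "f ` carrier P1 = mod_ker P0 Z g" "is_tr R P1 f P0 T q"
  using assms by (simp_all add: pres_def)

lemma is_trD:
  assumes "is_tr R P1 f P0 T q"
  shows "left_module R\<^sup>o T" "lin R\<^sup>o (star R P1) T q" "q ` carrier (star R P1) = carrier T"
    "\<And>k. k \<in> carrier (star R P1) ==> q k = \<zero>\<^sub>T \<longleftrightarrow> (\<exists>l\<in>carrier (star R P0). \<forall>x\<in>carrier P1. k x = l (f x))"
  using assms by (simp_all add: is_tr_def)

lemma star_lin: "k \<in> carrier (star R X) ==> lin R X (reg R) k"
  by (simp add: mod_hom_iff)

lemma star_closed: "k \<in> carrier (star R X) ==> x \<in> carrier X ==> k x \<in> carrier R"
  using lin_closed[OF star_lin] by simp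

lemma starI: "left_module R X ==> lin R X (reg R) k ==> restrict k (carrier X) \<in> carrier (star R X)"
  by (simp add: restrict_mod_hom)

lemma star_eqI:
  assumes "p \<in> carrier (star R X)" "q \<in> carrier (star R X)" "\<And>x. x \<in> carrier X ==> p x = q x"
  shows "p = q"
  by (rule extensionalityI[of _ "carrier X"]) (use assms in \<open>auto simp: mod_hom_iff\<close>)

lemma rmult_lin:
  assumes R: "ring R" and a: "a \<in> carrier R"
  shows "lin R (reg R) (reg R) (\<lambda>x. x \<otimes>\<^sub>R a)"
  by (rule linI) (use R a in \<open>auto simp: ring.ring_simprules(5,11,13)\<close>)

lemma opp_ring: "ring R ==> ring R\<^sup>o"
proof -
  assume R: "ring R"
  show ?thesis
  proof (rule ringI)
    show "abelian_group R\<^sup>o" by (rule ag_cong[OF ring.is_abelian_group[OF R]]) auto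
    show "Group.monoid R\<^sup>o"
      by (rule Group.monoidI) (use R in \<open>auto simp: ring.ring_simprules(5,6,11,12) monoid.r_one ring.is_monoid\<close>)
  qed (use R in \<open>auto simp: ring.ring_simprules(13,23)\<close>)
qed

lemma star_lm:
  assumes X: "left_module R X"
  shows "left_module R\<^sup>o (star R X)"
proof (rule lm_intro)
  have R: "ring R" by (rule lm_ring[OF X])
  note RG = ring.is_abelian_group[OF R] and RL = regular_lm[OF R]
  show "ring R\<^sup>o" by (rule opp_ring[OF R])
  show "abelian_group (star R X)"
  proof (rule ag_intro)
    fix p q assume pq: "p \<in> carrier (star R X)" "q \<in> carrier (star R X)"
    show "p \<oplus>\<^bsub>star R X\<^esub> q \<in> carrier (star R X)"
      using starI[OF X lin_plus[OF RL star_lin[OF pq(1)] star_lin[OF pq(2)]]] by simp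
    show "p \<oplus>\<^bsub>star R X\<^esub> q = q \<oplus>\<^bsub>star R X\<^esub> p"
      by (simp, intro restrict_ext ag_comm[OF RG] star_closed[OF pq(1)] star_closed[OF pq(2)])
  next
    show "\<zero>\<^bsub>star R X\<^esub> \<in> carrier (star R X)" using starI[OF X lin_const_zero[OF RL]] by simp
  next
    fix p q r assume pq: "p \<in> carrier (star R X)" "q \<in> carrier (star R X)" "r \<in> carrier (star R X)"
    show "p \<oplus>\<^bsub>star R X\<^esub> q \<oplus>\<^bsub>star R X\<^esub> r = p \<oplus>\<^bsub>star R X\<^esub> (q \<oplus>\<^bsub>star R X\<^esub> r)"
      by (simp, intro restrict_ext) (simp add: ag_assoc[OF RG] star_closed[OF pq(1)] star_closed[OF pq(2)] star_closed[OF pq(3)])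
  next
    fix p assume p: "p \<in> carrier (star R X)"
    show "\<zero>\<^bsub>star R X\<^esub> \<oplus>\<^bsub>star R X\<^esub> p = p"
    proof (rule extensionalityI[of _ "carrier X"])
      show "p \<in> extensional (carrier X)" using p by (simp add: mod_hom_iff)
    qed (auto simp: ag_lzero[OF RG] star_closed[OF p])
    show "\<exists>q\<in>carrier (star R X). q \<oplus>\<^bsub>star R X\<^esub> p = \<zero>\<^bsub>star R X\<^esub>"
    proof (rule bexI)
      show "restrict (\<lambda>x. \<ominus>\<^bsub>reg R\<^esub> (p x)) (carrier X) \<in> carrier (star R X)"
        by (rule starI[OF X lin_uminus[OF RL star_lin[OF p]]])
      show "restrict (\<lambda>x. \<ominus>\<^bsub>reg R\<^esub> (p x)) (carrier X) \<oplus>\<^bsub>star R X\<^esub> p = \<zero>\<^bsub>star R X\<^esub>"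
        by (simp, intro restrict_ext) (use ag_lneg[OF regular_ag[OF R]] star_closed[OF p] in simp)
    qed
  qed
next
  have R: "ring R" by (rule lm_ring[OF X])
  fix a p assume a: "a \<in> carrier R\<^sup>o" and p: "p \<in> carrier (star R X)"
  show "a \<odot>\<^bsub>star R X\<^esub> p \<in> carrier (star R X)"
    using starI[OF X lin_comp[OF star_lin[OF p] rmult_lin[OF R]]] a by simp
next
  have R: "ring R" by (rule lm_ring[OF X])
  fix a b p assume "a \<in> carrier R\<^sup>o" "b \<in> carrier R\<^sup>o" and p: "p \<in> carrier (star R X)"
  then have a: "a \<in> carrier R" "b \<in> carrier R" by simp_all
  show "(a \<oplus>\<^bsub>R\<^sup>o\<^esub> b) \<odot>\<^bsub>star R X\<^esub> p = a \<odot>\<^bsub>star R X\<^esub> p \<oplus>\<^bsub>star R X\<^esub> b \<odot>\<^bsub>star R X\<^esub> p"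
    by (simp, intro restrict_ext) (simp add: a R ring.ring_simprules(23) star_closed[OF p])
  show "(a \<otimes>\<^bsub>R\<^sup>o\<^esub> b) \<odot>\<^bsub>star R X\<^esub> p = a \<odot>\<^bsub>star R X\<^esub> (b \<odot>\<^bsub>star R X\<^esub> p)"
    by (simp, intro restrict_ext) (simp add: a R ring.ring_simprules(11) star_closed[OF p])
next
  have R: "ring R" by (rule lm_ring[OF X])
  fix a p q assume "a \<in> carrier R\<^sup>o"
    and p: "p \<in> carrier (star R X)" and q: "q \<in> carrier (star R X)"
  then have a: "a \<in> carrier R" by simp
  show "a \<odot>\<^bsub>star R X\<^esub> (p \<oplus>\<^bsub>star R X\<^esub> q) = a \<odot>\<^bsub>star R X\<^esub> p \<oplus>\<^bsub>star R X\<^esub> a \<odot>\<^bsub>star R X\<^esub> q"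
    by (simp, intro restrict_ext) (simp add: a R ring.ring_simprules(13) star_closed[OF p] star_closed[OF q])
next
  have R: "ring R" by (rule lm_ring[OF X])
  fix p assume p: "p \<in> carrier (star R X)"
  show "\<one>\<^bsub>R\<^sup>o\<^esub> \<odot>\<^bsub>star R X\<^esub> p = p"
  proof (rule extensionalityI[of _ "carrier X"])
    show "p \<in> extensional (carrier X)" using p by (simp add: mod_hom_iff)
  qed (auto simp: R monoid.r_one ring.is_monoid star_closed[OF p])
qed

definition smap where "smap X w k = (\<lambda>x\<in>carrier X. k (w x))"

lemma smap_closed: "left_module R X ==> lin R X Y w ==> k \<in> carrier (star R Y) ==> smap X w k \<in> carrier (star R X)"
  unfolding smap_def by (intro starI lin_comp[OF _ star_lin])

lemma smap_lin:
  assumes X: "left_module R X" and w: "lin R X Y w"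
  shows "lin R\<^sup>o (star R Y) (star R X) (smap X w)"
proof (rule linI)
  fix k assume "k \<in> carrier (star R Y)"
  thus "smap X w k \<in> carrier (star R X)" by (rule smap_closed[OF X w])
next
  fix k l show "smap X w (k \<oplus>\<^bsub>star R Y\<^esub> l) = smap X w k \<oplus>\<^bsub>star R X\<^esub> smap X w l"
    unfolding smap_def by (simp, intro restrict_ext) (simp add: lin_closed[OF w])
next
  fix a k show "smap X w (a \<odot>\<^bsub>star R Y\<^esub> k) = a \<odot>\<^bsub>star R X\<^esub> smap X w k"
    unfolding smap_def by (simp, intro restrict_ext) (simp add: lin_closed[OF w])
qed

text \<open>Lift \<open>h\<close> to the presentations; on transposes the lift acts in the opposite direction.\<close>

lemma tr_map:
  assumes p: "pres R Q1 f Q0 g Z T q" and p': "pres R Q1' f' Q0' g' Z' T' q'" and h: "lin R Z Z' h"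
  obtains h0 h1 t where "lin R Q0 Q0' h0" "lin R Q1 Q1' h1" "\<And>x. x \<in> carrier Q0 ==> g' (h0 x) = h (g x)"
    "\<And>x. x \<in> carrier Q1 ==> f' (h1 x) = h0 (f x)" "lin R\<^sup>o T' T t"
    "\<And>k. k \<in> carrier (star R Q1') ==> t (q' k) = q (smap Q1 h1 k)"
proof -
  note d = presD[OF p] and d' = presD[OF p']
  note tr = is_trD[OF d(10)] and tr' = is_trD[OF d'(10)]
  obtain h0 where h0: "lin R Q0 Q0' h0" "\<And>x. x \<in> carrier Q0 ==> g' (h0 x) = h (g x)"
    using proj_lift[OF d(4,3) d'(3,5) lin_comp[OF d(7) h] d'(7,8)] by blast
  let ?L = "mod_ker Q0' Z' g'"
  have L: "submodule ?L R Q0'" by (rule ker_submod[OF d'(3,5,7)])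
  note LL = sub_lm[OF d'(3) L]
  have "h0 (f x) \<in> ?L" if x: "x \<in> carrier Q1" for x
  proof -
    have "f x \<in> f ` carrier Q1" using x by simp
    hence fx: "f x \<in> carrier Q0" "g (f x) = \<zero>\<^sub>Z" unfolding d(9) by (simp_all add: mod_ker_def)
    have "g' (h0 (f x)) = \<zero>\<^sub>Z'" using h0(2)[OF fx(1)] fx(2) lm_lin_zero[OF h d(5) d'(5)] by simp
    thus ?thesis using lin_closed[OF h0(1) fx(1)] by (simp add: mod_ker_def)
  qed
  hence hf: "lin R Q1 (Q0'\<restriction>?L) (\<lambda>x. h0 (f x))"
    using lin_comp[OF d(6) h0(1)] by (subst lin_into_sub[OF submodD(1)[OF d'(3) L]]) simp
  have f'L: "lin R Q1' (Q0'\<restriction>?L) f'"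
    using d'(6) d'(9) by (subst lin_into_sub[OF submodD(1)[OF d'(3) L]]) (simp only: d'(9)[symmetric] image_eqI simp_thms, simp)
  have "f' ` carrier Q1' = carrier (Q0'\<restriction>?L)" using d'(9) by simp
  then obtain h1 where h1: "lin R Q1 Q1' h1" "\<And>x. x \<in> carrier Q1 ==> f' (h1 x) = h0 (f x)"
    using proj_lift[OF d(2,1) d'(1) LL hf f'L] by blast
  note sl = lin_comp[OF smap_lin[OF d(1) h1(1)] tr(2)]
  have "q (smap Q1 h1 k) = \<zero>\<^sub>T" if k: "k \<in> carrier (star R Q1')" "q' k = \<zero>\<^sub>T'" for k
  proof -
    obtain l where l: "l \<in> carrier (star R Q0')" "\<forall>x\<in>carrier Q1'. k x = l (f' x)" using tr'(4)[OF k(1)] k(2) by blast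
    have "smap Q1 h1 k x = smap Q0 h0 l (f x)" if x: "x \<in> carrier Q1" for x
      using x l(2) lin_closed[OF h1(1) x] h1(2)[OF x] lin_closed[OF d(6) x] by (simp add: smap_def)
    with tr(4)[OF smap_closed[OF d(1) h1(1) k(1)]] smap_closed[OF d(3) h0(1) l(1)] show ?thesis by blast
  qed
  then obtain t where "lin R\<^sup>o T' T t" "\<And>k. k \<in> carrier (star R Q1') ==> t (q' k) = q (smap Q1 h1 k)"
    using lin_factor[OF star_lm[OF d'(1)] tr(1) tr'(1,2,3) sl] by metis
  with h0 h1 that show thesis by blast
qed

text \<open>A sum of composites lifts to the sum of the lifted composites, and so does the map induced on the
  transposes. The lifts are part of the statement because the induced map is described through them.\<close>

lemma tr_thru:
  assumes p: "pres R Q1 f Q0 g Z T q" and p': "pres R Q1' f' Q0' g' Z' T' q'" and pp: "pres R P1 fP P0 gP Y U m"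
    and th: "thru R Y Z Z' h"
  shows "\<exists>h0 h1 t. lin R Q0 Q0' h0 \<and> lin R Q1 Q1' h1 \<and> (\<forall>x\<in>carrier Q0. g' (h0 x) = h (g x)) \<and>
    (\<forall>x\<in>carrier Q1. f' (h1 x) = h0 (f x)) \<and> thru R\<^sup>o U T' T t \<and>
    (\<forall>k\<in>carrier (star R Q1'). t (q' k) = q (smap Q1 h1 k))"
  using th
proof (induction rule: thru.induct)
  case (thru_zero h)
  note d = presD[OF p] and d' = presD[OF p']
  note tr = is_trD[OF d(10)] and tr' = is_trD[OF d'(10)]
  have z: "f' \<zero>\<^sub>Q1' = \<zero>\<^sub>Q0'" by (rule lm_lin_zero[OF d'(6) d'(1) d'(3)])
  have z': "g' \<zero>\<^sub>Q0' = \<zero>\<^sub>Z'" by (rule lm_lin_zero[OF d'(7) d'(3) d'(5)])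
  have "smap Q1 (\<lambda>x. \<zero>\<^sub>Q1') k = \<zero>\<^bsub>star R Q1\<^esub>" if k: "k \<in> carrier (star R Q1')" for k
    using lin_zero[OF star_lin[OF k] lm_ag[OF d'(1)] regular_ag[OF lm_ring[OF d'(1)]]] by (simp add: smap_def)
  hence "q (smap Q1 (\<lambda>x. \<zero>\<^sub>Q1') k) = \<zero>\<^sub>T" if k: "k \<in> carrier (star R Q1')" for k
    using that lm_lin_zero[OF tr(2) star_lm[OF d(1)] tr(1)] by simp
  moreover have "thru R\<^sup>o U T' T (\<lambda>x. \<zero>\<^sub>T)" by (rule thru.thru_zero) simp
  ultimately show ?case
    using lin_const_zero[OF d'(3), of Q0] lin_const_zero[OF d'(1), of Q1] z z' thru_zero lin_closed[OF d(7)]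
    by (intro exI[of _ "\<lambda>x. \<zero>\<^sub>Q0'"] exI[of _ "\<lambda>x. \<zero>\<^sub>Q1'"] exI[of _ "\<lambda>x. \<zero>\<^sub>T"]) simp
next
  case (thru_add h' u v h)
  note d = presD[OF p] and d' = presD[OF p'] and dp = presD[OF pp]
  note tr = is_trD[OF d(10)] and tr' = is_trD[OF d'(10)]
  from thru_add.IH obtain h0 h1 t where h: "lin R Q0 Q0' h0" "lin R Q1 Q1' h1" "\<forall>x\<in>carrier Q0. g' (h0 x) = h' (g x)"
    "\<forall>x\<in>carrier Q1. f' (h1 x) = h0 (f x)" "thru R\<^sup>o U T' T t"
    "\<forall>k\<in>carrier (star R Q1'). t (q' k) = q (smap Q1 h1 k)" by blast
  obtain u0 u1 s where u: "lin R Q0 P0 u0" "lin R Q1 P1 u1" "\<And>x. x \<in> carrier Q0 ==> gP (u0 x) = u (g x)"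
    "\<And>x. x \<in> carrier Q1 ==> fP (u1 x) = u0 (f x)" "lin R\<^sup>o U T s"
    "\<And>k. k \<in> carrier (star R P1) ==> s (m k) = q (smap Q1 u1 k)"
    by (rule tr_map[OF p pp thru_add.hyps(2)]) (rule that; assumption)
  obtain v0 v1 r where v: "lin R P0 Q0' v0" "lin R P1 Q1' v1" "\<And>x. x \<in> carrier P0 ==> g' (v0 x) = v (gP x)"
    "\<And>x. x \<in> carrier P1 ==> f' (v1 x) = v0 (fP x)" "lin R\<^sup>o T' U r"
    "\<And>k. k \<in> carrier (star R Q1') ==> r (q' k) = m (smap P1 v1 k)"
    by (rule tr_map[OF pp p' thru_add.hyps(3)]) (rule that; assumption)
  have l0: "lin R Q0 Q0' (\<lambda>x. h0 x \<oplus>\<^sub>Q0' v0 (u0 x))" by (rule lin_plus[OF d'(3) h(1) lin_comp[OF u(1) v(1)]])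
  have l1: "lin R Q1 Q1' (\<lambda>x. h1 x \<oplus>\<^sub>Q1' v1 (u1 x))" by (rule lin_plus[OF d'(1) h(2) lin_comp[OF u(2) v(2)]])
  have g0: "g' (h0 x \<oplus>\<^sub>Q0' v0 (u0 x)) = h (g x)" if x: "x \<in> carrier Q0" for x
    using x h(3) u(3)[OF x] v(3)[OF lin_closed[OF u(1) x]] thru_add.hyps(4)[OF lin_closed[OF d(7) x]]
      lin_add[OF d'(7) lin_closed[OF h(1) x] lin_closed[OF v(1) lin_closed[OF u(1) x]]] by simp
  have f1: "f' (h1 x \<oplus>\<^sub>Q1' v1 (u1 x)) = h0 (f x) \<oplus>\<^sub>Q0' v0 (u0 (f x))" if x: "x \<in> carrier Q1" for x
    using x h(4) u(4)[OF x] v(4)[OF lin_closed[OF u(2) x]]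
      lin_add[OF d'(6) lin_closed[OF h(2) x] lin_closed[OF v(2) lin_closed[OF u(2) x]]] by simp
  have th': "thru R\<^sup>o U T' T (\<lambda>x. t x \<oplus>\<^sub>T s (r x))" by (rule thru.thru_add[OF h(5) v(5) u(5) refl])
  have tq: "t (q' k) \<oplus>\<^sub>T s (r (q' k)) = q (smap Q1 (\<lambda>x. h1 x \<oplus>\<^sub>Q1' v1 (u1 x)) k)" if k: "k \<in> carrier (star R Q1')" for k
  proof -
    have "smap Q1 (\<lambda>x. h1 x \<oplus>\<^sub>Q1' v1 (u1 x)) k = smap Q1 h1 k \<oplus>\<^bsub>star R Q1\<^esub> smap Q1 u1 (smap P1 v1 k)"
      unfolding smap_def star_simps
    proof (rule restrict_ext)
      fix x assume x: "x \<in> carrier Q1"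
      show "k (h1 x \<oplus>\<^sub>Q1' v1 (u1 x)) = (\<lambda>x\<in>carrier Q1. k (h1 x)) x \<oplus>\<^sub>R (\<lambda>x\<in>carrier Q1. (\<lambda>x\<in>carrier P1. k (v1 x)) (u1 x)) x"
        using x lin_add[OF star_lin[OF k] lin_closed[OF h(2) x] lin_closed[OF v(2) lin_closed[OF u(2) x]]] lin_closed[OF u(2) x] by simp
    qed
    moreover have a: "smap Q1 h1 k \<in> carrier (star R Q1)" by (rule smap_closed[OF d(1) h(2) k])
    moreover have b: "smap P1 v1 k \<in> carrier (star R P1)" by (rule smap_closed[OF dp(1) v(2) k])
    moreover have "smap Q1 u1 (smap P1 v1 k) \<in> carrier (star R Q1)" by (rule smap_closed[OF d(1) u(2) b])
    ultimately show ?thesis using h(6) k v(6)[OF k] u(6)[OF b] lin_add[OF tr(2)] by simp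
  qed
  from l0 l1 g0 f1 th' tq show ?case by blast
qed

context fdalg begin

text \<open>No proper submodule of a cover maps onto \<open>X\<close>, so \<open>w\<close> is onto, and surjective endomorphisms of
  finite-dimensional modules are bijective.\<close>

lemma cover_auto:
  fixes P :: "('a, nat \<Rightarrow> 'k) module"
  assumes X: "left_module R X" and c: "projective_cover R P g X" and w: "lin R P P w"
    and gw: "\<And>x. x \<in> carrier X ==> \<exists>p\<in>carrier P. g (w p) = x"
  shows "bij_betw w (carrier P) (carrier P)"
proof -
  have P: "P \<in> fg_mod R" and min: "\<And>N. submodule N R P ==> g ` N = carrier X ==> N = carrier P"
    and g: "lin R P X g"
    using c by (simp_all add: projective_cover_iff[OF X] mod_hom_iff)
  note L = fg_modD[OF P]
  have "w ` carrier P = carrier P"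
  proof (rule min[OF image_submod[OF L(1) L(1) w carrier_submod[OF L(1)]]])
    show "g ` w ` carrier P = carrier X" using lin_closed[OF w] lin_closed[OF g] gw by (auto simp: image_image) force
  qed
  thus ?thesis by (rule surj_endo_inj[OF L w])
qed

text \<open>On a minimal presentation the lift of the identity of \<open>Z\<close> is an automorphism, hence so is the map
  that it induces on \<open>T\<close>. By \<open>tr_thru\<close> this map is a sum of composites through \<open>U\<close>.\<close>

lemma tr_minimal:
  assumes p: "pres R Q1 f Q0 g Z T q" and pp: "pres R P1 fP P0 gP Y U m"
    and th: "summand R Y Z"
    and c0: "projective_cover R Q0 g Z" and c1: "projective_cover R Q1 f (Q0\<restriction>(mod_ker Q0 Z g))"
  shows "summand R\<^sup>o U T"
proof -
  note d = presD[OF p]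
  note tr = is_trD[OF d(10)]
  obtain h0 h1 t where h: "lin R Q0 Q0 h0" "lin R Q1 Q1 h1" "\<forall>x\<in>carrier Q0. g (h0 x) = g x"
    "\<forall>x\<in>carrier Q1. f (h1 x) = h0 (f x)" "thru R\<^sup>o U T T t"
    "\<forall>k\<in>carrier (star R Q1). t (q k) = q (smap Q1 h1 k)" using tr_thru[OF p p pp th] by blast
  have b0: "bij_betw h0 (carrier Q0) (carrier Q0)"
  proof (rule cover_auto[OF d(5) c0 h(1)])
    fix z assume "z \<in> carrier Z"
    then obtain x where "x \<in> carrier Q0" "z = g x" using surjE[OF d(8)] by blast
    thus "\<exists>p\<in>carrier Q0. g (h0 p) = z" using h(3) by auto
  qed
  obtain i0 where i0: "lin R Q0 Q0 i0" "\<And>x. x \<in> carrier Q0 ==> i0 (h0 x) = x" "\<And>x. x \<in> carrier Q0 ==> h0 (i0 x) = x"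
    by (rule lin_inverse[OF d(3) d(3) h(1) b0]) (rule that; assumption)
  let ?L = "mod_ker Q0 Z g"
  have L: "submodule ?L R Q0" by (rule ker_submod[OF d(3,5,7)])
  note LL = sub_lm[OF d(3) L]
  have b1: "bij_betw h1 (carrier Q1) (carrier Q1)"
  proof (rule cover_auto[OF LL c1 h(2)])
    fix z assume "z \<in> carrier (Q0\<restriction>?L)"
    hence z: "z \<in> carrier Q0" "g z = \<zero>\<^sub>Z" by (simp_all add: mod_ker_def)
    have iz: "i0 z \<in> carrier Q0" by (rule lin_closed[OF i0(1) z(1)])
    have "g (i0 z) = g (h0 (i0 z))" using bspec[OF h(3) iz] by simp
    also have "\<dots> = \<zero>\<^sub>Z" using i0(3)[OF z(1)] z(2) by simp
    finally have "i0 z \<in> ?L" using iz by (simp add: mod_ker_def)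
    then obtain y where y: "y \<in> carrier Q1" "i0 z = f y" using surjE[OF d(9)] by blast
    have "f (h1 y) = z" using h(4) y i0(3)[OF z(1)] by simp
    with y show "\<exists>p\<in>carrier Q1. f (h1 p) = z" by blast
  qed
  obtain i1 where i1: "lin R Q1 Q1 i1" "\<And>x. x \<in> carrier Q1 ==> i1 (h1 x) = x" "\<And>x. x \<in> carrier Q1 ==> h1 (i1 x) = x"
    by (rule lin_inverse[OF d(1) d(1) h(2) b1]) (rule that; assumption)
  have fi: "f (i1 y) = i0 (f y)" if y: "y \<in> carrier Q1" for y
  proof -
    have iy: "i1 y \<in> carrier Q1" by (rule lin_closed[OF i1(1) y])
    have "i0 (f y) = i0 (h0 (f (i1 y)))" using bspec[OF h(4) iy] i1(3)[OF y] by simp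
    also have "\<dots> = f (i1 y)" by (rule i0(2)[OF lin_closed[OF d(6) iy]])
    finally show ?thesis by simp
  qed
  have tl: "lin R\<^sup>o T T t" by (rule thru_lin[OF h(5) tr(1,1)])
  have tb: "bij_betw t (carrier T) (carrier T)"
    unfolding bij_betw_def
  proof
    show "inj_on t (carrier T)"
    proof (rule inj_if_ker[OF tr(1) tr(1) tl])
      fix x assume x: "x \<in> carrier T" "t x = \<zero>\<^sub>T"
      then have "x \<in> q ` carrier (star R Q1)" by (simp only: tr(3))
      then obtain k where k: "k \<in> carrier (star R Q1)" "x = q k" by blast
      have "q (smap Q1 h1 k) = \<zero>\<^sub>T" using bspec[OF h(6) k(1)] k(2) x(2) by simp
      then obtain l where l: "l \<in> carrier (star R Q0)" "\<forall>x\<in>carrier Q1. smap Q1 h1 k x = l (f x)"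
        using tr(4)[OF smap_closed[OF d(1) h(2) k(1)]] by blast
      have "k y = smap Q0 i0 l (f y)" if y: "y \<in> carrier Q1" for y
        using bspec[OF l(2) lin_closed[OF i1(1) y]] i1(3)[OF y] fi[OF y] lin_closed[OF i1(1) y] lin_closed[OF d(6) y] by (simp add: smap_def)
      with smap_closed[OF d(3) i0(1) l(1)] tr(4)[OF k(1)] show "x = \<zero>\<^sub>T" unfolding k(2) by blast
    qed
    show "t ` carrier T = carrier T"
    proof
      show "t ` carrier T \<subseteq> carrier T" using lin_closed[OF tl] by blast
      show "carrier T \<subseteq> t ` carrier T"
      proof
        fix x assume "x \<in> carrier T"
        then have "x \<in> q ` carrier (star R Q1)" by (simp only: tr(3))
        then obtain k where k: "k \<in> carrier (star R Q1)" "x = q k" by blast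
        have k': "smap Q1 i1 k \<in> carrier (star R Q1)" by (rule smap_closed[OF d(1) i1(1) k(1)])
        have "smap Q1 h1 (smap Q1 i1 k) = k"
          by (rule star_eqI[OF smap_closed[OF d(1) h(2) k'] k(1)]) (simp add: smap_def i1(2) lin_closed[OF h(2)])
        hence "t (q (smap Q1 i1 k)) = x" using bspec[OF h(6) k'] k(2) by simp
        thus "x \<in> t ` carrier T" using lin_closed[OF tr(2) k'] by blast
      qed
    qed
  qed
  from lin_inverse[OF tr(1) tr(1) tl tb] obtain s where s: "lin R\<^sup>o T T s" "\<And>x. x \<in> carrier T ==> s (t x) = x" by metis
  from thru_cong[OF thru_post[OF h(5) s(1) tr(1,1,1)]] s(2) show ?thesis by simp
qed

lemma pres_minimal:
  assumes mp: "minimal_presentation R P1 f P0 g Z" and Z: "left_module R Z" and tr: "is_tr R P1 f P0 T q"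
    and i: "lin R Z Z' i" "bij_betw i (carrier Z) (carrier Z')" and Z': "left_module R Z'"
  shows "pres R P1 f P0 (\<lambda>x. i (g x)) Z' T q"
proof -
  have c0: "projective_cover R P0 g Z" and c1: "projective_cover R P1 f (P0\<restriction>(mod_ker P0 Z g))"
    using mp by (simp_all add: minimal_presentation_def)
  have q0: "P0 \<in> fg_mod R" "proj R P0" "lin R P0 Z g" "g ` carrier P0 = carrier Z"
    using c0 by (simp_all add: projective_cover_iff[OF Z] mod_hom_iff)
  note L0 = fg_modD(1)[OF q0(1)]
  have K0: "submodule (mod_ker P0 Z g) R P0" by (rule ker_submod[OF L0 Z q0(3)])
  have q1: "P1 \<in> fg_mod R" "proj R P1" "lin R P1 (P0\<restriction>(mod_ker P0 Z g)) f" "f ` carrier P1 = mod_ker P0 Z g"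
    using c1 by (simp_all add: projective_cover_iff[OF sub_lm[OF L0 K0]] mod_hom_iff)
  have iz: "i z = \<zero>\<^sub>Z' \<longleftrightarrow> z = \<zero>\<^sub>Z" if "z \<in> carrier Z" for z
    using inj_onD[OF bij_betw_imp_inj_on[OF i(2)] _ that lm_zero[OF Z]] lm_lin_zero[OF i(1) Z Z'] by auto
  have "(\<lambda>x. i (g x)) ` carrier P0 = i ` carrier Z" unfolding q0(4)[symmetric] by (simp add: image_image)
  hence im: "(\<lambda>x. i (g x)) ` carrier P0 = carrier Z'" using bij_betw_imp_surj_on[OF i(2)] by simp
  have "mod_ker P0 Z' (\<lambda>x. i (g x)) = mod_ker P0 Z g" using iz lin_closed[OF q0(3)] by (auto simp: mod_ker_def)
  thus ?thesis unfolding pres_def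
    using q0 q1 fg_modD(1)[OF q1(1)] L0 Z' tr im lin_comp[OF q0(3) i(1)] by (simp add: lin_into_sub[OF submodD(1)[OF L0 K0]])
qed

text \<open>Both factors of a composite \<open>X \<rightarrow> M \<rightarrow> X'\<close> lift to the projective modules, and the lifts preserve the
  kernels.\<close>

lemma syzygy_thru:
  assumes th: "thru R M X X' h" and M: "left_module R M" and X: "left_module R X" and X': "left_module R X'"
    and G: "left_module R G" "proj R G" "lin R G M g" "g ` carrier G = carrier M"
    and Q: "left_module R Q" "proj R Q" "lin R Q X c"
    and Q': "left_module R Q'" "lin R Q' X' c'" "c' ` carrier Q' = carrier X'"
  shows "\<exists>w. lin R Q Q' w \<and> (\<forall>q\<in>carrier Q. c' (w q) = h (c q)) \<and>
    thru R (G\<restriction>(mod_ker G M g)) (Q\<restriction>(mod_ker Q X c)) (Q'\<restriction>(mod_ker Q' X' c')) w"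
  using th
proof (induction rule: thru.induct)
  case (thru_zero h)
  have "thru R (G\<restriction>(mod_ker G M g)) (Q\<restriction>(mod_ker Q X c)) (Q'\<restriction>(mod_ker Q' X' c')) (\<lambda>x. \<zero>\<^sub>Q')"
    by (rule thru.thru_zero) simp
  then show ?case using lin_const_zero[OF Q'(1), of Q] thru_zero lm_lin_zero[OF Q'(2) Q'(1) X'] lin_closed[OF Q(3)]
    by (intro exI[of _ "\<lambda>x. \<zero>\<^sub>Q'"]) simp
next
  case (thru_add h' u v h)
  then obtain w where w: "lin R Q Q' w" "\<forall>q\<in>carrier Q. c' (w q) = h' (c q)"
    "thru R (G\<restriction>(mod_ker G M g)) (Q\<restriction>(mod_ker Q X c)) (Q'\<restriction>(mod_ker Q' X' c')) w" by blast
  obtain u' where u': "lin R Q G u'" "\<And>q. q \<in> carrier Q ==> g (u' q) = u (c q)"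
    using proj_lift[OF Q(2,1) G(1) M lin_comp[OF Q(3) thru_add.hyps(2)] G(3,4)] by blast
  obtain v' where v': "lin R G Q' v'" "\<And>p. p \<in> carrier G ==> c' (v' p) = v (g p)"
    using proj_lift[OF G(2,1) Q'(1) X' lin_comp[OF G(3) thru_add.hyps(3)] Q'(2,3)] by blast
  have L: "submodule (mod_ker Q' X' c') R Q'" by (rule ker_submod[OF Q'(1) X' Q'(2)])
  have Y: "submodule (mod_ker G M g) R G" by (rule ker_submod[OF G(1) M G(3)])
  have L0: "submodule (mod_ker Q X c) R Q" by (rule ker_submod[OF Q(1) X Q(3)])
  have 1: "lin R (Q\<restriction>(mod_ker Q X c)) (G\<restriction>(mod_ker G M g)) u'"
    using lin_sub[OF u'(1) submodD(1)[OF Q(1) L0]] u'(2) lin_closed[OF u'(1)] lm_lin_zero[OF thru_add.hyps(2) X M]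
    by (subst lin_into_sub[OF submodD(1)[OF G(1) Y]]) (simp add: mod_ker_def)
  have 2: "lin R (G\<restriction>(mod_ker G M g)) (Q'\<restriction>(mod_ker Q' X' c')) v'"
    using lin_sub[OF v'(1) submodD(1)[OF G(1) Y]] v'(2) lin_closed[OF v'(1)] lm_lin_zero[OF thru_add.hyps(3) M X']
    by (subst lin_into_sub[OF submodD(1)[OF Q'(1) L]]) (simp add: mod_ker_def)
  have "lin R Q Q' (\<lambda>q. w q \<oplus>\<^sub>Q' v' (u' q))" by (rule lin_plus[OF Q'(1) w(1) lin_comp[OF u'(1) v'(1)]])
  moreover have "c' (w q \<oplus>\<^sub>Q' v' (u' q)) = h (c q)" if q: "q \<in> carrier Q" for q
    using q w(2) v'(2)[OF lin_closed[OF u'(1) q]] u'(2)[OF q] thru_add.hyps(4)[OF lin_closed[OF Q(3) q]]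
      lin_add[OF Q'(2) lin_closed[OF w(1) q] lin_closed[OF v'(1) lin_closed[OF u'(1) q]]] by simp
  moreover have "thru R (G\<restriction>(mod_ker G M g)) (Q\<restriction>(mod_ker Q X c)) (Q'\<restriction>(mod_ker Q' X' c')) (\<lambda>q. w q \<oplus>\<^sub>Q' v' (u' q))"
    by (rule thru.thru_add[OF w(3) 1 2]) simp
  ultimately show ?case by blast
qed

text \<open>For a cover the lift of the identity is an automorphism, and its inverse preserves the kernel.\<close>

lemma syzygy_minimal:
  assumes th: "summand R M X" and M: "left_module R M" and X: "left_module R X"
    and G: "left_module R G" "proj R G" "lin R G M g" "g ` carrier G = carrier M"
    and c: "projective_cover R Q c X"
  shows "summand R (G\<restriction>(mod_ker G M g)) (Q\<restriction>(mod_ker Q X c))"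
proof -
  have Q: "Q \<in> fg_mod R" "proj R Q" "lin R Q X c" "c ` carrier Q = carrier X"
    using c by (simp_all add: projective_cover_iff[OF X] mod_hom_iff)
  note LQ = fg_modD(1)[OF Q(1)]
  let ?L = "mod_ker Q X c"
  obtain w where w: "lin R Q Q w" "\<forall>q\<in>carrier Q. c (w q) = c q" "thru R (G\<restriction>(mod_ker G M g)) (Q\<restriction>?L) (Q\<restriction>?L) w"
    using syzygy_thru[OF th M X X G LQ Q(2,3) LQ Q(3,4)] by blast
  have "bij_betw w (carrier Q) (carrier Q)"
  proof (rule cover_auto[OF X c w(1)])
    fix x assume "x \<in> carrier X"
    hence "x \<in> c ` carrier Q" by (simp only: Q(4))
    thus "\<exists>p\<in>carrier Q. c (w p) = x" using w(2) by auto
  qed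
  then obtain i where i: "lin R Q Q i" "\<And>x. x \<in> carrier Q ==> i (w x) = x" "\<And>x. x \<in> carrier Q ==> w (i x) = x"
    by (rule lin_inverse[OF LQ LQ w(1)]) (rule that; assumption)
  have L: "submodule ?L R Q" by (rule ker_submod[OF LQ X Q(3)])
  note LL = sub_lm[OF LQ L]
  have "i x \<in> ?L" if "x \<in> ?L" for x
  proof -
    have x: "x \<in> carrier Q" "c x = \<zero>\<^sub>X" using that by (simp_all add: mod_ker_def)
    have ix: "i x \<in> carrier Q" by (rule lin_closed[OF i(1) x(1)])
    have "c (i x) = c (w (i x))" using bspec[OF w(2) ix] by simp
    thus ?thesis using ix x i(3)[OF x(1)] by (simp add: mod_ker_def)
  qed
  hence "lin R (Q\<restriction>?L) (Q\<restriction>?L) i"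
    using lin_sub[OF i(1) submodD(1)[OF LQ L]] by (subst lin_into_sub[OF submodD(1)[OF LQ L]]) simp
  from thru_cong[OF thru_post[OF w(3) this LL LL LL]] i(2) submodD(1)[OF LQ L] show ?thesis by (simp add: subset_iff)
qed

end


section \<open>Socles and tops over a quotient algebra\<close>

lemma inflate_simps [simp]:
  "carrier (inflate R I X) = carrier X" "\<zero>\<^bsub>inflate R I X\<^esub> = \<zero>\<^sub>X"
  "x \<oplus>\<^bsub>inflate R I X\<^esub> y = x \<oplus>\<^sub>X y" "a \<odot>\<^bsub>inflate R I X\<^esub> x = (I +>\<^sub>R a) \<odot>\<^sub>X x"
  by (simp_all add: inflate_def)

lemma quot_algebra_simps [simp]:
  "carrier (quot_algebra R I) = (\<lambda>a. I +>\<^sub>R a) ` carrier R" "\<zero>\<^bsub>quot_algebra R I\<^esub> = I" "\<one>\<^bsub>quot_algebra R I\<^esub> = I +>\<^sub>R \<one>\<^sub>R"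
  "C \<oplus>\<^bsub>quot_algebra R I\<^esub> C' = C <+>\<^sub>R C'" "C \<otimes>\<^bsub>quot_algebra R I\<^esub> C' = rcoset_mult R I C C'"
  "k \<odot>\<^bsub>quot_algebra R I\<^esub> C = (\<Union>x\<in>C. I +>\<^sub>R (k \<odot>\<^sub>R x))"
  by (simp_all add: quot_algebra_def FactRing_def coset_carrier)

text \<open>The submodule \<open>IX\<close>.\<close>

definition isub where
  "isub R I X = \<Inter>{N. submodule N R X \<and> (\<forall>a\<in>I. \<forall>x\<in>carrier X. a \<odot>\<^sub>X x \<in> N)}"

lemma isub_least: "submodule N R X ==> (\<And>a x. a \<in> I ==> x \<in> carrier X ==> a \<odot>\<^sub>X x \<in> N) ==> isub R I X \<subseteq> N"
  unfolding isub_def by blast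

lemma isub_mem: "a \<in> I ==> x \<in> carrier X ==> a \<odot>\<^sub>X x \<in> isub R I X"
  unfolding isub_def by blast

lemma isub_submod:
  assumes X: "left_module R X" and I: "I \<subseteq> carrier R"
  shows "submodule (isub R I X) R X"
proof (rule submodI[OF X])
  have "carrier X \<in> {N. submodule N R X \<and> (\<forall>a\<in>I. \<forall>x\<in>carrier X. a \<odot>\<^sub>X x \<in> N)}"
    using carrier_submod[OF X] lm_smult[OF X] I by auto
  thus "isub R I X \<subseteq> carrier X" unfolding isub_def by blast
qed (auto simp: isub_def submodD[OF X])

lemma isub_map:
  assumes X: "left_module R X" and Y: "left_module R Y" and f: "lin R X Y f" and I: "I \<subseteq> carrier R" and x: "x \<in> isub R I X"
  shows "f x \<in> isub R I Y"
proof -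
  have "isub R I X \<subseteq> {x \<in> carrier X. f x \<in> isub R I Y}"
    by (rule isub_least[OF preimage_submod[OF X Y f isub_submod[OF Y I]]])
       (use I in \<open>auto simp: lm_smult[OF X] lin_smult[OF f] lin_closed[OF f] isub_mem subset_iff\<close>)
  with x show ?thesis by blast
qed

lemma isub_surj:
  assumes X: "left_module R X" and Y: "left_module R Y" and f: "lin R X Y f" "f ` carrier X = carrier Y" and I: "I \<subseteq> carrier R"
    and y: "y \<in> isub R I Y"
  obtains x where "x \<in> isub R I X" "y = f x"
proof -
  have "isub R I Y \<subseteq> f ` isub R I X"
  proof (rule isub_least[OF image_submod[OF X Y f(1) isub_submod[OF X I]]])
    fix a y assume a: "a \<in> I" and "y \<in> carrier Y"
    then obtain x where x: "x \<in> carrier X" "y = f x" using surjE[OF f(2)] by blast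
    have "a \<odot>\<^sub>Y y = f (a \<odot>\<^sub>X x)" using a I x lin_smult[OF f(1)] by auto
    thus "a \<odot>\<^sub>Y y \<in> f ` isub R I X" using isub_mem[OF a x(1)] by blast
  qed
  with y that show thesis by blast
qed

text \<open>\<open>V\<close> is \<open>X/IX\<close>, given by a surjection and its kernel.\<close>

definition is_top where
  "is_top R I X V p \<longleftrightarrow> left_module R X \<and> left_module (quot_algebra R I) V \<and> lin R X (inflate R I V) p \<and>
     p ` carrier X = carrier V \<and> (\<forall>x\<in>carrier X. p x = \<zero>\<^sub>V \<longleftrightarrow> x \<in> isub R I X)"

text \<open>The socle of \<open>X\<close> relative to \<open>I\<close>: the largest submodule on which the quotient by \<open>I\<close> acts.\<close>

definition soc where "soc I X = {x \<in> carrier X. \<forall>a\<in>I. a \<odot>\<^sub>X x = \<zero>\<^sub>X}"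

definition is_soc where
  "is_soc R I X V i \<longleftrightarrow> left_module R X \<and> left_module (quot_algebra R I) V \<and> lin R (inflate R I V) X i \<and>
     inj_on i (carrier V) \<and> i ` carrier V = soc I X"

text \<open>A module annihilated by \<open>I\<close>, as a module over the quotient: all representatives of a coset act in
  the same way.\<close>

definition defl :: "('k, 'a) module \<Rightarrow> 'a set \<Rightarrow> ('a, 'm) module \<Rightarrow> ('a set, 'm) module" where
  "defl R I X = \<lparr>carrier = carrier X, monoid.mult = undefined, monoid.one = undefined, ring.zero = \<zero>\<^sub>X, ring.add = ring.add X,
     smult = (\<lambda>C x. (SOME a. a \<in> carrier R \<and> I +>\<^sub>R a = C) \<odot>\<^sub>X x)\<rparr>"

lemma defl_simps [simp]: "carrier (defl R I X) = carrier X" "\<zero>\<^bsub>defl R I X\<^esub> = \<zero>\<^sub>X" "x \<oplus>\<^bsub>defl R I X\<^esub> y = x \<oplus>\<^sub>X y"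
  by (simp_all add: defl_def)

lemma a_r_coset_opp [simp]: "I +>\<^bsub>R\<^sup>o\<^esub> a = I +>\<^sub>R a"
  by (auto simp: coset_mem)

lemma quot_opp: "quot_algebra R\<^sup>o I = opp_algebra (quot_algebra R I)"
proof -
  have "A_RCOSETS R\<^sup>o I = A_RCOSETS R I" by (simp add: coset_carrier)
  moreover have "set_add R\<^sup>o = set_add R" by (intro ext) (simp add: set_add_def')
  moreover have "rcoset_mult R\<^sup>o I = (\<lambda>x y. rcoset_mult R I y x)" by (intro ext) (auto simp: rcoset_mult_def)
  ultimately have "quot_algebra R\<^sup>o I = \<lparr>carrier = A_RCOSETS R I, monoid.mult = (\<lambda>x y. rcoset_mult R I y x),
    monoid.one = I +>\<^sub>R \<one>\<^sub>R, ring.zero = I, ring.add = set_add R, smult = (\<lambda>k X. \<Union>x\<in>X. I +>\<^sub>R (k \<odot>\<^sub>R x))\<rparr>"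
    by (simp add: quot_algebra_def FactRing_def)
  also have "\<dots> = opp_algebra (quot_algebra R I)"
    by (simp add: quot_algebra_def FactRing_def opp_algebra_def)
  finally show ?thesis .
qed

locale idl = fdalg K R for K :: "'k ring" and R :: "('k, 'a) module" +
  fixes I :: "'a set"
  assumes idl: "ideal I R"
begin

abbreviation B where "B \<equiv> quot_algebra R I"
abbreviation cls where "cls a \<equiv> I +>\<^sub>R a"
abbreviation infl where "infl X \<equiv> inflate R I X"

lemma I_sub: "I \<subseteq> carrier R"
  using idl by (simp add: ideal.Icarr subsetI)

lemma I_closed: "a \<in> I ==> x \<in> carrier R ==> x \<otimes>\<^sub>R a \<in> I" "a \<in> I ==> x \<in> carrier R ==> a \<otimes>\<^sub>R x \<in> I"
  using idl by (simp_all add: ideal.I_l_closed ideal.I_r_closed)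

lemma I_submod: "submodule I R (reg R)"
proof (rule submodI[OF regR])
  interpret ideal I R by (rule idl)
  show "\<zero>\<^bsub>reg R\<^esub> \<in> I" by simp
  show "x \<oplus>\<^bsub>reg R\<^esub> y \<in> I" if "x \<in> I" "y \<in> I" for x y using that by (simp add: a_closed)
qed (use I_sub I_closed in auto)

lemma I_addsub: "addsub I R"
proof -
  interpret ideal I R by (rule idl)
  show ?thesis unfolding addsub_def using RG I_sub by (simp add: a_closed)
qed

lemma cls_add: "a \<in> carrier R ==> b \<in> carrier R ==> cls a <+>\<^sub>R cls b = cls (a \<oplus>\<^sub>R b)"
  by (rule coset_add[OF I_addsub])

lemma cls_mult: "a \<in> carrier R ==> b \<in> carrier R ==> rcoset_mult R I (cls a) (cls b) = cls (a \<otimes>\<^sub>R b)"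
  using ideal.rcoset_mult_add[OF idl] by simp

lemma cls_smult:
  assumes k: "k \<in> carrier K" and a: "a \<in> carrier R"
  shows "(\<Union>x\<in>cls a. cls (k \<odot>\<^sub>R x)) = cls (k \<odot>\<^sub>R a)"
proof (rule coset_lift[OF I_addsub a I_addsub])
  fix y assume y: "y \<in> carrier R" "y \<ominus>\<^sub>R a \<in> I"
  have "k \<odot>\<^sub>R y \<ominus>\<^sub>R k \<odot>\<^sub>R a = (k \<odot>\<^sub>R \<one>\<^sub>R) \<otimes>\<^sub>R (y \<ominus>\<^sub>R a)"
    using y(1) a io[OF k] R ag_neg[OF RG]
    by (simp add: io_mult(1)[OF k, symmetric] a_minus_def ring.ring_simprules(23) ring.ring_simprules(27))
  thus "k \<odot>\<^sub>R y \<in> carrier R \<and> k \<odot>\<^sub>R y \<ominus>\<^sub>R k \<odot>\<^sub>R a \<in> I"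
    using I_closed(1)[OF y(2) io[OF k]] multR[OF io[OF k] y(1)] io_mult(1)[OF k y(1)] by simp
qed

lemma cls_zero: "a \<in> carrier R ==> cls a = I \<longleftrightarrow> a \<in> I"
  by (rule coset_eq_zero[OF I_addsub])

lemmas cls_ops = cls_add cls_mult cls_smult cls_zero

lemma B_ag: "abelian_group B"
proof (rule ag_intro)
  show "\<zero>\<^sub>B \<in> carrier B" using coset_zero[OF I_addsub] ag_zero[OF RG] by force
  fix C assume "C \<in> carrier B"
  then obtain a where a: "a \<in> carrier R" "C = cls a" by auto
  show "\<zero>\<^sub>B \<oplus>\<^sub>B C = C" using a cls_add[OF ag_zero[OF RG] a(1)] by (simp add: coset_zero[OF I_addsub] ag_lzero[OF RG])
  show "\<exists>D\<in>carrier B. D \<oplus>\<^sub>B C = \<zero>\<^sub>B"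
    by (rule bexI[of _ "cls (\<ominus>\<^sub>R a)"]) (use a in \<open>auto simp: cls_ops ag_simps[OF RG] coset_zero[OF I_addsub]\<close>)
  fix D assume "D \<in> carrier B"
  then obtain b where b: "b \<in> carrier R" "D = cls b" by auto
  show "C \<oplus>\<^sub>B D = D \<oplus>\<^sub>B C" using a b by (simp add: cls_ops ag_comm[OF RG])
qed (auto simp: cls_ops ag_simps[OF RG] ag_assoc[OF RG])

lemma B_alg: "fdalg K B"
proof
  have mon: "Group.monoid B"
    by (rule Group.monoidI) (auto simp: cls_ops multR oneR ring.ring_simprules(11,12)[OF R] monoid.r_one[OF ring.is_monoid[OF R]])
  have ringB: "ring B"
    by (rule ringI[OF B_ag mon]) (auto simp: cls_ops multR ag_closed[OF RG] ring.ring_simprules(13,23)[OF R])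
  have crK: "cring K" using fld by (simp add: field_def domain_def)
  note MK = module.smult_closed[OF KR] module.smult_l_distr[OF KR] module.smult_r_distr[OF KR] module.smult_assoc1[OF KR] module.smult_one[OF KR]
  note cK = ag_closed[OF KG] ring.ring_simprules(5)[OF K] oneK
  have modB: "Module.module K B"
  proof (rule moduleI[OF crK B_ag])
    fix k C assume k: "k \<in> carrier K" and "C \<in> carrier B"
    then obtain a where a: "a \<in> carrier R" "C = cls a" by auto
    show "k \<odot>\<^sub>B C \<in> carrier B" using k a MK(1) by (simp add: cls_smult)
    fix k' assume k': "k' \<in> carrier K"
    show "(k \<oplus>\<^sub>K k') \<odot>\<^sub>B C = k \<odot>\<^sub>B C \<oplus>\<^sub>B k' \<odot>\<^sub>B C"
      using k k' a MK(1) by (simp add: cls_smult cls_add cK MK(2))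
    show "(k \<otimes>\<^sub>K k') \<odot>\<^sub>B C = k \<odot>\<^sub>B (k' \<odot>\<^sub>B C)"
      using k k' a MK(1) by (simp add: cls_smult cK MK(4))
  next
    fix k C D assume k: "k \<in> carrier K" and "C \<in> carrier B" "D \<in> carrier B"
    then obtain a b where a: "a \<in> carrier R" "C = cls a" "b \<in> carrier R" "D = cls b" by auto
    show "k \<odot>\<^sub>B (C \<oplus>\<^sub>B D) = k \<odot>\<^sub>B C \<oplus>\<^sub>B k \<odot>\<^sub>B D"
      using k a MK(1) by (simp add: cls_smult cls_add ag_closed[OF RG] MK(3))
  next
    fix C assume "C \<in> carrier B"
    then obtain a where a: "a \<in> carrier R" "C = cls a" by auto
    show "\<one>\<^sub>K \<odot>\<^sub>B C = C" using a by (simp add: cls_smult oneK MK(5))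
  qed
  have sm: "(k \<odot>\<^sub>R a) \<otimes>\<^sub>R b = k \<odot>\<^sub>R (a \<otimes>\<^sub>R b)" "a \<otimes>\<^sub>R (k \<odot>\<^sub>R b) = k \<odot>\<^sub>R (a \<otimes>\<^sub>R b)"
    if "k \<in> carrier K" "a \<in> carrier R" "b \<in> carrier R" for k a b using alg that by (simp_all add: k_algebra_def)
  show algB: "k_algebra K B"
    unfolding k_algebra_def using fld ringB modB by (auto simp: cls_ops multR sm module.smult_closed[OF KR])
  have l: "lin K (kv R (reg R)) (kv B (reg B)) cls"
    by (rule linI) (auto simp: cls_ops oneR io multR)
  have lm: "left_module K (kv B (reg B))"
  proof (rule restrict_scalars_lm[OF regular_lm[OF ringB] K])
  qed (auto simp: cls_ops oneR io module.smult_l_distr[OF KR] module.smult_assoc1[OF KR] module.smult_one[OF KR] ag_closed[OF KG] ring.ring_simprules(5)[OF K]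
      io_mult(1) oneK)
  show "fin_generated K (kv B (reg B))"
    by (rule fg_image[OF kv_lm[OF regR] lm l _ fdR]) simp
qed

sublocale B: fdalg K "quot_algebra R I" by (rule B_alg)

lemma opp_idl: "idl K R\<^sup>o I"
proof -
  interpret O: fdalg K "R\<^sup>o" by (rule opp_alg)
  interpret i: ideal I R by (rule idl)
  have "ideal I R\<^sup>o"
  proof (rule idealI[OF O.R])
    have "add_monoid R\<^sup>o = add_monoid R" by (simp add: opp_algebra_def)
    thus "subgroup I (add_monoid R\<^sup>o)" using i.a_subgroup by simp
  qed (use I_closed in auto)
  thus ?thesis by (intro idl.intro opp_alg idl_axioms.intro)
qed

lemma infl_lm: "left_module B V ==> left_module R (infl V)"
  unfolding inflate_def by (rule restrict_scalars_lm[OF _ R]) (auto simp: cls_ops)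

lemma lin_infl: "lin R (infl V) (infl W) f \<longleftrightarrow> lin B V W f"
  by (auto simp: lin_def)

lemma infl_killed: "left_module B V ==> a \<in> I ==> x \<in> carrier V ==> cls a \<odot>\<^sub>V x = \<zero>\<^sub>V"
  using lm_zero_smult[of B V x] cls_zero[of a] I_sub by auto

lemma infl_submod:
  assumes V: "left_module B V" shows "submodule N R (infl V) \<longleftrightarrow> submodule N B V"
proof
  assume N: "submodule N R (infl V)"
  show "submodule N B V" by (rule submodI[OF V]) (use submodD[OF infl_lm[OF V] N] in auto)
next
  assume N: "submodule N B V"
  show "submodule N R (infl V)" by (rule submodI[OF infl_lm[OF V]]) (use submodD[OF V N] in auto)
qed

lemma infl_fg: "left_module B V ==> fin_generated R (infl V) \<longleftrightarrow> fin_generated B V"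
  unfolding fin_generated_def by (simp add: infl_submod)

lemma thru_infl: "thru R (infl M) (infl X) (infl Y) h \<longleftrightarrow> thru B M X Y h"
proof
  show "thru R (infl M) (infl X) (infl Y) h ==> thru B M X Y h"
  proof (induction rule: thru.induct)
    case (thru_add g u v h)
    then show ?case by (intro thru.thru_add[of B M X Y g u v h]) (auto simp: lin_infl)
  qed (auto intro: thru.thru_zero)
  show "thru B M X Y h ==> thru R (infl M) (infl X) (infl Y) h"
  proof (induction rule: thru.induct)
    case (thru_add g u v h)
    then show ?case by (intro thru.thru_add[of R "infl M" "infl X" "infl Y" g u v h]) (auto simp: lin_infl)
  qed (auto intro: thru.thru_zero)
qed

lemma defl:
  assumes X: "left_module R X" and k: "\<And>a x. a \<in> I ==> x \<in> carrier X ==> a \<odot>\<^sub>X x = \<zero>\<^sub>X"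
  shows "left_module B (defl R I X)" "\<And>a x. a \<in> carrier R ==> x \<in> carrier X ==> cls a \<odot>\<^bsub>defl R I X\<^esub> x = a \<odot>\<^sub>X x"
proof -
  note G = lm_ag[OF X]
  show s: "cls a \<odot>\<^bsub>defl R I X\<^esub> x = a \<odot>\<^sub>X x" if a: "a \<in> carrier R" and x: "x \<in> carrier X" for a x
  proof -
    define b where "b = (SOME b. b \<in> carrier R \<and> cls b = cls a)"
    have "\<exists>b. b \<in> carrier R \<and> cls b = cls a" using a by blast
    from someI_ex[OF this] have b: "b \<in> carrier R" "cls b = cls a" by (simp_all add: b_def)
    hence "b \<ominus>\<^sub>R a \<in> I" using coset_eq[OF I_addsub b(1) a] by simp
    from k[OF this x] have "b \<odot>\<^sub>X x \<ominus>\<^sub>X a \<odot>\<^sub>X x = \<zero>\<^sub>X"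
      using a b x by (simp add: a_minus_def lm_l_distr[OF X] lm_neg_smult[OF X] ag_neg[OF RG])
    hence "b \<odot>\<^sub>X x = a \<odot>\<^sub>X x" using ag_diff_zero[OF G lm_smult[OF X b(1) x] lm_smult[OF X a x]] by simp
    thus ?thesis by (simp add: defl_def b_def)
  qed
  show "left_module B (defl R I X)"
  proof (rule lm_intro[OF B.R])
    show "abelian_group (defl R I X)" by (rule ag_cong[OF G]) auto
  qed (auto simp: s cls_ops lm_smult[OF X] ag_closed[OF RG] multR oneR lm_l_distr[OF X] lm_r_distr[OF X] lm_assoc[OF X] lm_one[OF X] ag_closed[OF G])
qed

lemma top_exists:
  fixes X :: "('a, 'm) module"
  assumes X: "left_module R X"
  obtains V :: "('a set, 'm set) module" and p where "is_top R I X V p"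
proof -
  let ?N = "isub R I X"
  have N: "submodule ?N R X" by (rule isub_submod[OF X I_sub])
  let ?Q = "quot_module X ?N"
  have Q: "left_module R ?Q" by (rule quot_lm[OF X N])
  note p = quot_proj[OF X N]
  have k: "a \<odot>\<^sub>?Q C = \<zero>\<^sub>?Q" if "a \<in> I" "C \<in> carrier ?Q" for a C
  proof -
    obtain x where x: "x \<in> carrier X" "C = ?N +>\<^sub>X x" using \<open>C \<in> carrier ?Q\<close> by auto
    have a: "a \<in> carrier R" using that I_sub by auto
    have "a \<odot>\<^sub>?Q C = ?N +>\<^sub>X (a \<odot>\<^sub>X x)" unfolding x(2) by (rule lin_smult[OF p(1) a x(1), symmetric])
    also have "\<dots> = \<zero>\<^sub>?Q" using p(2)[OF lm_smult[OF X a x(1)]] isub_mem[OF that(1) x(1)] by blast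
    finally show ?thesis .
  qed
  note d = defl[OF Q k]
  have "is_top R I X (defl R I ?Q) (\<lambda>x. ?N +>\<^sub>X x)"
    unfolding is_top_def
  proof (intro conjI ballI)
    show "lin R X (infl (defl R I ?Q)) (\<lambda>x. ?N +>\<^sub>X x)"
    proof (rule linI)
      fix a x assume "a \<in> carrier R" "x \<in> carrier X"
      thus "?N +>\<^sub>X (a \<odot>\<^sub>X x) = a \<odot>\<^bsub>infl (defl R I ?Q)\<^esub> (?N +>\<^sub>X x)"
        unfolding inflate_simps using d(2)[of a "?N +>\<^sub>X x"] lin_smult[OF p(1), of a x] lin_closed[OF p(1), of x] by simp
    qed (use lin_closed[OF p(1)] lin_add[OF p(1)] in auto)
  qed (use X d(1) p(2) in auto)
  with that show thesis by blast
qed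

lemma topD:
  assumes "is_top R I X V p"
  shows "left_module R X" "left_module B V" "lin R X (infl V) p" "p ` carrier X = carrier V"
    "\<And>x. x \<in> carrier X ==> p x = \<zero>\<^sub>V \<longleftrightarrow> x \<in> isub R I X"
  using assms by (simp_all add: is_top_def)

lemma infl_top: "left_module B V ==> is_top R I (infl V) V (\<lambda>x. x)"
  unfolding is_top_def
proof (intro conjI ballI)
  assume V: "left_module B V"
  show "left_module R (infl V)" by (rule infl_lm[OF V])
  fix x
  have "isub R I (infl V) \<subseteq> {\<zero>\<^sub>V}"
    using zero_submod[OF infl_lm[OF V]] by (intro isub_least) (auto simp: infl_killed[OF V])
  thus "(x = \<zero>\<^sub>V) = (x \<in> isub R I (infl V))" using submodD(2)[OF infl_lm[OF V] isub_submod[OF infl_lm[OF V] I_sub]] by auto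
qed (auto intro: lin_id)

lemma top_univ:
  assumes t: "is_top R I X V p" and W: "left_module B W" and f: "lin R X (infl W) f"
  obtains f' where "lin B V W f'" "\<And>x. x \<in> carrier X ==> f' (p x) = f x"
proof -
  note d = topD[OF t]
  have W': "left_module R (infl W)" and V': "left_module R (infl V)" using infl_lm W d(2) by auto
  have "f x = \<zero>\<^sub>W" if "x \<in> carrier X" "p x = \<zero>\<^sub>V" for x
    using isub_map[OF d(1) W' f I_sub] d(5)[OF that(1)] that(2) topD(5)[OF infl_top[OF W], of "f x"] lin_closed[OF f that(1)] by simp
  then obtain f' where "lin R (infl V) (infl W) f'" "\<And>x. x \<in> carrier X ==> f' (p x) = f x"
    using lin_factor[OF d(1) W' V' d(3) _ f] d(4) by (metis inflate_simps(1,2))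
  with that show thesis by (auto simp: lin_infl)
qed

lemma top_map:
  assumes t: "is_top R I X V p" and t': "is_top R I Y W q" and f: "lin R X Y f"
  obtains f' where "lin B V W f'" "\<And>x. x \<in> carrier X ==> f' (p x) = q (f x)"
  by (rule top_univ[OF t topD(2)[OF t'] lin_comp[OF f topD(3)[OF t']]]) (rule that; assumption)

lemma top_iso:
  assumes t: "is_top R I X V p" and t': "is_top R I Y W q" and i: "mod_iso R X Y"
  shows "mod_iso B V W"
proof -
  note d = topD[OF t] and d' = topD[OF t']
  obtain f g where fg: "lin R X Y f" "lin R Y X g" "\<And>x. x \<in> carrier X ==> g (f x) = x" "\<And>y. y \<in> carrier Y ==> f (g y) = y"
    by (rule mod_isoE[OF i d(1) d'(1)]) (rule that; assumption)
  obtain f' where f': "lin B V W f'" "\<And>x. x \<in> carrier X ==> f' (p x) = q (f x)" by (rule top_map[OF t t' fg(1)]) (rule that; assumption)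
  obtain g' where g': "lin B W V g'" "\<And>x. x \<in> carrier Y ==> g' (q x) = p (g x)" by (rule top_map[OF t' t fg(2)]) (rule that; assumption)
  have "bij_betw f' (carrier V) (carrier W)"
  proof (rule bij_if_inverse[OF f'(1) g'(1)])
    fix v assume "v \<in> carrier V"
    then obtain x where "x \<in> carrier X" "v = p x" using d(4) by (metis image_iff)
    thus "g' (f' v) = v" using f'(2) g'(2)[OF lin_closed[OF fg(1)]] fg(3) by simp
  next
    fix v assume "v \<in> carrier W"
    then obtain x where "x \<in> carrier Y" "v = q x" using d'(4) by (metis image_iff)
    thus "f' (g' v) = v" using g'(2) f'(2)[OF lin_closed[OF fg(2)]] fg(4) by simp
  qed
  thus ?thesis by (rule mod_isoI[OF d(2) f'(1)])
qed

lemma top_thru: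
  assumes tM: "is_top R I M U m" and t: "is_top R I X V p" and th: "summand R M X"
  shows "summand B U V"
proof -
  note d = topD[OF t]
  have "\<exists>h'. thru B U V V h' \<and> (\<forall>x\<in>carrier X. h' (p x) = p (h x))" if "thru R M X X h" for h
    using that
  proof (induction rule: thru.induct)
    case (thru_zero h)
    have "thru B U V V (\<lambda>x. \<zero>\<^sub>V)" by (rule thru.thru_zero) simp
    moreover have "p \<zero>\<^sub>X = \<zero>\<^sub>V" using lm_lin_zero[OF d(3) d(1) infl_lm[OF d(2)]] by simp
    ultimately show ?case using thru_zero by (intro exI[of _ "\<lambda>x. \<zero>\<^sub>V"]) simp
  next
    case (thru_add g u v h)
    then obtain g' where g': "thru B U V V g'" "\<forall>x\<in>carrier X. g' (p x) = p (g x)" by blast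
    obtain u' where u': "lin B V U u'" "\<And>x. x \<in> carrier X ==> u' (p x) = m (u x)"
      by (rule top_map[OF t tM thru_add.hyps(2)]) (rule that; assumption)
    obtain v' where v': "lin B U V v'" "\<And>x. x \<in> carrier M ==> v' (m x) = p (v x)"
      by (rule top_map[OF tM t thru_add.hyps(3)]) (rule that; assumption)
    have "thru B U V V (\<lambda>x. g' x \<oplus>\<^sub>V v' (u' x))" by (rule thru.thru_add[OF g'(1) u'(1) v'(1) refl])
    moreover have "g' (p x) \<oplus>\<^sub>V v' (u' (p x)) = p (h x)" if x: "x \<in> carrier X" for x
      using x g'(2) u'(2)[OF x] v'(2)[OF lin_closed[OF thru_add.hyps(2) x]] thru_add.hyps(4)[OF x]
        lin_add[OF d(3) lin_closed[OF thru_lin[OF thru_add.hyps(1) d(1,1)] x] lin_closed[OF thru_add.hyps(3) lin_closed[OF thru_add.hyps(2) x]]] by simp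
    ultimately show ?case by (intro exI[of _ "\<lambda>x. g' x \<oplus>\<^sub>V v' (u' x)"]) simp
  qed
  from this[OF th] obtain h' where h': "thru B U V V h'" "\<forall>x\<in>carrier X. h' (p x) = p x" by blast
  show ?thesis
  proof (rule thru_cong[OF h'(1)])
    fix v assume "v \<in> carrier V"
    then have "v \<in> p ` carrier X" by (simp only: d(4))
    thus "v = h' v" using h'(2) by auto
  qed
qed

lemma reg_top: "is_top R I (reg R) (reg B) cls"
  unfolding is_top_def
proof (intro conjI ballI)
  show "lin R (reg R) (infl (reg B)) cls" by (rule linI) (auto simp: cls_ops)
  fix x assume x: "x \<in> carrier (reg R)"
  have "isub R I (reg R) \<subseteq> I" by (rule isub_least[OF I_submod]) (auto simp: I_closed)
  moreover have "I \<subseteq> isub R I (reg R)"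
  proof
    fix a assume a: "a \<in> I"
    hence "a \<otimes>\<^sub>R \<one>\<^sub>R = a" using I_sub R by (auto simp: monoid.r_one ring.is_monoid)
    thus "a \<in> isub R I (reg R)" using isub_mem[OF a, of "\<one>\<^sub>R" "reg R" R] oneR by simp
  qed
  ultimately show "(cls x = \<zero>\<^bsub>reg B\<^esub>) = (x \<in> isub R I (reg R))" using x cls_zero by auto
qed (auto simp: regR B.regR)

lemma top_proj: "is_top R I P V p ==> proj R P ==> proj B V"
  by (rule top_thru[OF reg_top])

lemma soc_submod: assumes X: "left_module R X" shows "submodule (soc I X) R X"
proof (rule submodI[OF X])
  fix b x assume b: "b \<in> carrier R" and x: "x \<in> soc I X"
  have "a \<odot>\<^sub>X (b \<odot>\<^sub>X x) = \<zero>\<^sub>X" if a: "a \<in> I" for a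
  proof -
    have "(a \<otimes>\<^sub>R b) \<odot>\<^sub>X x = \<zero>\<^sub>X" using x I_closed(2)[OF a b] by (simp add: soc_def)
    thus ?thesis using lm_assoc[OF X _ b, of a x] a I_sub x by (auto simp: soc_def)
  qed
  thus "b \<odot>\<^sub>X x \<in> soc I X" using x b lm_smult[OF X] by (simp add: soc_def)
qed (use I_sub in \<open>auto simp: soc_def lm_smult_zero[OF X] ag_simps[OF lm_ag[OF X]] lm_r_distr[OF X] subset_iff\<close>)

lemma soc_exists:
  fixes X :: "('a, 'm) module"
  assumes X: "left_module R X"
  obtains V :: "('a set, 'm) module" and i where "is_soc R I X V i"
proof -
  let ?S = "X\<restriction>(soc I X)"
  have S: "left_module R ?S" by (rule sub_lm[OF X soc_submod[OF X]])
  have k: "a \<odot>\<^sub>?S x = \<zero>\<^sub>?S" if "a \<in> I" "x \<in> carrier ?S" for a x using that by (simp add: soc_def)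
  note d = defl[OF S k]
  have "is_soc R I X (defl R I ?S) (\<lambda>x. x)"
    unfolding is_soc_def
  proof (intro conjI)
    show "lin R (infl (defl R I ?S)) X (\<lambda>x. x)" by (rule linI) (use d(2) in \<open>auto simp: soc_def\<close>)
  qed (use X d(1) in auto)
  with that show thesis by blast
qed

lemma socD:
  assumes "is_soc R I X V i"
  shows "left_module R X" "left_module B V" "lin R (infl V) X i" "inj_on i (carrier V)" "i ` carrier V = soc I X"
  using assms by (simp_all add: is_soc_def)

lemma soc_univ:
  assumes s: "is_soc R I X V i" and W: "left_module B W" and f: "lin R (infl W) X f"
  obtains f' where "lin B W V f'" "\<And>x. x \<in> carrier W ==> i (f' x) = f x"
proof -
  note d = socD[OF s]
  let ?S = "X\<restriction>(soc I X)"
  have S: "left_module R ?S" by (rule sub_lm[OF d(1) soc_submod[OF d(1)]])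
  note sub = submodD(1)[OF d(1) soc_submod[OF d(1)]]
  have il: "lin R (infl V) ?S i" using d(3,5) by (subst lin_into_sub[OF sub]) auto
  have "bij_betw i (carrier (infl V)) (carrier ?S)" using d(4,5) by (simp add: bij_betw_def)
  from lin_inverse[OF infl_lm[OF d(2)] S il this] obtain j where j: "lin R ?S (infl V) j" "\<And>y. y \<in> carrier ?S ==> i (j y) = y" by metis
  have fs: "f x \<in> soc I X" if x: "x \<in> carrier W" for x
  proof -
    have "a \<odot>\<^sub>X f x = \<zero>\<^sub>X" if a: "a \<in> I" for a
    proof -
      have "a \<odot>\<^sub>X f x = f (a \<odot>\<^bsub>infl W\<^esub> x)" using lin_smult[OF f, of a x] a I_sub x by auto
      also have "\<dots> = \<zero>\<^sub>X" using infl_killed[OF W a x] lm_lin_zero[OF f infl_lm[OF W] d(1)] by simp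
      finally show ?thesis .
    qed
    thus ?thesis using lin_closed[OF f, of x] x by (simp add: soc_def)
  qed
  have "lin R (infl W) ?S f" using f fs by (subst lin_into_sub[OF sub]) simp
  from lin_comp[OF this j(1)] have "lin B W V (\<lambda>x. j (f x))" by (simp add: lin_infl)
  moreover have "i (j (f x)) = f x" if "x \<in> carrier W" for x using j(2) fs[OF that] by simp
  ultimately show thesis using that by blast
qed

lemma soc_map:
  assumes s: "is_soc R I X V i" and s': "is_soc R I Y W j" and f: "lin R X Y f"
  obtains f' where "lin B V W f'" "\<And>x. x \<in> carrier V ==> j (f' x) = f (i x)"
  by (rule soc_univ[OF s' socD(2)[OF s] lin_comp[OF socD(3)[OF s] f]]) (rule that; assumption)

lemma soc_iso:
  assumes s: "is_soc R I X V i" and s': "is_soc R I Y W j" and iso: "mod_iso R X Y"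
  shows "mod_iso B V W"
proof -
  note d = socD[OF s] and d' = socD[OF s']
  obtain f g where fg: "lin R X Y f" "lin R Y X g" "\<And>x. x \<in> carrier X ==> g (f x) = x" "\<And>y. y \<in> carrier Y ==> f (g y) = y"
    by (rule mod_isoE[OF iso d(1) d'(1)]) (rule that; assumption)
  obtain f' where f': "lin B V W f'" "\<And>x. x \<in> carrier V ==> j (f' x) = f (i x)" by (rule soc_map[OF s s' fg(1)]) (rule that; assumption)
  obtain g' where g': "lin B W V g'" "\<And>x. x \<in> carrier W ==> i (g' x) = g (j x)" by (rule soc_map[OF s' s fg(2)]) (rule that; assumption)
  have "bij_betw f' (carrier V) (carrier W)"
  proof (rule bij_if_inverse[OF f'(1) g'(1)])
    fix v assume v: "v \<in> carrier V"
    have c: "f' v \<in> carrier W" "g' (f' v) \<in> carrier V" using lin_closed[OF f'(1) v] lin_closed[OF g'(1)] by auto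
    have "i (g' (f' v)) = i v" using g'(2)[OF c(1)] f'(2)[OF v] fg(3) lin_closed[OF d(3)] v by simp
    thus "g' (f' v) = v" by (rule inj_onD[OF d(4) _ c(2) v])
  next
    fix v assume v: "v \<in> carrier W"
    have c: "g' v \<in> carrier V" "f' (g' v) \<in> carrier W" using lin_closed[OF g'(1) v] lin_closed[OF f'(1)] by auto
    have "j (f' (g' v)) = j v" using f'(2)[OF c(1)] g'(2)[OF v] fg(4) lin_closed[OF d'(3)] v by simp
    thus "f' (g' v) = v" by (rule inj_onD[OF d'(4) _ c(2) v])
  qed
  thus ?thesis by (rule mod_isoI[OF d(2) f'(1)])
qed

lemma soc_thru:
  assumes sM: "is_soc R I M U m" and s: "is_soc R I X V i" and th: "summand R M X"
  shows "summand B U V"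
proof -
  note d = socD[OF s]
  have "\<exists>h'. thru B U V V h' \<and> (\<forall>x\<in>carrier V. i (h' x) = h (i x))" if "thru R M X X h" for h
    using that
  proof (induction rule: thru.induct)
    case (thru_zero h)
    have "thru B U V V (\<lambda>x. \<zero>\<^sub>V)" by (rule thru.thru_zero) simp
    moreover have "i \<zero>\<^sub>V = \<zero>\<^sub>X" using lm_lin_zero[OF d(3) infl_lm[OF d(2)] d(1)] by simp
    ultimately show ?case using thru_zero lin_closed[OF d(3)] by (intro exI[of _ "\<lambda>x. \<zero>\<^sub>V"]) simp
  next
    case (thru_add g u v h)
    then obtain g' where g': "thru B U V V g'" "\<forall>x\<in>carrier V. i (g' x) = g (i x)" by blast
    obtain u' where u': "lin B V U u'" "\<And>x. x \<in> carrier V ==> m (u' x) = u (i x)"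
      by (rule soc_map[OF s sM thru_add.hyps(2)]) (rule that; assumption)
    obtain v' where v': "lin B U V v'" "\<And>x. x \<in> carrier U ==> i (v' x) = v (m x)"
      by (rule soc_map[OF sM s thru_add.hyps(3)]) (rule that; assumption)
    have "thru B U V V (\<lambda>x. g' x \<oplus>\<^sub>V v' (u' x))" by (rule thru.thru_add[OF g'(1) u'(1) v'(1) refl])
    moreover have "i (g' x \<oplus>\<^sub>V v' (u' x)) = h (i x)" if x: "x \<in> carrier V" for x
    proof -
      have c: "g' x \<in> carrier V" "u' x \<in> carrier U" "v' (u' x) \<in> carrier V"
        using lin_closed[OF thru_lin[OF g'(1) d(2,2)] x] lin_closed[OF u'(1) x] lin_closed[OF v'(1)] by auto
      show ?thesis using c x g'(2) u'(2)[OF x] v'(2)[OF c(2)] thru_add.hyps(4)[of "i x"] lin_closed[OF d(3), of x]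
          lin_add[OF d(3), of "g' x" "v' (u' x)"] by simp
    qed
    ultimately show ?case by (intro exI[of _ "\<lambda>x. g' x \<oplus>\<^sub>V v' (u' x)"]) simp
  qed
  from this[OF th] obtain h' where h': "thru B U V V h'" "\<forall>x\<in>carrier V. i (h' x) = i x" by blast
  show ?thesis
  proof (rule thru_cong[OF h'(1)])
    fix v assume v: "v \<in> carrier V"
    have "h' v = v" by (rule inj_onD[OF d(4) _ lin_closed[OF thru_lin[OF h'(1) d(2,2)] v] v]) (use h'(2) v in simp)
    thus "v = h' v" by simp
  qed
qed

lemma dual_B_carrier: "carrier (B.D V) = carrier (D (infl V))"
  by (auto simp: mod_hom_iff lin_def oneR cls_smult io)

text \<open>A functional vanishes on the socle of \<open>X\<close> iff it lies in \<open>I (D X)\<close>, since an element of \<open>X\<close> is killed by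
  all functionals \<open>p(a -)\<close> with \<open>a \<in> I\<close> iff it is in the socle.\<close>

lemma soc_dual_top:
  fixes X :: "('a, 'm) module"
  assumes s: "is_soc R I X V i" and fg: "fin_generated R X"
  shows "is_top R\<^sup>o I (D X) (B.D V) (dmap V i)"
  unfolding is_top_def
proof (intro conjI ballI)
  note d = socD[OF s]
  note X = d(1) and DX = dual_lm[OF d(1)] and N = soc_submod[OF d(1)]
  interpret O: idl K "R\<^sup>o" I by (rule opp_idl)
  show DV: "left_module (quot_algebra R\<^sup>o I) (B.D V)"
    unfolding quot_opp by (rule B.dual_lm[OF d(2)])
  show "left_module R\<^sup>o (D X)" by (rule DX)
  have iV: "left_module R (infl V)" by (rule infl_lm[OF d(2)])
  have ic: "i v \<in> carrier X" if "v \<in> carrier V" for v using lin_closed[OF d(3)] that by simp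
  show dl: "lin R\<^sup>o (D X) (inflate R\<^sup>o I (B.D V)) (dmap V i)"
  proof (rule linI)
    fix p assume p: "p \<in> carrier (D X)"
    have "dmap (infl V) i p \<in> carrier (D (infl V))" by (rule dmap_closed[OF d(3) iV p])
    thus "dmap V i p \<in> carrier (inflate R\<^sup>o I (B.D V))"
      unfolding inflate_simps dual_B_carrier by (simp add: dmap_def del: dual_simps)
  next
    fix p q show "dmap V i (p \<oplus>\<^bsub>D X\<^esub> q) = dmap V i p \<oplus>\<^bsub>inflate R\<^sup>o I (B.D V)\<^esub> dmap V i q"
      unfolding dmap_def inflate_simps dual_simps by (rule restrict_ext) (simp add: ic)
  next
    fix a p assume "a \<in> carrier R\<^sup>o"
    hence a: "a \<in> carrier R" by simp
    have "i (cls a \<odot>\<^sub>V v) = a \<odot>\<^sub>X i v" if "v \<in> carrier V" for v using lin_smult[OF d(3) a] that by simp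
    moreover have "cls a \<odot>\<^sub>V v \<in> carrier V" if "v \<in> carrier V" for v using lm_smult[OF iV a] that by simp
    ultimately show "dmap V i (a \<odot>\<^bsub>D X\<^esub> p) = a \<odot>\<^bsub>inflate R\<^sup>o I (B.D V)\<^esub> dmap V i p"
      unfolding dmap_def inflate_simps dual_simps by (intro restrict_ext) (simp add: ic)
  qed
  show "dmap V i ` carrier (D X) = carrier (B.D V)"
  proof
    show "dmap V i ` carrier (D X) \<subseteq> carrier (B.D V)" using lin_closed[OF dl] by (auto simp del: dual_simps)
    show "carrier (B.D V) \<subseteq> dmap V i ` carrier (D X)"
    proof
      fix q assume q: "q \<in> carrier (B.D V)"
      hence q': "q \<in> carrier (D (infl V))" by (simp only: dual_B_carrier)
      let ?S = "X\<restriction>(soc I X)"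
      have S: "left_module R ?S" by (rule sub_lm[OF X N])
      have il: "lin R (infl V) ?S i" using d(3,5) by (subst lin_into_sub[OF submodD(1)[OF X N]]) auto
      have "bij_betw i (carrier (infl V)) (carrier ?S)" using d(4,5) by (simp add: bij_betw_def)
      from lin_inverse[OF iV S il this] obtain j where j: "lin R ?S (infl V) j" "\<And>x. x \<in> carrier V ==> j (i x) = x" by (metis inflate_simps(1))
      obtain p where p: "p \<in> carrier (D X)" "\<And>y. y \<in> soc I X ==> p y = dmap ?S j q y"
        by (rule extend_dual[OF X fg N dmap_closed[OF j(1) S q']]) (rule that; assumption)
      have "dmap V i p = q"
      proof (rule B.dual_eqI[of _ V])
        show "dmap V i p \<in> carrier (B.D V)" using lin_closed[OF dl p(1)] by (simp del: dual_simps)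
        fix v assume v: "v \<in> carrier V"
        have "i v \<in> soc I X" using d(5) v by blast
        thus "dmap V i p v = q v" using v p(2) j(2)[OF v] by (simp add: dmap_def)
      qed (rule q)
      with p(1) show "q \<in> dmap V i ` carrier (D X)" by blast
    qed
  qed
  fix p assume p: "p \<in> carrier (D X)"
  have "dmap V i p = \<zero>\<^bsub>B.D V\<^esub> \<longleftrightarrow> (\<forall>v\<in>carrier V. p (i v) = \<zero>\<^sub>K)"
    unfolding dmap_def by (auto simp: restrict_def fun_eq_iff)
  also have "\<dots> \<longleftrightarrow> (\<forall>x\<in>soc I X. p x = \<zero>\<^sub>K)" unfolding d(5)[symmetric] by blast
  also have "\<dots> \<longleftrightarrow> p \<in> isub R\<^sup>o I (D X)"
  proof
    assume v: "\<forall>x\<in>soc I X. p x = \<zero>\<^sub>K"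
    show "p \<in> isub R\<^sup>o I (D X)"
    proof (rule ccontr)
      assume np: "p \<notin> isub R\<^sup>o I (D X)"
      obtain P where P: "P \<in> carrier (D (D X))" "\<And>y. y \<in> isub R\<^sup>o I (D X) ==> P y = \<zero>\<^sub>K" "P p \<noteq> \<zero>\<^sub>K"
        using O.separate_dual[OF DX dual_fg[OF X fg] isub_submod[OF DX O.I_sub] p np] by (metis dual_opp)
      have "P \<in> evm X ` carrier X" using P(1) evm_bij[OF X fg] by (simp only: bij_betw_def)
      then obtain x where x: "x \<in> carrier X" "P = evm X x" by blast
      have Px: "P q = q x" if "q \<in> carrier (D X)" for q using that unfolding x(2) evm_def by (rule restrict_apply')
      have "a \<odot>\<^sub>X x = \<zero>\<^sub>X" if a: "a \<in> I" for a
      proof (rule ccontr)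
        assume n: "a \<odot>\<^sub>X x \<noteq> \<zero>\<^sub>X"
        have aR: "a \<in> carrier R" using a I_sub by auto
        have ax: "a \<odot>\<^sub>X x \<in> carrier X" by (rule lm_smult[OF X aR x(1)])
        obtain q where q: "q \<in> carrier (D X)" "q (a \<odot>\<^sub>X x) \<noteq> \<zero>\<^sub>K"
          by (rule separate_dual[OF X fg zero_submod[OF X] ax]) (use n in \<open>auto intro: that simp del: dual_simps\<close>)
        have "a \<odot>\<^bsub>D X\<^esub> q \<in> carrier (D X)" using lm_smult[OF DX _ q(1)] aR by simp
        from Px[OF this] have "P (a \<odot>\<^bsub>D X\<^esub> q) = q (a \<odot>\<^sub>X x)" using x(1) by simp
        moreover have "P (a \<odot>\<^bsub>D X\<^esub> q) = \<zero>\<^sub>K" by (rule P(2)[OF isub_mem[OF a q(1)]])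
        ultimately show False using q(2) by simp
      qed
      hence "x \<in> soc I X" using x(1) by (simp add: soc_def)
      thus False using v Px[OF p] P(3) by simp
    qed
  next
    assume pi: "p \<in> isub R\<^sup>o I (D X)"
    let ?N = "{q \<in> carrier (D X). \<forall>x\<in>soc I X. q x = \<zero>\<^sub>K}"
    have sc: "x \<in> carrier X" if "x \<in> soc I X" for x using that by (simp add: soc_def)
    have "submodule ?N R\<^sup>o (D X)"
    proof (rule submodI[OF DX])
      show "\<zero>\<^bsub>D X\<^esub> \<in> ?N" using lm_zero[OF DX] sc by simp
      fix q r assume "q \<in> ?N" "r \<in> ?N"
      thus "q \<oplus>\<^bsub>D X\<^esub> r \<in> ?N" using lm_closed[OF DX, of q r] sc by (simp add: ag_lzero[OF KG] ag_zero[OF KG])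
    next
      fix a q assume a: "a \<in> carrier R\<^sup>o" and q: "q \<in> ?N"
      thus "a \<odot>\<^bsub>D X\<^esub> q \<in> ?N" using lm_smult[OF DX a, of q] sc submodD(4)[OF X N] by simp
    qed auto
    moreover have "a \<odot>\<^bsub>D X\<^esub> q \<in> ?N" if a: "a \<in> I" and q: "q \<in> carrier (D X)" for a q
    proof -
      have aR: "a \<in> carrier R" using a I_sub by auto
      have "a \<odot>\<^bsub>D X\<^esub> q \<in> carrier (D X)" by (rule lm_smult[OF DX _ q]) (simp add: aR)
      moreover have "(a \<odot>\<^bsub>D X\<^esub> q) x = \<zero>\<^sub>K" if "x \<in> soc I X" for x
        using that a sc[OF that] dual_zero[OF q X] by (simp add: soc_def)
      ultimately show ?thesis by (simp del: dual_simps)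
    qed
    ultimately have "isub R\<^sup>o I (D X) \<subseteq> ?N" by (intro isub_least) auto
    with pi show "\<forall>x\<in>soc I X. p x = \<zero>\<^sub>K" by blast
  qed
  finally show "(dmap V i p = \<zero>\<^bsub>B.D V\<^esub>) = (p \<in> isub R\<^sup>o I (D X))" .
qed

section \<open>Transposes over a quotient algebra\<close>

text \<open>Write the identity of \<open>P\<close> as \<open>x \<mapsto> \<Sum> u\<^sub>i(x) v\<^sub>i 1\<close>. Then \<open>l\<close> is the sum of the \<open>u\<^sub>i\<close>, multiplied by
  \<open>l(v\<^sub>i 1) \<in> I\<close>.\<close>

lemma star_isub:
  assumes P: "left_module R P" "proj R P" and l: "l \<in> carrier (star R P)"
  shows "l \<in> isub R\<^sup>o I (star R P) \<longleftrightarrow> (\<forall>x\<in>carrier P. l x \<in> I)"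
proof
  let ?S = "star R P"
  note S = star_lm[OF P(1)]
  interpret O: idl K "R\<^sup>o" I by (rule opp_idl)
  let ?N = "{k \<in> carrier ?S. \<forall>x\<in>carrier P. k x \<in> I}"
  note DI = submodD[OF regR I_submod]
  have "submodule ?N R\<^sup>o ?S"
  proof (rule submodI[OF S])
    show "\<zero>\<^sub>?S \<in> ?N" using lm_zero[OF S] DI(2) by simp
    fix q r assume "q \<in> ?N" "r \<in> ?N"
    thus "q \<oplus>\<^sub>?S r \<in> ?N" using lm_closed[OF S, of q r] DI(3) by simp
  next
    fix a q assume a: "a \<in> carrier R\<^sup>o" and q: "q \<in> ?N"
    thus "a \<odot>\<^sub>?S q \<in> ?N" using lm_smult[OF S a, of q] I_closed by simp
  qed auto
  moreover have "a \<odot>\<^sub>?S q \<in> ?N" if a: "a \<in> I" and q: "q \<in> carrier ?S" for a q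
    using lm_smult[OF S _ q, of a] a I_sub I_closed star_closed[OF q] by auto
  ultimately have "isub R\<^sup>o I ?S \<subseteq> ?N" by (intro isub_least) auto
  thus "l \<in> isub R\<^sup>o I ?S ==> \<forall>x\<in>carrier P. l x \<in> I" by blast
  assume lI: "\<forall>x\<in>carrier P. l x \<in> I"
  note Isub = isub_submod[OF S O.I_sub]
  have "(\<lambda>x\<in>carrier P. l (h x)) \<in> isub R\<^sup>o I ?S" if "thru R (reg R) P P h" for h
    using that
  proof (induction rule: thru.induct)
    case (thru_zero h)
    have "(\<lambda>x\<in>carrier P. l (h x)) = \<zero>\<^sub>?S"
      using thru_zero lm_lin_zero[OF star_lin[OF l] P(1) regR] by (simp cong: restrict_cong)
    thus ?case using submodD(2)[OF S Isub] by (simp only:)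
  next
    case (thru_add g u v h)
    have v1: "v \<one>\<^sub>R \<in> carrier P" using lin_closed[OF thru_add.hyps(3)] oneR by simp
    let ?u = "restrict u (carrier P)"
    have u: "?u \<in> carrier ?S" by (rule starI[OF P(1) thru_add.hyps(2)])
    have "(\<lambda>x\<in>carrier P. l (h x)) = (\<lambda>x\<in>carrier P. l (g x)) \<oplus>\<^sub>?S l (v \<one>\<^sub>R) \<odot>\<^sub>?S ?u"
      unfolding star_simps
    proof (rule restrict_ext)
      fix x assume x: "x \<in> carrier P"
      have ux: "u x \<in> carrier R" using lin_closed[OF thru_add.hyps(2) x] by simp
      have gx: "g x \<in> carrier P" by (rule lin_closed[OF thru_lin[OF thru_add.hyps(1) P(1,1)] x])
      have "l (v (u x)) = u x \<otimes>\<^sub>R l (v \<one>\<^sub>R)"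
        using lin_regular[OF R thru_add.hyps(3) ux] lin_smult[OF star_lin[OF l] ux v1] by simp
      thus "l (h x) = (\<lambda>x\<in>carrier P. l (g x)) x \<oplus>\<^sub>R (\<lambda>x\<in>carrier P. ?u x \<otimes>\<^sub>R l (v \<one>\<^sub>R)) x"
        using x thru_add.hyps(4)[OF x] lin_add[OF star_lin[OF l] gx, of "v (u x)"] lin_closed[OF thru_add.hyps(3), of "u x"] ux by simp
    qed
    moreover have "(\<lambda>x\<in>carrier P. l (g x)) \<oplus>\<^sub>?S l (v \<one>\<^sub>R) \<odot>\<^sub>?S ?u \<in> isub R\<^sup>o I ?S"
      by (rule submodD(3)[OF S Isub thru_add.IH isub_mem[OF _ u]]) (use lI v1 in blast)
    ultimately show ?case by (simp only:)
  qed
  from this[OF P(2)] show "l \<in> isub R\<^sup>o I ?S" using l by (simp add: mod_hom_iff extensional_restrict)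
qed

text \<open>Every homomorphism from \<open>P/IP\<close> to \<open>B\<close> is reached because the composite \<open>P \<rightarrow> P/IP \<rightarrow> B\<close> lifts to \<open>R\<close>.\<close>

lemma star_reduce:
  assumes t: "is_top R I P V p" and P: "proj R P"
  obtains r where "lin R\<^sup>o (star R P) (inflate R\<^sup>o I (star B V)) r"
    "r ` carrier (star R P) = carrier (star B V)"
    "\<And>l x. l \<in> carrier (star R P) ==> x \<in> carrier P ==> r l (p x) = cls (l x)"
proof -
  note d = topD[OF t] and rt = topD[OF reg_top]
  let ?S = "star R P" and ?T = "star B V"
  have surj: "v \<in> carrier V ==> \<exists>x\<in>carrier P. v = p x" for v
  proof -
    assume "v \<in> carrier V"
    hence "v \<in> p ` carrier P" by (simp only: d(4))
    thus ?thesis by blast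
  qed
  have pc: "p x \<in> carrier V" if "x \<in> carrier P" for x using lin_closed[OF d(3) that] by simp
  have ex: "\<exists>k. k \<in> carrier ?T \<and> (\<forall>x\<in>carrier P. k (p x) = cls (l x))" if l: "l \<in> carrier ?S" for l
  proof -
    obtain k where k: "lin B V (reg B) k" "\<And>x. x \<in> carrier P ==> k (p x) = cls (l x)"
      by (rule top_univ[OF t B.regR lin_comp[OF star_lin[OF l] rt(3)]]) (rule that; assumption)
    show ?thesis by (rule exI[of _ "restrict k (carrier V)"]) (use starI[OF d(2) k(1)] k(2) pc in \<open>simp del: star_simps\<close>)
  qed
  define r where "r l = (SOME k. k \<in> carrier ?T \<and> (\<forall>x\<in>carrier P. k (p x) = cls (l x)))" for l
  have r: "r l \<in> carrier ?T" "\<And>x. x \<in> carrier P ==> r l (p x) = cls (l x)" if "l \<in> carrier ?S" for l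
    using someI_ex[OF ex[OF that]] unfolding r_def by blast+
  have uniq: "k = k'" if "k \<in> carrier ?T" "k' \<in> carrier ?T" "\<And>x. x \<in> carrier P ==> k (p x) = k' (p x)" for k k'
    by (rule star_eqI[OF that(1,2)]) (use surj that(3) in blast)
  note S = star_lm[OF d(1)]
  have T: "left_module (quot_algebra R\<^sup>o I) ?T" unfolding quot_opp by (rule star_lm[OF d(2)])
  interpret O: idl K "R\<^sup>o" I by (rule opp_idl)
  note iT = O.infl_lm[OF T]
  have "lin R\<^sup>o ?S (inflate R\<^sup>o I ?T) r"
  proof (rule linI)
    fix k l assume kl: "k \<in> carrier ?S" "l \<in> carrier ?S"
    show "r (k \<oplus>\<^sub>?S l) = r k \<oplus>\<^bsub>inflate R\<^sup>o I ?T\<^esub> r l"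
    proof (rule uniq)
      have s: "k \<oplus>\<^sub>?S l \<in> carrier ?S" by (rule lm_closed[OF S kl])
      show "r (k \<oplus>\<^sub>?S l) \<in> carrier ?T" by (rule r(1)[OF s])
      show "r k \<oplus>\<^bsub>inflate R\<^sup>o I ?T\<^esub> r l \<in> carrier ?T"
        using lm_closed[OF iT, of "r k" "r l"] r(1)[OF kl(1)] r(1)[OF kl(2)] by (simp del: star_simps)
      fix x assume x: "x \<in> carrier P"
      show "r (k \<oplus>\<^sub>?S l) (p x) = (r k \<oplus>\<^bsub>inflate R\<^sup>o I ?T\<^esub> r l) (p x)"
        unfolding r(2)[OF s x] using x pc[OF x] r(2)[OF kl(1) x] r(2)[OF kl(2) x] star_closed[OF kl(1) x] star_closed[OF kl(2) x] by (simp add: cls_ops)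
    qed
  next
    fix a k assume "a \<in> carrier R\<^sup>o" and k: "k \<in> carrier ?S"
    hence a: "a \<in> carrier R" by simp
    show "r (a \<odot>\<^sub>?S k) = a \<odot>\<^bsub>inflate R\<^sup>o I ?T\<^esub> r k"
    proof (rule uniq)
      have s: "a \<odot>\<^sub>?S k \<in> carrier ?S" by (rule lm_smult[OF S _ k]) (use a in simp)
      show "r (a \<odot>\<^sub>?S k) \<in> carrier ?T" by (rule r(1)[OF s])
      show "a \<odot>\<^bsub>inflate R\<^sup>o I ?T\<^esub> r k \<in> carrier ?T"
        using lm_smult[OF iT, of a "r k"] r(1)[OF k] a by (simp del: star_simps)
      fix x assume x: "x \<in> carrier P"
      show "r (a \<odot>\<^sub>?S k) (p x) = (a \<odot>\<^bsub>inflate R\<^sup>o I ?T\<^esub> r k) (p x)"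
        unfolding r(2)[OF s x] using x pc[OF x] r(2)[OF k x] star_closed[OF k x] a by (simp add: cls_ops)
    qed
  qed (use r(1) in \<open>simp del: star_simps\<close>)
  moreover have "r ` carrier ?S = carrier ?T"
  proof
    show "r ` carrier ?S \<subseteq> carrier ?T" using r(1) by (auto simp del: star_simps)
    show "carrier ?T \<subseteq> r ` carrier ?S"
    proof
      fix k assume k: "k \<in> carrier ?T"
      have kl: "lin R (infl V) (infl (reg B)) k" using star_lin[OF k] by (simp add: lin_infl)
      have cs: "cls ` carrier (reg R) = carrier (infl (reg B))" by simp
      obtain l where l: "lin R P (reg R) l" "\<And>x. x \<in> carrier P ==> cls (l x) = k (p x)"
        by (rule proj_lift[OF P d(1) regR infl_lm[OF B.regR] lin_comp[OF d(3) kl] rt(3) cs]) (rule that; assumption)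
      have l': "restrict l (carrier P) \<in> carrier ?S" by (rule starI[OF d(1) l(1)])
      have "k = r (restrict l (carrier P))" by (rule uniq[OF k r(1)[OF l']]) (use r(2)[OF l'] l(2) in simp)
      with l' show "k \<in> r ` carrier ?S" by blast
    qed
  qed
  ultimately show thesis using that r(2) by blast
qed

text \<open>By \<open>star_isub\<close> and \<open>star_reduce\<close> the functor \<open>Hom(-, R)\<close> commutes with reduction modulo \<open>I\<close> on
  projective modules, and reduction is right exact, so that it commutes with cokernels.\<close>

lemma tr_top:
  assumes t1: "is_top R I P1 V1 p1" and t0: "is_top R I P0 V0 p0" and P1: "proj R P1" and P0: "proj R P0"
    and f: "lin R P1 P0 f" and f': "lin B V1 V0 f'" "\<And>x. x \<in> carrier P1 ==> f' (p1 x) = p0 (f x)"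
    and tr: "is_tr R P1 f P0 T q" and tT: "is_top R\<^sup>o I T U u"
  obtains q' where "is_tr B V1 f' V0 U q'"
proof -
  interpret O: idl K "R\<^sup>o" I by (rule opp_idl)
  note d1 = topD[OF t1] and d0 = topD[OF t0] and dT = O.topD[OF tT] and q = is_trD[OF tr]
  let ?S1 = "star R P1" and ?S0 = "star R P0" and ?T1 = "star B V1" and ?T0 = "star B V0"
  note S1 = star_lm[OF d1(1)] and S0 = star_lm[OF d0(1)]
  obtain r1 where r1: "lin R\<^sup>o ?S1 (inflate R\<^sup>o I ?T1) r1" "r1 ` carrier ?S1 = carrier ?T1"
    "\<And>l x. l \<in> carrier ?S1 ==> x \<in> carrier P1 ==> r1 l (p1 x) = cls (l x)"
    by (rule star_reduce[OF t1 P1]) (rule that; assumption)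
  obtain r0 where r0: "lin R\<^sup>o ?S0 (inflate R\<^sup>o I ?T0) r0" "r0 ` carrier ?S0 = carrier ?T0"
    "\<And>l x. l \<in> carrier ?S0 ==> x \<in> carrier P0 ==> r0 l (p0 x) = cls (l x)"
    by (rule star_reduce[OF t0 P0]) (rule that; assumption)
  have T1: "left_module (quot_algebra R\<^sup>o I) ?T1" unfolding quot_opp by (rule star_lm[OF d1(2)])
  note iT1 = O.infl_lm[OF T1] and iU = O.infl_lm[OF dT(2)]
  have surj1: "\<exists>x\<in>carrier P1. v = p1 x" if "v \<in> carrier V1" for v by (rule surjE[OF d1(4) that])
  have p1c: "p1 x \<in> carrier V1" if "x \<in> carrier P1" for x using lin_closed[OF d1(3) that] by simp
  have r1c: "r1 l \<in> carrier ?T1" if "l \<in> carrier ?S1" for l using lin_closed[OF r1(1) that] by (simp del: star_simps)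
  have uq: "lin R\<^sup>o ?S1 (inflate R\<^sup>o I U) (\<lambda>k. u (q k))" by (rule lin_comp[OF q(2) dT(3)])
  have ker: "u (q l) = \<zero>\<^sub>U" if l: "l \<in> carrier ?S1" "r1 l = \<zero>\<^sub>?T1" for l
  proof -
    have "l x \<in> I" if x: "x \<in> carrier P1" for x
      using r1(3)[OF l(1) x] l(2) p1c[OF x] cls_zero[OF star_closed[OF l(1) x]] by simp
    hence "l \<in> isub R\<^sup>o I ?S1" using star_isub[OF d1(1) P1 l(1)] by blast
    hence "q l \<in> isub R\<^sup>o I T" by (rule isub_map[OF S1 q(1,2) O.I_sub])
    thus ?thesis using dT(5)[OF lin_closed[OF q(2) l(1)]] by simp
  qed
  obtain q' where q': "lin R\<^sup>o (inflate R\<^sup>o I ?T1) (inflate R\<^sup>o I U) q'"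
      "\<And>l. l \<in> carrier ?S1 ==> q' (r1 l) = u (q l)"
    by (rule lin_factor[OF S1 iU iT1 r1(1) _ uq]) (use r1(2) ker in \<open>auto intro: that simp del: star_simps simp: star_simps(2)\<close>)
  have ql: "lin B\<^sup>o ?T1 U q'" using q'(1) by (simp only: O.lin_infl quot_opp)
  have rsurj: "\<exists>l\<in>carrier ?S1. k = r1 l" if "k \<in> carrier ?T1" for k by (rule surjE[OF r1(2) that])
  have rsurj0: "\<exists>l\<in>carrier ?S0. k = r0 l" if "k \<in> carrier ?T0" for k by (rule surjE[OF r0(2) that])
  have "is_tr B V1 f' V0 U q'"
    unfolding is_tr_def
  proof (intro conjI ballI)
    show "left_module B\<^sup>o U" using dT(2) by (simp only: quot_opp)
    show "lin B\<^sup>o ?T1 U q'" by (rule ql)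
    show "q' ` carrier ?T1 = carrier U"
    proof
      show "q' ` carrier ?T1 \<subseteq> carrier U" using lin_closed[OF ql] by (auto simp del: star_simps)
      show "carrier U \<subseteq> q' ` carrier ?T1"
      proof
        fix y assume "y \<in> carrier U"
        then obtain z where z: "z \<in> carrier T" "y = u z" using surjE[OF dT(4)] by blast
        then obtain l where l: "l \<in> carrier ?S1" "z = q l" using surjE[OF q(3)] by blast
        have "y = q' (r1 l)" using q'(2)[OF l(1)] l(2) z(2) by simp
        thus "y \<in> q' ` carrier ?T1" using r1c[OF l(1)] by blast
      qed
    qed
    fix k assume k: "k \<in> carrier ?T1"
    show "(q' k = \<zero>\<^sub>U) = (\<exists>m\<in>carrier ?T0. \<forall>x\<in>carrier V1. k x = m (f' x))"
    proof
      assume z: "q' k = \<zero>\<^sub>U"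
      obtain l where l: "l \<in> carrier ?S1" "k = r1 l" using rsurj[OF k] by blast
      have "q l \<in> isub R\<^sup>o I T" using z q'(2)[OF l(1)] l(2) dT(5)[OF lin_closed[OF q(2) l(1)]] by simp
      then obtain l' where l': "l' \<in> isub R\<^sup>o I ?S1" "q l = q l'"
        by (rule isub_surj[OF S1 q(1,2,3) O.I_sub]) (rule that; assumption)
      have l'S: "l' \<in> carrier ?S1" using l'(1) submodD(1)[OF S1 isub_submod[OF S1 O.I_sub]] by blast
      have l'I: "\<And>x. x \<in> carrier P1 ==> l' x \<in> I" using l'(1) star_isub[OF d1(1) P1 l'S] by blast
      define m where "m = l \<ominus>\<^sub>?S1 l'"
      have m: "m \<in> carrier ?S1" "q m = \<zero>\<^sub>T"
        unfolding m_def
        by (simp_all add: ag_diff[OF lm_ag[OF S1] l(1) l'S] lin_diff[OF q(2) lm_ag[OF S1] lm_ag[OF q(1)] l(1) l'S] l'(2)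
              ag_diff_zero[OF lm_ag[OF q(1)]] lin_closed[OF q(2) l'S] del: star_simps)
      have lm: "l = m \<oplus>\<^sub>?S1 l'" unfolding m_def by (rule ag_diff_add[OF lm_ag[OF S1] l(1) l'S, symmetric])
      obtain l0 where l0: "l0 \<in> carrier ?S0" "\<forall>x\<in>carrier P1. m x = l0 (f x)" using q(4)[OF m(1)] m(2) by blast
      have r0l: "r0 l0 \<in> carrier ?T0" using lin_closed[OF r0(1) l0(1)] by (simp del: star_simps)
      have "k v = r0 l0 (f' v)" if "v \<in> carrier V1" for v
      proof -
        obtain x where x: "x \<in> carrier P1" "v = p1 x" using surj1[OF \<open>v \<in> carrier V1\<close>] by blast
        have fx: "f x \<in> carrier P0" by (rule lin_closed[OF f x(1)])
        have c: "m x \<in> carrier R" "l' x \<in> carrier R" using star_closed[OF m(1) x(1)] star_closed[OF l'S x(1)] by auto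
        have "k v = cls (m x \<oplus>\<^sub>R l' x)" using r1(3)[OF l(1) x(1)] l(2) x lm by simp
        also have "\<dots> = cls (m x)" using coset_eq[OF I_addsub ag_closed[OF RG c] c(1)] l'I[OF x(1)] ag_add_diff[OF RG c] by simp
        also have "\<dots> = r0 l0 (p0 (f x))" using r0(3)[OF l0(1) fx] l0(2) x(1) by simp
        also have "p0 (f x) = f' v" using f'(2) x by simp
        finally show ?thesis .
      qed
      with r0l show "\<exists>m\<in>carrier ?T0. \<forall>x\<in>carrier V1. k x = m (f' x)" by blast
    next
      assume "\<exists>m\<in>carrier ?T0. \<forall>x\<in>carrier V1. k x = m (f' x)"
      then obtain m where m: "m \<in> carrier ?T0" "\<forall>x\<in>carrier V1. k x = m (f' x)" by blast
      obtain l0 where l0: "l0 \<in> carrier ?S0" "m = r0 l0" using rsurj0[OF m(1)] by blast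
      let ?l = "smap P1 f l0"
      have l: "?l \<in> carrier ?S1" by (rule smap_closed[OF d1(1) f l0(1)])
      have "r1 ?l = k"
      proof (rule star_eqI[OF r1c[OF l] k])
        fix v assume v: "v \<in> carrier V1"
        then obtain x where x: "x \<in> carrier P1" "v = p1 x" using surj1 by blast
        show "r1 ?l v = k v"
          using r1(3)[OF l x(1)] x bspec[OF m(2) v] l0(2) f'(2)[OF x(1)] r0(3)[OF l0(1) lin_closed[OF f x(1)]] by (simp add: smap_def)
      qed
      moreover have "q ?l = \<zero>\<^sub>T" using q(4)[OF l] l0(1) by (auto simp: smap_def simp del: star_simps)
      moreover have "u \<zero>\<^sub>T = \<zero>\<^sub>U" using lm_lin_zero[OF dT(3) dT(1) iU] by simp
      ultimately show "q' k = \<zero>\<^sub>U" using q'(2)[OF l] by simp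
    qed
  qed
  with that show thesis by blast
qed

text \<open>With \<open>Y\<close> the kernel of \<open>g\<close>, the condition on elements of \<open>Y\<close> says \<open>Y \<inter> IG = IY\<close>. Hence \<open>Y/IY\<close> is the kernel
  of \<open>G/IG \<rightarrow> M/IM\<close>, and reducing the presentation of \<open>Y\<close> gives a projective presentation of this kernel over
  \<open>B\<close>, with transpose \<open>U\<close> by \<open>tr_top\<close>. Minimal data for a summand \<open>X\<close> of a power of \<open>M/IM\<close> are summands of
  powers of these.\<close>

lemma tr_quotient:
  fixes P1 :: "('a, 'p1) module" and P0 :: "('a, 'p0) module"
  assumes G: "proj R G" "lin R G M g" "g ` carrier G = carrier M" and M: "left_module R M"
    and tG: "is_top R I G VG pG" and tM: "is_top R I M VM pM"
    and star: "\<And>y. y \<in> mod_ker G M g ==> y \<in> isub R I G ==> y \<in> isub R I (G\<restriction>(mod_ker G M g))"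
    and p: "pres R P1 f P0 h (G\<restriction>(mod_ker G M g)) T q" and tT: "is_top R\<^sup>o I T U u"
    and X: "left_module B X" "summand B VM X"
    and c: "projective_cover B Q c X" and Z: "left_module B Z" "mod_iso B Z (Q\<restriction>(mod_ker Q X c))"
    and mp: "minimal_presentation B Q1 f1 Q0 c0 Z" and tS: "is_tr B Q1 f1 Q0 TS qS"
  shows "summand B\<^sup>o U TS"
proof -
  note dG = topD[OF tG] and dM = topD[OF tM] and dp = presD[OF p]
  let ?Y = "mod_ker G M g"
  have Y: "submodule ?Y R G" by (rule ker_submod[OF dG(1) M G(2)])
  note LY = sub_lm[OF dG(1) Y] and YG = submodD(1)[OF dG(1) Y]
  obtain V1 :: "('a set, 'p1 set) module" and p1 where t1: "is_top R I P1 V1 p1" by (rule top_exists[OF dp(1)]) (rule that; assumption)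
  obtain V0 :: "('a set, 'p0 set) module" and p0 where t0: "is_top R I P0 V0 p0" by (rule top_exists[OF dp(3)]) (rule that; assumption)
  note d1 = topD[OF t1] and d0 = topD[OF t0]
  obtain g' where g': "lin B VG VM g'" "\<And>x. x \<in> carrier G ==> g' (pG x) = pM (g x)" by (rule top_map[OF tG tM G(2)]) (rule that; assumption)
  obtain f' where f': "lin B V1 V0 f'" "\<And>x. x \<in> carrier P1 ==> f' (p1 x) = p0 (f x)" by (rule top_map[OF t1 t0 dp(6)]) (rule that; assumption)
  have hG: "lin R P0 G h" and hY: "\<And>x. x \<in> carrier P0 ==> h x \<in> ?Y" using dp(7) by (simp_all add: lin_into_sub[OF YG])
  obtain h' where h': "lin B V0 VG h'" "\<And>x. x \<in> carrier P0 ==> h' (p0 x) = pG (h x)" by (rule top_map[OF t0 tG hG]) (rule that; assumption)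
  obtain q' where q': "is_tr B V1 f' V0 U q'"
    by (rule tr_top[OF t1 t0 dp(2,4,6) f'(1) _ dp(10) tT]) (erule f'(2), rule that)
  let ?L = "mod_ker VG VM g'"
  have L: "submodule ?L B VG" by (rule ker_submod[OF dG(2) dM(2) g'(1)])
  note LL = sub_lm[OF dG(2) L]
  have surjp: "\<exists>x\<in>carrier P0. v = p0 x" if "v \<in> carrier V0" for v by (rule surjE[OF d0(4) that])
  have surjG: "\<exists>x\<in>carrier G. v = pG x" if "v \<in> carrier VG" for v by (rule surjE[OF dG(4) that])
  have pGc: "pG x \<in> carrier VG" if "x \<in> carrier G" for x using lin_closed[OF dG(3) that] by simp
  have pMz: "pM \<zero>\<^sub>M = \<zero>\<^sub>VM" using lm_lin_zero[OF dM(3) M infl_lm[OF dM(2)]] by simp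
  have pGz: "pG \<zero>\<^sub>G = \<zero>\<^sub>VG" using lm_lin_zero[OF dG(3) dG(1) infl_lm[OF dG(2)]] by simp
  have h'L: "h' v \<in> ?L" if "v \<in> carrier V0" for v
  proof -
    obtain x where x: "x \<in> carrier P0" "v = p0 x" using surjp[OF \<open>v \<in> carrier V0\<close>] by blast
    have "h x \<in> carrier G" "g (h x) = \<zero>\<^sub>M" using hY[OF x(1)] by (simp_all add: mod_ker_def)
    thus ?thesis using x h'(2)[OF x(1)] g'(2) pMz pGc by (simp add: mod_ker_def)
  qed
  have presB: "pres B V1 f' V0 h' (VG\<restriction>?L) U q'"
    unfolding pres_def
  proof (intro conjI)
    show "proj B V1" by (rule top_proj[OF t1 dp(2)])
    show "proj B V0" by (rule top_proj[OF t0 dp(4)])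
    show "lin B V0 (VG\<restriction>?L) h'" using h'(1) h'L by (simp add: lin_into_sub[OF submodD(1)[OF dG(2) L]])
    show "h' ` carrier V0 = carrier (VG\<restriction>?L)"
    proof
      show "h' ` carrier V0 \<subseteq> carrier (VG\<restriction>?L)" using h'L by auto
      show "carrier (VG\<restriction>?L) \<subseteq> h' ` carrier V0"
      proof
        fix v assume "v \<in> carrier (VG\<restriction>?L)"
        hence v: "v \<in> carrier VG" "g' v = \<zero>\<^sub>VM" by (simp_all add: mod_ker_def)
        obtain x where x: "x \<in> carrier G" "v = pG x" using surjG[OF v(1)] by blast
        have gx: "g x \<in> carrier M" by (rule lin_closed[OF G(2) x(1)])
        have "g x \<in> isub R I M" using v(2) g'(2)[OF x(1)] x(2) dM(5)[OF gx] by simp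
        then obtain i where i: "i \<in> isub R I G" "g x = g i" by (rule isub_surj[OF dG(1) M G(2,3) I_sub]) (rule that; assumption)
        have iG: "i \<in> carrier G" using i(1) submodD(1)[OF dG(1) isub_submod[OF dG(1) I_sub]] by blast
        have "x \<ominus>\<^sub>G i \<in> ?Y" by (rule lin_surj_sum[OF dG(1) M G(2) x(1) iG i(2)])
        hence "x \<ominus>\<^sub>G i \<in> h ` carrier P0" using dp(8) by simp
        then obtain z where z: "z \<in> carrier P0" "x \<ominus>\<^sub>G i = h z" by blast
        have "pG (x \<ominus>\<^sub>G i) = pG x \<ominus>\<^bsub>infl VG\<^esub> pG i" by (rule lin_diff[OF dG(3) lm_ag[OF dG(1)] lm_ag[OF infl_lm[OF dG(2)]] x(1) iG])
        moreover have "pG i = \<zero>\<^bsub>infl VG\<^esub>" using dG(5)[OF iG] i(1) by simp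
        moreover have "pG x \<ominus>\<^bsub>infl VG\<^esub> \<zero>\<^bsub>infl VG\<^esub> = pG x"
          using ag_neg_zero[OF lm_ag[OF infl_lm[OF dG(2)]]] ag_rzero[OF lm_ag[OF infl_lm[OF dG(2)]], of "pG x"] pGc[OF x(1)] by (simp add: a_minus_def)
        ultimately have "v = h' (p0 z)" using h'(2)[OF z(1)] z(2) x(2) by simp
        thus "v \<in> h' ` carrier V0" using lin_closed[OF d0(3) z(1)] by simp
      qed
    qed
    show "f' ` carrier V1 = mod_ker V0 (VG\<restriction>?L) h'"
    proof
      show "f' ` carrier V1 \<subseteq> mod_ker V0 (VG\<restriction>?L) h'"
      proof
        fix v assume "v \<in> f' ` carrier V1"
        then obtain w where w: "w \<in> carrier V1" "v = f' w" by blast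
        then obtain x where x: "x \<in> carrier P1" "w = p1 x" using surjE[OF d1(4)] by blast
        have "f x \<in> f ` carrier P1" using x by simp
        hence fx: "f x \<in> carrier P0" "h (f x) = \<zero>\<^sub>G" unfolding dp(9) by (simp_all add: mod_ker_def)
        show "v \<in> mod_ker V0 (VG\<restriction>?L) h'"
          using w x f'(2)[OF x(1)] h'(2)[OF fx(1)] fx pGz lin_closed[OF d0(3) fx(1)] by (simp add: mod_ker_def)
      qed
      show "mod_ker V0 (VG\<restriction>?L) h' \<subseteq> f' ` carrier V1"
      proof
        fix v assume "v \<in> mod_ker V0 (VG\<restriction>?L) h'"
        hence v: "v \<in> carrier V0" "h' v = \<zero>\<^sub>VG" by (simp_all add: mod_ker_def)
        obtain x where x: "x \<in> carrier P0" "v = p0 x" using surjp[OF v(1)] by blast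
        have hx: "h x \<in> carrier G" by (rule lin_closed[OF hG x(1)])
        have "h x \<in> isub R I G" using v(2) h'(2)[OF x(1)] x(2) dG(5)[OF hx] by simp
        hence "h x \<in> isub R I (G\<restriction>?Y)" by (rule star[OF hY[OF x(1)]])
        then obtain j where j: "j \<in> isub R I P0" "h x = h j" by (rule isub_surj[OF dp(3,5,7,8) I_sub]) (rule that; assumption)
        have jP: "j \<in> carrier P0" using j(1) submodD(1)[OF dp(3) isub_submod[OF dp(3) I_sub]] by blast
        have "x \<ominus>\<^sub>P0 j \<in> f ` carrier P1" unfolding dp(9) by (rule lin_surj_sum[OF dp(3,5,7) x(1) jP j(2)])
        then obtain z where z: "z \<in> carrier P1" "x \<ominus>\<^sub>P0 j = f z" by blast
        have "p0 (x \<ominus>\<^sub>P0 j) = p0 x \<ominus>\<^bsub>infl V0\<^esub> p0 j" by (rule lin_diff[OF d0(3) lm_ag[OF dp(3)] lm_ag[OF infl_lm[OF d0(2)]] x(1) jP])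
        moreover have "p0 j = \<zero>\<^bsub>infl V0\<^esub>" using d0(5)[OF jP] j(1) by simp
        moreover have "p0 x \<ominus>\<^bsub>infl V0\<^esub> \<zero>\<^bsub>infl V0\<^esub> = p0 x"
          using ag_neg_zero[OF lm_ag[OF infl_lm[OF d0(2)]]] ag_rzero[OF lm_ag[OF infl_lm[OF d0(2)]], of "p0 x"] lin_closed[OF d0(3) x(1)] by (simp add: a_minus_def)
        ultimately have "v = f' (p1 z)" using f'(2)[OF z(1)] z(2) x(2) by simp
        thus "v \<in> f' ` carrier V1" using lin_closed[OF d1(3) z(1)] by simp
      qed
    qed
  qed (use d1(2) d0(2) LL f'(1) q' in simp_all)
  have g's: "g' ` carrier VG = carrier VM"
  proof
    show "g' ` carrier VG \<subseteq> carrier VM" using lin_closed[OF g'(1)] by blast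
    show "carrier VM \<subseteq> g' ` carrier VG"
    proof
      fix v assume "v \<in> carrier VM"
      then obtain y where y: "y \<in> carrier M" "v = pM y" using surjE[OF dM(4)] by blast
      then obtain x where x: "x \<in> carrier G" "y = g x" using surjE[OF G(3)] by blast
      have "v = g' (pG x)" using g'(2)[OF x(1)] x(2) y(2) by simp
      thus "v \<in> g' ` carrier VG" using pGc[OF x(1)] by blast
    qed
  qed
  have Q: "Q \<in> fg_mod B" "lin B Q X c" using c by (simp_all add: B.projective_cover_iff[OF X(1)] mod_hom_iff)
  have LQ: "left_module B (Q\<restriction>(mod_ker Q X c))" by (rule sub_lm[OF fg_modD(1)[OF Q(1)] ker_submod[OF fg_modD(1)[OF Q(1)] X(1) Q(2)]])
  have "summand B (VG\<restriction>?L) (Q\<restriction>(mod_ker Q X c))"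
    by (rule B.syzygy_minimal[OF X(2) dM(2) X(1) dG(2) top_proj[OF tG G(1)] g'(1) g's c])
  hence thZ: "summand B (VG\<restriction>?L) Z" using Z(2) by (intro thru_iso[OF _ _ LQ Z(1)]) auto
  have c: "projective_cover B Q0 c0 Z" "projective_cover B Q1 f1 (Q0\<restriction>(mod_ker Q0 Z c0))"
    using mp by (simp_all add: minimal_presentation_def)
  have "bij_betw (\<lambda>x. x) (carrier Z) (carrier Z)" by (simp add: bij_betw_def)
  note B.pres_minimal[OF mp Z(1) tS lin_id this Z(1)]
  from B.tr_minimal[OF this presB thZ c] show ?thesis .
qed

end


section \<open>Existence of the chosen representatives\<close>

context fdalg begin

text \<open>Among the direct summands of an injective module that contain \<open>X\<close> take one of least dimension. If a
  submodule \<open>N\<close> meets \<open>X\<close> trivially, then \<open>X\<close> embeds into the quotient by \<open>N\<close>, so some endomorphism fixes \<open>X\<close>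
  and kills \<open>N\<close>. Fitting's lemma splits off a smaller summand unless \<open>N = 0\<close>.\<close>

lemma injective_envelope_exists:
  fixes X :: "('a, 'm) module"
  assumes X: "left_module R X" and fg: "fin_generated R X"
  obtains J g where "injective_envelope R X g J" "inje J"
proof -
  obtain J0 w where J0: "J0 \<in> fg_mod R" "inje J0" "lin R X J0 w" "inj_on w (carrier X)"
    by (rule inj_env_exists0[OF X fg]) (rule that; assumption)
  note L0 = fg_modD[OF J0(1)]
  let ?Q = "\<lambda>S. submodule S R J0 \<and> w ` carrier X \<subseteq> S \<and> (\<exists>r. lin R J0 (J0\<restriction>S) r \<and> (\<forall>x\<in>S. r x = x))"
  have "w ` carrier X \<subseteq> carrier J0" using lin_closed[OF J0(3)] by blast
  moreover have "lin R J0 (J0\<restriction>(carrier J0)) (\<lambda>x. x)" using lin_id by (simp add: lin_into_sub)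
  ultimately have "?Q (carrier J0)" using carrier_submod[OF L0(1)] by blast
  from ex_has_least_nat[of ?Q, OF this, of "fspace.dimS K (kv R J0)"]
  obtain S where S: "?Q S" and least: "\<And>S'. ?Q S' ==> fspace.dimS K (kv R J0) S \<le> fspace.dimS K (kv R J0) S'"
    by (elim exE conjE) blast
  have Sm: "submodule S R J0" and wS: "w ` carrier X \<subseteq> S" using S by auto
  obtain r where r: "lin R J0 (J0\<restriction>S) r" "\<And>x. x \<in> S ==> r x = x" using S by blast
  let ?J = "J0\<restriction>S"
  note D0 = submodD[OF L0(1) Sm] and LJ = sub_lm[OF L0(1) Sm] and FJ = fg_sub[OF L0 Sm]
  have J: "?J \<in> fg_mod R" using LJ FJ by (simp add: fg_mod_def)
  have inJ: "inje ?J"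
    by (rule thru_transfer[OF J0(2) lin_sub[OF lin_id D0(1)] r(1) _ L0(1) LJ]) (use r(2) in simp)
  have wJ: "lin R X ?J w" using J0(3) wS by (auto simp: lin_into_sub[OF D0(1)])
  have ess: "N = {\<zero>\<^sub>J0}" if N: "submodule N R ?J" "N \<inter> w ` carrier X = {\<zero>\<^sub>J0}" for N
  proof (rule ccontr)
    assume NZ: "N \<noteq> {\<zero>\<^sub>J0}"
    let ?QN = "quot_module ?J N" and ?\<pi> = "\<lambda>x. N +>\<^sub>?J x"
    note DN = submodD[OF LJ N(1)] and qp = quot_proj[OF LJ N(1)] and LQ = quot_lm[OF LJ N(1)]
    have g: "lin R X ?QN (\<lambda>x. ?\<pi> (w x))" by (rule lin_comp[OF wJ qp(1)])
    have gi: "inj_on (\<lambda>x. ?\<pi> (w x)) (carrier X)"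
    proof (rule inj_if_ker[OF X LQ g])
      fix x assume x: "x \<in> carrier X" "?\<pi> (w x) = \<zero>\<^sub>?QN"
      have "w x \<in> N" using qp(2)[OF lin_closed[OF wJ x(1)]] x(2) by blast
      hence "w x = \<zero>\<^sub>J0" using N(2) x(1) by blast
      also have "\<dots> = w \<zero>\<^sub>X" using lm_lin_zero[OF J0(3) X L0(1)] by simp
      finally show "x = \<zero>\<^sub>X" using inj_onD[OF J0(4)] x(1) lm_zero[OF X] by blast
    qed
    have FQ: "fin_generated R ?QN" by (rule fg_image[OF LJ LQ qp(1) _ FJ]) simp
    obtain l where l: "lin R ?QN ?J l" "\<And>x. x \<in> carrier X ==> l (?\<pi> (w x)) = w x"
      using thru_extend[OF inJ LJ X LQ FQ wJ g gi] by blast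
    let ?f = "\<lambda>x. l (?\<pi> x)"
    have f: "lin R ?J ?J ?f" by (rule lin_comp[OF qp(1) l(1)])
    obtain n s T where T: "T = (?f ^^ n) ` carrier ?J" "submodule T R ?J" "?f ` T = T" "lin R ?J (?J\<restriction>T) s"
      "\<And>x. x \<in> T ==> s x = x" by (rule fitting_retract[OF LJ FJ f]) (rule that; assumption)
    have TS: "T \<subseteq> S" using submodD(1)[OF LJ T(2)] by simp
    have T0: "submodule T R J0"
      by (rule submodI[OF L0(1)]) (use TS D0 submodD[OF LJ T(2)] in auto)
    have fw: "(?f ^^ m) (w x) = w x" if "x \<in> carrier X" for m x by (induction m) (use l(2)[OF that] in auto)
    have wT: "w ` carrier X \<subseteq> T"
    proof
      fix y assume "y \<in> w ` carrier X"
      then obtain x where x: "x \<in> carrier X" "y = w x" by blast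
      have "y = (?f ^^ n) (w x)" using fw[OF x(1)] x(2) by simp
      moreover have "w x \<in> carrier ?J" by (rule lin_closed[OF wJ x(1)])
      ultimately show "y \<in> T" unfolding T(1) by (rule image_eqI)
    qed
    have "lin R J0 (J0\<restriction>T) (\<lambda>x. s (r x))"
      using lin_comp[OF r(1) T(4)] by simp
    moreover have "\<forall>x\<in>T. s (r x) = x" using r(2) T(5) TS by (simp add: subset_iff)
    ultimately have "\<exists>r. lin R J0 (J0\<restriction>T) r \<and> (\<forall>x\<in>T. r x = x)" by (intro exI conjI)
    hence "?Q T" using T0 wT by (intro conjI)
    from least[OF this] have "T = S" using fg_dim_less[OF L0 T0 Sm TS] by (meson leD)
    hence "?f ` carrier ?J = carrier ?J" using T(3) by simp
    hence fi: "inj_on ?f (carrier ?J)" using surj_endo_inj[OF LJ FJ f] by (simp add: bij_betw_def)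
    obtain x where x: "x \<in> N" "x \<noteq> \<zero>\<^sub>J0" using NZ DN(2) by auto
    have xJ: "x \<in> carrier ?J" "\<zero>\<^sub>?J \<in> carrier ?J" using x(1) DN(1,2) by auto
    have "?\<pi> x = \<zero>\<^sub>?QN" using qp(2)[OF xJ(1)] x(1) by simp
    moreover have "?\<pi> \<zero>\<^sub>?J = \<zero>\<^sub>?QN" using qp(2)[OF xJ(2)] DN(2) by simp
    ultimately have "x = \<zero>\<^sub>?J" using inj_onD[OF fi _ xJ] by simp
    with x(2) show False by simp
  qed
  have "injective_envelope R X (restrict w (carrier X)) ?J"
    unfolding injective_envelope_def
  proof (intro conjI allI impI)
    show "injective R ?J" using J inJ by (simp add: injective_iff)
    show "restrict w (carrier X) \<in> mod_hom R X ?J" by (rule restrict_mod_hom[OF X wJ])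
    show "inj_on (restrict w (carrier X)) (carrier X)" using J0(4) by simp
  qed (use ess in auto)
  with inJ that show thesis by blast
qed

text \<open>Syzygies, cosyzygies and transposes are arbitrary choices among isomorphic modules. What can be used
  about them is that they come from some minimal data.\<close>

lemma syzygyE:
  assumes X: "X \<in> fg_mod R"
  obtains P g where "projective_cover R P g X" "syzygy R X \<in> fg_mod R" "mod_iso R (syzygy R X) (P\<restriction>(mod_ker P X g))"
proof -
  note LX = fg_modD[OF X]
  obtain P g where c: "projective_cover R P g X" by (rule projective_cover_exists[OF LX]) (rule that; assumption)
  hence P: "P \<in> fg_mod R" "lin R P X g" by (simp_all add: projective_cover_iff[OF LX(1)] mod_hom_iff)
  note LP = fg_modD[OF P(1)] and N = ker_submod[OF fg_modD(1)[OF P(1)] LX(1) P(2)]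
  note LN = sub_lm[OF LP(1) N]
  have "(P\<restriction>(mod_ker P X g)) \<in> fg_mod R" using LN fg_sub[OF LP N] by (simp add: fg_mod_def)
  moreover have "mod_iso R (P\<restriction>(mod_ker P X g)) (P\<restriction>(mod_ker P X g))"
    by (rule mod_isoI[OF LN lin_id]) (simp add: bij_betw_def)
  ultimately have "\<exists>Y. Y \<in> fg_mod R \<and> (\<exists>P g. projective_cover R P g X \<and> mod_iso R Y (P\<restriction>(mod_ker P X g)))"
    using c by blast
  from someI_ex[OF this] that show thesis unfolding syzygy_def by blast
qed

lemma rep_iso:
  fixes X :: "('a, 'm) module"
  assumes X: "left_module R X" and fg: "fin_generated R X"
  obtains Y where "Y \<in> fg_mod R" "mod_iso R Y X" "mod_iso R X Y"
proof -
  obtain Y f g where Y: "Y \<in> fg_mod R" "lin R X Y f" "lin R Y X g"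
    "\<And>x. x \<in> carrier X ==> g (f x) = x" "\<And>y. y \<in> carrier Y ==> f (g y) = y"
    by (rule rep[OF X fg]) (rule that; assumption)
  have "mod_iso R Y X" by (rule mod_isoI[OF fg_modD(1)[OF Y(1)] Y(3) bij_if_inverse[OF Y(3,2)]]) (use Y(4,5) in simp_all)
  moreover have "mod_iso R X Y" by (rule mod_isoI[OF X Y(2) bij_if_inverse[OF Y(2,3)]]) (use Y(4,5) in simp_all)
  ultimately show thesis using Y(1) that by blast
qed

lemma cosyzygyE:
  assumes X: "X \<in> fg_mod R"
  obtains J g where "injective_envelope R X g J" "cosyzygy R X \<in> fg_mod R" "mod_iso R (cosyzygy R X) (quot_module J (g ` carrier X))"
proof -
  note LX = fg_modD[OF X]
  obtain J g where c: "injective_envelope R X g J" by (rule injective_envelope_exists[OF LX]) (rule that; assumption)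
  hence J: "J \<in> fg_mod R" "lin R X J g" by (simp_all add: injective_envelope_def injective_iff mod_hom_iff)
  note LJ = fg_modD[OF J(1)]
  note N = image_submod[OF LX(1) LJ(1) J(2) carrier_submod[OF LX(1)]]
  have F: "fin_generated R (quot_module J (g ` carrier X))"
    by (rule fg_image[OF LJ(1) quot_lm[OF LJ(1) N] quot_proj(1)[OF LJ(1) N] _ LJ(2)]) simp
  obtain Y where Y: "Y \<in> fg_mod R" "mod_iso R Y (quot_module J (g ` carrier X))"
    by (rule rep_iso[OF quot_lm[OF LJ(1) N] F]) (rule that; assumption)
  with c have "\<exists>Y. Y \<in> fg_mod R \<and> (\<exists>J g. injective_envelope R X g J \<and> mod_iso R Y (quot_module J (g ` carrier X)))" by blast
  from someI_ex[OF this] that show thesis unfolding cosyzygy_def by blast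
qed

text \<open>Composition with \<open>x \<mapsto> v (u x)\<close> sends \<open>l\<close> to the multiple of \<open>u\<close> by \<open>l (v 1)\<close>, so it factors through the
  regular module.\<close>

lemma star_thru:
  assumes P: "left_module R P" and th: "thru R (reg R) P P h"
  shows "thru R\<^sup>o (reg R\<^sup>o) (star R P) (star R P) (smap P h)"
  using th
proof (induction rule: thru.induct)
  case (thru_zero h)
  show ?case
  proof (rule thru.thru_zero)
    fix l assume l: "l \<in> carrier (star R P)"
    show "smap P h l = \<zero>\<^bsub>star R P\<^esub>"
      using thru_zero lm_lin_zero[OF star_lin[OF l] P regR] by (simp add: smap_def cong: restrict_cong)
  qed
next
  case (thru_add g u v h)
  note S = star_lm[OF P]
  have v1: "v \<one>\<^sub>R \<in> carrier P" using lin_closed[OF thru_add.hyps(3)] oneR by simp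
  let ?u = "restrict u (carrier P)"
  have u: "?u \<in> carrier (star R P)" by (rule starI[OF P thru_add.hyps(2)])
  have ev: "lin R\<^sup>o (star R P) (reg R\<^sup>o) (\<lambda>l. l (v \<one>\<^sub>R))"
  proof (rule linI)
    show "l (v \<one>\<^sub>R) \<in> carrier (reg R\<^sup>o)" if "l \<in> carrier (star R P)" for l
      using star_closed[OF that v1] by simp
  qed (use v1 in simp_all)
  have cy: "lin R\<^sup>o (reg R\<^sup>o) (star R P) (\<lambda>r. r \<odot>\<^bsub>star R P\<^esub> ?u)"
    by (rule cyclic_lin[OF S u])
  show ?case
  proof (rule thru.thru_add[OF thru_add.IH ev cy])
    fix l assume l: "l \<in> carrier (star R P)"
    show "smap P h l = smap P g l \<oplus>\<^bsub>star R P\<^esub> l (v \<one>\<^sub>R) \<odot>\<^bsub>star R P\<^esub> ?u"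
      unfolding star_simps smap_def
    proof (rule restrict_ext)
      fix x assume x: "x \<in> carrier P"
      have ux: "u x \<in> carrier R" using lin_closed[OF thru_add.hyps(2) x] by simp
      have gx: "g x \<in> carrier P" by (rule lin_closed[OF thru_lin[OF thru_add.hyps(1) P P] x])
      have "l (v (u x)) = u x \<otimes>\<^sub>R l (v \<one>\<^sub>R)"
        using lin_regular[OF R thru_add.hyps(3) ux] lin_smult[OF star_lin[OF l] ux v1] by simp
      thus "l (h x) = (\<lambda>x\<in>carrier P. l (g x)) x \<oplus>\<^sub>R (\<lambda>x\<in>carrier P. ?u x \<otimes>\<^sub>R l (v \<one>\<^sub>R)) x"
        using x thru_add.hyps(4)[OF x] lin_add[OF star_lin[OF l] gx, of "v (u x)"] lin_closed[OF thru_add.hyps(3), of "u x"] ux by simp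
    qed
  qed
qed

lemma star_proj:
  assumes P: "left_module R P" "proj R P"
  shows "proj R\<^sup>o (star R P)"
  by (rule thru_cong[OF star_thru[OF P]]) (simp add: smap_def mod_hom_iff extensional_restrict)

lemma transposeE:
  fixes X :: "('a, 'm) module"
  assumes X: "left_module R X" and fg: "fin_generated R X"
  obtains P1 f P0 g q where "minimal_presentation R P1 f P0 g X" "module_transpose R X \<in> fg_mod R\<^sup>o"
    "is_tr R P1 f P0 (module_transpose R X) q"
proof -
  interpret O: fdalg K "R\<^sup>o" by (rule opp_alg)
  let ?im = "\<lambda>P1 f P0. (\<lambda>h. compose (carrier P1) h f) ` carrier (star R P0)"
  let ?Q = "\<lambda>P1 f P0. quot_module (star R P1) (?im P1 f P0)"
  have cf: "(\<lambda>h. compose (carrier P1) h f) = smap P1 f" for P1 :: "('a, nat \<Rightarrow> 'k) module" and f :: "(nat \<Rightarrow> 'k) \<Rightarrow> (nat \<Rightarrow> 'k)"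
    by (rule ext) (simp add: compose_def smap_def)
  have mpD: "P1 \<in> fg_mod R" "proj R P1" "P0 \<in> fg_mod R" "lin R P1 P0 f"
    if "minimal_presentation R P1 f P0 g X" for P1 f P0 g
  proof -
    have c0: "projective_cover R P0 g X" and c1: "projective_cover R P1 f (P0\<restriction>(mod_ker P0 X g))"
      using that by (simp_all add: minimal_presentation_def)
    have p0: "P0 \<in> fg_mod R" "lin R P0 X g" using c0 by (simp_all add: projective_cover_iff[OF X] mod_hom_iff)
    note L0 = fg_modD(1)[OF p0(1)]
    note N = ker_submod[OF L0 X p0(2)]
    show "P1 \<in> fg_mod R" "proj R P1" "P0 \<in> fg_mod R" "lin R P1 P0 f"
      using c1 p0(1) by (simp_all add: projective_cover_iff[OF sub_lm[OF L0 N]] mod_hom_iff lin_into_sub[OF submodD(1)[OF L0 N]])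
  qed
  have Nsub: "submodule (?im P1 f P0) R\<^sup>o (star R P1)"
    if "minimal_presentation R P1 f P0 g X" for P1 f P0 g
    unfolding cf
    by (rule image_submod[OF star_lm[OF fg_modD(1)[OF mpD(3)[OF that]]] star_lm[OF fg_modD(1)[OF mpD(1)[OF that]]]
        smap_lin[OF fg_modD(1)[OF mpD(1)[OF that]] mpD(4)[OF that]] carrier_submod[OF star_lm[OF fg_modD(1)[OF mpD(3)[OF that]]]]])
  obtain P0 g where c0: "projective_cover R P0 g X" by (rule projective_cover_exists[OF X fg]) (rule that; assumption)
  have p0: "P0 \<in> fg_mod R" "lin R P0 X g" using c0 by (simp_all add: projective_cover_iff[OF X] mod_hom_iff)
  note L0 = fg_modD[OF p0(1)]
  note N = ker_submod[OF L0(1) X p0(2)]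
  obtain P1 f where c1: "projective_cover R P1 f (P0\<restriction>(mod_ker P0 X g))"
    by (rule projective_cover_exists[OF sub_lm[OF L0(1) N] fg_sub[OF L0 N]]) (rule that; assumption)
  have mp: "minimal_presentation R P1 f P0 g X" using c0 c1 by (simp add: minimal_presentation_def)
  note L1 = fg_modD[OF mpD(1)[OF mp]] and S1 = star_lm[OF fg_modD(1)[OF mpD(1)[OF mp]]]
  have F1: "fin_generated R\<^sup>o (star R P1)"
    by (rule thru_regular_fg[OF star_proj[OF L1(1) mpD(2)[OF mp]] S1])
  have "fin_generated R\<^sup>o (?Q P1 f P0)"
    by (rule fg_image[OF S1 quot_lm[OF S1 Nsub[OF mp]] quot_proj(1)[OF S1 Nsub[OF mp]] _ F1]) simp
  then obtain Y where "Y \<in> fg_mod R\<^sup>o" "mod_iso R\<^sup>o Y (?Q P1 f P0)"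
    by (rule O.rep_iso[OF quot_lm[OF S1 Nsub[OF mp]]]) (rule that; assumption)
  with mp have "\<exists>Y. Y \<in> fg_mod R\<^sup>o \<and> (\<exists>P1 f P0 g. minimal_presentation R P1 f P0 g X \<and> mod_iso R\<^sup>o Y (?Q P1 f P0))"
    by blast
  from someI_ex[OF this] obtain P1 f P0 g where T: "module_transpose R X \<in> fg_mod R\<^sup>o"
    and m: "minimal_presentation R P1 f P0 g X" and i: "mod_iso R\<^sup>o (module_transpose R X) (?Q P1 f P0)"
    unfolding module_transpose_def by blast
  note S1 = star_lm[OF fg_modD(1)[OF mpD(1)[OF m]]]
  note LQ = quot_lm[OF S1 Nsub[OF m]] and qp = quot_proj[OF S1 Nsub[OF m]] and LT = fg_modD(1)[OF T]
  obtain a b where ab: "lin R\<^sup>o (module_transpose R X) (?Q P1 f P0) a" "lin R\<^sup>o (?Q P1 f P0) (module_transpose R X) b"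
    "\<And>x. x \<in> carrier (module_transpose R X) ==> b (a x) = x" "\<And>y. y \<in> carrier (?Q P1 f P0) ==> a (b y) = y"
    by (rule mod_isoE[OF i LT LQ]) (rule that; assumption)
  let ?\<pi> = "\<lambda>k. ?im P1 f P0 +>\<^bsub>star R P1\<^esub> k"
  have bz: "b y = \<zero>\<^bsub>module_transpose R X\<^esub> \<longleftrightarrow> y = \<zero>\<^bsub>?Q P1 f P0\<^esub>" if "y \<in> carrier (?Q P1 f P0)" for y
    using ab(4)[OF that] lm_lin_zero[OF ab(1) LT LQ] lm_lin_zero[OF ab(2) LQ LT] by metis
  have "is_tr R P1 f P0 (module_transpose R X) (\<lambda>k. b (?\<pi> k))"
    unfolding is_tr_def
  proof (intro conjI ballI)
    show "lin R\<^sup>o (star R P1) (module_transpose R X) (\<lambda>k. b (?\<pi> k))" by (rule lin_comp[OF qp(1) ab(2)])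
    show "(\<lambda>k. b (?\<pi> k)) ` carrier (star R P1) = carrier (module_transpose R X)"
    proof
      show "(\<lambda>k. b (?\<pi> k)) ` carrier (star R P1) \<subseteq> carrier (module_transpose R X)"
        using lin_closed[OF lin_comp[OF qp(1) ab(2)]] by blast
      show "carrier (module_transpose R X) \<subseteq> (\<lambda>k. b (?\<pi> k)) ` carrier (star R P1)"
      proof
        fix t assume t: "t \<in> carrier (module_transpose R X)"
        have "a t \<in> ?\<pi> ` carrier (star R P1)" using lin_closed[OF ab(1) t] by (simp del: star_simps)
        then obtain k where "k \<in> carrier (star R P1)" "a t = ?\<pi> k" by blast
        thus "t \<in> (\<lambda>k. b (?\<pi> k)) ` carrier (star R P1)" using ab(3)[OF t] by force
      qed
    qed
    fix k assume k: "k \<in> carrier (star R P1)"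
    have "b (?\<pi> k) = \<zero>\<^bsub>module_transpose R X\<^esub> \<longleftrightarrow> k \<in> ?im P1 f P0"
      using bz[OF lin_closed[OF qp(1) k]] qp(2)[OF k] by blast
    also have "\<dots> \<longleftrightarrow> (\<exists>l\<in>carrier (star R P0). \<forall>x\<in>carrier P1. k x = l (f x))"
    proof
      assume "k \<in> ?im P1 f P0"
      then obtain l where "l \<in> carrier (star R P0)" "k = smap P1 f l" unfolding cf by blast
      thus "\<exists>l\<in>carrier (star R P0). \<forall>x\<in>carrier P1. k x = l (f x)" by (auto simp: smap_def simp del: star_simps)
    next
      assume "\<exists>l\<in>carrier (star R P0). \<forall>x\<in>carrier P1. k x = l (f x)"
      then obtain l where l: "l \<in> carrier (star R P0)" "\<forall>x\<in>carrier P1. k x = l (f x)" by blast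
      have "k = smap P1 f l"
        by (rule star_eqI[OF k smap_closed[OF fg_modD(1)[OF mpD(1)[OF m]] mpD(4)[OF m] l(1)]]) (use l(2) in \<open>simp add: smap_def\<close>)
      thus "k \<in> ?im P1 f P0" unfolding cf using l(1) by (simp del: star_simps)
    qed
    finally show "b (?\<pi> k) = \<zero>\<^bsub>module_transpose R X\<^esub> \<longleftrightarrow> (\<exists>l\<in>carrier (star R P0). \<forall>x\<in>carrier P1. k x = l (f x))" .
  qed (rule LT)
  with m T that show thesis by blast
qed

end


section \<open>Quotients of path algebras are finite-dimensional\<close>

lemma path_algebra_simps [simp]:
  "f \<oplus>\<^bsub>path_algebra K Q\<^esub> g = (\<lambda>p. f p \<oplus>\<^sub>K g p)" "k \<odot>\<^bsub>path_algebra K Q\<^esub> f = (\<lambda>p. k \<otimes>\<^sub>K f p)"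
  by (simp_all add: path_algebra_def)

lemma path_algebra_carrier: "f \<in> carrier (path_algebra K Q) \<longleftrightarrow>
    (\<forall>p. f p \<in> carrier K) \<and> (\<forall>p. \<not> quiver_path Q p \<longrightarrow> f p = \<zero>\<^sub>K) \<and> finite {p. f p \<noteq> \<zero>\<^sub>K}"
  by (simp add: path_algebra_def)

lemma finite_short_paths:
  assumes "fin_digraph Q"
  shows "finite {p. quiver_path Q p \<and> length (snd p) < m}"
proof (rule finite_subset)
  show "{p. quiver_path Q p \<and> length (snd p) < m} \<subseteq> verts Q \<times> {xs. set xs \<subseteq> arcs Q \<and> length xs \<le> m}"
    by (auto simp: quiver_path_def pre_digraph.awalk_def)
  show "finite (verts Q \<times> {xs. set xs \<subseteq> arcs Q \<and> length xs \<le> m})"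
    using assms by (intro finite_cartesian_product finite_lists_length_le) (simp_all add: fin_digraph.finite_verts fin_digraph.finite_arcs)
qed

lemma ideal_addsub:
  assumes "ideal J P" shows "addsub J P"
proof -
  interpret ideal J P by (rule assms)
  show ?thesis unfolding addsub_def using a_inv_closed additive_subgroup.a_subset[OF is_additive_subgroup] is_abelian_group by auto
qed

text \<open>The algebra is spanned by the residues of the finitely many paths that are shorter than some \<open>m\<close>, since
  an admissible ideal contains the paths of length at least \<open>m\<close>. The induction is on the number of short paths
  in the support of a representative.\<close>

lemma fd_algebra_fdalg:
  assumes A: "fd_algebra K A"
  shows "fdalg K A"
proof
  show kA: "k_algebra K A" using A by (simp add: fd_algebra_def)
  obtain Q :: "(nat, nat) pre_digraph" and J where Q: "fin_digraph Q" and J: "admissible_ideal K Q J"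
    and iso: "k_algebra_iso K A (quot_algebra (path_algebra K Q) J)"
    using A by (auto simp: fd_algebra_def)
  let ?P = "path_algebra K Q"
  obtain h where h: "h \<in> ring_iso A (quot_algebra ?P J)" and hk: "\<And>k a. k \<in> carrier K ==> a \<in> carrier A ==> h (k \<odot>\<^sub>A a) = k \<odot>\<^bsub>quot_algebra ?P J\<^esub> h a"
    using iso by (auto simp: k_algebra_iso_def)
  obtain m where m: "arrow_ideal_power K Q m \<subseteq> J" using J by (auto simp: admissible_ideal_def)
  have "ideal J ?P" using J by (simp add: admissible_ideal_def)
  note JS = ideal_addsub[OF this]
  have PG: "abelian_group ?P" using JS by (simp add: addsub_def)
  have fK: "field K" and rA: "ring A" and mA: "Module.module K A" using kA by (simp_all add: k_algebra_def)
  have rK: "ring K" using fK by (simp add: field_def domain_def cring_def)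
  have AG: "abelian_group A" using rA by (rule ring.is_abelian_group)
  note KG = ring.is_abelian_group[OF rK]
  have one: "\<one>\<^sub>A \<in> carrier A" using rA by (simp add: ring.ring_simprules)
  have hb: "bij_betw h (carrier A) ((\<lambda>f. J +>\<^sub>?P f) ` carrier ?P)" and
    ha: "\<And>a b. a \<in> carrier A ==> b \<in> carrier A ==> h (a \<oplus>\<^sub>A b) = h a <+>\<^sub>?P h b"
    using h by (simp_all add: ring_iso_def ring_hom_def)
  have hinj: "inj_on h (carrier A)" using hb by (simp add: bij_betw_def)
  have hsurj: "\<exists>a\<in>carrier A. h a = J +>\<^sub>?P f" if "f \<in> carrier ?P" for f
  proof -
    have "J +>\<^sub>?P f \<in> h ` carrier A" using bij_betw_imp_surj_on[OF hb] that by simp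
    thus ?thesis by (metis image_iff)
  qed
  \<comment> \<open>the scalar multiple of a coset is a union of cosets that is itself a coset, hence equal to each of them\<close>
  have hsm: "h (k \<odot>\<^sub>A a) = J +>\<^sub>?P (k \<odot>\<^sub>?P f)"
    if k: "k \<in> carrier K" and a: "a \<in> carrier A" and f: "f \<in> carrier ?P" "k \<odot>\<^sub>?P f \<in> carrier ?P" and e: "h a = J +>\<^sub>?P f" for k a f
  proof -
    let ?C = "\<Union>x\<in>J +>\<^sub>?P f. J +>\<^sub>?P (k \<odot>\<^sub>?P x)"
    have hC: "h (k \<odot>\<^sub>A a) = ?C" by (simp only: hk[OF k a] e quot_algebra_simps(6))
    have "h (k \<odot>\<^sub>A a) \<in> h ` carrier A" using module.smult_closed[OF mA k a] by blast
    hence "h (k \<odot>\<^sub>A a) \<in> (\<lambda>f. J +>\<^sub>?P f) ` carrier ?P" by (simp only: bij_betw_imp_surj_on[OF hb])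
    then obtain g where g: "g \<in> carrier ?P" "?C = J +>\<^sub>?P g" unfolding hC by (elim imageE)
    have "f \<in> J +>\<^sub>?P f" "k \<odot>\<^sub>?P f \<in> J +>\<^sub>?P (k \<odot>\<^sub>?P f)" by (rule coset_self[OF JS f(1)], rule coset_self[OF JS f(2)])
    hence "k \<odot>\<^sub>?P f \<in> J +>\<^sub>?P g" unfolding g(2)[symmetric] by blast
    hence "J +>\<^sub>?P (k \<odot>\<^sub>?P f) = J +>\<^sub>?P g" using coset_sub[OF JS g(1)] coset_eq[OF JS f(2) g(1)] by blast
    thus ?thesis using hC g(2) by simp
  qed
  let ?SP = "{p. quiver_path Q p \<and> length (snd p) < m}"
  let ?e = "\<lambda>p q. if q = p then \<one>\<^sub>K else \<zero>\<^sub>K"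
  let ?s = "\<lambda>p. inv_into (carrier A) h (J +>\<^sub>?P ?e p)"
  have eP: "?e p \<in> carrier ?P" if "quiver_path Q p" for p
  proof -
    have "finite {q. ?e p q \<noteq> \<zero>\<^sub>K}" by (rule finite_subset[of _ "{p}"]) auto
    thus ?thesis using that rK by (auto simp: path_algebra_carrier ring.ring_simprules)
  qed
  have sp: "?s p \<in> carrier A" "h (?s p) = J +>\<^sub>?P ?e p" if "quiver_path Q p" for p
  proof -
    have "J +>\<^sub>?P ?e p \<in> h ` carrier A" using bij_betw_imp_surj_on[OF hb] eP[OF that] by simp
    thus "?s p \<in> carrier A" "h (?s p) = J +>\<^sub>?P ?e p" by (rule inv_into_into, rule f_inv_into_f)
  qed
  let ?V = "kv A (reg A)"
  show "fin_generated K ?V"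
    unfolding fin_generated_def
  proof (intro exI[of _ "?s ` ?SP"] conjI allI impI)
    show "finite (?s ` ?SP)" by (rule finite_imageI[OF finite_short_paths[OF Q]])
    show "?s ` ?SP \<subseteq> carrier ?V" using sp(1) by auto
    fix N assume N: "submodule N K ?V \<and> ?s ` ?SP \<subseteq> N"
    hence NS: "submodule N K ?V" by blast
    note sg = submodule.axioms(1)[OF NS] and sm = submodule.smult_closed[OF NS]
    have NA: "N \<subseteq> carrier A" using subgroup.subset[OF sg] by simp
    have N0: "\<zero>\<^sub>A \<in> N" using subgroup.one_closed[OF sg] by simp
    have Nadd: "x \<oplus>\<^sub>A y \<in> N" if "x \<in> N" "y \<in> N" for x y using subgroup.m_closed[OF sg that] by simp
    have Nsm: "k \<odot>\<^sub>A x \<in> N" if k: "k \<in> carrier K" and x: "x \<in> N" for k x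
    proof -
      have xA: "x \<in> carrier A" using x NA by blast
      have "(k \<odot>\<^sub>A \<one>\<^sub>A) \<otimes>\<^sub>A x = k \<odot>\<^sub>A (\<one>\<^sub>A \<otimes>\<^sub>A x)" using kA k xA one by (simp add: k_algebra_def)
      also have "\<dots> = k \<odot>\<^sub>A x" using rA xA by (simp add: ring.ring_simprules)
      finally show ?thesis using sm[OF k x] by simp
    qed
    have "\<forall>f a. f \<in> carrier ?P \<longrightarrow> a \<in> carrier A \<longrightarrow> h a = J +>\<^sub>?P f \<longrightarrow> card {p. length (snd p) < m \<and> f p \<noteq> \<zero>\<^sub>K} = n \<longrightarrow> a \<in> N" for n
    proof (induction n)
      case 0
      show ?case
      proof (intro allI impI)
        fix f a assume f: "f \<in> carrier ?P" and a: "a \<in> carrier A" "h a = J +>\<^sub>?P f" and c: "card {p. length (snd p) < m \<and> f p \<noteq> \<zero>\<^sub>K} = 0"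
        have "finite {p. length (snd p) < m \<and> f p \<noteq> \<zero>\<^sub>K}"
          by (rule finite_subset[of _ "{p. f p \<noteq> \<zero>\<^sub>K}"]) (use f in \<open>auto simp: path_algebra_carrier\<close>)
        with c have "{p. length (snd p) < m \<and> f p \<noteq> \<zero>\<^sub>K} = {}" by simp
        hence "f \<in> arrow_ideal_power K Q m" using f by (auto simp: arrow_ideal_power_def)
        hence "f \<in> J" using m by blast
        hence hJ: "h a = J" using coset_eq_zero[OF JS f] a(2) by simp
        have "h (a \<oplus>\<^sub>A a) = J <+>\<^sub>?P J" using ha[OF a(1) a(1)] hJ by simp
        also have "\<dots> = J" using coset_add[OF JS ag_zero[OF PG] ag_zero[OF PG]] coset_zero[OF JS] ag_lzero[OF PG ag_zero[OF PG]] by (simp only:)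
        finally have "h (a \<oplus>\<^sub>A a) = h a" using hJ by simp
        hence "a \<oplus>\<^sub>A a = a" using inj_onD[OF hinj _ ag_closed[OF AG a(1) a(1)] a(1)] by blast
        hence "a = \<zero>\<^sub>A" by (rule ag_eq_zeroI[OF AG a(1)])
        thus "a \<in> N" using N0 by simp
      qed
    next
      case (Suc n)
      show ?case
      proof (intro allI impI)
        fix f a assume f: "f \<in> carrier ?P" and a: "a \<in> carrier A" "h a = J +>\<^sub>?P f" and c: "card {p. length (snd p) < m \<and> f p \<noteq> \<zero>\<^sub>K} = Suc n"
        have fc: "\<And>p. f p \<in> carrier K" "\<And>p. \<not> quiver_path Q p ==> f p = \<zero>\<^sub>K" "finite {p. f p \<noteq> \<zero>\<^sub>K}"
          using f by (auto simp: path_algebra_carrier)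
        have "{p. length (snd p) < m \<and> f p \<noteq> \<zero>\<^sub>K} \<noteq> {}" using c by (metis card.empty nat.distinct(1))
        then obtain p where p: "length (snd p) < m" "f p \<noteq> \<zero>\<^sub>K" by blast
        hence qp: "quiver_path Q p" using fc(2) by blast
        let ?f = "f(p := \<zero>\<^sub>K)"
        have "{q. ?f q \<noteq> \<zero>\<^sub>K} \<subseteq> {p. f p \<noteq> \<zero>\<^sub>K}" by auto
        hence f': "?f \<in> carrier ?P" using fc finite_subset[OF _ fc(3)] by (auto simp: path_algebra_carrier ag_zero[OF KG])
        have ke: "f p \<odot>\<^sub>?P ?e p \<in> carrier ?P"
        proof -
          have "finite {q. f p \<otimes>\<^sub>K ?e p q \<noteq> \<zero>\<^sub>K}" by (rule finite_subset[of _ "{p}"]) (use fc(1) rK in \<open>auto simp: ring.ring_simprules\<close>)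
          thus ?thesis using fc(1) qp rK by (auto simp: path_algebra_carrier ring.ring_simprules)
        qed
        have fs: "f = (f p \<odot>\<^sub>?P ?e p) \<oplus>\<^sub>?P ?f"
        proof
          interpret Kr: ring K by (rule rK)
          fix q
          show "f q = ((f p \<odot>\<^sub>?P ?e p) \<oplus>\<^sub>?P ?f) q"
            using fc(1)[of p] fc(1)[of q]
            by (cases "q = p") simp_all
        qed
        have "{q. length (snd q) < m \<and> f q \<noteq> \<zero>\<^sub>K} = insert p {q. length (snd q) < m \<and> ?f q \<noteq> \<zero>\<^sub>K}" using p by auto
        moreover have "finite {q. length (snd q) < m \<and> ?f q \<noteq> \<zero>\<^sub>K}"
          by (rule finite_subset[OF _ fc(3)]) auto
        ultimately have c': "card {q. length (snd q) < m \<and> ?f q \<noteq> \<zero>\<^sub>K} = n" using c by simp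
        obtain b where b: "b \<in> carrier A" "h b = J +>\<^sub>?P ?f" using hsurj[OF f'] by blast
        have bN: "b \<in> N" using Suc.IH f' b c' by blast
        have ksN: "f p \<odot>\<^sub>A ?s p \<in> N" by (rule Nsm[OF fc(1)]) (use N qp p(1) in blast)
        have hks: "h (f p \<odot>\<^sub>A ?s p) = J +>\<^sub>?P (f p \<odot>\<^sub>?P ?e p)" by (rule hsm[OF fc(1) sp(1)[OF qp] eP[OF qp] ke sp(2)[OF qp]])
        have ksA: "f p \<odot>\<^sub>A ?s p \<in> carrier A" using ksN NA by blast
        have "h (f p \<odot>\<^sub>A ?s p \<oplus>\<^sub>A b) = J +>\<^sub>?P ((f p \<odot>\<^sub>?P ?e p) \<oplus>\<^sub>?P ?f)"
          unfolding ha[OF ksA b(1)] hks b(2) by (rule coset_add[OF JS ke f'])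
        also have "\<dots> = h a" using fs a(2) by simp
        finally have "f p \<odot>\<^sub>A ?s p \<oplus>\<^sub>A b = a" using inj_onD[OF hinj _ ag_closed[OF AG ksA b(1)] a(1)] by blast
        thus "a \<in> N" using Nadd[OF ksN bN] by simp
      qed
    qed
    hence all: "a \<in> N" if "f \<in> carrier ?P" "a \<in> carrier A" "h a = J +>\<^sub>?P f" for f a using that by blast
    have "a \<in> N" if a: "a \<in> carrier A" for a
    proof -
      have "h a \<in> h ` carrier A" using a by blast
      hence "h a \<in> (\<lambda>f. J +>\<^sub>?P f) ` carrier ?P" by (simp only: bij_betw_imp_surj_on[OF hb])
      then obtain f where "f \<in> carrier ?P" "h a = J +>\<^sub>?P f" by (elim imageE)
      from all[OF this(1) a this(2)] show ?thesis .
    qed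
    thus "N = carrier ?V" using NA by auto
  qed
qed

section \<open>Homomorphisms from and tensor products with the quotient algebra\<close>

context idl begin

text \<open>A homomorphism from \<open>R/I\<close> to \<open>X\<close> is given by the image of \<open>1\<close>, which can be any element of the socle.\<close>

lemma soc_hom_iso:
  assumes s: "is_soc R I X V i" and iso: "mod_iso R (infl (hom_from_quot R I X)) Y"
  shows "mod_iso R (infl V) Y"
proof -
  note d = socD[OF s]
  let ?Z = "hom_from_quot R I X" and ?G = "inflate R I (reg B)"
  have Zs: "carrier ?Z = mod_hom R ?G X" "\<And>f g. f \<oplus>\<^sub>?Z g = (\<lambda>C\<in>carrier B. f C \<oplus>\<^sub>X g C)"
    "\<And>b f. b \<odot>\<^sub>?Z f = (\<lambda>C\<in>carrier B. f (C \<otimes>\<^sub>B b))"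
    by (simp_all add: hom_from_quot_def hom_module_def hom_group_def)
  have G: "left_module R ?G" by (rule infl_lm[OF B.regR])
  define h where "h = (\<lambda>v. \<lambda>C\<in>carrier B. i (C \<odot>\<^sub>V v))"
  have Bl: "\<And>a. a \<in> carrier R ==> cls a \<in> carrier B" by simp
  have hc: "h v \<in> carrier ?Z" if v: "v \<in> carrier V" for v
  proof -
    have "lin R ?G (infl V) (\<lambda>C. C \<odot>\<^sub>V v)" using cyclic_lin[OF d(2) v] by (simp add: lin_infl)
    from restrict_mod_hom[OF G lin_comp[OF this d(3)]] show ?thesis unfolding Zs h_def by simp
  qed
  have Vsm: "C \<odot>\<^sub>V v \<in> carrier V" if "C \<in> carrier B" "v \<in> carrier V" for C v by (rule lm_smult[OF d(2) that])
  have hl: "lin R (infl V) (infl ?Z) h"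
  proof (rule linI)
    show "h v \<in> carrier (infl ?Z)" if "v \<in> carrier (infl V)" for v using hc that by simp
    fix v w assume vw: "v \<in> carrier (infl V)" "w \<in> carrier (infl V)"
    show "h (v \<oplus>\<^bsub>infl V\<^esub> w) = h v \<oplus>\<^bsub>infl ?Z\<^esub> h w"
      unfolding inflate_simps Zs h_def
      by (rule restrict_ext) (use vw Vsm lin_add[OF d(3)] in \<open>simp add: lm_r_distr[OF d(2)] del: quot_algebra_simps\<close>)
  next
    fix a v assume a: "a \<in> carrier R" and v: "v \<in> carrier (infl V)"
    show "h (a \<odot>\<^bsub>infl V\<^esub> v) = a \<odot>\<^bsub>infl ?Z\<^esub> h v"
      unfolding inflate_simps Zs h_def
      by (rule restrict_ext) (use v Bl[OF a] in \<open>simp add: lm_assoc[OF d(2)] B.multR del: quot_algebra_simps\<close>)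
  qed
  have i0: "i \<zero>\<^sub>V = \<zero>\<^sub>X" using lm_lin_zero[OF d(3) infl_lm[OF d(2)] d(1)] by simp
  have hb: "bij_betw h (carrier (infl V)) (carrier (infl ?Z))"
  proof (rule bij_betwI')
    fix v w assume vw: "v \<in> carrier (infl V)" "w \<in> carrier (infl V)"
    have "v = w" if e: "h v = h w"
    proof -
      have "h v \<one>\<^sub>B = h w \<one>\<^sub>B" using e by simp
      hence "i v = i w" using vw B.oneR by (simp add: h_def lm_one[OF d(2)] del: quot_algebra_simps)
      thus "v = w" using inj_onD[OF d(4)] vw by simp
    qed
    thus "(h v = h w) = (v = w)" by blast
  next
    show "h v \<in> carrier (infl ?Z)" if "v \<in> carrier (infl V)" for v using hc that by simp
  next
    fix f assume "f \<in> carrier (infl ?Z)"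
    hence f: "f \<in> extensional (carrier B)" "lin R ?G X f" by (simp_all add: Zs mod_hom_iff del: quot_algebra_simps)
    have f0: "f \<zero>\<^sub>B = \<zero>\<^sub>X" using lm_lin_zero[OF f(2) G d(1)] by simp
    have fa: "f (cls a) = a \<odot>\<^sub>X f \<one>\<^sub>B" if a: "a \<in> carrier R" for a
      using lin_smult[OF f(2) a, of "\<one>\<^sub>B"] B.oneR Bl[OF a] by (simp add: ring.ring_simprules[OF B.R] del: quot_algebra_simps) (simp add: cls_mult a oneR monoid.r_one[OF ring.is_monoid[OF R]])
    have "f \<one>\<^sub>B \<in> carrier X" using lin_closed[OF f(2), of "\<one>\<^sub>B"] B.oneR by simp
    moreover have "a \<odot>\<^sub>X f \<one>\<^sub>B = \<zero>\<^sub>X" if "a \<in> I" for a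
    proof -
      have aR: "a \<in> carrier R" using that I_sub by blast
      have "cls a = I" using cls_zero[OF aR] that by simp
      thus ?thesis using fa[OF aR] f0 by simp
    qed
    ultimately have "f \<one>\<^sub>B \<in> soc I X" by (simp add: soc_def)
    then obtain v where v: "v \<in> carrier V" "f \<one>\<^sub>B = i v" using surjE[OF d(5)] by blast
    have "f = h v"
    proof (rule extensionalityI[OF f(1)])
      show "h v \<in> extensional (carrier B)" by (simp add: h_def)
      fix C assume C: "C \<in> carrier B"
      then obtain a where a: "a \<in> carrier R" "C = cls a" by auto
      have "i (cls a \<odot>\<^sub>V v) = a \<odot>\<^sub>X i v" using lin_smult[OF d(3) a(1), of v] v(1) by simp
      thus "f C = h v C" using fa[OF a(1)] a(2) v(2) C by (simp add: h_def del: quot_algebra_simps)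
    qed
    thus "\<exists>v\<in>carrier (infl V). f = h v" using v(1) by auto
  qed
  obtain f where f: "lin R (infl ?Z) Y f" "bij_betw f (carrier (infl ?Z)) (carrier Y)"
    using iso by (auto simp: mod_iso_def mod_hom_iff)
  show ?thesis
    by (rule mod_isoI[OF infl_lm[OF d(2)] lin_comp[OF hl f(1)]]) (use bij_betw_trans[OF hb f(2)] in \<open>simp add: comp_def\<close>)
qed

text \<open>The map \<open>x \<mapsto> 1 \<otimes> x\<close> is onto and kills \<open>IX\<close>. Its kernel is not larger, because \<open>(b, x) \<mapsto> b p(x)\<close>
  respects the relations of the tensor product and sends \<open>1 \<otimes> x\<close> to \<open>p(x)\<close>.\<close>

lemma top_tensor_iso:
  assumes t: "is_top R I X V p" and iso: "mod_iso R (infl (quot_tensor R I X)) Y"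
  shows "mod_iso R (infl V) Y"
proof -
  note d = topD[OF t]
  note X = d(1)
  let ?Z = "quot_tensor R I X"
  define F where "F = free_Abelian_group (carrier B \<times> carrier X)"
  define rels where "rels = tensor_relations R B (\<lambda>y a. y \<otimes>\<^sub>B cls a) X"
  define H where "H = generate F rels"
  \<comment> \<open>the action of an element of B on representatives of the tensor product\<close>
  define \<phi> where "\<phi> = (\<lambda>b. frag_extend (\<lambda>(n, x :: 'b). frag_of (b \<otimes>\<^sub>B n, x)))"
  have Fs: "carrier F = {c. Poly_Mapping.keys c \<subseteq> carrier B \<times> carrier X}" "\<And>x y. x \<otimes>\<^sub>F y = x + y" "\<one>\<^sub>F = 0"
    by (simp_all add: F_def free_Abelian_group_def)
  have FG: "comm_group F" unfolding F_def by (rule abelian_free_Abelian_group)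
  have Fgr: "Group.group F" using FG by (simp add: comm_group_def)
  have Finv: "inv\<^bsub>F\<^esub> x = - x" if "x \<in> carrier F" for x using that unfolding F_def by simp
  have kF: "frag_of (n, x) \<in> carrier F" if "n \<in> carrier B" "x \<in> carrier X" for n x
    using that unfolding Fs by (simp add: keys_frag_of del: quot_algebra_simps)
  have Fdiff: "a - b \<in> carrier F" if "a \<in> carrier F" "b \<in> carrier F" for a b
    using that keys_diff[of a b] unfolding Fs by blast
  have BX: "\<And>b c. b \<in> carrier B ==> c \<in> carrier B ==> b \<oplus>\<^sub>B c \<in> carrier B"
    "\<And>b c. b \<in> carrier B ==> c \<in> carrier B ==> b \<otimes>\<^sub>B c \<in> carrier B" "\<And>a. a \<in> carrier R ==> cls a \<in> carrier B"
    by (rule ag_closed[OF B.RG], assumption+, rule B.multR, assumption+, simp)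
  have rF: "rels \<subseteq> carrier F"
    unfolding rels_def tensor_relations_def
    by (auto intro!: Fdiff kF BX lm_closed[OF X] lm_smult[OF X] simp del: quot_algebra_simps)
  have H0: "0 \<in> H" unfolding H_def using generate.one[of F rels] Fs(3) by simp
  have Hadd: "a + b \<in> H" if "a \<in> H" "b \<in> H" for a b
    using generate.eng[of a F rels b] that Fs(2) unfolding H_def by simp
  have HF: "H \<subseteq> carrier F" unfolding H_def by (rule group.generate_incl[OF Fgr rF])
  have Hneg: "- a \<in> H" if "a \<in> H" for a
    using group.generate_m_inv_closed[OF Fgr rF, of a] Finv[of a] that HF unfolding H_def by auto
  have Hdiff: "a - b \<in> H" if "a \<in> H" "b \<in> H" for a b using Hadd[OF that(1) Hneg[OF that(2)]] by simp
  have rel1: "frag_of (n \<oplus>\<^sub>B n', x) - frag_of (n, x) - frag_of (n', x) \<in> H" if "n \<in> carrier B" "n' \<in> carrier B" "x \<in> carrier X" for n n' x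
    unfolding H_def by (rule generate.incl) (use that in \<open>force simp: rels_def tensor_relations_def simp del: quot_algebra_simps\<close>)
  have rel2: "frag_of (n, x \<oplus>\<^sub>X x') - frag_of (n, x) - frag_of (n, x') \<in> H" if "n \<in> carrier B" "x \<in> carrier X" "x' \<in> carrier X" for n x x'
    unfolding H_def by (rule generate.incl) (use that in \<open>force simp: rels_def tensor_relations_def simp del: quot_algebra_simps\<close>)
  have rel3: "frag_of (n \<otimes>\<^sub>B cls a, x) - frag_of (n, a \<odot>\<^sub>X x) \<in> H" if "n \<in> carrier B" "a \<in> carrier R" "x \<in> carrier X" for n a x
    unfolding H_def by (rule generate.incl) (use that in \<open>force simp: rels_def tensor_relations_def simp del: quot_algebra_simps\<close>)
  \<comment> \<open>the subgroup of relations is closed under what all relations satisfy\<close>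
  have Hind: "P c" if c: "c \<in> H" and P: "P 0" "\<And>r. r \<in> rels ==> P r" "\<And>a. a \<in> H ==> P a ==> P (- a)" "\<And>a b. a \<in> H ==> b \<in> H ==> P a ==> P b ==> P (a + b)" for P c
    using c unfolding H_def
  proof (induction rule: generate.induct)
    case one then show ?case using P(1) Fs(3) by simp
  next
    case (incl h) then show ?case by (rule P(2))
  next
    case (inv h)
    then have "P (- h)" using P(3)[OF _ P(2)] generate.incl[of h rels F] unfolding H_def by blast
    then show ?case using Finv[of h] inv rF by auto
  next
    case (eng h1 h2) then show ?case using P(4)[of h1 h2] Fs(2) unfolding H_def by simp
  qed
  have rel_cases: "P r" if r: "r \<in> rels"
      and P1: "\<And>n n' x. n \<in> carrier B ==> n' \<in> carrier B ==> x \<in> carrier X ==> P (frag_of (n \<oplus>\<^sub>B n', x) - frag_of (n, x) - frag_of (n', x))"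
      and P2: "\<And>n x x'. n \<in> carrier B ==> x \<in> carrier X ==> x' \<in> carrier X ==> P (frag_of (n, x \<oplus>\<^sub>X x') - frag_of (n, x) - frag_of (n, x'))"
      and P3: "\<And>n a x. n \<in> carrier B ==> a \<in> carrier R ==> x \<in> carrier X ==> P (frag_of (n \<otimes>\<^sub>B cls a, x) - frag_of (n, a \<odot>\<^sub>X x))" for P r
    using r unfolding rels_def tensor_relations_def by (elim UnE CollectE exE conjE) (simp_all only: P1 P2 P3)
  have \<phi>H: "\<phi> b c \<in> H" if b: "b \<in> carrier B" and c: "c \<in> H" for b c
    using c
  proof (rule Hind)
    show "\<phi> b 0 \<in> H" using H0 by (simp add: \<phi>_def)
    show "\<phi> b (- a) \<in> H" if "\<phi> b a \<in> H" for a using Hneg[OF that] by (simp add: \<phi>_def frag_extend_minus)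
    show "\<phi> b (a + a') \<in> H" if "\<phi> b a \<in> H" "\<phi> b a' \<in> H" for a a' using Hadd[OF that] by (simp add: \<phi>_def frag_extend_add)
    fix r assume "r \<in> rels"
    thus "\<phi> b r \<in> H"
    proof (rule rel_cases)
      fix n n' x assume nx: "n \<in> carrier B" "n' \<in> carrier B" "x \<in> carrier X"
      show "\<phi> b (frag_of (n \<oplus>\<^sub>B n', x) - frag_of (n, x) - frag_of (n', x)) \<in> H"
        using rel1[OF BX(2)[OF b nx(1)] BX(2)[OF b nx(2)] nx(3)] ring.ring_simprules(23)[OF B.R nx(1,2) b]
        by (simp add: \<phi>_def frag_extend_diff del: quot_algebra_simps)
    next
      fix n x x' assume nx: "n \<in> carrier B" "x \<in> carrier X" "x' \<in> carrier X"
      show "\<phi> b (frag_of (n, x \<oplus>\<^sub>X x') - frag_of (n, x) - frag_of (n, x')) \<in> H"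
        using rel2[OF BX(2)[OF b nx(1)] nx(2,3)] by (simp add: \<phi>_def frag_extend_diff del: quot_algebra_simps)
    next
      fix n a x assume nx: "n \<in> carrier B" "a \<in> carrier R" "x \<in> carrier X"
      show "\<phi> b (frag_of (n \<otimes>\<^sub>B cls a, x) - frag_of (n, a \<odot>\<^sub>X x)) \<in> H"
        using rel3[OF BX(2)[OF b nx(1)] nx(2,3)] ring.ring_simprules(11)[OF B.R b nx(1) BX(3)[OF nx(2)]]
        by (simp add: \<phi>_def frag_extend_diff del: quot_algebra_simps)
    qed
  qed
  define k where "k = (\<lambda>c. H #>\<^bsub>F\<^esub> c)"
  have kmem: "y \<in> k c \<longleftrightarrow> y - c \<in> H" for y c
  proof -
    have "y \<in> k c \<longleftrightarrow> (\<exists>h\<in>H. y = h + c)" by (simp add: k_def r_coset_def Fs(2))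
    also have "\<dots> \<longleftrightarrow> y - c \<in> H" by force
    finally show ?thesis .
  qed
  have keq: "k c = k c' \<longleftrightarrow> c - c' \<in> H" for c c'
  proof
    assume "k c = k c'" thus "c - c' \<in> H" using kmem[of c c'] kmem[of c c] H0 by simp
  next
    assume cc: "c - c' \<in> H"
    have "y - c \<in> H \<longleftrightarrow> y - c' \<in> H" for y using Hadd[of "y - c" "c - c'"] Hdiff[of "y - c'" "c - c'"] cc by auto
    thus "k c = k c'" by (auto simp: kmem)
  qed
  have Zs: "carrier ?Z = k ` carrier F" "\<And>C C'. C \<oplus>\<^sub>?Z C' = C <#>\<^bsub>F\<^esub> C'" "\<And>b C. b \<odot>\<^sub>?Z C = (\<Union>c\<in>C. k (\<phi> b c))"
    by (simp_all add: quot_tensor_def tensor_module_def Let_def F_def[symmetric] rels_def[symmetric] H_def[symmetric] FactGroup_def RCOSETS_def k_def \<phi>_def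
        UNION_singleton_eq_range del: quot_algebra_simps)
  have kadd: "k c \<oplus>\<^sub>?Z k c' = k (c + c')" for c c'
  proof -
    have "y \<in> k c \<oplus>\<^sub>?Z k c' \<longleftrightarrow> y \<in> k (c + c')" for y
    proof
      assume "y \<in> k c \<oplus>\<^sub>?Z k c'"
      then obtain u v where "u - c \<in> H" "v - c' \<in> H" "y = u + v" by (auto simp: Zs(2) set_mult_def Fs(2) kmem)
      thus "y \<in> k (c + c')" using Hadd[of "u - c" "v - c'"] by (simp add: kmem algebra_simps)
    next
      assume y: "y \<in> k (c + c')"
      have "y - c' \<in> k c" "c' \<in> k c'" using y H0 by (simp_all add: kmem algebra_simps)
      thus "y \<in> k c \<oplus>\<^sub>?Z k c'" unfolding Zs(2) set_mult_def Fs(2) by force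
    qed
    thus ?thesis by blast
  qed
  have ksm: "b \<odot>\<^sub>?Z k c = k (\<phi> b c)" if b: "b \<in> carrier B" for b c
  proof -
    have "k (\<phi> b c') = k (\<phi> b c)" if "c' \<in> k c" for c'
      using \<phi>H[OF b, of "c' - c"] that by (simp add: kmem keq \<phi>_def frag_extend_diff)
    moreover have "c \<in> k c" using H0 by (simp add: kmem)
    ultimately show ?thesis unfolding Zs(3) by blast
  qed
  let ?o = "\<one>\<^sub>B"
  note o = B.oneR
  let ?fr = "\<lambda>x. frag_of (?o, x)"
  note XG = lm_ag[OF X]
  have fadd: "?fr (x \<oplus>\<^sub>X y) - ?fr x - ?fr y \<in> H" if "x \<in> carrier X" "y \<in> carrier X" for x y by (rule rel2[OF o that])
  have fsm: "\<phi> (cls a) (?fr x) - ?fr (a \<odot>\<^sub>X x) \<in> H" if a: "a \<in> carrier R" and x: "x \<in> carrier X" for a x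
    using rel3[OF o a x] ring.ring_simprules(12)[OF B.R BX(3)[OF a]] monoid.r_one[OF ring.is_monoid[OF B.R] BX(3)[OF a]]
    by (simp add: \<phi>_def del: quot_algebra_simps)
  have fdiff: "?fr x - ?fr (x \<ominus>\<^sub>X y) - ?fr y \<in> H" if "x \<in> carrier X" "y \<in> carrier X" for x y
    using fadd[OF ag_diff[OF XG that] that(2)] ag_diff_add[OF XG that] by simp
  have f0: "?fr \<zero>\<^sub>X \<in> H" using fadd[OF ag_zero[OF XG] ag_zero[OF XG]] Hneg ag_lzero[OF XG ag_zero[OF XG]] by fastforce
  \<comment> \<open>every class contains a representative of the form \<open>1 \<otimes> x\<close>\<close>
  have cover: "\<exists>x\<in>carrier X. c - ?fr x \<in> H" if "c \<in> carrier F" for c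
  proof -
    have "Poly_Mapping.keys c \<subseteq> carrier B \<times> carrier X" using that Fs(1) by simp
    thus ?thesis
    proof (induction rule: frag_induction)
      case zero
      show ?case using Hneg[OF f0] ag_zero[OF XG] by (intro bexI[of _ "\<zero>\<^sub>X"]) simp_all
    next
      case (one nx)
      then obtain n x where nx: "nx = (n, x)" "n \<in> carrier B" "x \<in> carrier X" by (cases nx) blast
      then obtain a where a: "a \<in> carrier R" "n = cls a" by auto
      have "frag_of nx - ?fr (a \<odot>\<^sub>X x) \<in> H"
        using rel3[OF o a(1) nx(3)] ring.ring_simprules(12)[OF B.R BX(3)[OF a(1)]] nx(1) a(2) by (simp del: quot_algebra_simps)
      thus ?case using lm_smult[OF X a(1) nx(3)] by blast
    next
      case (diff a b)
      then obtain x y where xy: "x \<in> carrier X" "a - ?fr x \<in> H" "y \<in> carrier X" "b - ?fr y \<in> H" by blast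
      have "(a - ?fr x) - (b - ?fr y) + (?fr x - ?fr (x \<ominus>\<^sub>X y) - ?fr y) \<in> H"
        by (rule Hadd[OF Hdiff[OF xy(2,4)] fdiff[OF xy(1,3)]])
      hence "a - b - ?fr (x \<ominus>\<^sub>X y) \<in> H" by (simp add: algebra_simps)
      thus ?case using ag_diff[OF XG xy(1,3)] by blast
    qed
  qed
  have ker1: "?fr x \<in> H" if "x \<in> isub R I X" for x
  proof -
    have "isub R I X \<subseteq> {x \<in> carrier X. ?fr x \<in> H}"
    proof (rule isub_least[OF submodI[OF X]])
      show "\<zero>\<^sub>X \<in> {x \<in> carrier X. ?fr x \<in> H}" using f0 ag_zero[OF XG] by simp
      fix x y assume xy: "x \<in> {x \<in> carrier X. ?fr x \<in> H}" "y \<in> {x \<in> carrier X. ?fr x \<in> H}"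
      have "(?fr (x \<oplus>\<^sub>X y) - ?fr x - ?fr y) + (?fr x + ?fr y) \<in> H" using xy fadd Hadd by blast
      thus "x \<oplus>\<^sub>X y \<in> {x \<in> carrier X. ?fr x \<in> H}" using xy ag_closed[OF XG] by simp
    next
      fix a x assume a: "a \<in> carrier R" and x: "x \<in> {x \<in> carrier X. ?fr x \<in> H}"
      have "\<phi> (cls a) (?fr x) - (\<phi> (cls a) (?fr x) - ?fr (a \<odot>\<^sub>X x)) \<in> H"
        using x by (intro Hdiff \<phi>H[OF BX(3)[OF a]] fsm[OF a]) auto
      thus "a \<odot>\<^sub>X x \<in> {x \<in> carrier X. ?fr x \<in> H}" using x lm_smult[OF X a] by simp
    next
      fix a x assume a: "a \<in> I" and x: "x \<in> carrier X"
      have aR: "a \<in> carrier R" using a I_sub by blast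
      have ca: "cls a = \<zero>\<^sub>B" using cls_zero[OF aR] a by simp
      have z: "\<zero>\<^sub>B \<in> carrier B" by (rule ag_zero[OF B.RG])
      have "frag_of (\<zero>\<^sub>B, x) \<in> H" using Hneg[OF rel1[OF z z x]] ag_lzero[OF B.RG z] by (simp del: quot_algebra_simps)
      moreover have "frag_of (\<zero>\<^sub>B, x) - ?fr (a \<odot>\<^sub>X x) \<in> H"
        using rel3[OF o aR x] ring.ring_simprules(12)[OF B.R BX(3)[OF aR]] ca by (simp del: quot_algebra_simps)
      ultimately have "frag_of (\<zero>\<^sub>B, x) - (frag_of (\<zero>\<^sub>B, x) - ?fr (a \<odot>\<^sub>X x)) \<in> H" by (rule Hdiff)
      thus "a \<odot>\<^sub>X x \<in> {x \<in> carrier X. ?fr x \<in> H}" using lm_smult[OF X aR x] by simp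
    qed auto
    thus ?thesis using that by blast
  qed
  note VG = lm_ag[OF d(2)]
  interpret VC: comm_group "add_monoid V" by (rule abelian_group.a_comm_group[OF VG])
  have pc: "p x \<in> carrier V" if "x \<in> carrier X" for x using lin_closed[OF d(3) that] by simp
  have psm: "p (a \<odot>\<^sub>X x) = cls a \<odot>\<^sub>V p x" if "a \<in> carrier R" "x \<in> carrier X" for a x using lin_smult[OF d(3) that] by simp
  have padd: "p (x \<oplus>\<^sub>X y) = p x \<oplus>\<^sub>V p y" if "x \<in> carrier X" "y \<in> carrier X" for x y using lin_add[OF d(3) that] by simp
  have "(\<lambda>(n, x). n \<odot>\<^sub>V p x) ` (carrier B \<times> carrier X) \<subseteq> carrier (add_monoid V)"
    using lm_smult[OF d(2)] pc by (force simp del: quot_algebra_simps)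
  \<comment> \<open>the homomorphism \<open>(b, x) \<mapsto> b p(x)\<close>\<close>
  from VC.free_Abelian_group_universal[OF this]
  obtain \<psi> where \<psi>: "\<psi> \<in> hom F (add_monoid V)" "\<And>nx. nx \<in> carrier B \<times> carrier X ==> \<psi> (frag_of nx) = (\<lambda>(n, x). n \<odot>\<^sub>V p x) nx"
    unfolding F_def by blast
  have \<psi>c: "\<psi> c \<in> carrier V" if "c \<in> carrier F" for c using \<psi>(1) that by (auto simp: hom_def Pi_iff)
  have \<psi>add: "\<psi> (c + c') = \<psi> c \<oplus>\<^sub>V \<psi> c'" if "c \<in> carrier F" "c' \<in> carrier F" for c c'
    using hom_mult[OF \<psi>(1) that] Fs(2) by simp
  have \<psi>0: "\<psi> 0 = \<zero>\<^sub>V"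
  proof -
    have z: "0 \<in> carrier F" using Fs(1) by simp
    show ?thesis using \<psi>add[OF z z] ag_eq_zeroI[OF VG \<psi>c[OF z]] by simp
  qed
  have \<psi>diff: "\<psi> (c - c') \<oplus>\<^sub>V \<psi> c' = \<psi> c" if "c \<in> carrier F" "c' \<in> carrier F" for c c'
    using \<psi>add[OF Fdiff[OF that] that(2)] by simp
  have canc: "u = w" if "u \<oplus>\<^sub>V v = w \<oplus>\<^sub>V v" "u \<in> carrier V" "v \<in> carrier V" "w \<in> carrier V" for u v w
    using that VC.right_cancel[of v u w] by simp
  have \<psi>f: "\<psi> (frag_of (n, x)) = n \<odot>\<^sub>V p x" if "n \<in> carrier B" "x \<in> carrier X" for n x
    using \<psi>(2)[of "(n, x)"] that by (simp del: quot_algebra_simps)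
  have \<psi>r3: "\<psi> (c - c' - c'') = \<zero>\<^sub>V" if c: "c \<in> carrier F" "c' \<in> carrier F" "c'' \<in> carrier F" and e: "\<psi> c = \<psi> c' \<oplus>\<^sub>V \<psi> c''" for c c' c''
  proof (rule canc[of _ "\<psi> c'' \<oplus>\<^sub>V \<psi> c'"])
    have "\<psi> (c - c' - c'') \<oplus>\<^sub>V (\<psi> c'' \<oplus>\<^sub>V \<psi> c') = \<psi> c"
      using \<psi>diff[OF Fdiff[OF c(1,2)] c(3)] \<psi>diff[OF c(1,2)] ag_assoc[OF VG \<psi>c[OF Fdiff[OF Fdiff[OF c(1,2)] c(3)]] \<psi>c[OF c(3)] \<psi>c[OF c(2)]] by simp
    thus "\<psi> (c - c' - c'') \<oplus>\<^sub>V (\<psi> c'' \<oplus>\<^sub>V \<psi> c') = \<zero>\<^sub>V \<oplus>\<^sub>V (\<psi> c'' \<oplus>\<^sub>V \<psi> c')"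
      using e ag_lzero[OF VG ag_closed[OF VG \<psi>c[OF c(3)] \<psi>c[OF c(2)]]] ag_comm[OF VG \<psi>c[OF c(3)] \<psi>c[OF c(2)]] by simp
  qed (use c \<psi>c ag_closed[OF VG] Fdiff ag_zero[OF VG] in auto)
  have \<psi>H: "\<psi> c = \<zero>\<^sub>V" if "c \<in> H" for c
    using that
  proof (rule Hind)
    show "\<psi> (- a) = \<zero>\<^sub>V" if "a \<in> H" "\<psi> a = \<zero>\<^sub>V" for a
    proof -
      have aF: "a \<in> carrier F" "- a \<in> carrier F" using that(1) Hneg HF by auto
      show ?thesis using \<psi>add[OF aF(2,1)] that(2) \<psi>0 ag_rzero[OF VG \<psi>c[OF aF(2)]] by simp
    qed
    show "\<psi> (a + b) = \<zero>\<^sub>V" if "a \<in> H" "b \<in> H" "\<psi> a = \<zero>\<^sub>V" "\<psi> b = \<zero>\<^sub>V" for a b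
      using \<psi>add[of a b] that HF ag_lzero[OF VG ag_zero[OF VG]] by auto
    fix r assume "r \<in> rels"
    thus "\<psi> r = \<zero>\<^sub>V"
    proof (rule rel_cases)
      fix n n' x assume nx: "n \<in> carrier B" "n' \<in> carrier B" "x \<in> carrier X"
      show "\<psi> (frag_of (n \<oplus>\<^sub>B n', x) - frag_of (n, x) - frag_of (n', x)) = \<zero>\<^sub>V"
        by (rule \<psi>r3[OF kF[OF BX(1)[OF nx(1,2)] nx(3)] kF[OF nx(1,3)] kF[OF nx(2,3)]])
           (use nx BX(1)[OF nx(1,2)] in \<open>simp add: \<psi>f lm_l_distr[OF d(2)] pc del: quot_algebra_simps\<close>)
    next
      fix n x x' assume nx: "n \<in> carrier B" "x \<in> carrier X" "x' \<in> carrier X"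
      show "\<psi> (frag_of (n, x \<oplus>\<^sub>X x') - frag_of (n, x) - frag_of (n, x')) = \<zero>\<^sub>V"
        by (rule \<psi>r3[OF kF[OF nx(1) ag_closed[OF XG nx(2,3)]] kF[OF nx(1,2)] kF[OF nx(1,3)]])
           (use nx ag_closed[OF XG nx(2,3)] in \<open>simp add: \<psi>f padd lm_r_distr[OF d(2)] pc del: quot_algebra_simps\<close>)
    next
      fix n a x assume nx: "n \<in> carrier B" "a \<in> carrier R" "x \<in> carrier X"
      note c1 = kF[OF BX(2)[OF nx(1) BX(3)[OF nx(2)]] nx(3)] and c2 = kF[OF nx(1) lm_smult[OF X nx(2,3)]]
      have "\<psi> (frag_of (n \<otimes>\<^sub>B cls a, x)) = \<psi> (frag_of (n, a \<odot>\<^sub>X x))"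
        using \<psi>f[OF BX(2)[OF nx(1) BX(3)[OF nx(2)]] nx(3)] \<psi>f[OF nx(1) lm_smult[OF X nx(2,3)]] psm[OF nx(2,3)]
          lm_assoc[OF d(2) nx(1) BX(3)[OF nx(2)] pc[OF nx(3)]] by (simp del: quot_algebra_simps)
      thus "\<psi> (frag_of (n \<otimes>\<^sub>B cls a, x) - frag_of (n, a \<odot>\<^sub>X x)) = \<zero>\<^sub>V"
        using \<psi>diff[OF c1 c2] ag_add_left_zero[OF VG \<psi>c[OF Fdiff[OF c1 c2]] \<psi>c[OF c2]] by simp
    qed
  qed (rule \<psi>0)
  have keyq: "k (?fr x) = k (?fr y) \<longleftrightarrow> p x = p y" if xy: "x \<in> carrier X" "y \<in> carrier X" for x y
  proof
    assume "k (?fr x) = k (?fr y)"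
    hence "\<psi> (?fr x - ?fr y) = \<zero>\<^sub>V" using \<psi>H keq by blast
    hence "\<psi> (?fr x) = \<psi> (?fr y)" using \<psi>diff[OF kF[OF o xy(1)] kF[OF o xy(2)]] ag_lzero[OF VG \<psi>c[OF kF[OF o xy(2)]]] by simp
    thus "p x = p y" using \<psi>f[OF o xy(1)] \<psi>f[OF o xy(2)] lm_one[OF d(2)] pc xy by (simp del: quot_algebra_simps)
  next
    assume e: "p x = p y"
    have "p (x \<ominus>\<^sub>X y) = p x \<ominus>\<^bsub>infl V\<^esub> p y" by (rule lin_diff[OF d(3) XG lm_ag[OF infl_lm[OF d(2)]] xy])
    also have "\<dots> = \<zero>\<^bsub>infl V\<^esub>" using ag_diff_zero[OF lm_ag[OF infl_lm[OF d(2)]], of "p x" "p y"] pc xy e by simp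
    finally have "x \<ominus>\<^sub>X y \<in> isub R I X" using d(5)[OF ag_diff[OF XG xy]] by simp
    from Hadd[OF fdiff[OF xy] ker1[OF this]] show "k (?fr x) = k (?fr y)" by (simp add: keq algebra_simps)
  qed
  define s where "s = (\<lambda>v. SOME x. x \<in> carrier X \<and> p x = v)"
  have sx: "s v \<in> carrier X \<and> p (s v) = v" if "v \<in> carrier V" for v
  proof -
    have "v \<in> p ` carrier X" using that by (simp only: d(4))
    hence "\<exists>x. x \<in> carrier X \<and> p x = v" by blast
    thus ?thesis unfolding s_def by (rule someI_ex)
  qed
  define h where "h = (\<lambda>v. k (?fr (s v)))"
  have hp: "h (p x) = k (?fr x)" if "x \<in> carrier X" for x
    unfolding h_def using keyq[of "s (p x)" x] sx[OF pc[OF that]] that by blast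
  have hl: "lin R (infl V) (infl ?Z) h"
  proof (rule linI)
    show "h v \<in> carrier (infl ?Z)" if "v \<in> carrier (infl V)" for v
      using sx[of v] that kF[OF o] unfolding h_def by (auto simp: Zs(1) simp del: quot_algebra_simps)
    fix v w assume "v \<in> carrier (infl V)" "w \<in> carrier (infl V)"
    then obtain x y where xy: "x \<in> carrier X" "v = p x" "y \<in> carrier X" "w = p y" using sx by (metis inflate_simps(1))
    have "h (v \<oplus>\<^bsub>infl V\<^esub> w) = k (?fr (x \<oplus>\<^sub>X y))" using hp[OF ag_closed[OF XG xy(1,3)]] padd[OF xy(1,3)] xy by simp
    also have "\<dots> = k (?fr x + ?fr y)" unfolding keq using fadd[OF xy(1,3)] by (simp add: algebra_simps)
    finally show "h (v \<oplus>\<^bsub>infl V\<^esub> w) = h v \<oplus>\<^bsub>infl ?Z\<^esub> h w" using kadd hp xy by simp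
  next
    fix a v assume a: "a \<in> carrier R" and "v \<in> carrier (infl V)"
    then obtain x where x: "x \<in> carrier X" "v = p x" using sx by (metis inflate_simps(1))
    have "k (\<phi> (cls a) (?fr x)) = k (?fr (a \<odot>\<^sub>X x))" unfolding keq by (rule fsm[OF a x(1)])
    thus "h (a \<odot>\<^bsub>infl V\<^esub> v) = a \<odot>\<^bsub>infl ?Z\<^esub> h v"
      using hp[OF lm_smult[OF X a x(1)]] psm[OF a x(1)] ksm[OF BX(3)[OF a]] hp[OF x(1)] x(2) by simp
  qed
  have hb: "bij_betw h (carrier (infl V)) (carrier (infl ?Z))"
  proof (rule bij_betwI')
    show "(h v = h w) = (v = w)" if "v \<in> carrier (infl V)" "w \<in> carrier (infl V)" for v w
      using keyq[of "s v" "s w"] sx[of v] sx[of w] that unfolding h_def by auto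
    show "h v \<in> carrier (infl ?Z)" if "v \<in> carrier (infl V)" for v by (rule lin_closed[OF hl that])
    fix C assume "C \<in> carrier (infl ?Z)"
    then obtain c where c: "c \<in> carrier F" "C = k c" by (auto simp: Zs(1))
    obtain x where x: "x \<in> carrier X" "c - ?fr x \<in> H" using cover[OF c(1)] by blast
    have "C = h (p x)" using hp[OF x(1)] x(2) c(2) keq by simp
    thus "\<exists>v\<in>carrier (infl V). C = h v" using pc[OF x(1)] by auto
  qed
  obtain f where f: "lin R (infl ?Z) Y f" "bij_betw f (carrier (infl ?Z)) (carrier Y)"
    using iso by (auto simp: mod_iso_def mod_hom_iff)
  show ?thesis
    by (rule mod_isoI[OF infl_lm[OF d(2)] lin_comp[OF hl f(1)]]) (use bij_betw_trans[OF hb f(2)] in \<open>simp add: comp_def\<close>)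
qed

end


section \<open>Duals of injective envelopes\<close>

context fdalg begin

lemma dmap_surj:
  assumes X: "left_module R X" and Y: "left_module R Y" and fg: "fin_generated R Y" and f: "lin R X Y f" "inj_on f (carrier X)"
    and p: "p \<in> carrier (D X)"
  obtains q where "q \<in> carrier (D Y)" "dmap X f q = p"
proof -
  let ?N = "f ` carrier X"
  have N: "submodule ?N R Y" by (rule image_submod[OF X Y f(1) carrier_submod[OF X]])
  have fN: "lin R X (Y\<restriction>?N) f" using f(1) by (simp add: lin_into_sub[OF submodD(1)[OF Y N]])
  have bN: "bij_betw f (carrier X) (carrier (Y\<restriction>?N))" using f(2) by (simp add: bij_betw_def)
  obtain g where g: "lin R (Y\<restriction>?N) X g" "\<And>x. x \<in> carrier X ==> g (f x) = x"
    by (rule lin_inverse[OF X sub_lm[OF Y N] fN bN]) (rule that; assumption)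
  obtain q where q: "q \<in> carrier (D Y)" "\<And>y. y \<in> ?N ==> q y = dmap (Y\<restriction>?N) g p y"
    by (rule extend_dual[OF Y fg N dmap_closed[OF g(1) sub_lm[OF Y N] p]]) (rule that; assumption)
  have "dmap X f q = p"
  proof (rule dual_eqI[OF dmap_closed[OF f(1) X q(1)] p])
    fix x assume x: "x \<in> carrier X"
    show "dmap X f q x = p x" using q(2)[of "f x"] g(2)[OF x] x by (simp add: dmap_def)
  qed
  with q(1) that show thesis by blast
qed

text \<open>Functionals on the quotient of \<open>Y\<close> by the image of \<open>f\<close> are functionals on \<open>Y\<close> that vanish on this image.\<close>

lemma dual_quotient:
  assumes X: "left_module R X" and Y: "left_module R Y" and C: "left_module R C" and f: "lin R X Y f"
    and \<pi>: "lin R Y C \<pi>" "\<pi> ` carrier Y = carrier C" "\<And>y. y \<in> carrier Y ==> \<pi> y = \<zero>\<^sub>C \<longleftrightarrow> y \<in> f ` carrier X"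
  shows "lin R\<^sup>o (D C) ((D Y)\<restriction>(mod_ker (D Y) (D X) (dmap X f))) (dmap Y \<pi>)"
    and "bij_betw (dmap Y \<pi>) (carrier (D C)) (mod_ker (D Y) (D X) (dmap X f))"
proof -
  have surj: "\<exists>y\<in>carrier Y. c = \<pi> y" if "c \<in> carrier C" for c by (rule surjE[OF \<pi>(2) that])
  have im: "dmap Y \<pi> p \<in> mod_ker (D Y) (D X) (dmap X f)" if p: "p \<in> carrier (D C)" for p
  proof -
    have m: "dmap Y \<pi> p \<in> carrier (D Y)" by (rule dmap_closed[OF \<pi>(1) Y p])
    have "dmap X f (dmap Y \<pi> p) = \<zero>\<^bsub>D X\<^esub>"
    proof (rule dual_eqI[OF dmap_closed[OF f X m] lm_zero[OF dual_lm[OF X]]])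
      fix x assume x: "x \<in> carrier X"
      have fx: "f x \<in> carrier Y" by (rule lin_closed[OF f x])
      have "\<pi> (f x) = \<zero>\<^sub>C" using \<pi>(3)[OF fx] x by blast
      thus "dmap X f (dmap Y \<pi> p) x = \<zero>\<^bsub>D X\<^esub> x" using x fx dual_zero[OF p C] by (simp add: dmap_def)
    qed
    thus ?thesis using m by (simp add: mod_ker_def del: dual_simps)
  qed
  show "lin R\<^sup>o (D C) ((D Y)\<restriction>(mod_ker (D Y) (D X) (dmap X f))) (dmap Y \<pi>)"
  proof -
    have "mod_ker (D Y) (D X) (dmap X f) \<subseteq> carrier (D Y)" by (auto simp: mod_ker_def simp del: dual_simps)
    thus ?thesis using dmap_lin[OF \<pi>(1) Y] im by (simp add: lin_into_sub del: dual_simps)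
  qed
  show "bij_betw (dmap Y \<pi>) (carrier (D C)) (mod_ker (D Y) (D X) (dmap X f))"
  proof (rule bij_betwI')
    fix p q assume pq: "p \<in> carrier (D C)" "q \<in> carrier (D C)"
    show "(dmap Y \<pi> p = dmap Y \<pi> q) = (p = q)"
    proof
      assume e: "dmap Y \<pi> p = dmap Y \<pi> q"
      show "p = q"
      proof (rule dual_eqI[OF pq])
        fix c assume "c \<in> carrier C"
        then obtain y where y: "y \<in> carrier Y" "c = \<pi> y" using surj by blast
        show "p c = q c" using fun_cong[OF e, of y] y by (simp add: dmap_def)
      qed
    qed simp
  next
    fix q assume "q \<in> mod_ker (D Y) (D X) (dmap X f)"
    hence q: "q \<in> carrier (D Y)" and qz: "dmap X f q = \<zero>\<^bsub>D X\<^esub>" by (simp_all add: mod_ker_def del: dual_simps)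
    have qf: "q (f x) = \<zero>\<^sub>K" if "x \<in> carrier X" for x using fun_cong[OF qz, of x] that by (simp add: dmap_def)
    obtain p where p: "lin K (kv R C) (reg K) p" "\<And>y. y \<in> carrier (kv R Y) ==> p (\<pi> y) = q y"
    proof (rule lin_factor[OF kv_lm[OF Y] regK kv_lm[OF C] kv_lin[OF \<pi>(1)] _ dual_lin[OF q]])
      show "\<pi> ` carrier (kv R Y) = carrier (kv R C)" using \<pi>(2) by simp
      fix y assume y: "y \<in> carrier (kv R Y)" "\<pi> y = \<zero>\<^bsub>kv R C\<^esub>"
      hence "y \<in> f ` carrier X" using \<pi>(3)[of y] by simp
      thus "q y = \<zero>\<^bsub>reg K\<^esub>" using qf by auto
    qed (rule that; assumption)
    have pD: "restrict p (carrier C) \<in> carrier (D C)" by (rule dualI[OF C p(1)])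
    have "q = dmap Y \<pi> (restrict p (carrier C))"
    proof (rule dual_eqI[OF q dmap_closed[OF \<pi>(1) Y pD]])
      fix y assume y: "y \<in> carrier Y"
      show "q y = dmap Y \<pi> (restrict p (carrier C)) y" using p(2)[of y] y lin_closed[OF \<pi>(1) y] by (simp add: dmap_def)
    qed
    with pD show "\<exists>p\<in>carrier (D C). q = dmap Y \<pi> p" by blast
  qed (rule im)
qed

text \<open>The double dual of the regular module is the regular module.\<close>

lemma dual_proj:
  assumes J: "left_module R J" "inje J"
  shows "proj R\<^sup>o (D J)"
proof -
  interpret O: fdalg K "R\<^sup>o" by (rule opp_alg)
  have th: "summand R\<^sup>o (D DR) (D J)" by (rule thru_dual_id[OF J(2,1) DR_lm])
  have "mod_iso R\<^sup>o (reg R\<^sup>o) (O.D (O.D (reg R\<^sup>o)))"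
    by (rule O.bidual_iso[OF O.regR O.regR_fg])
  hence "mod_iso R\<^sup>o (reg R\<^sup>o) (D DR)" by (simp only: dual_opp)
  from thru_iso_base[OF th disjI2[OF this] dual_lm[OF J(1)] dual_lm[OF DR_lm] O.regR] show ?thesis .
qed

text \<open>For the minimality let \<open>N\<close> be a submodule of \<open>D J\<close> that maps onto \<open>D X\<close>. An element of \<open>X\<close> annihilated by
  \<open>N\<close> is annihilated by all functionals on \<open>X\<close>, so the annihilator of \<open>N\<close> in \<open>J\<close> meets \<open>X\<close> trivially and is
  zero. By double duality \<open>N\<close> is everything.\<close>

lemma dual_cover:
  assumes e: "injective_envelope R X g J" and X: "X \<in> fg_mod R" and C: "left_module R C"
    and \<pi>: "lin R J C \<pi>" "\<pi> ` carrier J = carrier C" "\<And>y. y \<in> carrier J ==> \<pi> y = \<zero>\<^sub>C \<longleftrightarrow> y \<in> g ` carrier X"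
  obtains Q c where "projective_cover R\<^sup>o Q c (D X)" "mod_iso R\<^sup>o (D C) (Q\<restriction>(mod_ker Q (D X) c))"
proof -
  interpret O: fdalg K "R\<^sup>o" by (rule opp_alg)
  note LX = fg_modD[OF X]
  have J: "J \<in> fg_mod R" "inje J" "lin R X J g" "inj_on g (carrier X)"
    and ess: "\<And>N. submodule N R J ==> N \<inter> g ` carrier X = {\<zero>\<^sub>J} ==> N = {\<zero>\<^sub>J}"
    using e by (simp_all add: injective_envelope_def injective_iff mod_hom_iff)
  note LJ = fg_modD[OF J(1)] and DJ = dual_lm[OF fg_modD(1)[OF J(1)]] and DX = dual_lm[OF LX(1)]
  have DJf: "fin_generated R\<^sup>o (D J)" by (rule dual_fg[OF LJ])
  obtain Q b a where Q: "Q \<in> fg_mod R\<^sup>o" "lin R\<^sup>o (D J) Q b" "lin R\<^sup>o Q (D J) a"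
    "\<And>x. x \<in> carrier (D J) ==> a (b x) = x" "\<And>y. y \<in> carrier Q ==> b (a y) = y"
  proof (rule O.rep[OF DJ DJf])
    fix Q f g assume 1: "Q \<in> fg_mod R\<^sup>o" "lin R\<^sup>o (D J) Q f" "lin R\<^sup>o Q (D J) g"
      and 2: "\<And>x. x \<in> carrier (D J) ==> g (f x) = x" and 3: "\<And>y. y \<in> carrier Q ==> f (g y) = y"
    show thesis by (rule that[of Q f g, OF 1 2 3])
  qed
  note LQ = fg_modD[OF Q(1)]
  let ?d = "dmap X g"
  have d: "lin R\<^sup>o (D J) (D X) ?d" by (rule dmap_lin[OF J(3) LX(1)])
  define c where "c = restrict (\<lambda>q. ?d (a q)) (carrier Q)"
  have cl: "lin R\<^sup>o Q (D X) (\<lambda>q. ?d (a q))" by (rule lin_comp[OF Q(3) d])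
  have cq: "c q = ?d (a q)" if "q \<in> carrier Q" for q using that by (simp add: c_def)
  have csurj: "c ` carrier Q = carrier (D X)"
  proof
    show "c ` carrier Q \<subseteq> carrier (D X)" using lin_closed[OF cl] by (auto simp: c_def simp del: dual_simps)
    show "carrier (D X) \<subseteq> c ` carrier Q"
    proof
      fix p assume p: "p \<in> carrier (D X)"
      obtain q where q: "q \<in> carrier (D J)" "?d q = p" by (rule dmap_surj[OF LX(1) LJ J(3,4) p]) (rule that; assumption)
      have bq: "b q \<in> carrier Q" by (rule lin_closed[OF Q(2) q(1)])
      have "p = c (b q)" using cq[OF bq] Q(4)[OF q(1)] q(2) by simp
      thus "p \<in> c ` carrier Q" using bq by blast
    qed
  qed
  have min: "N = carrier Q" if N: "submodule N R\<^sup>o Q" "c ` N = carrier (D X)" for N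
  proof (rule ccontr)
    assume "N \<noteq> carrier Q"
    note DN = submodD[OF LQ(1) N(1)]
    obtain q where q: "q \<in> carrier Q" "q \<notin> N" using \<open>N \<noteq> carrier Q\<close> DN(1) by blast
    have aN: "submodule (a ` N) R\<^sup>o (D J)" by (rule image_submod[OF LQ(1) DJ Q(3) N(1)])
    have aq: "a q \<in> carrier (D J)" by (rule lin_closed[OF Q(3) q(1)])
    have "a q \<notin> a ` N"
    proof
      assume "a q \<in> a ` N"
      then obtain n where n: "n \<in> N" "a q = a n" by blast
      hence "q = n" using Q(5)[OF q(1)] Q(5)[of n] DN(1) by auto
      with n(1) q(2) show False by simp
    qed
    then obtain E where E: "E \<in> carrier (D (D J))" "\<And>y. y \<in> a ` N ==> E y = \<zero>\<^sub>K" "E (a q) \<noteq> \<zero>\<^sub>K"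
      using O.separate_dual[OF DJ DJf aN aq] unfolding dual_opp by blast
    have "E \<in> evm J ` carrier J" using evm_bij[OF LJ] E(1) by (simp add: bij_betw_def del: dual_simps)
    then obtain x where x: "x \<in> carrier J" "E = evm J x" by blast
    have Ep: "E p = p x" if "p \<in> carrier (D J)" for p using that x(2) by (simp add: evm_def del: dual_simps)
    have anJ: "a n \<in> carrier (D J)" if "n \<in> N" for n using lin_closed[OF Q(3)] DN(1) that by blast
    let ?L = "{y \<in> carrier J. \<forall>n\<in>N. a n y = \<zero>\<^sub>K}"
    have L: "submodule ?L R J"
    proof (rule submodI[OF LJ(1)])
      show "\<zero>\<^sub>J \<in> ?L" using lm_zero[OF LJ(1)] dual_zero[OF anJ LJ(1)] by simp
      fix y z assume yz: "y \<in> ?L" "z \<in> ?L"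
      have "a n (y \<oplus>\<^sub>J z) = \<zero>\<^sub>K" if "n \<in> N" for n
        using dual_add[OF anJ[OF that], of y z] yz that ag_lzero[OF KG ag_zero[OF KG]] by simp
      thus "y \<oplus>\<^sub>J z \<in> ?L" using yz lm_closed[OF LJ(1)] by simp
    next
      fix r y assume r: "r \<in> carrier R" and y: "y \<in> ?L"
      have "a n (r \<odot>\<^sub>J y) = \<zero>\<^sub>K" if n: "n \<in> N" for n
      proof -
        have rn: "r \<odot>\<^sub>Q n \<in> N" using DN(4)[of r n] r n by simp
        have "a (r \<odot>\<^sub>Q n) y = (r \<odot>\<^bsub>D J\<^esub> a n) y" using lin_smult[OF Q(3), of r n] r n DN(1) by auto
        thus ?thesis using y rn by simp
      qed
      thus "r \<odot>\<^sub>J y \<in> ?L" using y lm_smult[OF LJ(1) r] by simp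
    qed auto
    have "?L \<inter> g ` carrier X = {\<zero>\<^sub>J}"
    proof
      show "?L \<inter> g ` carrier X \<subseteq> {\<zero>\<^sub>J}"
      proof
        fix y assume "y \<in> ?L \<inter> g ` carrier X"
        then obtain z where z: "z \<in> carrier X" "y = g z" and yL: "\<And>n. n \<in> N ==> a n y = \<zero>\<^sub>K" by blast
        have "z = \<zero>\<^sub>X"
        proof (rule ccontr)
          assume "z \<noteq> \<zero>\<^sub>X"
          hence "z \<notin> {\<zero>\<^sub>X}" by simp
          from separate_dual[OF LX zero_submod[OF LX(1)] z(1) this]
          obtain p where p: "p \<in> carrier (D X)" "p z \<noteq> \<zero>\<^sub>K" by blast
          have "p \<in> c ` N" using p(1) N(2) by simp
          then obtain n where n: "n \<in> N" "p = c n" by blast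
          have "p z = a n (g z)" using n DN(1) cq[of n] z(1) by (auto simp: dmap_def)
          with yL[OF n(1)] z(2) p(2) show False by simp
        qed
        thus "y \<in> {\<zero>\<^sub>J}" using z(2) lm_lin_zero[OF J(3) LX(1) LJ(1)] by simp
      qed
      have "g \<zero>\<^sub>X = \<zero>\<^sub>J" by (rule lm_lin_zero[OF J(3) LX(1) LJ(1)])
      hence "\<zero>\<^sub>J \<in> g ` carrier X" using lm_zero[OF LX(1)] by (metis imageI)
      thus "{\<zero>\<^sub>J} \<subseteq> ?L \<inter> g ` carrier X" using submodD(2)[OF LJ(1) L] by simp
    qed
    from ess[OF L this] have L0: "?L = {\<zero>\<^sub>J}" .
    have "x \<in> ?L" using x(1) E(2) Ep[OF anJ] by auto
    hence "x = \<zero>\<^sub>J" using L0 by blast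
    thus False using E(3) Ep[OF aq] dual_zero[OF aq LJ(1)] by simp
  qed
  have "projective_cover R\<^sup>o Q c (D X)"
    unfolding O.projective_cover_iff[OF DX]
  proof (intro conjI allI impI)
    show "Q \<in> fg_mod R\<^sup>o" by (rule Q(1))
    show "proj R\<^sup>o Q"
      by (rule thru_transfer[OF dual_proj[OF LJ(1) J(2)] Q(3,2) _ DJ LQ(1)]) (use Q(5) in simp)
    show "c \<in> mod_hom R\<^sup>o Q (D X)" unfolding c_def by (rule restrict_mod_hom[OF LQ(1) cl])
  qed (use csurj min in auto)
  moreover have "mod_iso R\<^sup>o (D C) (Q\<restriction>(mod_ker Q (D X) c))"
  proof (rule mod_isoI[OF dual_lm[OF C]])
    note dq = dual_quotient[OF LX(1) LJ(1) C J(3) \<pi>]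
    have bb: "bij_betw b (mod_ker (D J) (D X) ?d) (mod_ker Q (D X) c)"
    proof (rule bij_betwI[where g = a])
      show "b \<in> mod_ker (D J) (D X) ?d \<rightarrow> mod_ker Q (D X) c"
        using cq lin_closed[OF Q(2)] Q(4) by (auto simp: mod_ker_def simp del: dual_simps)
      show "a \<in> mod_ker Q (D X) c \<rightarrow> mod_ker (D J) (D X) ?d"
        using cq lin_closed[OF Q(3)] by (auto simp: mod_ker_def simp del: dual_simps)
    qed (use Q(4,5) in \<open>auto simp: mod_ker_def simp del: dual_simps\<close>)
    show bij: "bij_betw (\<lambda>p. b (dmap J \<pi> p)) (carrier (D C)) (carrier (Q\<restriction>(mod_ker Q (D X) c)))"
      using bij_betw_trans[OF dq(2) bb] by (simp add: comp_def del: dual_simps)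
    have "lin R\<^sup>o (D C) Q (\<lambda>p. b (dmap J \<pi> p))" by (rule lin_comp[OF dmap_lin[OF \<pi>(1) LJ(1)] Q(2)])
    moreover have "b (dmap J \<pi> p) \<in> mod_ker Q (D X) c" if "p \<in> carrier (D C)" for p
      using bij_betw_apply[OF bij that] by simp
    moreover have "mod_ker Q (D X) c \<subseteq> carrier Q" by (auto simp: mod_ker_def)
    ultimately show "lin R\<^sup>o (D C) (Q\<restriction>(mod_ker Q (D X) c)) (\<lambda>p. b (dmap J \<pi> p))"
      by (simp add: lin_into_sub del: dual_simps)
  qed
  ultimately show thesis by (rule that)
qed

end


section \<open>Precluster tilting modules over the quotient\<close>

text \<open>Choose a lift \<open>l\<close> from \<open>Q\<close> to \<open>E\<close> over \<open>X\<close>. Every element of \<open>E\<close> is the sum of some \<open>l q\<close> and a kernel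
  element. On the kernel \<open>f\<close> is given, and \<open>f \<circ> l\<close> extends to \<open>Q\<close>; these two values are added.\<close>

lemma extends_any:
  assumes e: "extends R (mod_ker Q X w) Q Z" and Q: "left_module R Q" "proj R Q" and w: "lin R Q X w" "w ` carrier Q = carrier X"
    and X: "left_module R X" and Z: "left_module R Z" and E: "left_module R E" and c: "lin R E X c" "c ` carrier E = carrier X"
  shows "extends R (mod_ker E X c) E Z"
  unfolding extends_def
proof (intro allI impI)
  fix f assume f: "lin R (E\<restriction>(mod_ker E X c)) Z f"
  note EG = lm_ag[OF E] and ZG = lm_ag[OF Z] and QG = lm_ag[OF Q(1)] and XG = lm_ag[OF X]
  have fc: "f x \<in> carrier Z" if "x \<in> mod_ker E X c" for x using lin_closed[OF f] that by simp
  have fa: "f (x \<oplus>\<^sub>E y) = f x \<oplus>\<^sub>Z f y" if "x \<in> mod_ker E X c" "y \<in> mod_ker E X c" for x y using lin_add[OF f] that by simp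
  have fs: "f (a \<odot>\<^sub>E x) = a \<odot>\<^sub>Z f x" if "a \<in> carrier R" "x \<in> mod_ker E X c" for a x using lin_smult[OF f] that by simp
  obtain l where l: "lin R Q E l" "\<And>q. q \<in> carrier Q ==> c (l q) = w q"
    by (rule proj_lift[OF Q(2,1) E X w(1) c]) (rule that; assumption)
  have lc: "l q \<in> carrier E" if "q \<in> carrier Q" for q by (rule lin_closed[OF l(1) that])
  have lker: "l q \<in> mod_ker E X c" if "q \<in> mod_ker Q X w" for q using that l(2) lc by (auto simp: mod_ker_def)
  have "lin R (Q\<restriction>(mod_ker Q X w)) Z (\<lambda>q. f (l q))"
  proof (rule lin_comp[OF _ f])
    have "mod_ker E X c \<subseteq> carrier E" "mod_ker Q X w \<subseteq> carrier Q" by (auto simp: mod_ker_def)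
    thus "lin R (Q\<restriction>(mod_ker Q X w)) (E\<restriction>(mod_ker E X c)) l"
      using lin_sub[OF l(1)] lker by (simp add: lin_into_sub)
  qed
  then obtain F0 where F0: "lin R Q Z F0" "\<And>q. q \<in> mod_ker Q X w ==> F0 q = f (l q)"
    using e unfolding extends_def by blast
  have F0c: "F0 q \<in> carrier Z" if "q \<in> carrier Q" for q by (rule lin_closed[OF F0(1) that])
  define G where "G = (\<lambda>e q. f (e \<ominus>\<^sub>E l q) \<oplus>\<^sub>Z F0 q)"
  have dk: "e \<ominus>\<^sub>E l q \<in> mod_ker E X c" if "e \<in> carrier E" "q \<in> carrier Q" "w q = c e" for e q
    by (rule lin_surj_sum[OF E X c(1) that(1) lc[OF that(2)]]) (use l(2)[OF that(2)] that(3) in simp)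
  have indep: "G e q' = G e q" if e: "e \<in> carrier E" and q: "q \<in> carrier Q" "w q = c e" "q' \<in> carrier Q" "w q' = c e" for e q q'
  proof -
    let ?d = "q \<ominus>\<^sub>Q q'"
    have d: "?d \<in> mod_ker Q X w" by (rule lin_surj_sum[OF Q(1) X w(1) q(1,3)]) (use q in simp)
    have dQ: "?d \<in> carrier Q" using d by (simp add: mod_ker_def)
    have qd: "q = ?d \<oplus>\<^sub>Q q'" using ag_diff_add[OF QG q(1,3)] by simp
    have lq: "l q = l ?d \<oplus>\<^sub>E l q'" using lin_add[OF l(1) dQ q(3)] qd by simp
    have "e \<ominus>\<^sub>E l q' = (e \<ominus>\<^sub>E l q) \<oplus>\<^sub>E l ?d"
      unfolding lq using e lc[OF dQ] lc[OF q(3)] by (simp add: a_minus_def ag_neg_add[OF EG] ag_simps[OF EG] ag_ac[OF EG])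
    hence "G e q' = (f (e \<ominus>\<^sub>E l q) \<oplus>\<^sub>Z F0 ?d) \<oplus>\<^sub>Z F0 q'"
      unfolding G_def using fa[OF dk[OF e q(1,2)] lker[OF d]] F0(2)[OF d] by simp
    also have "\<dots> = f (e \<ominus>\<^sub>E l q) \<oplus>\<^sub>Z (F0 ?d \<oplus>\<^sub>Z F0 q')"
      by (rule ag_assoc[OF ZG fc[OF dk[OF e q(1,2)]] F0c[OF dQ] F0c[OF q(3)]])
    also have "F0 ?d \<oplus>\<^sub>Z F0 q' = F0 q" using lin_add[OF F0(1) dQ q(3)] qd by simp
    finally show ?thesis by (simp add: G_def)
  qed
  define s where "s = (\<lambda>e. SOME q. q \<in> carrier Q \<and> w q = c e)"
  have s: "s e \<in> carrier Q \<and> w (s e) = c e" if "e \<in> carrier E" for e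
  proof -
    have "c e \<in> w ` carrier Q" using lin_closed[OF c(1) that] by (simp only: w(2))
    hence "\<exists>q. q \<in> carrier Q \<and> w q = c e" by force
    thus ?thesis unfolding s_def by (rule someI_ex)
  qed
  define F where "F = (\<lambda>e. G e (s e))"
  have FG: "F e = G e q" if "e \<in> carrier E" "q \<in> carrier Q" "w q = c e" for e q
    unfolding F_def using indep[OF that] s[OF that(1)] by blast
  have "lin R E Z F"
  proof (rule linI)
    show "F e \<in> carrier Z" if "e \<in> carrier E" for e
      unfolding F_def G_def using s[OF that] fc[OF dk[OF that]] F0c ag_closed[OF ZG] by blast
    fix e e' assume e: "e \<in> carrier E" "e' \<in> carrier E"
    let ?q = "s e" and ?q' = "s e'"
    have q: "?q \<in> carrier Q" "w ?q = c e" "?q' \<in> carrier Q" "w ?q' = c e'" using s e by auto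
    note d1 = dk[OF e(1) q(1,2)] and d2 = dk[OF e(2) q(3,4)]
    have "F (e \<oplus>\<^sub>E e') = G (e \<oplus>\<^sub>E e') (?q \<oplus>\<^sub>Q ?q')"
      by (rule FG) (use e q ag_closed[OF EG] ag_closed[OF QG] lin_add[OF w(1)] lin_add[OF c(1)] in auto)
    moreover have "(e \<oplus>\<^sub>E e') \<ominus>\<^sub>E l (?q \<oplus>\<^sub>Q ?q') = (e \<ominus>\<^sub>E l ?q) \<oplus>\<^sub>E (e' \<ominus>\<^sub>E l ?q')"
      using e lc[OF q(1)] lc[OF q(3)] lin_add[OF l(1) q(1,3)] by (simp add: a_minus_def ag_neg_add[OF EG] ag_simps[OF EG] ag_ac[OF EG])
    ultimately show "F (e \<oplus>\<^sub>E e') = F e \<oplus>\<^sub>Z F e'"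
      using fa[OF d1 d2] lin_add[OF F0(1) q(1,3)] fc[OF d1] fc[OF d2] F0c[OF q(1)] F0c[OF q(3)]
      unfolding F_def[of] G_def by (simp add: ag_simps[OF ZG] ag_ac[OF ZG])
  next
    fix a e assume a: "a \<in> carrier R" and e: "e \<in> carrier E"
    let ?q = "s e"
    have q: "?q \<in> carrier Q" "w ?q = c e" using s e by auto
    note d1 = dk[OF e q]
    have "F (a \<odot>\<^sub>E e) = G (a \<odot>\<^sub>E e) (a \<odot>\<^sub>Q ?q)"
      by (rule FG) (use a e q lm_smult[OF E] lm_smult[OF Q(1)] lin_smult[OF w(1)] lin_smult[OF c(1)] in auto)
    moreover have "(a \<odot>\<^sub>E e) \<ominus>\<^sub>E l (a \<odot>\<^sub>Q ?q) = a \<odot>\<^sub>E (e \<ominus>\<^sub>E l ?q)"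
      using a e lc[OF q(1)] lin_smult[OF l(1) a q(1)] ag_neg[OF EG lc[OF q(1)]] by (simp add: a_minus_def lm_r_distr[OF E] lm_smult_neg[OF E])
    ultimately show "F (a \<odot>\<^sub>E e) = a \<odot>\<^sub>Z F e"
      using fs[OF a d1] lin_smult[OF F0(1) a q(1)] fc[OF d1] F0c[OF q(1)] a unfolding F_def G_def by (simp add: lm_r_distr[OF Z])
  qed
  moreover have "F x = f x" if x: "x \<in> mod_ker E X c" for x
  proof -
    have xE: "x \<in> carrier E" "c x = \<zero>\<^sub>X" using x by (simp_all add: mod_ker_def)
    have "F x = G x \<zero>\<^sub>Q" by (rule FG[OF xE(1) ag_zero[OF QG]]) (use lin_zero[OF w(1) QG XG] xE(2) in simp)
    thus ?thesis
      using lin_zero[OF l(1) QG EG] lin_zero[OF F0(1) QG ZG] ag_rzero[OF EG xE(1)] ag_rzero[OF ZG fc[OF x]]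
      by (simp add: G_def a_minus_def ag_neg_zero[OF EG])
  qed
  ultimately show "\<exists>F. lin R E Z F \<and> (\<forall>x\<in>mod_ker E X c. F x = f x)" by blast
qed

context idl begin

lemma infl_soc: "left_module B V ==> is_soc R I (infl V) V (\<lambda>x. x)"
  using infl_lm infl_killed by (auto simp: is_soc_def soc_def lin_id)

lemma isub_infl: "left_module B V ==> x \<in> isub R I (infl V) ==> x = \<zero>\<^sub>V"
  using topD(5)[OF infl_top, of V x] submodD(1)[OF infl_lm isub_submod[OF infl_lm I_sub], of V] by auto

end

locale pct = idl K R I for K :: "'k ring" and R :: "('k, 'a) module" and I :: "'a set" +
  fixes M :: "('a, nat \<Rightarrow> 'k) module"
  assumes pct: "precluster_tilting_module K R 2 M"
    and hom_cl: "\<And>X. X \<in> add_subcat R M ==> in_subcat R (add_subcat R M) (inflate R I (hom_from_quot R I X))"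
    and tensor_cl: "\<And>X. X \<in> add_subcat R M ==> in_subcat R (add_subcat R M) (inflate R I (quot_tensor R I X))"
begin

abbreviation inM where "inM X \<equiv> summand R M X"

lemma M: "M \<in> fg_mod R" "left_module R M" "fin_generated R M"
  using pct by (simp_all add: precluster_tilting_module_def fg_mod_def)

lemma add_iff: "X \<in> add_subcat R M \<longleftrightarrow> X \<in> fg_mod R \<and> inM X"
  using in_add_iff[OF M(2)] by (auto simp: add_subcat_def fg_mod_def)

lemma inM_M: "inM M"
  by (rule thru_retract[OF lin_id lin_id _ M(2)]) simp

lemma inM_fg: "left_module R X ==> inM X ==> fin_generated R X" for X :: "('a, 'm) module"
  by (rule fg_thru[OF _ _ M(2,3)])

lemma inM_rep:
  fixes X :: "('a, 'm) module"
  assumes X: "left_module R X" "inM X"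
  obtains Y where "Y \<in> add_subcat R M" "mod_iso R X Y"
proof -
  obtain Y where Y: "Y \<in> fg_mod R" "mod_iso R Y X" "mod_iso R X Y" by (rule rep_iso[OF X(1) inM_fg[OF X]]) (rule that; assumption)
  have "inM Y" by (rule thru_iso[OF X(2) disjI1[OF Y(3)] X(1) fg_modD(1)[OF Y(1)]])
  with Y that show thesis by (simp add: add_iff)
qed

lemma infl_iso: "mod_iso B V W ==> left_module B V ==> mod_iso R (infl V) (infl W)"
  by (auto simp: mod_iso_def mod_hom_iff lin_infl)

text \<open>The closure under tensor products, for modules of any type: a module in \<open>add(M)\<close> is isomorphic to one
  of the subcategory, and tops are preserved by isomorphisms.\<close>

lemma add_top:
  fixes X :: "('a, 'm) module"
  assumes X: "inM X" and t: "is_top R I X V p"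
  shows "inM (infl V)"
proof -
  note d = topD[OF t]
  obtain Y where Y: "Y \<in> add_subcat R M" "mod_iso R X Y" by (rule inM_rep[OF d(1) X]) (rule that; assumption)
  have LY: "left_module R Y" using Y(1) by (simp add: add_iff fg_modD)
  obtain W :: "('a set, (nat \<Rightarrow> 'k) set) module" and q where s: "is_top R I Y W q" by (rule top_exists[OF LY]) (rule that; assumption)
  obtain Z where Z: "Z \<in> add_subcat R M" "mod_iso R (inflate R I (quot_tensor R I Y)) Z"
    using tensor_cl[OF Y(1)] by (auto simp: in_subcat_def)
  have LZ: "left_module R Z" "inM Z" using Z(1) by (simp_all add: add_iff fg_modD)
  have LW: "left_module R (infl W)" by (rule infl_lm[OF topD(2)[OF s]])
  have "inM (infl W)" by (rule thru_iso[OF LZ(2) disjI2[OF top_tensor_iso[OF s Z(2)]] LZ(1) LW])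
  thus ?thesis by (rule thru_iso[OF _ disjI2[OF infl_iso[OF top_iso[OF t s Y(2)] d(2)]] LW infl_lm[OF d(2)]])
qed

lemma add_soc:
  fixes X :: "('a, 'm) module"
  assumes X: "inM X" and t: "is_soc R I X V i"
  shows "inM (infl V)"
proof -
  note d = socD[OF t]
  obtain Y where Y: "Y \<in> add_subcat R M" "mod_iso R X Y" by (rule inM_rep[OF d(1) X]) (rule that; assumption)
  have LY: "left_module R Y" using Y(1) by (simp add: add_iff fg_modD)
  obtain W :: "('a set, nat \<Rightarrow> 'k) module" and q where s: "is_soc R I Y W q" by (rule soc_exists[OF LY]) (rule that; assumption)
  obtain Z where Z: "Z \<in> add_subcat R M" "mod_iso R (inflate R I (hom_from_quot R I Y)) Z"
    using hom_cl[OF Y(1)] by (auto simp: in_subcat_def)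
  have LZ: "left_module R Z" "inM Z" using Z(1) by (simp_all add: add_iff fg_modD)
  have LW: "left_module R (infl W)" by (rule infl_lm[OF socD(2)[OF s]])
  have "inM (infl W)" by (rule thru_iso[OF LZ(2) disjI2[OF soc_hom_iso[OF s Z(2)]] LZ(1) LW])
  thus ?thesis by (rule thru_iso[OF _ disjI2[OF infl_iso[OF soc_iso[OF t s Y(2)] d(2)]] LW infl_lm[OF d(2)]])
qed

lemma quotient_generator:
  obtains N p where "N \<in> fg_mod B" "is_top R I M N p"
proof -
  obtain V :: "('a set, (nat \<Rightarrow> 'k) set) module" and p where t: "is_top R I M V p" by (rule top_exists[OF M(2)]) (rule that; assumption)
  note d = topD[OF t]
  have "fin_generated R (infl V)" by (rule fg_image[OF M(2) infl_lm[OF d(2)] d(3) _ M(3)]) (use d(4) in simp)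
  hence "fin_generated B V" by (simp add: infl_fg[OF d(2)])
  then obtain N f g where N: "N \<in> fg_mod B" "lin B V N f" "lin B N V g" "\<And>x. x \<in> carrier V ==> g (f x) = x" "\<And>y. y \<in> carrier N ==> f (g y) = y"
    using B.rep[OF d(2)] by blast
  note LN = fg_modD(1)[OF N(1)]
  have pc: "p x \<in> carrier V" if "x \<in> carrier M" for x using lin_closed[OF d(3) that] by simp
  have "is_top R I M N (\<lambda>x. f (p x))"
    unfolding is_top_def
  proof (intro conjI ballI)
    show "lin R M (infl N) (\<lambda>x. f (p x))" by (rule lin_comp[OF d(3)]) (simp add: lin_infl N(2))
    have "(\<lambda>x. f (p x)) ` carrier M = f ` carrier V" unfolding d(4)[symmetric] by (simp add: image_image)
    also have "\<dots> = carrier N"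
    proof
      show "f ` carrier V \<subseteq> carrier N" using lin_closed[OF N(2)] by blast
      show "carrier N \<subseteq> f ` carrier V" using N(5) lin_closed[OF N(3)] by (metis imageI subsetI)
    qed
    finally show "(\<lambda>x. f (p x)) ` carrier M = carrier N" .
    fix x assume x: "x \<in> carrier M"
    have "f (p x) = \<zero>\<^sub>N \<longleftrightarrow> p x = \<zero>\<^sub>V"
      using N(4)[OF pc[OF x]] lm_lin_zero[OF N(2) d(2) LN] lm_lin_zero[OF N(3) LN d(2)] by auto
    thus "f (p x) = \<zero>\<^sub>N \<longleftrightarrow> x \<in> isub R I M" using d(5)[OF x] by simp
  qed (use M(2) LN in auto)
  with N(1) that show thesis by blast
qed

text \<open>That \<open>E\<close> is arbitrary makes this usable over \<open>B\<close>, whose projective modules are not projective over \<open>R\<close>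
  in general.\<close>

lemma ext_vanish:
  fixes X :: "('a, 'x) module" and Z :: "('a, 'z) module" and E :: "('a, 'e) module"
  assumes X: "left_module R X" "inM X" and Z: "left_module R Z" "inM Z" and E: "left_module R E" and c: "lin R E X c" "c ` carrier E = carrier X"
  shows "extends R (mod_ker E X c) E Z"
proof -
  have "trivial_group (Ext R 1 M M)" using pct by (simp add: precluster_tilting_module_def)
  then obtain P g where P: "P \<in> fg_mod R" "proj R P" "lin R P M g" "g ` carrier P = carrier M" and e: "extends R (mod_ker P M g) P M"
    using ext1_iff_extends[OF M(1) M(1)] by metis
  note LP = fg_modD(1)[OF P(1)]
  have e2: "extends R (mod_ker P M g) P Z" by (rule extends_post[OF e LP ker_submod[OF LP M(2) P(3)] M(2) Z])
  obtain Q w where Q: "Q \<in> fg_mod R" "proj R Q" "lin R Q X w" "w ` carrier Q = carrier X"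
    by (rule proj_cover_exists0[OF X(1) inM_fg[OF X]]) (rule that; assumption)
  note LQ = fg_modD(1)[OF Q(1)]
  have "extends R (mod_ker Q X w) Q Z" by (rule extends_pre[OF e2 LP P(2,3,4) M(2) Z(1) X LQ Q(2,3,4)])
  from extends_any[OF this LQ Q(2,3,4) X(1) Z(1) E c] show ?thesis .
qed

lemma inM_regular: "inM (reg R)"
proof -
  obtain Y where Y: "Y \<in> fg_mod R" "mod_iso R Y (reg R)" "mod_iso R (reg R) Y"
    by (rule rep_iso[OF regR regR_fg]) (rule that; assumption)
  have "proj R (reg R)" by (rule thru_retract[OF lin_id lin_id _ regR]) simp
  from thru_iso[OF this disjI1[OF Y(3)] regR fg_modD(1)[OF Y(1)]] have "projective R Y" using Y(1) by (simp add: projective_iff)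
  hence "inM Y" using pct by (auto simp: precluster_tilting_module_def add_iff)
  thus ?thesis by (rule thru_iso[OF _ disjI1[OF Y(2)] fg_modD(1)[OF Y(1)] regR])
qed

lemma inM_DR: "inM DR"
proof -
  obtain Y where Y: "Y \<in> fg_mod R" "mod_iso R Y DR" "mod_iso R DR Y"
    by (rule rep_iso[OF DR_lm DR_fg]) (rule that; assumption)
  have "inje DR" by (rule thru_retract[OF lin_id lin_id _ DR_lm]) simp
  from thru_iso[OF this disjI1[OF Y(3)] DR_lm fg_modD(1)[OF Y(1)]] have "injective R Y" using Y(1) by (simp add: injective_iff)
  hence "inM Y" using pct by (auto simp: precluster_tilting_module_def add_iff)
  thus ?thesis by (rule thru_iso[OF _ disjI1[OF Y(2)] fg_modD(1)[OF Y(1)] DR_lm])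
qed

end

locale pct_top = pct K R I M for K :: "'k ring" and R :: "('k, 'a) module" and I :: "'a set" and M :: "('a, nat \<Rightarrow> 'k) module" +
  fixes N :: "('a set, nat \<Rightarrow> 'k) module" and pN
  assumes N: "N \<in> fg_mod B" and topN: "is_top R I M N pN"
begin

abbreviation inN where "inN V \<equiv> summand B N V"

lemma LN: "left_module B N" "fin_generated B N" using N by (simp_all add: fg_modD)

text \<open>A module annihilated by \<open>I\<close> is its own top, so a summand of a power of \<open>M\<close> that is annihilated by \<open>I\<close> is a
  summand of a power of \<open>M/IM\<close>.\<close>

lemma inN_iff: "left_module B V ==> inN V \<longleftrightarrow> inM (infl V)"
proof
  assume V: "left_module B V"
  show "inM (infl V) ==> inN V" by (rule top_thru[OF topN infl_top[OF V]])
  assume "inN V"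
  hence "summand R (infl N) (infl V)" by (simp add: thru_infl)
  thus "inM (infl V)" by (rule thru_trans[OF _ add_top[OF inM_M topN] infl_lm[OF V] infl_lm[OF V] infl_lm[OF LN(1)]])
qed

lemma inN_N: "inN N"
  by (rule thru_retract[OF lin_id lin_id _ LN(1)]) simp

lemma inN_regular: "inN (reg B)"
  by (rule top_thru[OF topN reg_top inM_regular])

text \<open>The dual of \<open>V\<close> is the socle of the dual of \<open>U\<close>.\<close>

lemma dual_top_inN:
  fixes U :: "('a, 'u) module"
  assumes U: "left_module R\<^sup>o U" "fin_generated R\<^sup>o U" "inM (D U)" and t: "is_top R\<^sup>o I U V u"
  shows "inN (B.D V)"
proof -
  interpret O: idl K "R\<^sup>o" I by (rule opp_idl)
  interpret BO: fdalg K "B\<^sup>o" by (rule B.opp_alg)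
  have V: "left_module B\<^sup>o V" using t by (simp add: is_top_def quot_opp)
  have X: "left_module R (D U)" by (rule dual_lm'[OF U(1)])
  have Xf: "fin_generated R (D U)" by (rule inM_fg[OF X U(3)])
  obtain W :: "('a set, 'u \<Rightarrow> 'k) module" and i where s: "is_soc R I (D U) W i" by (rule soc_exists[OF X]) (rule that; assumption)
  note W = socD(2)[OF s]
  have inW: "inN W" unfolding inN_iff[OF W] by (rule add_soc[OF U(3) s])
  have st: "is_top R\<^sup>o I (D (D U)) (B.D W) (dmap W i)" by (rule soc_dual_top[OF s Xf])
  have "mod_iso R\<^sup>o U (O.D (O.D U))" by (rule O.bidual_iso[OF U(1,2)])
  hence "mod_iso R\<^sup>o U (D (D U))" by (simp only: dual_opp)
  from O.top_iso[OF t st this] have iso: "mod_iso B\<^sup>o V (B.D W)" by (simp only: quot_opp)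
  have "summand B\<^sup>o (B.D N) (B.D W)"
    by (rule B.thru_dual_id[OF inW W LN(1)])
  from thru_iso[OF this disjI2[OF iso] B.dual_lm[OF W] V]
  have "summand B\<^sup>o (B.D N) V" .
  from BO.thru_dual_id[OF this V B.dual_lm[OF LN(1)]]
  have th: "summand B (B.D (B.D N)) (B.D V)" by (simp only: dual_opp opp_simps(7))
  have DV: "left_module B (B.D V)" using B.dual_lm'[OF V] .
  have DDN: "left_module B (B.D (B.D N))" by (rule B.dual_lm'[OF B.dual_lm[OF LN(1)]])
  show ?thesis by (rule thru_iso_base[OF th disjI2[OF B.bidual_iso[OF LN]] DV DDN LN(1)])
qed

lemma inN_BDR: "inN B.DR"
proof -
  interpret O: idl K "R\<^sup>o" I by (rule opp_idl)
  have "is_top R\<^sup>o I (reg R\<^sup>o) (reg B\<^sup>o) O.cls"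
    using O.reg_top by (simp only: quot_opp)
  from dual_top_inN[OF O.regR O.regR_fg inM_DR this] show ?thesis .
qed

lemma generator_cogenerator: "projective B X \<or> injective B X ==> X \<in> add_subcat B N"
proof -
  assume "projective B X \<or> injective B X"
  hence X: "X \<in> fg_mod B" and "proj B X \<or> B.inje X" by (auto simp: B.projective_iff B.injective_iff)
  note LX = fg_modD(1)[OF X]
  have "inN X"
    using \<open>proj B X \<or> B.inje X\<close> thru_trans[OF _ inN_regular LX LX B.regR] thru_trans[OF _ inN_BDR LX LX B.DR_lm] by blast
  thus ?thesis using X by (simp add: add_subcat_def in_add_iff[OF LN(1) LX])
qed

text \<open>A projective module over \<open>B\<close> that maps onto \<open>N\<close> is in particular an \<open>R\<close>-module that maps onto \<open>N\<close>.\<close>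

lemma ext_quotient: "trivial_group (Ext B 1 N N)"
proof -
  obtain P g where P: "P \<in> fg_mod B" "proj B P" "lin B P N g" "g ` carrier P = carrier N"
    and e: "trivial_group (Ext B 1 N N) \<longleftrightarrow> extends B (mod_ker P N g) P N"
    by (rule B.ext1_iff_extends[OF N N]) (rule that; assumption)
  note LP = fg_modD(1)[OF P(1)]
  have iN: "inM (infl N)" using inN_iff[OF LN(1)] inN_N by blast
  have c: "lin R (infl P) (infl N) g" "g ` carrier (infl P) = carrier (infl N)" using P(3,4) by (simp_all add: lin_infl)
  have "extends R (mod_ker (infl P) (infl N) g) (infl P) (infl N)"
    by (rule ext_vanish[OF infl_lm[OF LN(1)] iN infl_lm[OF LN(1)] iN infl_lm[OF LP] c])
  moreover have "(infl P)\<restriction>L = infl (P\<restriction>L)" for L by (simp add: inflate_def restrict_scalars_sub)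
  moreover have "mod_ker (infl P) (infl N) g = mod_ker P N g" by (simp add: mod_ker_def)
  ultimately have "extends B (mod_ker P N g) P N" by (simp add: extends_def lin_infl)
  with e show ?thesis by blast
qed

lemma tau_quotient: "in_add B N (tau_d K B 2 N)"
proof -
  interpret O: idl K "R\<^sup>o" I by (rule opp_idl)
  interpret BO: fdalg K "B\<^sup>o" by (rule B.opp_alg)
  obtain G g where G: "projective_cover R G g M" "syzygy R M \<in> fg_mod R" "mod_iso R (syzygy R M) (G\<restriction>(mod_ker G M g))"
    by (rule syzygyE[OF M(1)]) (rule that; assumption)
  let ?Y = "G\<restriction>(mod_ker G M g)"
  have g: "G \<in> fg_mod R" "proj R G" "lin R G M g" "g ` carrier G = carrier M"
    using G(1) by (simp_all add: projective_cover_iff[OF M(2)] mod_hom_iff)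
  note LG = fg_modD[OF g(1)] and LS = fg_modD[OF G(2)]
  note Ys = ker_submod[OF LG(1) M(2) g(3)]
  note LY = sub_lm[OF LG(1) Ys]
  obtain i where i: "lin R (syzygy R M) ?Y i" "bij_betw i (carrier (syzygy R M)) (carrier ?Y)"
    using G(3) by (auto simp: mod_iso_def mod_hom_iff)
  let ?T = "module_transpose R (syzygy R M)"
  obtain P1 f P0 h q where T: "minimal_presentation R P1 f P0 h (syzygy R M)" "?T \<in> fg_mod R\<^sup>o" "is_tr R P1 f P0 ?T q"
    by (rule transposeE[OF LS]) (rule that; assumption)
  note p = pres_minimal[OF T(1) LS(1) T(3) i LY]
  note LT = fg_modD[OF T(2)]
  obtain VG :: "('a set, (nat \<Rightarrow> 'k) set) module" and pG where tG: "is_top R I G VG pG" by (rule top_exists[OF LG(1)]) (rule that; assumption)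
  obtain U :: "('a set, (nat \<Rightarrow> 'k) set) module" and u where tT: "is_top R\<^sup>o I ?T U u" by (rule O.top_exists[OF LT(1)]) (rule that; assumption)
  \<comment> \<open>a homomorphism from the kernel to \<open>D B\<close> that does not vanish at \<open>y\<close> extends to \<open>G\<close>, where it vanishes on \<open>IG\<close>\<close>
  have star: "y \<in> isub R I ?Y" if y: "y \<in> mod_ker G M g" "y \<in> isub R I G" for y
  proof (rule ccontr)
    assume n: "y \<notin> isub R I ?Y"
    obtain W :: "('a set, (nat \<Rightarrow> 'k) set) module" and w where tY: "is_top R I ?Y W w" by (rule top_exists[OF LY]) (rule that; assumption)
    note dY = topD[OF tY]
    have yY: "y \<in> carrier ?Y" using y(1) by simp
    have wy: "w y \<in> carrier W" "w y \<noteq> \<zero>\<^sub>W" using lin_closed[OF dY(3) yY] dY(5)[OF yY] n by simp_all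
    have "fin_generated R (infl W)" by (rule fg_image[OF LY infl_lm[OF dY(2)] dY(3) _ fg_sub[OF LG Ys]]) (use dY(4) in simp)
    hence Wf: "fin_generated B W" by (simp add: infl_fg[OF dY(2)])
    have "w y \<notin> {\<zero>\<^sub>W}" using wy(2) by simp
    from B.separate_dual[OF dY(2) Wf zero_submod[OF dY(2)] wy(1) this]
    obtain r where r: "r \<in> carrier (B.D W)" "r (w y) \<noteq> \<zero>\<^sub>K" by blast
    let ?\<phi> = "\<lambda>x. \<lambda>a\<in>carrier B. r (a \<odot>\<^sub>W x)"
    have "lin B W B.DR ?\<phi>" by (rule B.functional_hom[OF dY(2) r(1)])
    hence "lin R (infl W) (infl B.DR) ?\<phi>" by (simp only: lin_infl)
    from lin_comp[OF dY(3) this] have f: "lin R ?Y (infl B.DR) (\<lambda>x. ?\<phi> (w x))" .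
    have iD: "inM (infl B.DR)" using inN_iff[OF B.DR_lm] inN_BDR by blast
    have "extends R (mod_ker G M g) G (infl B.DR)"
      by (rule ext_vanish[OF M(2) inM_M infl_lm[OF B.DR_lm] iD LG(1) g(3,4)])
    then obtain F where F: "lin R G (infl B.DR) F" "\<And>x. x \<in> mod_ker G M g ==> F x = ?\<phi> (w x)"
      using f unfolding extends_def by blast
    have "F y \<in> isub R I (infl B.DR)" by (rule isub_map[OF LG(1) infl_lm[OF B.DR_lm] F(1) I_sub y(2)])
    hence "?\<phi> (w y) = \<zero>\<^bsub>B.DR\<^esub>" using isub_infl[OF B.DR_lm] F(2)[OF y(1)] by simp
    hence "?\<phi> (w y) \<one>\<^sub>B = \<zero>\<^bsub>B.DR\<^esub> \<one>\<^sub>B" by (rule fun_cong)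
    hence "r (w y) = \<zero>\<^sub>K" using B.oneR lm_one[OF dY(2) wy(1)] by (simp del: quot_algebra_simps)
    with r(2) show False by simp
  qed
  obtain Q c where Q: "projective_cover B Q c N" "syzygy B N \<in> fg_mod B" "mod_iso B (syzygy B N) (Q\<restriction>(mod_ker Q N c))"
    by (rule B.syzygyE[OF N]) (rule that; assumption)
  note LZ = fg_modD[OF Q(2)]
  let ?S = "module_transpose B (syzygy B N)"
  obtain Q1 f1 Q0 c0 qS where S: "minimal_presentation B Q1 f1 Q0 c0 (syzygy B N)" "?S \<in> fg_mod B\<^sup>o" "is_tr B Q1 f1 Q0 ?S qS"
    by (rule B.transposeE[OF LZ]) (rule that; assumption)
  have th: "summand B\<^sup>o U ?S"
    by (rule tr_quotient[OF g(2,3,4) M(2) tG topN star p tT LN(1) inN_N Q(1) LZ(1) Q(3) S(1,3)])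
  have U: "left_module B\<^sup>o U" using tT by (simp add: is_top_def quot_opp)
  note LS = fg_modD(1)[OF S(2)]
  have "tau_d K R 2 M = D ?T" by (simp add: tau_d_def ar_translate_def)
  moreover have "in_add R M (tau_d K R 2 M)" using pct by (simp add: precluster_tilting_module_def)
  ultimately have "inM (D ?T)" using in_add_iff[OF M(2) dual_lm'[OF LT(1)]] by simp
  from dual_top_inN[OF LT this tT] have iU: "inN (B.D U)" .
  from BO.thru_dual_id[OF th LS U] have "summand B (B.D U) (B.D ?S)"
    by (simp only: dual_opp opp_simps(7))
  from thru_trans[OF this iU B.dual_lm'[OF LS] B.dual_lm'[OF LS] B.dual_lm'[OF U]]
  have "inN (B.D ?S)" .
  moreover have "tau_d K B 2 N = B.D ?S" by (simp add: tau_d_def ar_translate_def)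
  ultimately show ?thesis using in_add_iff[OF LN(1) B.dual_lm'[OF LS]] by simp
qed

lemma cosyzygy_map:
  assumes "fdalg K S" "X \<in> fg_mod S"
  obtains J g \<pi> where "injective_envelope S X g J" "cosyzygy S X \<in> fg_mod S" "lin S J (cosyzygy S X) \<pi>" "\<pi> ` carrier J = carrier (cosyzygy S X)"
    "\<And>y. y \<in> carrier J ==> \<pi> y = \<zero>\<^bsub>cosyzygy S X\<^esub> \<longleftrightarrow> y \<in> g ` carrier X"
proof -
  interpret S: fdalg K S by (rule assms(1))
  let ?C = "cosyzygy S X"
  obtain J g where J: "injective_envelope S X g J" "?C \<in> fg_mod S" "mod_iso S ?C (quot_module J (g ` carrier X))"
    by (rule S.cosyzygyE[OF assms(2)]) (rule that; assumption)
  have j: "J \<in> fg_mod S" "lin S X J g" using J(1) by (simp_all add: injective_envelope_def S.injective_iff mod_hom_iff)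
  note LJ = fg_modD(1)[OF j(1)] and LX = fg_modD(1)[OF assms(2)] and LC = fg_modD(1)[OF J(2)]
  let ?N = "g ` carrier X"
  have Ns: "submodule ?N S J" by (rule image_submod[OF LX LJ j(2) carrier_submod[OF LX]])
  note LQ = quot_lm[OF LJ Ns] and qp = quot_proj[OF LJ Ns]
  obtain a b where ab: "lin S ?C (quot_module J ?N) a" "lin S (quot_module J ?N) ?C b"
    "\<And>x. x \<in> carrier ?C ==> b (a x) = x" "\<And>y. y \<in> carrier (quot_module J ?N) ==> a (b y) = y"
    by (rule mod_isoE[OF J(3) LC LQ]) (rule that; assumption)
  let ?\<pi> = "\<lambda>x. b (?N +>\<^sub>J x)"
  have l: "lin S J ?C ?\<pi>" by (rule lin_comp[OF qp(1) ab(2)])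
  have s: "?\<pi> ` carrier J = carrier ?C"
  proof
    show "?\<pi> ` carrier J \<subseteq> carrier ?C" using lin_closed[OF l] by blast
    show "carrier ?C \<subseteq> ?\<pi> ` carrier J"
    proof
      fix t assume t: "t \<in> carrier ?C"
      have "a t \<in> (\<lambda>x. ?N +>\<^sub>J x) ` carrier J" using lin_closed[OF ab(1) t] by simp
      then obtain x where "x \<in> carrier J" "a t = ?N +>\<^sub>J x" by blast
      thus "t \<in> ?\<pi> ` carrier J" using ab(3)[OF t] by force
    qed
  qed
  have k: "?\<pi> y = \<zero>\<^sub>?C \<longleftrightarrow> y \<in> ?N" if y: "y \<in> carrier J" for y
  proof -
    have c: "?N +>\<^sub>J y \<in> carrier (quot_module J ?N)" by (rule lin_closed[OF qp(1) y])
    have "?\<pi> y = \<zero>\<^sub>?C \<longleftrightarrow> ?N +>\<^sub>J y = \<zero>\<^bsub>quot_module J ?N\<^esub>"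
      using ab(4)[OF c] lm_lin_zero[OF ab(1) LC LQ] lm_lin_zero[OF ab(2) LQ LC] by auto
    thus ?thesis using qp(2)[OF y] by blast
  qed
  show thesis by (rule that[OF J(1,2) l s k])
qed

text \<open>Multiplying \<open>x\<^sub>0\<close> by elements of \<open>I\<close> gives a homomorphism \<open>I \<rightarrow> M\<close>, which extends to \<open>R\<close>. Subtracting the
  image of \<open>1\<close> from \<open>x\<^sub>0\<close> makes it a socle element without changing its residue.\<close>

lemma soc_lift:
  assumes J: "left_module R J" and j: "lin R M J j" "inj_on j (carrier M)" and C: "left_module R C"
    and \<pi>: "lin R J C \<pi>" "\<And>y. y \<in> carrier J ==> \<pi> y = \<zero>\<^sub>C \<longleftrightarrow> y \<in> j ` carrier M"
    and x: "x0 \<in> carrier J" "\<pi> x0 \<in> soc I C"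
  obtains x where "x \<in> soc I J" "\<pi> x = \<pi> x0"
proof -
  note JG = lm_ag[OF J] and CG = lm_ag[OF C]
  let ?N = "j ` carrier M"
  have N: "submodule ?N R J" by (rule image_submod[OF M(2) J j(1) carrier_submod[OF M(2)]])
  have jN: "lin R M (J\<restriction>?N) j" using j(1) by (simp add: lin_into_sub[OF submodD(1)[OF J N]])
  have bN: "bij_betw j (carrier M) (carrier (J\<restriction>?N))" using j(2) by (simp add: bij_betw_def)
  obtain k where k: "lin R (J\<restriction>?N) M k" "\<And>y. y \<in> carrier (J\<restriction>?N) ==> j (k y) = y"
    by (rule lin_inverse[OF M(2) sub_lm[OF J N] jN bN]) (rule that; assumption)
  have ax: "a \<odot>\<^sub>J x0 \<in> ?N" if "a \<in> I" for a
  proof -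
    have aR: "a \<in> carrier R" using that I_sub by blast
    have "\<pi> (a \<odot>\<^sub>J x0) = \<zero>\<^sub>C" using lin_smult[OF \<pi>(1) aR x(1)] x(2) that by (simp add: soc_def)
    thus ?thesis using \<pi>(2)[OF lm_smult[OF J aR x(1)]] by blast
  qed
  let ?G = "infl (reg B)"
  note rt = topD[OF reg_top]
  have kI: "mod_ker (reg R) ?G cls = I" using I_sub cls_zero by (auto simp: mod_ker_def)
  have iG: "inM ?G" using inN_iff[OF B.regR] inN_regular by blast
  have ext: "extends R I (reg R) M"
    using ext_vanish[OF infl_lm[OF B.regR] iG M(2) inM_M regR rt(3)] rt(4) unfolding kI by simp
  have "lin R ((reg R)\<restriction>I) M (\<lambda>a. k (a \<odot>\<^sub>J x0))"
  proof (rule lin_comp[OF _ k(1)])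
    have "lin R ((reg R)\<restriction>I) J (\<lambda>a. a \<odot>\<^sub>J x0)"
      by (rule lin_sub[OF cyclic_lin[OF J x(1)]]) (use I_sub in simp)
    thus "lin R ((reg R)\<restriction>I) (J\<restriction>?N) (\<lambda>a. a \<odot>\<^sub>J x0)"
      using ax by (simp add: lin_into_sub[OF submodD(1)[OF J N]])
  qed
  then obtain F where F: "lin R (reg R) M F" "\<And>a. a \<in> I ==> F a = k (a \<odot>\<^sub>J x0)"
    using ext unfolding extends_def by blast
  let ?m = "F \<one>\<^sub>R"
  have m: "?m \<in> carrier M" using lin_closed[OF F(1)] oneR by simp
  have jm: "j ?m \<in> carrier J" by (rule lin_closed[OF j(1) m])
  let ?x = "x0 \<ominus>\<^sub>J j ?m"
  have xJ: "?x \<in> carrier J" by (rule ag_diff[OF JG x(1) jm])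
  have "a \<odot>\<^sub>J ?x = \<zero>\<^sub>J" if a: "a \<in> I" for a
  proof -
    have aR: "a \<in> carrier R" using a I_sub by blast
    have "a \<odot>\<^sub>J j ?m = j (F a)" using lin_smult[OF j(1) aR m] lin_regular[OF R F(1) aR] by simp
    also have "\<dots> = a \<odot>\<^sub>J x0" using F(2)[OF a] k(2)[of "a \<odot>\<^sub>J x0"] ax[OF a] by simp
    finally show ?thesis
      using lm_smult[OF J aR x(1)] ag_neg[OF JG jm]
      by (simp add: a_minus_def lm_r_distr[OF J aR x(1)] lm_smult_neg[OF J aR jm] ag_rneg[OF JG])
  qed
  hence xs: "?x \<in> soc I J" using xJ by (simp add: soc_def)
  have "\<pi> (j ?m) = \<zero>\<^sub>C" using \<pi>(2)[OF jm] m by blast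
  hence "\<pi> ?x = \<pi> x0"
    using lin_diff[OF \<pi>(1) JG CG x(1) jm] ag_rzero[OF CG lin_closed[OF \<pi>(1) x(1)]] by (simp add: a_minus_def ag_neg_zero[OF CG])
  with xs that show thesis by blast
qed

lemma tau_inv_quotient: "in_add B N (tau_d_inv K B 2 N)"
proof -
  interpret O: idl K "R\<^sup>o" I by (rule opp_idl)
  interpret BO: fdalg K "B\<^sup>o" by (rule B.opp_alg)
  let ?C = "cosyzygy R M"
  obtain J j \<pi> where J: "injective_envelope R M j J" "?C \<in> fg_mod R" and \<pi>: "lin R J ?C \<pi>" "\<pi> ` carrier J = carrier ?C"
    "\<And>y. y \<in> carrier J ==> \<pi> y = \<zero>\<^sub>?C \<longleftrightarrow> y \<in> j ` carrier M"
    by (rule cosyzygy_map[OF fdalg_axioms M(1)]) (rule that; assumption)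
  have j: "J \<in> fg_mod R" "inje J" "lin R M J j" "inj_on j (carrier M)"
    using J(1) by (simp_all add: injective_envelope_def injective_iff mod_hom_iff)
  note LJ = fg_modD[OF j(1)] and LC = fg_modD[OF J(2)]
  note DJ = dual_lm[OF fg_modD(1)[OF j(1)]] and DM = dual_lm[OF M(2)] and DC = dual_lm[OF fg_modD(1)[OF J(2)]]
  let ?g = "dmap M j"
  have gl: "lin R\<^sup>o (D J) (D M) ?g" by (rule dmap_lin[OF j(3) M(2)])
  have gs: "?g ` carrier (D J) = carrier (D M)"
  proof
    show "?g ` carrier (D J) \<subseteq> carrier (D M)" using lin_closed[OF gl] by blast
    show "carrier (D M) \<subseteq> ?g ` carrier (D J)"
    proof
      fix p assume p: "p \<in> carrier (D M)"
      obtain q where "q \<in> carrier (D J)" "?g q = p" by (rule dmap_surj[OF M(2) LJ j(3,4) p]) (rule that; assumption)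
      thus "p \<in> ?g ` carrier (D J)" by blast
    qed
  qed
  let ?Y = "(D J)\<restriction>(mod_ker (D J) (D M) ?g)"
  note Ys = ker_submod[OF DJ DM gl]
  note LY = sub_lm[OF DJ Ys]
  have dq: "lin R\<^sup>o (D ?C) ?Y (dmap J \<pi>)" "bij_betw (dmap J \<pi>) (carrier (D ?C)) (mod_ker (D J) (D M) ?g)"
    by (rule dual_quotient[OF M(2) LJ(1) LC(1) j(3) \<pi>(1,2)], erule \<pi>(3))+
  let ?T = "module_transpose R\<^sup>o (D ?C)"
  obtain P1 f P0 h q where T: "minimal_presentation R\<^sup>o P1 f P0 h (D ?C)" "?T \<in> fg_mod (R\<^sup>o\<^sup>o)"
    "is_tr R\<^sup>o P1 f P0 ?T q"
    by (rule O.transposeE[OF DC dual_fg[OF LC]]) (rule that; assumption)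
  have bY: "bij_betw (dmap J \<pi>) (carrier (D ?C)) (carrier ?Y)" using dq(2) by simp
  note p = O.pres_minimal[OF T(1) DC T(3) dq(1) bY LY]
  have T2: "?T \<in> fg_mod R" using T(2) by (simp only: opp_simps(7))
  note LT = fg_modD[OF T2]
  obtain VG :: "('a set, ((nat \<Rightarrow> 'k) \<Rightarrow> 'k) set) module" and pG where tG: "is_top R\<^sup>o I (D J) VG pG"
    by (rule O.top_exists[OF DJ]) (rule that; assumption)
  obtain V :: "('a set, nat \<Rightarrow> 'k) module" and i where sM: "is_soc R I M V i" by (rule soc_exists[OF M(2)]) (rule that; assumption)
  have tM: "is_top R\<^sup>o I (D M) (B.D V) (dmap V i)" by (rule soc_dual_top[OF sM M(3)])
  obtain U :: "('a set, (nat \<Rightarrow> 'k) set) module" and u where tU: "is_top R I ?T U u" by (rule top_exists[OF LT(1)]) (rule that; assumption)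
  have tT: "is_top (R\<^sup>o\<^sup>o) I ?T U u" using tU by (simp only: opp_simps(7))
  \<comment> \<open>both memberships mean that a functional vanishes on a socle, and socle elements lift from \<open>J/M\<close> to \<open>J\<close>\<close>
  have star: "y \<in> isub R\<^sup>o I ?Y" if y: "y \<in> mod_ker (D J) (D M) ?g" "y \<in> isub R\<^sup>o I (D J)" for y
  proof -
    have "y \<in> dmap J \<pi> ` carrier (D ?C)" using y(1) bij_betw_imp_surj_on[OF dq(2)] by (simp only:)
    then obtain z where z: "z \<in> carrier (D ?C)" "y = dmap J \<pi> z" by blast
    have yD: "y \<in> carrier (D J)" using dmap_closed[OF \<pi>(1) LJ(1) z(1)] z(2) by (simp only:)
    obtain S :: "('a set, nat \<Rightarrow> 'k) module" and s where sJ: "is_soc R I J S s" by (rule soc_exists[OF LJ(1)]) (rule that; assumption)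
    obtain S' :: "('a set, nat \<Rightarrow> 'k) module" and s' where sC: "is_soc R I ?C S' s'" by (rule soc_exists[OF LC(1)]) (rule that; assumption)
    have tJ: "dmap S s y = \<zero>\<^bsub>B.D S\<^esub>" using soc_dual_top[OF sJ LJ(2)] y(2) yD unfolding is_top_def by blast
    have vJ: "y x = \<zero>\<^sub>K" if "x \<in> soc I J" for x
    proof -
      have "x \<in> s ` carrier S" using that by (simp only: socD(5)[OF sJ])
      then obtain v where v: "v \<in> carrier S" "x = s v" by blast
      thus ?thesis using fun_cong[OF tJ, of v] by (simp add: dmap_def)
    qed
    have "dmap S' s' z = \<zero>\<^bsub>B.D S'\<^esub>"
    proof
      fix v
      show "dmap S' s' z v = \<zero>\<^bsub>B.D S'\<^esub> v"
      proof (cases "v \<in> carrier S'")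
        case True
        have sv: "s' v \<in> soc I ?C" unfolding socD(5)[OF sC, symmetric] using True by blast
        hence "s' v \<in> carrier ?C" by (simp add: soc_def)
        then obtain x0 where x0: "x0 \<in> carrier J" "s' v = \<pi> x0" using surjE[OF \<pi>(2)] by blast
        obtain x where x: "x \<in> soc I J" "\<pi> x = \<pi> x0"
          by (rule soc_lift[OF LJ(1) j(3,4) LC(1) \<pi>(1,3) x0(1)]) (use sv x0(2) that in auto)
        have xJ: "x \<in> carrier J" using x(1) by (simp add: soc_def)
        have "z (s' v) = y x" using z(2) xJ x(2) x0(2) by (simp add: dmap_def)
        thus ?thesis using vJ[OF x(1)] True by (simp add: dmap_def)
      qed (simp add: dmap_def)
    qed
    hence "z \<in> isub R\<^sup>o I (D ?C)" using soc_dual_top[OF sC LC(2)] z(1) unfolding is_top_def by blast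
    from isub_map[OF DC LY dq(1) O.I_sub this] show ?thesis using z(2) by (simp only:)
  qed
  let ?CB = "cosyzygy B N"
  obtain JB jB \<rho> where JB: "injective_envelope B N jB JB" "?CB \<in> fg_mod B" and \<rho>: "lin B JB ?CB \<rho>" "\<rho> ` carrier JB = carrier ?CB"
    "\<And>y. y \<in> carrier JB ==> \<rho> y = \<zero>\<^sub>?CB \<longleftrightarrow> y \<in> jB ` carrier N"
    by (rule cosyzygy_map[OF B.fdalg_axioms N]) (rule that; assumption)
  note LCB = fg_modD[OF JB(2)]
  note DCB = B.dual_lm[OF fg_modD(1)[OF JB(2)]] and DN = B.dual_lm[OF LN(1)]
  obtain Q c where Q: "projective_cover B\<^sup>o Q c (B.D N)" "mod_iso B\<^sup>o (B.D ?CB) (Q\<restriction>(mod_ker Q (B.D N) c))"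
    by (rule B.dual_cover[OF JB(1) N LCB(1) \<rho>(1,2)]) (erule \<rho>(3), rule that)
  let ?S = "module_transpose B\<^sup>o (B.D ?CB)"
  obtain Q1 f1 Q0 c0 qS where S: "minimal_presentation B\<^sup>o Q1 f1 Q0 c0 (B.D ?CB)" "?S \<in> fg_mod (B\<^sup>o\<^sup>o)"
    "is_tr B\<^sup>o Q1 f1 Q0 ?S qS"
    by (rule BO.transposeE[OF DCB B.dual_fg[OF LCB]]) (rule that; assumption)
  have S2: "?S \<in> fg_mod B" using S(2) by (simp only: opp_simps(7))
  note LS = fg_modD(1)[OF S2]
  have iN: "inM (infl N)" using inN_iff[OF LN(1)] inN_N by blast
  have "summand B V N" by (rule soc_thru[OF sM infl_soc[OF LN(1)] iN])
  from B.thru_dual_id[OF this LN(1) socD(2)[OF sM]]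
  have thN: "summand B\<^sup>o (B.D V) (B.D N)" .
  note tq = O.tr_quotient[OF dual_proj[OF LJ(1) j(2)] gl gs DM tG tM _ p tT, unfolded quot_opp]
  have th: "summand (B\<^sup>o\<^sup>o) U ?S"
    by (rule tq[OF _ DN thN Q(1) DCB Q(2) S(1,3)]) (rule star)
  have U: "left_module B U" by (rule topD(2)[OF tU])
  have "tau_d_inv K R 2 M = ?T" by (simp add: tau_d_inv_def ar_translate_inv_def)
  moreover have "in_add R M (tau_d_inv K R 2 M)" using pct by (simp add: precluster_tilting_module_def)
  ultimately have "inM ?T" using in_add_iff[OF M(2) LT(1)] by simp
  hence "inN U" unfolding inN_iff[OF U] by (rule add_top[OF _ tU])
  moreover have "summand B U ?S" using th by (simp only: quot_opp opp_simps(7))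
  ultimately have "inN ?S" using thru_trans[OF _ _ LS LS U] by blast
  moreover have "tau_d_inv K B 2 N = ?S" by (simp add: tau_d_inv_def ar_translate_inv_def)
  ultimately show ?thesis using in_add_iff[OF LN(1) LS] by simp
qed

lemma pct_quotient: "precluster_tilting_module K B 2 N"
  unfolding precluster_tilting_module_def
proof (intro conjI allI impI)
  fix i :: nat assume "0 < i \<and> i < 2"
  hence "i = 1" by simp
  thus "trivial_group (Ext B i N N)" using ext_quotient by (simp only:)
qed (use N tau_quotient tau_inv_quotient generator_cogenerator in auto)

lemma subcat_quotient: "subcat_inter_quot R I (add_subcat R M) = add_subcat B N"
proof -
  have "X \<in> fg_mod B \<and> infl X \<in> add_subcat R M \<longleftrightarrow> X \<in> add_subcat B N" for X
  proof (cases "X \<in> fg_mod B")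
    case True
    note LX = fg_modD[OF True]
    have "infl X \<in> fg_mod R" using infl_lm[OF LX(1)] infl_fg[OF LX(1)] LX(2) by (simp add: fg_mod_def)
    thus ?thesis using True inN_iff[OF LX(1)] in_add_iff[OF LN(1) LX(1)] by (simp add: add_iff) (simp add: add_subcat_def)
  qed (simp add: add_subcat_def)
  thus ?thesis by (auto simp: subcat_inter_quot_def)
qed

end

theorem theorem1p2:
  fixes K :: "'k ring" and A :: "('k, 'a) module" and e :: 'a
    and Ct :: "('a, nat \<Rightarrow> 'k) module set"
  assumes "fd_algebra K A"
    and "e \<in> carrier A" and "e \<otimes>\<^bsub>A\<^esub> e = e"
    and "precluster_tilting_subcat K A 2 Ct"
    and "\<And>X. X \<in> Ct \<Longrightarrow>
           in_subcat A Ct (inflate A (Idl\<^bsub>A\<^esub> {e}) (hom_from_quot A (Idl\<^bsub>A\<^esub> {e}) X))"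
    and "\<And>X. X \<in> Ct \<Longrightarrow>
           in_subcat A Ct (inflate A (Idl\<^bsub>A\<^esub> {e}) (quot_tensor A (Idl\<^bsub>A\<^esub> {e}) X))"
  shows "precluster_tilting_subcat K (quot_algebra A (Idl\<^bsub>A\<^esub> {e})) 2
           (subcat_inter_quot A (Idl\<^bsub>A\<^esub> {e}) Ct)"
proof -
  let ?I = "Idl\<^bsub>A\<^esub> {e}"
  obtain M where MC: "precluster_tilting_module K A 2 M" "Ct = add_subcat A M"
    using assms(4) by (auto simp: precluster_tilting_subcat_def)
  have A: "fdalg K A" by (rule fd_algebra_fdalg[OF assms(1)])
  have I: "ideal ?I A" by (rule ring.genideal_ideal[OF fdalg.R[OF A]]) (use assms(2) in simp)
  interpret pct K A ?I M
    by (intro pct.intro idl.intro idl_axioms.intro pct_axioms.intro A I MC(1)) (use assms(5,6) MC(2) in simp_all)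
  obtain N p where N: "N \<in> fg_mod (quot_algebra A ?I)" "is_top A ?I M N p" by (rule quotient_generator) (rule that; assumption)
  interpret pct_top K A ?I M N p by (intro pct_top.intro pct_top_axioms.intro pct_axioms N)
  show ?thesis
    unfolding precluster_tilting_subcat_def MC(2) by (intro exI conjI) (rule pct_quotient, rule subcat_quotient)
qed

end
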